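(* Let $S_0$ and $S_1$ be closed sectors in $\mathbb{C}$ of opening angles at most $\pi$. Suppose that $S_0\cap S_1=\{0\}$ and let $f$ be a transcendental entire function of finite order for which all but finitely many zeros are in $S_0$ while all but finitely many $1$-points are in $S_1$. Then $f$ has the form $$f(z)=\int_{0}^{z}p(\zeta)e^{q(\zeta)}\,d\zeta+c,$$ where $p$ and $q$ are polynomials and $c\in\mathbb{C}$.
   Context: A closed sector in $\mathbb{C}$ has its vertex at the origin, i.e. it is a set of the form $\{re^{it}\colon r\ge 0,\ \alpha\le t\le\beta\}$ with real $\alpha<\beta$, $\beta-\alpha<2\pi$; its opening angle is $\beta-\alpha$. A $1$-point of $f$ is a point $z$ with $f(z)=1$. An entire function is transcendental if it is not a polynomial. The order of an entire function $f$ is $\rho=\limsup_{r\to\infty}\frac{\log\log M(r)}{\log r}$, where $M(r)=\max_{|z|=r}|f(z)|$. The phrase "all but finitely many zeros (or $1$-points) are in a set" includes the case that there are only finitely many, or no, such points. *)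

theory Defs
  imports "HOL-Complex_Analysis.Complex_Analysis"
begin

definition closed_sector :: "real \<Rightarrow> real \<Rightarrow> complex set" where
  "closed_sector \<alpha> \<beta> = {rcis r t | r t. r \<ge> 0 \<and> \<alpha> \<le> t \<and> t \<le> \<beta>}"

definition is_closed_sector :: "complex set \<Rightarrow> real \<Rightarrow> bool" where
  \<comment> \<open>the second argument is the opening angle, which is determined by the set\<close>
  "is_closed_sector S \<theta> \<longleftrightarrow>
     (\<exists>\<alpha> \<beta>. \<alpha> < \<beta> \<and> \<beta> - \<alpha> < 2 * pi \<and> S = closed_sector \<alpha> \<beta> \<and> \<theta> = \<beta> - \<alpha>)"

definition transcendental_entire :: "(complex \<Rightarrow> complex) \<Rightarrow> bool" where
  "transcendental_entire f \<longleftrightarrow> f holomorphic_on UNIV \<and> (\<nexists>p. f = poly p)"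

definition max_modulus :: "(complex \<Rightarrow> complex) \<Rightarrow> real \<Rightarrow> real" where
  \<comment> \<open>for continuous f and r at least 0 the supremum is attained, so it is the maximum\<close>
  "max_modulus f r = (SUP z\<in>sphere 0 r. cmod (f z))"

definition entire_order :: "(complex \<Rightarrow> complex) \<Rightarrow> ereal" where
  \<comment> \<open>for a nonconstant entire f both logarithms in the numerator are eventually applied
     to positive numbers, so the library value of ln at nonpositive numbers plays no role\<close>
  "entire_order f = Limsup at_top (\<lambda>r. ereal (ln (ln (max_modulus f r)) / ln r))"

end

theory Submission
 imports Defs
begin

text \<open>In the coordinate \<open>w = log z\<close> sectors become strips, and \<open>f\<close>, freed of finitely many zeros, is \<open>exp G\<close> on
 a strip. With \<open>A s = log (2 + M(e\<^bsup>s\<^esup>))\<close> the functions \<open>exp (G (w + s) / A s)\<close> form a normal family; the limits on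
 the strip without zeros and on the strip without 1-points have equal modulus wherever it exceeds 1.
 Hence in the gaps between the sectors \<open>f\<close> is exponentially large, or close to 0, or close to 1.
 If it is large, \<open>z f' / f\<close> and \<open>z f' / (f - 1)\<close> almost agree in the gaps, and a periodic Cauchy kernel puts both
 within \<open>O(1)\<close> of one polynomial \<open>z Q' + c\<close>; so \<open>f' e\<^bsup>-Q\<^esup>\<close> is entire of polynomial growth.
 If \<open>f\<close> is close to 0, then \<open>log (1 - f)\<close> decays in a half-plane as fast as \<open>f\<close> grows in the opposite
 direction, and \<open>f = P e\<^bsup>bz\<^esup>\<close>; the last case is this one for \<open>1 - f\<close>.\<close>

text \<open>The normal family argument needs \<open>A (s + t) \<le> b t * A s\<close>, and finite
  order gives this only at special places. At near maxima of \<open>A x * exp (- m * x)\<close> it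
  holds, with limits bounded by \<open>exp (2 * exp (m * Re w))\<close>. For large \<open>m\<close>
  that is not an integer such limits do not exist: in the small cases Harnack's inequality bounds
  the rate, and in the large case the logarithmic derivatives of the limits glue to a
  \<open>2 * pi * \<i>\<close>-periodic entire function, which has to be
  \<open>c * exp (m * w)\<close>. So a near maximum stays at bounded distance from the point where
  its search began, which leads to the doubling property
  \<open>A (s + t) \<le> D * exp (m * t) * A s\<close>; then every sequence of radii is admissible.
  The three cases are told apart by the size of \<open>f\<close> on a single ray, so by continuity
  one of them holds for all large radii. The bound \<open>pi\<close> on the opening angles enters
  when \<open>f\<close> is close to 0 or 1: the sector where \<open>f\<close> is large then lies in
  a half-plane, and if it is narrower than that, Phragmen-Lindelof makes \<open>f\<close>
  bounded.\<close>

abbreviation ev_real :: "(real \<Rightarrow> bool) \<Rightarrow> bool" (binder "EV " 10) where "ev_real P \<equiv> eventually P at_top"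
abbreviation ev_nat :: "(nat \<Rightarrow> bool) \<Rightarrow> bool" (binder "EVN " 10) where "ev_nat P \<equiv> eventually P sequentially"
abbreviation diverges :: "(nat \<Rightarrow> real) \<Rightarrow> bool" where "diverges s \<equiv> filterlim s at_top sequentially"
abbreviation "pt s t \<equiv> exp (Complex s t)"

lemmas ev_top = eventually_at_top_linorder
lemmas hol_compose = holomorphic_on_compose_gen[unfolded o_def]

section \<open>Schwarz lemma and Harnack inequality for functions with positive real part\<close>

text \<open>\<open>v\<close> is \<open>q\<close> on the disc of radius \<open>d\<close> about
  \<open>z\<close>, rescaled to the unit disc and followed by the Cayley transform that takes the
  right half-plane to the unit disc and \<open>q z\<close> to 0. The estimates that follow are the
  Schwarz lemma for \<open>v\<close>.\<close>

lemma schwarz_halfplane_aux: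
 assumes hol: "q holomorphic_on ball z d" and d: "d > 0"
  and pos: "\<And>w. w \<in> ball z d \<Longrightarrow> Re (q w) > 0"
 defines "v \<equiv> \<lambda>u. (q (z + of_real d * u) - q z) / (q (z + of_real d * u) + cnj (q z))"
 shows "\<And>u. norm u < 1 \<Longrightarrow> norm (v u) \<le> norm u" and "norm (deriv v 0) \<le> 1"
  and "(v has_field_derivative (of_real d * deriv q z / of_real (2 * Re (q z)))) (at 0)"
proof -
 have inb: "z + of_real d * u \<in> ball z d" if "norm u < 1" for u
  using that d by (simp add: dist_norm norm_mult)
 have z0: "Re (q z) > 0" using pos d by simp
 have nz: "q (z + of_real d * u) + cnj (q z) \<noteq> 0" if "norm u < 1" for u
 proof -
  have "Re (q (z + of_real d * u) + cnj (q z)) > 0" using pos[OF inb[OF that]] z0 by simp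
  thus ?thesis by (metis less_irrefl zero_complex.simps(1))
 qed
 have hol2: "(\<lambda>u. q (z + of_real d * u)) holomorphic_on ball 0 1"
  by (rule hol_compose[OF _ hol])
    (use inb in \<open>auto intro!: holomorphic_intros simp: image_subset_iff\<close>)
 have hol3: "v holomorphic_on ball 0 1"
  unfolding v_def by (intro holomorphic_intros hol2) (use nz in auto)
 have psi0: "v 0 = 0" by (simp add: v_def)
 have lt1: "norm (v u) < 1" if u: "norm u < 1" for u
 proof -
  let ?a = "q (z + of_real d * u)"
  have a: "Re ?a > 0" using pos inb u by blast
  \<comment> \<open>The two squares differ by \<open>4 * Re ?a * Re (q z)\<close>.\<close>
  have "(norm (?a - q z))\<^sup>2 < (norm (?a + cnj (q z)))\<^sup>2"
   using mult_pos_pos[OF a z0] unfolding cmod_power2 by (simp add: power2_eq_square algebra_simps)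
  hence "norm (?a - q z) < norm (?a + cnj (q z))" by (simp add: power_less_imp_less_base)
  thus ?thesis using nz[OF u] by (simp add: v_def norm_divide)
 qed
 show "\<And>u. norm u < 1 \<Longrightarrow> norm (v u) \<le> norm u"
  using Schwarz_Lemma(1)[OF hol3 psi0 lt1] by blast
 show "norm (deriv v 0) \<le> 1" using Schwarz_Lemma(2)[OF hol3 psi0 lt1, of 0] by simp
 have d1: "(q has_field_derivative deriv q z) (at ((\<lambda>u. z + of_real d * u) 0))"
  using hol d by (simp add: holomorphic_derivI)
 have d2: "((\<lambda>u. q (z + of_real d * u)) has_field_derivative deriv q z * of_real d) (at 0)"
  by (rule DERIV_chain2[where f = q and g = "\<lambda>u. z + of_real d * u" and x = 0, OF d1]) (auto intro!: derivative_eq_intros)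
 have c: "q z + cnj (q z) = of_real (2 * Re (q z))" by (simp add: complex_eq_iff)
 have cnz: "q z + cnj (q z) \<noteq> 0" using z0 by (simp add: complex_eq_iff)
 define C where "C = q z + cnj (q z)"
 have "(v has_field_derivative ((deriv q z * of_real d - 0) * (q (z + of_real d * 0) + cnj (q z))
   - (q (z + of_real d * 0) - q z) * (deriv q z * of_real d + 0)) / ((q (z + of_real d * 0) + cnj (q z)) * (q (z + of_real d * 0) + cnj (q z)))) (at 0)"
  unfolding v_def by (rule DERIV_divide[OF DERIV_diff[OF d2 DERIV_const] DERIV_add[OF d2 DERIV_const]]) (use cnz in simp)
 hence "(v has_field_derivative ((deriv q z * of_real d) * C / (C * C))) (at 0)"
  by (simp only: C_def mult_zero_right add_0_right diff_zero diff_self mult_zero_left)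
 moreover have "(deriv q z * of_real d) * C / (C * C) = of_real d * deriv q z / of_real (2 * Re (q z))"
  using cnz unfolding c[symmetric] C_def[symmetric] by (simp add: C_def)
 ultimately show "(v has_field_derivative (of_real d * deriv q z / of_real (2 * Re (q z)))) (at 0)"
  by simp
qed

text \<open>The infinitesimal Harnack inequality: it bounds the gradient of \<open>ln (Re g)\<close>
  at \<open>z\<close> by \<open>2 / d\<close>.\<close>

lemma deriv_le_Re:
 assumes hol: "g holomorphic_on ball z d" and d: "d > 0"
  and pos: "\<And>w. w \<in> ball z d \<Longrightarrow> Re (g w) > 0"
 shows "norm (deriv g z) \<le> 2 * Re (g z) / d"
proof -
 have z0: "Re (g z) > 0" using pos d by simp
 have "norm (of_real d * deriv g z / of_real (2 * Re (g z))) \<le> 1"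
  using schwarz_halfplane_aux(2)[OF hol d] DERIV_imp_deriv[OF schwarz_halfplane_aux(3)[OF hol d]] pos
  by simp
 moreover have "norm (of_real d * deriv g z / of_real (2 * Re (g z))) = d * norm (deriv g z) / (2 * Re (g z))"
  unfolding norm_divide norm_mult norm_of_real using z0 d by simp
 ultimately have "d * norm (deriv g z) \<le> 2 * Re (g z)" using z0 by (simp add: divide_le_eq)
 thus ?thesis using d by (simp add: pos_le_divide_eq mult.commute)
qed

text \<open>The Schwarz bound solved for \<open>norm (g w)\<close>. It controls the modulus and not
  only the real part, with a loss that is only the reciprocal of the distance from \<open>w\<close>
  to the boundary of the disc.\<close>

lemma norm_le_halfplane_disc:
 assumes hol: "g holomorphic_on ball z d" and d: "d > 0"
  and pos: "\<And>w. w \<in> ball z d \<Longrightarrow> Re (g w) > 0" and w: "w \<in> ball z d"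
 shows "norm (g w) * (d - dist z w) \<le> norm (g z) * (d + dist z w)"
proof -
 define u where "u = (w - z) / of_real d"
 have wu: "z + of_real d * u = w" using d by (simp add: u_def)
 have nu: "norm u = dist z w / d" using d by (simp add: u_def norm_divide dist_norm norm_minus_commute)
 hence u1: "norm u < 1" using w d by simp
 have z0: "Re (g z) > 0" using pos d by simp
 have "Re (g w + cnj (g z)) > 0" using pos[OF w] z0 by simp
 hence nz: "norm (g w + cnj (g z)) > 0" by (metis less_irrefl zero_complex.simps(1) zero_less_norm_iff)
 have "norm (g w - g z) \<le> norm u * norm (g w + cnj (g z))"
  using schwarz_halfplane_aux(1)[OF hol d pos u1] nz unfolding wu norm_divide
  by (simp only: pos_divide_le_eq)
 also have "\<dots> \<le> norm u * (norm (g w) + norm (g z))"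
  by (intro mult_left_mono) (metis complex_mod_cnj norm_triangle_ineq, simp)
 finally have "norm (g w - g z) \<le> norm u * (norm (g w) + norm (g z))" .
 moreover have "norm (g w) \<le> norm (g w - g z) + norm (g z)"
  by (metis diff_add_cancel norm_triangle_ineq)
 ultimately have "norm (g w) \<le> norm u * (norm (g w) + norm (g z)) + norm (g z)" by linarith
 thus ?thesis using d by (simp add: nu field_simps)
qed

text \<open>By \<open>deriv_le_Re\<close>, \<open>ln (Re q)\<close> increases by at most
  \<open>2 * norm (b - a) / d\<close> along the segment; the mean value theorem integrates the
  gradient bound.\<close>

lemma harnack_segment:
 assumes hol: "q holomorphic_on U" and U: "open U" and d: "d > 0"
  and pos: "\<And>w. w \<in> U \<Longrightarrow> Re (q w) > 0"
  and sub: "\<And>x. x \<in> closed_segment a b \<Longrightarrow> ball x d \<subseteq> U"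
 shows "Re (q b) \<le> exp (2 * norm (b - a) / d) * Re (q a)"
proof -
 define j where "j = (\<lambda>t::real. a + of_real t * (b - a))"
 define g where "g = (\<lambda>t. ln (Re (q (j t))))"
 have seg: "j t \<in> closed_segment a b" if "0 \<le> t" "t \<le> 1" for t
  unfolding j_def closed_segment_def using that
  by (auto intro!: exI[of _ t] simp: algebra_simps scaleR_conv_of_real)
 have inU: "j t \<in> U" if "0 \<le> t" "t \<le> 1" for t
  using sub[OF seg[OF that]] d by auto
 have der: "(g has_real_derivative (Re (deriv q (j t) * (b - a)) / Re (q (j t)))) (at t)"
  if t: "0 \<le> t" "t \<le> 1" for t
 proof -
  have "(q has_field_derivative deriv q (j t)) (at (j t))"
   using hol U inU[OF t] by (simp add: holomorphic_derivI)
  moreover have "(j has_vector_derivative (b - a)) (at t)"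
   unfolding j_def by (auto intro!: derivative_eq_intros)
  ultimately have "((\<lambda>t. q (j t)) has_vector_derivative ((b - a) * deriv q (j t))) (at t)"
   using field_vector_diff_chain_at[of j "b - a" t q] by (simp add: o_def)
  hence "((\<lambda>t. Re (q (j t))) has_vector_derivative Re ((b - a) * deriv q (j t))) (at t)"
   by (rule bounded_linear.has_vector_derivative[OF bounded_linear_Re])
  hence "((\<lambda>t. Re (q (j t))) has_real_derivative Re (deriv q (j t) * (b - a))) (at t)"
   by (simp add: has_real_derivative_iff_has_vector_derivative mult.commute)
  from DERIV_chain2[OF DERIV_ln[OF pos[OF inU[OF t]]] this]
  show ?thesis unfolding g_def by (simp add: field_simps)
 qed
 have "\<exists>t. 0 < t \<and> t < 1 \<and> g 1 - g 0 = (1 - 0) * (Re (deriv q (j t) * (b - a)) / Re (q (j t)))"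
  by (rule MVT2) (use der in auto)
 then obtain t where t: "0 < t" "t < 1" "g 1 - g 0 = Re (deriv q (j t) * (b - a)) / Re (q (j t))"
  by auto
 have p: "Re (q (j t)) > 0" using pos inU t by simp
 have "norm (deriv q (j t)) \<le> 2 * Re (q (j t)) / d"
  by (rule deriv_le_Re[OF _ d])
   (use sub[OF seg[of t]] t pos hol in \<open>auto intro: holomorphic_on_subset\<close>)
 hence "norm (deriv q (j t)) * norm (b - a) \<le> 2 * Re (q (j t)) / d * norm (b - a)"
  by (rule mult_right_mono) simp
 moreover have "Re (deriv q (j t) * (b - a)) \<le> norm (deriv q (j t)) * norm (b - a)"
  by (metis complex_Re_le_cmod norm_mult)
 ultimately have "Re (deriv q (j t) * (b - a)) \<le> 2 * Re (q (j t)) / d * norm (b - a)"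
  by linarith
 hence "Re (deriv q (j t) * (b - a)) \<le> (2 * norm (b - a) / d) * Re (q (j t))"
  by (simp add: mult_ac)
 hence "Re (deriv q (j t) * (b - a)) / Re (q (j t)) \<le> 2 * norm (b - a) / d"
  using p by (simp only: pos_divide_le_eq)
 hence "ln (Re (q b)) - ln (Re (q a)) \<le> 2 * norm (b - a) / d"
  using t(3) by (simp add: g_def j_def)
 hence "exp (ln (Re (q b))) \<le> exp (2 * norm (b - a) / d + ln (Re (q a)))" by simp
 moreover have "Re (q a) > 0" "Re (q b) > 0" using pos inU[of 0] inU[of 1] by (auto simp: j_def)
 ultimately show ?thesis by (simp add: exp_add)
qed

section \<open>Maximum principles: rotated products, two constants, Phragmen-Lindelof\<close>

text \<open>The maximum principle for the product of the \<open>N\<close> rotated copies of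
  \<open>F\<close>, which all equal \<open>F 0\<close> at the centre. A single small factor at each
  point of the circle is then enough to estimate \<open>F 0\<close>.\<close>

lemma max_modulus_rotations:
 assumes hol: "F holomorphic_on ball 0 r" and cont: "continuous_on (cball 0 r) F" and r: "r > 0"
  and le: "\<And>z. norm z = r \<Longrightarrow> (\<Prod>j<N. norm (F (z * cis (2 * pi * real j / real N)))) \<le> B"
 shows "norm (F 0) ^ N \<le> B"
proof -
 let ?P = "\<lambda>z. \<Prod>j<N. F (z * cis (2 * pi * real j / real N))"
 have Ple: "norm (?P z) \<le> B" if "z \<in> frontier (ball 0 r)" for z
 proof -
  have "norm z = r" using that r by simp
  from le[OF this] show ?thesis by (simp only: prod_norm)
 qed
 have "norm (?P 0) \<le> B"
 proof (rule maximum_modulus_frontier[of ?P "ball 0 r", OF _ _ _ Ple])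
  show "?P holomorphic_on interior (ball 0 r)"
  proof (intro holomorphic_intros)
   fix j
   show "(\<lambda>z. F (z * cis (2 * pi * real j / real N))) holomorphic_on interior (ball 0 r)"
    by (rule hol_compose[OF _ hol])
      (auto intro!: holomorphic_intros simp: norm_mult)
  qed
  show "continuous_on (closure (ball 0 r)) ?P"
  proof (rule continuous_on_prod)
   fix j
   show "continuous_on (closure (ball 0 r)) (\<lambda>z. F (z * cis (2 * pi * real j / real N)))"
    by (rule continuous_on_compose2[OF cont])
      (use r in \<open>auto intro!: continuous_on_mult continuous_on_id continuous_on_const simp: norm_mult\<close>)
  qed
 qed (use r in auto)
 hence "(\<Prod>j<N. norm (F (0 * cis (2 * pi * real j / real N)))) \<le> B" by (simp only: prod_norm)
 thus ?thesis by simp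
qed

text \<open>The \<open>N\<close> rotates of a point are \<open>2 * pi / N\<close> apart, so one of
  them has an argument within \<open>pi / N\<close> of \<open>w\<close>. The angle \<open>t\<close>
  is not reduced modulo \<open>2 * pi\<close>, because it will be the imaginary part of a point in a
  strip.\<close>

lemma rotation_hits_arc:
 assumes "N > 0"
 obtains j t where "j < N" "\<bar>t - w\<bar> \<le> pi / real N" "cis v * cis (2 * pi * real j / real N) = cis t"
proof -
 define k where "k = \<lfloor>(w - v) * N / (2 * pi) + 1/2\<rfloor>"
 have k: "\<bar>(w - v) * N / (2 * pi) - of_int k\<bar> \<le> 1/2" unfolding k_def by linarith
 define j where "j = nat (k mod int N)"
 define t where "t = v + 2 * pi * of_int k / real N"
 have "j < N" using assms by (simp add: j_def nat_less_iff)
 moreover have "\<bar>t - w\<bar> \<le> pi / real N"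
 proof -
  have "t - w = - (2 * pi / real N) * ((w - v) * N / (2 * pi) - of_int k)"
   using assms by (simp add: t_def field_simps)
  hence "\<bar>t - w\<bar> = (2 * pi / real N) * \<bar>(w - v) * N / (2 * pi) - of_int k\<bar>"
   by (simp add: abs_mult)
  also have "\<dots> \<le> (2 * pi / real N) * (1/2)" using k by (intro mult_left_mono) auto
  finally show ?thesis by simp
 qed
 moreover have "cis v * cis (2 * pi * real j / real N) = cis t"
 proof -
  have "int j = k mod int N" using assms by (simp add: j_def)
  hence "k = int j + int N * (k div int N)" by simp
  hence "of_int k = real j + real N * of_int (k div int N)"
   by (metis of_int_add of_int_mult of_int_of_nat_eq)
  hence "t = v + 2 * pi * real j / real N + 2 * pi * of_int (k div int N)"
   using assms by (simp add: t_def field_simps)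
  thus ?thesis by (simp add: cis_mult[symmetric] cis_multiple_2pi)
 qed
 ultimately show thesis by (rule that)
qed

text \<open>A maximum principle for \<open>F u ^ N / u ^ n\<close> in an annulus, where \<open>n / N\<close> is close to \<open>m * k\<close>.\<close>

lemma two_constants_disc:
 assumes hol: "F holomorphic_on ball 0 1" and M: "\<And>u. norm u < 1 \<Longrightarrow> norm (F u) \<le> M" "M > 0"
  and k: "0 < k" "k < 1" and m: "m \<ge> 0"
  and small: "\<And>u. norm u \<le> k \<Longrightarrow> norm (F u) \<le> M * exp (- m)" and z: "norm z < 1"
 shows "norm (F z) \<le> M * exp (- m * k * (1 - norm z))"
proof (cases "norm z \<le> k")
 case True
 have "m * (k * (1 - norm z)) \<le> m * 1" using k m z by (intro mult_left_mono mult_le_one) auto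
 thus ?thesis using order_trans[OF small[OF True]] M(2) by (simp add: mult.assoc)
next
 case False
 define y where "y = exp (- m * k * (1 - norm z))"
 define G where "G u = norm (F u / M)" for u
 have G: "G u \<le> b" if "norm (F u) \<le> M * b" for u b using that M(2) by (simp add: G_def norm_divide field_simps)
 \<comment> \<open>Integer powers of \<open>F\<close> and \<open>u\<close> replace the multivalued
   power of \<open>u\<close> with exponent \<open>m * k\<close>. Rounding \<open>n\<close> down
   costs the factor \<open>exp 1\<close>, which disappears when the \<open>N\<close>-th root is
   taken and \<open>N\<close> tends to infinity.\<close>
 have bound: "G z ^ N \<le> exp 1 * y ^ N" for N
 proof -
  define n where "n = nat \<lfloor>real N * m * k\<rfloor>"
  have n: "real n \<le> real N * m * k" "real N * m * k - 1 \<le> real n" using m k by (auto simp: n_def)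
  \<comment> \<open>Nothing is known on the unit circle itself, so the outer boundary of the annulus
    has a radius \<open>r < 1\<close>, which tends to 1 afterwards.\<close>
  have "G z ^ N * r ^ n \<le> norm z ^ n" if r: "norm z < r" "r < 1" for r
  proof -
   let ?g = "\<lambda>u. (F u / M) ^ N / u ^ n"
   have ng: "norm (?g u) = G u ^ N / norm u ^ n" for u by (simp only: G_def norm_divide[of "(F u / M) ^ N"] norm_power)
   define S where "S = ball (0::complex) r - cball 0 k"
   have kr: "k < r" using r False by simp
   have "closure S \<subseteq> cball 0 r - ball 0 k" unfolding S_def
    by (rule closure_minimal) (auto intro!: closed_Diff)
   hence cl: "k \<le> norm u" "norm u \<le> r" if "u \<in> closure S" for u using that by auto
   have holg: "?g holomorphic_on ball 0 1 - {0}"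
    using M(2) by (intro holomorphic_intros holomorphic_on_subset[OF hol]) auto
   have "norm (?g z) \<le> 1 / r ^ n"
   proof (rule maximum_modulus_frontier[of ?g S])
    show "?g holomorphic_on interior S" 
     by (rule holomorphic_on_subset[OF holg]) (use r k interior_subset[of S] in \<open>auto simp: S_def\<close>)
    show "continuous_on (closure S) ?g"
     by (rule holomorphic_on_imp_continuous_on, rule holomorphic_on_subset[OF holg]) (use cl r k in force)
    show "bounded S" unfolding S_def by (rule bounded_subset[OF bounded_ball]) auto
    show "z \<in> S" using r False by (simp add: S_def)
    fix u assume u: "u \<in> frontier S"
    hence u1: "k \<le> norm u" "norm u \<le> r" using cl by (auto simp: frontier_def)
    have "open S" by (auto simp: S_def)
    hence "u \<notin> S" using u by (simp add: frontier_def interior_open)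
    hence "norm u = k \<or> norm u = r" using u1 by (auto simp: S_def)
    thus "norm (?g u) \<le> 1 / r ^ n"
    proof
     assume ur: "norm u = r"
     have "G u ^ N \<le> 1" using G[of u 1] M(1)[of u] ur r by (intro power_le_one) (auto simp: G_def)
     thus ?thesis using r k kr by (simp add: ng ur divide_right_mono)
    next
     assume uk: "norm u = k"
     have "G u ^ N \<le> exp (- m) ^ N" using G[OF small[of u]] uk by (intro power_mono) (auto simp: G_def)
     also have "\<dots> = exp (- (real N * m))" by (simp add: exp_of_nat_mult[symmetric])
     also have "\<dots> \<le> exp (- real n * (1 / k))" using n(1) k by (simp add: field_simps)
     \<comment> \<open>The exponent \<open>m * k\<close> is smaller than the sharp
       \<open>m / ln (1 / k)\<close>, by \<open>ln (1 / k) \<le> 1 / k\<close>; this is what makes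
       the inner circle harmless.\<close>
     also have "\<dots> \<le> exp (real n * ln k)" 
     proof -
      have "- ln k \<le> 1 / k" using ln_le_minus_one[of "1 / k"] k by (simp add: ln_div)
      hence "real n * (- ln k) \<le> real n * (1 / k)" by (rule mult_left_mono) simp
      thus ?thesis by simp
     qed
     also have "\<dots> = k ^ n" using k by (simp add: exp_of_nat_mult)
     finally have "G u ^ N * r ^ n \<le> k ^ n * 1" using r kr k by (intro mult_mono power_le_one) (auto simp: G_def)
     thus ?thesis unfolding ng uk using k kr by (simp add: divide_simps)
    qed
   qed
   moreover have "norm z ^ n > 0" "r ^ n > 0" using k kr False by (auto intro!: zero_less_power)
   ultimately show ?thesis unfolding ng by (simp add: field_simps)
  qed
  hence "\<forall>\<^sub>F r in at_left 1. G z ^ N * r ^ n \<le> norm z ^ n"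
   using z by (intro eventually_at_leftI[of "norm z"]) auto
  moreover have "((\<lambda>r. G z ^ N * r ^ n) \<longlongrightarrow> G z ^ N * 1 ^ n) (at_left 1)" by (intro tendsto_intros)
  ultimately have "G z ^ N * 1 ^ n \<le> norm z ^ n" by (intro tendsto_upperbound) auto
  also have "\<dots> \<le> exp (norm z - 1) ^ n" using exp_ge_add_one_self[of "norm z - 1"] by (intro power_mono) auto
  also have "\<dots> = exp (- (real n * (1 - norm z)))" by (simp add: exp_of_nat_mult[symmetric] algebra_simps)
  also have "\<dots> \<le> exp (1 - real N * (m * k * (1 - norm z)))"
  proof -
   have "(real N * m * k - 1) * (1 - norm z) \<le> real n * (1 - norm z)" using n(2) z by (intro mult_right_mono) auto
   moreover have "(real N * m * k - 1) * (1 - norm z) = real N * (m * k * (1 - norm z)) - (1 - norm z)" by (simp add: algebra_simps)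
   ultimately have "- (real n * (1 - norm z)) \<le> 1 - real N * (m * k * (1 - norm z))" using norm_ge_zero[of z] by linarith
   thus ?thesis by simp
  qed
  also have "\<dots> = exp 1 * y ^ N" unfolding y_def exp_of_nat_mult[symmetric] mult_exp_exp by (simp add: algebra_simps)
  finally show ?thesis by simp
 qed
 have "G z \<le> y"
 proof (rule ccontr)
  assume "\<not> ?thesis"
  hence "1 < G z / y" by (simp add: y_def)
  then obtain N where "exp 1 < (G z / y) ^ N" using real_arch_pow by blast
  thus False using bound[of N] by (simp add: power_divide y_def field_simps)
 qed
 thus ?thesis using M(2) by (simp add: G_def norm_divide field_simps y_def)
qed

lemma max_modulus_rect:
 assumes hol: "F holomorphic_on U" and U: "open U"
  and sub: "\<And>w. a \<le> Re w \<Longrightarrow> Re w \<le> b \<Longrightarrow> c \<le> Im w \<Longrightarrow> Im w \<le> d \<Longrightarrow> w \<in> U"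
  and bd: "\<And>w. a \<le> Re w \<Longrightarrow> Re w \<le> b \<Longrightarrow> c \<le> Im w \<Longrightarrow> Im w \<le> d \<Longrightarrow>
    Re w = a \<or> Re w = b \<or> Im w = c \<or> Im w = d \<Longrightarrow> norm (F w) \<le> B"
  and z: "a \<le> Re z" "Re z \<le> b" "c \<le> Im z" "Im z \<le> d"
 shows "norm (F z) \<le> B"
proof -
 define S where "S = cbox (Complex a c) (Complex b d)"
 have SU: "S \<subseteq> U" using sub by (auto simp: S_def in_cbox_complex_iff)
 have clS: "closure S = S" by (simp add: S_def)
 show ?thesis
 proof (rule maximum_modulus_frontier[of F S])
  show "F holomorphic_on interior S"
   using hol SU interior_subset holomorphic_on_subset by blast
  show "continuous_on (closure S) F"
   unfolding clS using holomorphic_on_imp_continuous_on[OF hol] SU continuous_on_subset by blast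
  show "bounded S" by (simp add: S_def)
  show "norm (F w) \<le> B" if "w \<in> frontier S" for w
  proof -
   have "w \<in> cbox (Complex a c) (Complex b d) - box (Complex a c) (Complex b d)"
    using that by (simp add: S_def frontier_def)
   hence "a \<le> Re w" "Re w \<le> b" "c \<le> Im w" "Im w \<le> d" "Re w = a \<or> Re w = b \<or> Im w = c \<or> Im w = d"
    by (auto simp: in_cbox_complex_iff in_box_complex_iff)
   thus ?thesis using bd by blast
  qed
  show "z \<in> S" using z by (simp add: S_def in_cbox_complex_iff)
 qed
qed

lemma exp_growth_beats:
 fixes C c k k' L :: real
 assumes "c > 0" "0 \<le> k" "k < k'"
 shows "\<exists>T. \<forall>S\<ge>T. C * exp (k * S) - c * exp (k' * S) \<le> - L"
proof -
 define T where "T = max 0 ((\<bar>C\<bar> + \<bar>L\<bar>) / (c * (k' - k)))"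
 show ?thesis
 proof (intro exI[of _ T] allI impI)
  fix S assume S: "T \<le> S"
  have S0: "S \<ge> 0" using S by (simp add: T_def)
  have "(\<bar>C\<bar> + \<bar>L\<bar>) / (c * (k' - k)) \<le> S" using S by (simp add: T_def)
  hence "\<bar>C\<bar> + \<bar>L\<bar> \<le> c * ((k' - k) * S)" using assms by (simp add: field_simps)
  also have "\<dots> \<le> c * exp ((k' - k) * S)"
   using assms exp_ge_add_one_self[of "(k' - k) * S"] by (intro mult_left_mono) linarith+
  finally have a: "C - c * exp ((k' - k) * S) \<le> - \<bar>L\<bar>" by linarith
  have "C * exp (k * S) - c * exp (k' * S) = exp (k * S) * (C - c * exp ((k' - k) * S))"
  proof -
   have "exp (k' * S) = exp (k * S) * exp ((k' - k) * S)" by (simp add: mult_exp_exp algebra_simps)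
   thus ?thesis by (simp add: algebra_simps)
  qed
  also have "\<dots> \<le> exp (k * S) * (- \<bar>L\<bar>)" using a by (intro mult_left_mono) auto
  also have "\<dots> \<le> 1 * (- \<bar>L\<bar>)"
   using assms S0 by (intro mult_right_mono_neg) auto
  finally show "C * exp (k * S) - c * exp (k' * S) \<le> - L" by simp
 qed
qed

text \<open>The factor \<open>exp (- e * exp (c' * u))\<close> with
  \<open>k < c' < pi / (2 * w)\<close> has modulus at most 1 in the half-strip, since
  \<open>c' * \<bar>Im u\<bar> < pi / 2\<close>, and beats the growth of \<open>F\<close> on a far
  vertical edge; then \<open>e\<close> tends to 0. One far edge for each \<open>e\<close> is enough,
  so \<open>growth\<close> speaks only of some arbitrarily far edges.\<close>

lemma phragmen_lindelof_strip:
 assumes hol: "F holomorphic_on U" and U: "open U"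
  and sub: "\<And>u. s0 \<le> Re u \<Longrightarrow> \<bar>Im u\<bar> \<le> w \<Longrightarrow> u \<in> U"
  and w: "w > 0" and kap: "0 \<le> k" "k * w < pi / 2"
  and side: "\<And>u. s0 \<le> Re u \<Longrightarrow> \<bar>Im u\<bar> = w \<Longrightarrow> norm (F u) \<le> M"
  and left: "\<And>u. Re u = s0 \<Longrightarrow> \<bar>Im u\<bar> \<le> w \<Longrightarrow> norm (F u) \<le> M"
  and growth: "\<And>T. \<exists>S\<ge>T. \<forall>u. Re u = S \<longrightarrow> \<bar>Im u\<bar> \<le> w \<longrightarrow> norm (F u) \<le> exp (C * exp (k * S))"
  and z: "s0 \<le> Re z" "\<bar>Im z\<bar> \<le> w"
 shows "norm (F z) \<le> M"
proof -
 define c' where "c' = (k + pi / (2 * w)) / 2"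
 have "k < pi / (2 * w)" using kap w by (simp add: field_simps)
 hence k': "k < c'" "c' < pi / (2 * w)" by (auto simp: c'_def)
 hence k'w: "c' * w < pi / 2" "c' > 0" using w kap by (auto simp: field_simps)
 define c where "c = cos (c' * w)"
 have c: "c > 0" unfolding c_def using k'w w by (intro cos_gt_zero_pi) (auto intro: order.strict_trans[of _ 0])
 have cosge: "cos (c' * y) \<ge> c" if "\<bar>y\<bar> \<le> w" for y
 proof -
  have "cos (c' * y) = cos (c' * \<bar>y\<bar>)" by (cases "y \<ge> 0") auto
  also have "\<dots> \<ge> cos (c' * w)"
  proof (intro cos_monotone_0_pi_le mult_left_mono mult_nonneg_nonneg)
   show "c' * w \<le> pi" using k'w pi_gt_zero by linarith
  qed (use that k'w w in auto)
  finally show ?thesis by (simp add: c_def)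
 qed
 have M0: "M \<ge> 0"
 proof -
  have "norm (F (Complex s0 0)) \<le> M" using left[of "Complex s0 0"] w by simp
  thus ?thesis by (rule order_trans[OF norm_ge_zero])
 qed
 define X where "X = exp (c' * Re z)"
 have normE: "norm (exp (- of_real e * exp (of_real c' * u))) = exp (- e * (exp (c' * Re u) * cos (c' * Im u)))" for e u
  by (simp add: Re_exp)
 have main: "norm (F z) \<le> (M + e) * exp (e * X)" if eps: "e > 0" for e
 proof -
  define P where "P = (\<lambda>u. F u * exp (- of_real e * exp (of_real c' * u)))"
  have PF: "norm (P u) \<le> norm (F u)" if "\<bar>Im u\<bar> \<le> w" for u
  proof -
   have "e * (exp (c' * Re u) * cos (c' * Im u)) \<ge> 0"
    using cosge[OF that] c eps by (intro mult_nonneg_nonneg) auto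
   thus ?thesis unfolding P_def norm_mult normE by (intro mult_right_le_one_le) auto
  qed
  obtain T where T: "\<And>S. S \<ge> T \<Longrightarrow> C * exp (k * S) - (e * c) * exp (c' * S) \<le> - (- ln e)"
   using exp_growth_beats[of "e * c" k c' C "- ln e"] c eps kap(1) k'(1) by auto
  obtain S where S: "S \<ge> max T (max s0 (Re z))"
   "\<And>u. Re u = S \<Longrightarrow> \<bar>Im u\<bar> \<le> w \<Longrightarrow> norm (F u) \<le> exp (C * exp (k * S))"
   using growth[of "max T (max s0 (Re z))"] by blast
  have right: "norm (P u) \<le> M + e" if "Re u = S" "\<bar>Im u\<bar> \<le> w" for u
  proof -
   have "norm (P u) \<le> exp (C * exp (k * S)) * exp (- e * (exp (c' * S) * c))"
    unfolding P_def norm_mult normE that(1)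
   proof (rule mult_mono[OF S(2)[OF that]])
    have "e * (exp (c' * S) * c) \<le> e * (exp (c' * S) * cos (c' * Im u))"
     using cosge[OF that(2)] eps by (intro mult_left_mono) auto
    thus "exp (- e * (exp (c' * S) * cos (c' * Im u))) \<le> exp (- e * (exp (c' * S) * c))" by simp
   qed auto
   also have "\<dots> = exp (C * exp (k * S) - (e * c) * exp (c' * S))"
    by (simp add: mult_exp_exp algebra_simps)
   also have "\<dots> \<le> exp (ln e)" using T[of S] S(1) by simp
   finally show ?thesis using eps M0 by simp
  qed
  have "norm (P z) \<le> M + e"
  proof (rule max_modulus_rect[where F = P and U = U and a = s0 and b = S and c = "-w" and d = w])
   show "P holomorphic_on U" unfolding P_def by (intro holomorphic_intros hol)
   fix u assume a: "s0 \<le> Re u" "Re u \<le> S" "- w \<le> Im u" "Im u \<le> w"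
    "Re u = s0 \<or> Re u = S \<or> Im u = - w \<or> Im u = w"
   have i: "\<bar>Im u\<bar> \<le> w" using a by auto
   from a(5) consider "Re u = s0" | "Re u = S" | "\<bar>Im u\<bar> = w" using w by fastforce
   thus "norm (P u) \<le> M + e"
    using right[OF _ i] left[OF _ i] side[OF a(1)] PF[OF i] eps by cases force+
  qed (use U sub z S(1) in auto)
  moreover have "F z = P z * exp (of_real e * exp (of_real c' * z))"
   by (simp add: P_def mult_exp_exp)
  ultimately have "norm (F z) \<le> (M + e) * norm (exp (of_real e * exp (of_real c' * z)))"
   by (simp add: norm_mult mult_right_mono)
  also have "norm (exp (of_real e * exp (of_real c' * z))) \<le> exp (e * X)"
  proof -
   have "Re (of_real e * exp (of_real c' * z)) \<le> e * X"
    using eps by (simp add: Re_exp X_def)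
   thus ?thesis by simp
  qed
  finally show ?thesis using M0 eps by (simp add: mult_left_mono)
 qed
 have "((\<lambda>e. (M + e) * exp (e * X)) \<longlongrightarrow> (M + 0) * exp (0 * X)) (at_right 0)"
  by (intro tendsto_intros)
 moreover have "\<forall>\<^sub>F e in at_right 0. norm (F z) \<le> (M + e) * exp (e * X)"
  using main by (auto simp: eventually_at_right_less intro: eventually_mono[OF eventually_at_right_less])
 ultimately have "norm (F z) \<le> (M + 0) * exp (0 * X)"
  by (intro tendsto_lowerbound) auto
 thus ?thesis by simp
qed

text \<open>The comparison function is \<open>Re (cos (pi / 2 * (w - z0))) = cos (pi / 2 * (Re w -
  s)) * cosh (pi / 2 * (Im w - Im z0))\<close>. It vanishes on the vertical sides, where only
  \<open>exp B\<close> is known; it is at most \<open>K\<close> on the horizontal sides, where the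
  multiple \<open>(B + m) / K\<close> of it may be added to the exponent; and it is at least 1 on
  the line \<open>Re w = s\<close>.\<close>

lemma two_constants_rect:
 assumes hol: "F holomorphic_on U" and U: "open U"
  and sub: "\<And>w. s - 1 \<le> Re w \<Longrightarrow> Re w \<le> s + 1 \<Longrightarrow> c \<le> Im w \<Longrightarrow> Im w \<le> d \<Longrightarrow> w \<in> U"
  and bd: "\<And>w. s - 1 \<le> Re w \<Longrightarrow> Re w \<le> s + 1 \<Longrightarrow> c \<le> Im w \<Longrightarrow> Im w \<le> d \<Longrightarrow> norm (F w) \<le> exp B"
  and side: "\<And>w. s - 1 \<le> Re w \<Longrightarrow> Re w \<le> s + 1 \<Longrightarrow> Im w = c \<or> Im w = d \<Longrightarrow> norm (F w) \<le> exp (- m)"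
  and B: "B \<ge> 0" and m: "m \<ge> 0" and z: "Re z = s" "c \<le> Im z" "Im z \<le> d"
 shows "norm (F z) \<le> exp (B - m / cosh (pi * (d - c) / 4))"
proof -
 define K where "K = cosh (pi * (d - c) / 4)"
 have K: "K \<ge> 1" unfolding K_def by (rule cosh_real_ge_1)
 define z0 where "z0 = Complex s ((c + d) / 2)"
 define P where "P = (\<lambda>w. F w * exp (of_real ((B + m) / K) * cos (of_real (pi / 2) * (w - z0))))"
 have Recos: "Re (cos (of_real (pi / 2) * (w - z0))) = cos (pi / 2 * (Re w - s)) * cosh (pi / 2 * (Im w - (c + d) / 2))" for w
  by (simp add: Re_cos z0_def cosh_def)
 have nP: "norm (P w) = norm (F w) * exp ((B + m) / K * (cos (pi / 2 * (Re w - s)) * cosh (pi / 2 * (Im w - (c + d) / 2))))" for w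
  unfolding P_def norm_mult norm_exp_eq_Re using Recos by simp
 have "norm (P z) \<le> exp B"
 proof (rule max_modulus_rect[where F = P and U = U and a = "s - 1" and b = "s + 1" and c = c and d = d])
  show "P holomorphic_on U" unfolding P_def by (intro holomorphic_intros hol)
  fix w assume a: "s - 1 \<le> Re w" "Re w \<le> s + 1" "c \<le> Im w" "Im w \<le> d"
    "Re w = s - 1 \<or> Re w = s + 1 \<or> Im w = c \<or> Im w = d"
  show "norm (P w) \<le> exp B"
  proof (cases "Im w = c \<or> Im w = d")
   case True
   have "cosh (pi / 2 * (Im w - (c + d) / 2)) = K"
   proof -
    have "pi / 2 * (Im w - (c + d) / 2) = pi * (d - c) / 4 \<or> pi / 2 * (Im w - (c + d) / 2) = - (pi * (d - c) / 4)"
     using True by (auto simp: field_simps)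
    thus ?thesis unfolding K_def by (metis cosh_minus)
   qed
   hence "norm (P w) = norm (F w) * exp ((B + m) * cos (pi / 2 * (Re w - s)))"
    unfolding nP using K by simp
   also have "\<dots> \<le> exp (-m) * exp ((B + m) * 1)"
    using side[OF a(1,2) True] B m by (intro mult_mono) (auto intro!: mult_left_le)
   finally show ?thesis by (simp add: mult_exp_exp)
  next
   case False
   have "pi / 2 * (Re w - s) = - (pi / 2) \<or> pi / 2 * (Re w - s) = pi / 2"
    using a(5) False by (auto simp: algebra_simps)
   hence "cos (pi / 2 * (Re w - s)) = 0" by (metis cos_pi_half cos_minus)
   thus ?thesis unfolding nP using bd[OF a(1-4)] by simp
  qed
 qed (use U sub z in auto)
 moreover have "norm (P z) \<ge> norm (F z) * exp ((B + m) / K)"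
 proof -
  have "cosh (pi / 2 * (Im z - (c + d) / 2)) \<ge> 1" by (rule cosh_real_ge_1)
  hence "(B + m) / K * 1 \<le> (B + m) / K * cosh (pi / 2 * (Im z - (c + d) / 2))"
   using B m K by (intro mult_left_mono) auto
  thus ?thesis unfolding nP using z by (intro mult_left_mono) auto
 qed
 ultimately have "norm (F z) * exp ((B + m) / K) \<le> exp B" by linarith
 hence "norm (F z) \<le> exp (B - (B + m) / K)" by (simp add: exp_diff field_simps)
 also have "\<dots> \<le> exp (B - m / K)" using B K by (simp add: divide_right_mono)
 finally show ?thesis by (simp add: K_def)
qed

text \<open>The strip version in the coordinate \<open>ln r + \<i> * (t - m)\<close>, where
  \<open>r powr k\<close> becomes \<open>exp (k * Re u)\<close>.\<close>

lemma phragmen_lindelof_sector: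
 assumes hol: "F holomorphic_on U" and U: "open U" and r0: "r0 > 0"
  and sub: "\<And>r t. r0 \<le> r \<Longrightarrow> \<bar>t - m\<bar> \<le> w \<Longrightarrow> of_real r * cis t \<in> U"
  and w: "w > 0" and kap: "0 \<le> k" "k * w < pi / 2"
  and side: "\<And>r t. r0 \<le> r \<Longrightarrow> \<bar>t - m\<bar> = w \<Longrightarrow> norm (F (of_real r * cis t)) \<le> M"
  and left: "\<And>t. \<bar>t - m\<bar> \<le> w \<Longrightarrow> norm (F (of_real r0 * cis t)) \<le> M"
  and growth: "\<And>T. \<exists>r\<ge>T. \<forall>t. \<bar>t - m\<bar> \<le> w \<longrightarrow> norm (F (of_real r * cis t)) \<le> exp (C * r powr k)"
  and z: "r0 \<le> r" "\<bar>t - m\<bar> \<le> w"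
 shows "norm (F (of_real r * cis t)) \<le> M"
proof -
 define E where "E = (\<lambda>u::complex. exp (u + \<i> * of_real m))"
 have E: "E u = of_real (exp (Re u)) * cis (Im u + m)" for u
  by (simp add: E_def exp_eq_polar exp_of_real)
 have openV: "open (E -` U)"
  unfolding E_def by (rule open_vimage[OF U]) (auto intro!: continuous_intros)
 have "norm ((F \<circ> E) (Complex (ln r) (t - m))) \<le> M"
 proof (rule phragmen_lindelof_strip[where F = "F \<circ> E" and M = M and U = "E -` U" and k = k and C = C and ?s0.0 = "ln r0" and w = w])
  show "F \<circ> E holomorphic_on E -` U"
   by (rule holomorphic_on_compose_gen[OF _ hol]) (auto simp: E_def intro!: holomorphic_intros)
  have r0le: "r0 \<le> exp x" if "ln r0 \<le> x" for x
   using that r0 by (metis exp_le_cancel_iff exp_ln)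
  show "u \<in> E -` U" if "ln r0 \<le> Re u" "\<bar>Im u\<bar> \<le> w" for u
   using sub[OF r0le[OF that(1)], of "Im u + m"] that by (simp add: E)
  show "norm ((F \<circ> E) u) \<le> M" if "ln r0 \<le> Re u" "\<bar>Im u\<bar> = w" for u
   using side[OF r0le[OF that(1)], of "Im u + m"] that by (simp add: E)
  show "norm ((F \<circ> E) u) \<le> M" if "Re u = ln r0" "\<bar>Im u\<bar> \<le> w" for u
   using left[of "Im u + m"] that r0 by (simp add: E)
  show "\<exists>S\<ge>T. \<forall>u. Re u = S \<longrightarrow> \<bar>Im u\<bar> \<le> w \<longrightarrow> norm ((F \<circ> E) u) \<le> exp (C * exp (k * S))" for T
  proof -
   obtain r where r: "r \<ge> exp T" "\<And>t. \<bar>t - m\<bar> \<le> w \<Longrightarrow> norm (F (of_real r * cis t)) \<le> exp (C * r powr k)"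
    using growth[of "exp T"] by blast
   have r0: "r > 0" using r(1) exp_gt_zero[of T] by linarith
   show ?thesis
   proof (intro exI[of _ "ln r"] conjI allI impI)
    show "T \<le> ln r" using r(1) r0 by (simp add: ln_ge_iff)
    fix u assume "Re u = ln r" "\<bar>Im u\<bar> \<le> w"
    thus "norm ((F \<circ> E) u) \<le> exp (C * exp (k * ln r))"
     using r(2)[of "Im u + m"] r0 by (simp add: E powr_def)
   qed
  qed
  show "ln r0 \<le> Re (Complex (ln r) (t - m))" using z(1) r0 by simp
 qed (use openV w kap z in auto)
 moreover have "r > 0" using z r0 by linarith
 ultimately show ?thesis by (simp add: E)
qed

section \<open>Strips and limits of roots\<close>

definition strip :: "real \<Rightarrow> real \<Rightarrow> complex set" where
 "strip l u = {w. l < Im w \<and> Im w < u}"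

lemma in_strip [simp]: "w \<in> strip l u \<longleftrightarrow> l < Im w \<and> Im w < u"
 by (simp add: strip_def)

lemma open_strip [simp]: "open (strip l u)"
proof -
 have "strip l u = {w. l < Im w} \<inter> {w. Im w < u}" by auto
 thus ?thesis by (simp add: open_halfspace_Im_gt open_halfspace_Im_lt open_Int)
qed

lemma convex_strip [simp]: "convex (strip l u)"
proof -
 have "strip l u = {w. l < Im w} \<inter> {w. Im w < u}" by auto
 thus ?thesis by (simp add: convex_halfspace_Im_gt convex_halfspace_Im_lt convex_Int)
qed

lemma connected_strip [simp]: "connected (strip l u)"
 by (simp add: convex_connected)

text \<open>Constant factors are invisible after taking roots of order \<open>A k\<close>, because
  \<open>c powr (1 / A k)\<close> tends to 1.\<close>

lemma powr_inverse_limit_eq: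
 fixes X Y :: "nat \<Rightarrow> real"
 assumes A: "diverges A"
  and X: "(\<lambda>k. X k powr (1 / A k)) \<longlonglongrightarrow> e"
  and c: "0 < c" and d: "0 < d"
  and XY: "EVN k. 0 \<le> X k \<and> c * X k \<le> Y k \<and> Y k \<le> d * X k"
 shows "(\<lambda>k. Y k powr (1 / A k)) \<longlonglongrightarrow> e"
proof -
 have A0: "EVN k. A k > 0"
  using A by (simp add: filterlim_at_top_dense)
 have iA: "(\<lambda>k. 1 / A k) \<longlonglongrightarrow> 0"
  using tendsto_divide_0[OF tendsto_const filterlim_mono[OF A at_top_le_at_infinity order_refl]] by simp
 have lim: "(\<lambda>k. c powr (1 / A k) * X k powr (1 / A k)) \<longlonglongrightarrow> e" if "c > 0" for c
 proof -
  have "(\<lambda>k. c powr (1 / A k) * X k powr (1 / A k)) \<longlonglongrightarrow> c powr 0 * e"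
   by (intro tendsto_intros iA X) (use that in auto)
  thus ?thesis using that by simp
 qed
 show ?thesis
 proof (rule tendsto_sandwich[OF _ _ lim[OF c] lim[OF d]])
  show "EVN k. c powr (1 / A k) * X k powr (1 / A k) \<le> Y k powr (1 / A k)"
   using XY A0 by eventually_elim (use c in \<open>simp add: powr_mult[symmetric] powr_mono2\<close>)
  show "EVN k. Y k powr (1 / A k) \<le> d powr (1 / A k) * X k powr (1 / A k)"
   using XY A0
  proof eventually_elim
   case (elim k)
   have "0 \<le> c * X k" using elim c by simp
   hence "0 \<le> Y k" using elim by linarith
   thus ?case using elim d by (simp add: powr_mult[symmetric] powr_mono2)
  qed
 qed
qed

text \<open>Meant for \<open>u k = norm (f z)\<close> and \<open>v k = norm (f z - 1)\<close>, for
  which \<open>uv\<close> collects the triangle inequalities. If \<open>e > 1\<close>, then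
  \<open>u k\<close> is eventually large and \<open>v k\<close> comparable to it; if
  \<open>e < 1\<close>, then \<open>u k\<close> is eventually small and \<open>v k\<close>
  comparable to 1.\<close>

lemma root_limits_aux:
 fixes u v :: "nat \<Rightarrow> real"
 assumes A: "diverges A"
  and u: "\<And>k. 0 \<le> u k" and v: "\<And>k. 0 \<le> v k"
  and uv: "\<And>k. \<bar>u k - v k\<bar> \<le> 1" "\<And>k. u k + v k \<ge> 1"
  and e: "(\<lambda>k. u k powr (1 / A k)) \<longlonglongrightarrow> e" and h: "(\<lambda>k. v k powr (1 / A k)) \<longlonglongrightarrow> h"
 shows "e > 1 \<Longrightarrow> h = e" and "e < 1 \<Longrightarrow> h = 1"
proof -
 have A0: "EVN k. A k > 0"
  using A by (simp add: filterlim_at_top_dense)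
 {
  assume e1: "e > 1"
  define q where "q = (1 + e) / 2"
  have q: "1 < q" "q < e" using e1 by (auto simp: q_def)
  have ev1: "EVN k. u k powr (1 / A k) > q" using order_tendstoD(1)[OF e q(2)] .
  have ev2: "EVN k. A k \<ge> 2 / ln q" using A by (simp add: filterlim_at_top)
  have "EVN k. 0 \<le> u k \<and> (1/2) * u k \<le> v k \<and> v k \<le> 2 * u k"
   using A0 ev1 ev2
  proof eventually_elim
   case (elim k)
   have "u k = (u k powr (1 / A k)) powr A k" using elim(1) u[of k] by (cases "u k = 0") (auto simp: powr_powr)
   also have "\<dots> \<ge> q powr A k" using elim q by (intro powr_mono2) auto
   finally have "u k \<ge> exp (A k * ln q)" using q by (simp add: powr_def)
   moreover have "A k * ln q \<ge> 2" using elim(3) q by (simp add: field_simps)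
   hence "exp (A k * ln q) \<ge> 2" using exp_ge_add_one_self[of "A k * ln q"] by linarith
   ultimately have "u k \<ge> 2" by linarith
   thus ?case using uv(1)[of k] by linarith
  qed
  from powr_inverse_limit_eq[OF A e _ _ this] have "(\<lambda>k. v k powr (1 / A k)) \<longlonglongrightarrow> e" by simp
  with h show "h = e" by (rule LIMSEQ_unique)
 }
 {
  assume e1: "e < 1"
  have e0: "0 \<le> e" by (rule tendsto_lowerbound[OF e]) auto
  define q where "q = (1 + e) / 2"
  have q: "0 < q" "q < 1" "e < q" using e1 e0 by (auto simp: q_def)
  have ev1: "EVN k. u k powr (1 / A k) < q" using order_tendstoD(2)[OF e q(3)] .
  have ev2: "EVN k. A k \<ge> 2 / ln (1 / q)" using A by (simp add: filterlim_at_top)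
  have "EVN k. 0 \<le> (1::real) \<and> (1/2) * 1 \<le> v k \<and> v k \<le> 2 * 1"
   using A0 ev1 ev2
  proof eventually_elim
   case (elim k)
   have lq: "ln (1 / q) > 0" using q by (simp add: ln_div)
   have "u k = (u k powr (1 / A k)) powr A k" using elim(1) u[of k] by (cases "u k = 0") (auto simp: powr_powr)
   also have "\<dots> \<le> q powr A k" using elim q by (intro powr_mono2) auto
   finally have uk: "u k \<le> exp (- (A k * ln (1 / q)))" using q by (simp add: powr_def ln_div)
   have "A k * ln (1 / q) \<ge> 2" using elim(3) lq by (simp add: field_simps)
   hence "exp (A k * ln (1 / q)) \<ge> 2" using exp_ge_add_one_self[of "A k * ln (1/q)"] by linarith
   hence "exp (- (A k * ln (1 / q))) \<le> 1 / 2" by (simp add: exp_minus field_simps)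
   hence "u k \<le> 1 / 2" using uk by linarith
   thus ?case using uv[of k] by linarith
  qed
  moreover have "(\<lambda>k. (1::real) powr (1 / A k)) \<longlonglongrightarrow> 1" by simp
  ultimately have "(\<lambda>k. v k powr (1 / A k)) \<longlonglongrightarrow> 1"
   using powr_inverse_limit_eq[OF A, of "\<lambda>_. 1" 1 "1/2" 2 v] by simp
  with h show "h = 1" by (rule LIMSEQ_unique)
 }
qed

lemma unimodular_on_open_imp_const:
 assumes hol: "H holomorphic_on S" and S: "open S" "connected S"
  and V: "open V" "V \<subseteq> S" "V \<noteq> {}" and le: "\<And>z. z \<in> V \<Longrightarrow> norm (H z) \<le> 1"
  and x: "x \<in> V" "norm (H x) = 1" and z: "z \<in> S"
 shows "norm (H z) = 1"
proof -
 have "H constant_on S"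
  by (rule maximum_modulus_principle[OF hol S V(1,2) x(1)]) (use le x in auto)
 thus ?thesis using x z V unfolding constant_on_def by (metis subsetD)
qed

section \<open>Trichotomy for a pair of limit functions\<close>

text \<open>\<open>E\<close> and \<open>H\<close> stand for limits of the roots of order
  \<open>A\<close> of \<open>f\<close> and \<open>f - 1\<close>, on strips \<open>S1\<close> and
  \<open>S0\<close> free of zeros and of 1-points. The first gap between the sectors is
  \<open>O1\<close> in both strips; the second is \<open>O2\<close> in \<open>S1\<close>, while in
  \<open>S0\<close> it appears translated by \<open>c\<close>, which will be
  \<open>- 2 * pi * \<i>\<close>. The eight implications are symmetric in \<open>E\<close> and
  \<open>H\<close>, so \<open>root_pair_swap\<close> saves half of the work.\<close>

locale root_pair =
 fixes E H :: "complex \<Rightarrow> complex" and S1 S0 O1 O2 :: "complex set" and c :: complex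
 assumes E: "E holomorphic_on S1" and H: "H holomorphic_on S0"
  and S1: "open S1" "connected S1" and S0: "open S0" "connected S0"
  and O1: "open O1" "connected O1" "O1 \<subseteq> S1" "O1 \<subseteq> S0" "O1 \<noteq> {}"
  and O2: "open O2" "connected O2" "O2 \<subseteq> S1" "\<And>z. z \<in> O2 \<Longrightarrow> z + c \<in> S0" "O2 \<noteq> {}"
  and gt1: "\<And>z. z \<in> O1 \<Longrightarrow> norm (E z) > 1 \<Longrightarrow> norm (H z) = norm (E z)"
  and gt1': "\<And>z. z \<in> O2 \<Longrightarrow> norm (E z) > 1 \<Longrightarrow> norm (H (z + c)) = norm (E z)"
  and lt1: "\<And>z. z \<in> O1 \<Longrightarrow> norm (E z) < 1 \<Longrightarrow> norm (H z) = 1"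
  and lt1': "\<And>z. z \<in> O2 \<Longrightarrow> norm (E z) < 1 \<Longrightarrow> norm (H (z + c)) = 1"
  and Hgt1: "\<And>z. z \<in> O1 \<Longrightarrow> norm (H z) > 1 \<Longrightarrow> norm (H z) = norm (E z)"
  and Hgt1': "\<And>z. z \<in> O2 \<Longrightarrow> norm (H (z + c)) > 1 \<Longrightarrow> norm (H (z + c)) = norm (E z)"
  and Hlt1: "\<And>z. z \<in> O1 \<Longrightarrow> norm (H z) < 1 \<Longrightarrow> norm (E z) = 1"
  and Hlt1': "\<And>z. z \<in> O2 \<Longrightarrow> norm (H (z + c)) < 1 \<Longrightarrow> norm (E z) = 1"
begin

text \<open>A point with \<open>norm (E x) < 1\<close> gives an open set on which \<open>H\<close>
  is unimodular, and the maximum principle spreads this to all of \<open>S0\<close>.\<close>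

lemma small_case_H1:
 assumes "x \<in> O1 \<union> O2" "norm (E x) < 1" "z \<in> S0"
 shows "norm (H z) = 1"
proof -
 have op: "open {z \<in> S1. norm (E z) < 1}"
 proof -
  have "continuous_on S1 (\<lambda>z. norm (E z))" using E by (intro continuous_on_norm holomorphic_on_imp_continuous_on)
  from continuous_on_open_vimage[OF S1(1), THEN iffD1, OF this, rule_format, of "{..<1}"]
  have "open ((\<lambda>z. norm (E z)) -` {..<1} \<inter> S1)" by simp
  moreover have "(\<lambda>z. norm (E z)) -` {..<1} \<inter> S1 = {z \<in> S1. norm (E z) < 1}" by auto
  ultimately show ?thesis by simp
 qed
 show ?thesis
 proof (cases "x \<in> O1")
  case True
  let ?V = "O1 \<inter> {z \<in> S1. norm (E z) < 1}"
  show ?thesis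
   by (rule unimodular_on_open_imp_const[OF H S0, of ?V x z])
     (use op O1 True assms lt1 in auto)
 next
  case False
  hence x2: "x \<in> O2" using assms by auto
  let ?V = "(\<lambda>z. z + c) ` (O2 \<inter> {z \<in> S1. norm (E z) < 1})"
  have oV: "open ?V" using open_translation[OF open_Int[OF O2(1) op], of c] by (simp add: add.commute)
  show ?thesis
   by (rule unimodular_on_open_imp_const[OF H S0 oV, of "x + c" z])
     (use O2 x2 assms lt1' in auto)
 qed
qed

text \<open>As \<open>H\<close> is unimodular, \<open>norm (E z) > 1\<close> is impossible in both
  gaps. So \<open>E\<close> is bounded by 1 there, and modulus 1 at one point would spread to all of
  \<open>S1\<close>, in particular to \<open>y\<close>.\<close>

lemma small_case_E:
 assumes x: "y \<in> O1 \<union> O2" "norm (E y) < 1" and z: "z \<in> O1 \<union> O2"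
 shows "norm (E z) < 1"
proof (rule ccontr)
 have H1: "norm (H z) = 1" if "z \<in> S0" for z using small_case_H1[OF x that] .
 have le: "norm (E z) \<le> 1" if "z \<in> O1 \<union> O2" for z
 proof (cases "z \<in> O1")
  case True
  thus ?thesis using gt1[OF True] H1[of z] O1 by (cases "norm (E z) > 1") auto
 next
  case False
  hence "z \<in> O2" using that by simp
  thus ?thesis using gt1'[of z] H1[of "z + c"] O2 by (cases "norm (E z) > 1") auto
 qed
 assume "\<not> norm (E z) < 1"
 hence e1: "norm (E z) = 1" using le[OF z] by simp
 have "norm (E y) = 1"
 proof (cases "z \<in> O1")
  case True
  show ?thesis by (rule unimodular_on_open_imp_const[OF E S1 O1(1,3) _ _ True e1]) (use le x O1 O2 in auto)
 next
  case False
  hence "z \<in> O2" using z by simp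
  show ?thesis by (rule unimodular_on_open_imp_const[OF E S1 O2(1,3) _ _ \<open>z \<in> O2\<close> e1]) (use le x O1 O2 in auto)
 qed
 thus False using x by simp
qed

text \<open>The maximum principle for \<open>inverse E\<close>, which is holomorphic on
  \<open>Q\<close> because \<open>E\<close> has modulus at least 1 there.\<close>

lemma large_case_aux:
 assumes ge: "\<And>z. z \<in> O1 \<union> O2 \<Longrightarrow> norm (E z) \<ge> 1" and Q: "Q \<in> {O1, O2}" and z: "z \<in> Q" "norm (E z) = 1" and w: "w \<in> S1"
 shows "norm (E w) = 1"
proof -
 have sub: "Q \<subseteq> S1" "open Q" "connected Q" using Q O1 O2 by auto
 have nz: "E w \<noteq> 0" if "w \<in> Q" for w using ge[of w] that Q by auto
 have hol: "(\<lambda>z. inverse (E z)) holomorphic_on Q"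
  using E sub nz by (intro holomorphic_on_inverse) (auto intro: holomorphic_on_subset)
 have "norm (inverse (E w)) = 1" if "w \<in> Q" for w
 proof (rule unimodular_on_open_imp_const[OF hol sub(2,3), of Q z w])
  show "norm (inverse (E z)) \<le> 1" if "z \<in> Q" for z
   using ge[of z] that Q by (auto simp: norm_inverse inverse_le_1_iff)
 qed (use that z sub in \<open>auto simp: norm_inverse\<close>)
 hence "norm (E w) = 1" if "w \<in> Q" for w using that by (simp add: norm_inverse)
 thus ?thesis using unimodular_on_open_imp_const[OF E S1 sub(2,1), of z w] z w by auto
qed

end

lemma root_pair_swap:
 assumes "root_pair E H S1 S0 O1 O2 c"
 shows "root_pair H E S0 S1 O1 ((\<lambda>z. z + c) ` O2) (- c)"
proof -
 interpret root_pair E H S1 S0 O1 O2 c by fact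
 have "open ((\<lambda>z. z + c) ` O2)" using open_translation[of O2 c] O2 by (simp add: add.commute)
 moreover have "connected ((\<lambda>z. z + c) ` O2)"
  by (intro connected_continuous_image continuous_intros O2)
 ultimately show ?thesis
 proof (intro root_pair.intro E H S1 S0 O1)
  show "(\<lambda>z. z + c) ` O2 \<subseteq> S0" using O2(4) by blast
  show "(\<lambda>z. z + c) ` O2 \<noteq> {}" using O2(5) by blast
  show "norm (E z) = norm (H z)" if "z \<in> O1" "norm (H z) > 1" for z using Hgt1[OF that] by simp
  show "norm (E z) = norm (H z)" if "z \<in> O1" "norm (E z) > 1" for z using gt1[OF that] by simp
  show "norm (E z) = 1" if "z \<in> O1" "norm (H z) < 1" for z using Hlt1[OF that] .
  show "norm (H z) = 1" if "z \<in> O1" "norm (E z) < 1" for z using lt1[OF that] .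
  fix z assume "z \<in> (\<lambda>z. z + c) ` O2"
  then obtain y where y: "y \<in> O2" "z = y + c" by blast
  show "z + - c \<in> S1" using y O2(3) by auto
  show "norm (E (z + - c)) = norm (H z)" if "norm (H z) > 1" using Hgt1'[OF y(1)] that y(2) by simp
  show "norm (E (z + - c)) = norm (H z)" if "norm (E (z + - c)) > 1" using gt1'[OF y(1)] that y(2) by simp
  show "norm (E (z + - c)) = 1" if "norm (H z) < 1" using Hlt1'[OF y(1)] that y(2) by simp
  show "norm (H z) = 1" if "norm (E (z + - c)) < 1" using lt1'[OF y(1)] that y(2) by simp
 qed
qed

text \<open>A value of \<open>E\<close> below 1 in a gap leads to the first alternative, one of
  \<open>H\<close> to the second by symmetry. Otherwise both moduli are at least 1 in the gaps and
  hence equal; if they were 1 at some point, both functions would be unimodular on their strips,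
  against \<open>nontriv\<close>.\<close>

theorem (in root_pair) trichotomy:
 assumes nontriv: "(\<exists>z\<in>S1. norm (E z) > 1) \<or> (\<exists>z\<in>S0. norm (H z) > 1)"
 obtains (small) "\<And>z. z \<in> S0 \<Longrightarrow> norm (H z) = 1" "\<And>z. z \<in> O1 \<union> O2 \<Longrightarrow> norm (E z) < 1"
  | (near1) "\<And>z. z \<in> S1 \<Longrightarrow> norm (E z) = 1" "\<And>z. z \<in> O1 \<Longrightarrow> norm (H z) < 1" "\<And>z. z \<in> O2 \<Longrightarrow> norm (H (z + c)) < 1"
  | (large) "\<And>z. z \<in> O1 \<Longrightarrow> norm (E z) > 1 \<and> norm (H z) = norm (E z)"
    "\<And>z. z \<in> O2 \<Longrightarrow> norm (E z) > 1 \<and> norm (H (z + c)) = norm (E z)"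
proof -
 interpret sw: root_pair H E S0 S1 O1 "(\<lambda>z. z + c) ` O2" "- c"
  by (rule root_pair_swap) unfold_locales
 consider (a) "\<exists>z\<in>O1 \<union> O2. norm (E z) < 1" | (b) "\<exists>z\<in>O1 \<union> (\<lambda>z. z + c) ` O2. norm (H z) < 1"
  | (c) "\<And>z. z \<in> O1 \<union> O2 \<Longrightarrow> norm (E z) \<ge> 1" "\<And>z. z \<in> O1 \<union> (\<lambda>z. z + c) ` O2 \<Longrightarrow> norm (H z) \<ge> 1"
 proof (cases "\<exists>z\<in>O1 \<union> O2. norm (E z) < 1")
  case False
  hence e: "norm (E z) \<ge> 1" if "z \<in> O1 \<union> O2" for z using that by (auto simp: not_less)
  show ?thesis
  proof (cases "\<exists>z\<in>O1 \<union> (\<lambda>z. z + c) ` O2. norm (H z) < 1")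
   case False
   hence "norm (H z) \<ge> 1" if "z \<in> O1 \<union> (\<lambda>z. z + c) ` O2" for z using that by (meson not_less)
   from that(3)[OF e this] show ?thesis by blast
  qed (rule that(2))
 qed (rule that(1))
 thus thesis
 proof cases
  case a
  then obtain x where x: "x \<in> O1 \<union> O2" "norm (E x) < 1" by blast
  show ?thesis
  proof (rule small)
   show "norm (H z) = 1" if "z \<in> S0" for z using small_case_H1[OF x that] .
   show "norm (E z) < 1" if "z \<in> O1 \<union> O2" for z using small_case_E[OF x that] .
  qed
 next
  case b
  then obtain x where x: "x \<in> O1 \<union> (\<lambda>z. z + c) ` O2" "norm (H x) < 1" by blast
  show ?thesis
  proof (rule near1)
   show "norm (E z) = 1" if "z \<in> S1" for z using sw.small_case_H1[OF x that] .
   show "norm (H z) < 1" if "z \<in> O1" for z by (rule sw.small_case_E[OF x]) (use that in simp)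
   show "norm (H (z + c)) < 1" if "z \<in> O2" for z by (rule sw.small_case_E[OF x]) (use that in simp)
  qed
 next
  case c
  have eq1: "norm (H z) = norm (E z)" if "z \<in> O1" for z
  proof -
   have "1 \<le> norm (E z)" by (rule c(1)) (use that in simp)
   moreover have "1 \<le> norm (H z)" by (rule c(2)) (use that in simp)
   ultimately show ?thesis using gt1[OF that] Hgt1[OF that]
    by (metis less_eq_real_def)
  qed
  have eq2: "norm (H (z + c)) = norm (E z)" if "z \<in> O2" for z
  proof -
   have "1 \<le> norm (E z)" by (rule c(1)) (use that in simp)
   moreover have "1 \<le> norm (H (z + c))" by (rule c(2)) (use that in simp)
   ultimately show ?thesis using gt1'[OF that] Hgt1'[OF that]
    by (metis less_eq_real_def)
  qed
  have ne: "norm (E z) \<noteq> 1" if z: "z \<in> O1 \<union> O2" for z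
  proof
   assume e: "norm (E z) = 1"
   obtain Q where Q: "Q \<in> {O1, O2}" "z \<in> Q" using z by auto
   have E1: "norm (E w) = 1" if "w \<in> S1" for w
    using large_case_aux[OF c(1) Q e that] by blast
   have "norm (H w) = 1" if w: "w \<in> S0" for w
   proof -
    obtain z1 where z1: "z1 \<in> O1" using O1 by auto
    have "norm (H z1) = 1" using eq1[OF z1] E1 z1 O1 by auto
    thus ?thesis using sw.large_case_aux[OF c(2) _ z1 _ w] by simp
   qed
   thus False using nontriv E1 by (metis less_irrefl)
  qed
  show ?thesis
  proof (rule large)
   show "norm (E z) > 1 \<and> norm (H z) = norm (E z)" if "z \<in> O1" for z
   proof -
    have "z \<in> O1 \<union> O2" using that by simp
    from c(1)[OF this] ne[OF this] eq1[OF that] show ?thesis by linarith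
   qed
   show "norm (E z) > 1 \<and> norm (H (z + c)) = norm (E z)" if "z \<in> O2" for z
   proof -
    have "z \<in> O1 \<union> O2" using that by simp
    from c(1)[OF this] ne[OF this] eq2[OF that] show ?thesis by linarith
   qed
  qed
 qed
qed

section \<open>Logarithms in strips and the normal family of rescaled roots\<close>

text \<open>A single point with \<open>Re W \<ge> 0\<close> turns an upper bound for
  \<open>Re W\<close> into a lower bound and a derivative bound on a vertical segment. The constant
  depends only on the geometry; as a predicate on \<open>K\<close> this uniformity in
  \<open>W\<close>, \<open>t\<close> and \<open>M\<close> can be passed on.\<close>

definition strip_bound :: "real \<Rightarrow> real \<Rightarrow> real \<Rightarrow> real \<Rightarrow> real \<Rightarrow> bool" where
 "strip_bound l u w w' K \<longleftrightarrow> K > 0 \<and>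
   (\<forall>W t M y0 y. W holomorphic_on strip l u \<longrightarrow> M > 0 \<longrightarrow>
    (\<forall>z\<in>strip l u. \<bar>Re z - t\<bar> < 1 \<longrightarrow> Re (W z) < M) \<longrightarrow>
    y0 \<in> {w..w'} \<longrightarrow> Re (W (Complex t y0)) \<ge> 0 \<longrightarrow> y \<in> {w..w'} \<longrightarrow>
    Re (W (Complex t y)) \<ge> - K * M \<and> norm (deriv W (Complex t y)) \<le> K * M)"

lemma strip_boundD:
 assumes "strip_bound l u v v' K" "W holomorphic_on strip l u" "M > 0"
  "\<And>w. w \<in> strip l u \<Longrightarrow> \<bar>Re w - t\<bar> < 1 \<Longrightarrow> Re (W w) < M"
  "y0 \<in> {v..v'}" "Re (W (Complex t y0)) \<ge> 0" "y \<in> {v..v'}"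
 shows "Re (W (Complex t y)) \<ge> - K * M" "norm (deriv W (Complex t y)) \<le> K * M"
 using assms unfolding strip_bound_def by blast+

text \<open>Harnack's inequality for \<open>M - W\<close>, whose real part is positive in the window
  of half-width 1 about \<open>t\<close>; discs of radius \<open>d\<close> about points of the
  segment stay inside it. The factor \<open>2 / d\<close> in \<open>K\<close> comes from
  \<open>deriv_le_Re\<close>, and as it is at least 1, the same \<open>K\<close> serves the lower
  bound.\<close>

lemma strip_bound_exists:
 assumes l: "l < w" "w \<le> w'" "w' < u"
 shows "\<exists>K. strip_bound l u w w' K"
proof -
 define d where "d = min 1 (min (w - l) (u - w'))"
 have d: "d > 0" "d \<le> 1" "d \<le> w - l" "d \<le> u - w'" using l by (auto simp: d_def)
 define K where "K = exp (2 * (w' - w) / d) * (2 / d)"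
 show ?thesis unfolding strip_bound_def
 proof (intro exI[of _ K] conjI[of "K > 0"] allI impI)
  show "K > 0" using d by (simp add: K_def)
  fix W :: "complex \<Rightarrow> complex" and t M a0 a :: real
  assume W: "W holomorphic_on strip l u" and M: "M > 0"
   and up: "\<forall>z\<in>strip l u. \<bar>Re z - t\<bar> < 1 \<longrightarrow> Re (W z) < M"
   and t0': "a0 \<in> {w..w'}" "Re (W (Complex t a0)) \<ge> 0" and th': "a \<in> {w..w'}"
  have t0: "w \<le> a0" "a0 \<le> w'" "Re (W (Complex t a0)) \<ge> 0" and th: "w \<le> a" "a \<le> w'"
   using t0' th' by auto
  define U where "U = strip l u \<inter> {z. \<bar>Re z - t\<bar> < 1}"
  define g where "g = (\<lambda>z. of_real M - W z)"
  have oU: "open U"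
  proof -
   have "{z. \<bar>Re z - t\<bar> < 1} = {z. Re z < t + 1} \<inter> {z. t - 1 < Re z}" by auto
   thus ?thesis unfolding U_def by (simp add: open_Int open_halfspace_Re_lt open_halfspace_Re_gt)
  qed
  have hol: "g holomorphic_on U" unfolding g_def U_def
   by (intro holomorphic_intros holomorphic_on_subset[OF W]) auto
  have pos: "Re (g z) > 0" if "z \<in> U" for z using up[rule_format, of z] that by (simp add: U_def g_def)
  have balls: "ball (Complex t y) d \<subseteq> U" if "w \<le> y" "y \<le> w'" for y
  proof
   fix x assume "x \<in> ball (Complex t y) d"
   hence "norm (x - Complex t y) < d" by (simp add: dist_norm norm_minus_commute)
   hence "\<bar>Re x - t\<bar> < d" "\<bar>Im x - y\<bar> < d"
    using abs_Re_le_cmod[of "x - Complex t y"] abs_Im_le_cmod[of "x - Complex t y"] by auto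
   thus "x \<in> U" using d that by (auto simp: U_def)
  qed
  have "Re (g (Complex t a)) \<le> exp (2 * norm (Complex t a - Complex t a0) / d) * Re (g (Complex t a0))"
  proof (rule harnack_segment[OF hol oU d(1) pos])
   fix x assume "x \<in> closed_segment (Complex t a0) (Complex t a)"
   then obtain v where v: "0 \<le> v" "v \<le> 1" "x = (1 - v) *\<^sub>R Complex t a0 + v *\<^sub>R Complex t a"
    by (auto simp: closed_segment_def)
   have "x = Complex t ((1 - v) * a0 + v * a)" using v by (simp add: complex_eq_iff algebra_simps)
   moreover have "(1 - v) * a0 + v * a \<ge> (1 - v) * w + v * w" using v t0 th by (intro add_mono mult_left_mono) auto
   moreover have "(1 - v) * a0 + v * a \<le> (1 - v) * w' + v * w'" using v t0 th by (intro add_mono mult_left_mono) auto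
   ultimately show "ball x d \<subseteq> U" using balls by (simp add: algebra_simps)
  qed
  also have "\<dots> \<le> exp (2 * (w' - w) / d) * M"
  proof (rule mult_mono)
   have "Complex t a - Complex t a0 = Complex 0 (a - a0)" by (simp add: complex_eq_iff)
   hence "norm (Complex t a - Complex t a0) = \<bar>a - a0\<bar>" by (simp add: cmod_def)
   moreover have "2 * \<bar>a - a0\<bar> \<le> 2 * (w' - w)"
   proof -
    have "\<bar>a - a0\<bar> \<le> w' - w" by (rule abs_leI) (use t0(1,2) th in linarith)+
    thus ?thesis by simp
   qed
   ultimately show "exp (2 * norm (Complex t a - Complex t a0) / d) \<le> exp (2 * (w' - w) / d)"
    using d by (simp only: exp_le_cancel_iff divide_right_mono less_imp_le)
   show "Re (g (Complex t a0)) \<le> M" using t0 by (simp add: g_def)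
   show "0 \<le> Re (g (Complex t a0))" using pos[of "Complex t a0"] balls[OF t0(1,2)] d
    by (meson centre_in_ball less_imp_le subsetD)
  qed simp
  finally have le: "Re (g (Complex t a)) \<le> exp (2 * (w' - w) / d) * M" .
  have "norm (deriv g (Complex t a)) \<le> 2 * Re (g (Complex t a)) / d"
   by (rule deriv_le_Re[OF holomorphic_on_subset[OF hol balls[OF th]] d(1)]) (use pos balls[OF th] in blast)
  also have "\<dots> \<le> 2 * (exp (2 * (w' - w) / d) * M) / d"
   using le d by (intro divide_right_mono mult_left_mono) auto
  also have "\<dots> = K * M" by (simp add: K_def)
  finally have "norm (deriv g (Complex t a)) \<le> K * M" .
  moreover have "deriv g (Complex t a) = - deriv W (Complex t a)"
  proof -
   have "W field_differentiable at (Complex t a)"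
    using W th l by (intro holomorphic_on_imp_differentiable_at[OF W]) auto
   thus ?thesis unfolding g_def by simp
  qed
  moreover have "- K * M \<le> Re (W (Complex t a))"
  proof -
   have "exp (2 * (w' - w) / d) * M \<le> exp (2 * (w' - w) / d) * (2 / d) * M"
    using d M by (intro mult_right_mono) (auto simp: field_simps)
   hence "Re (g (Complex t a)) \<le> K * M" using le by (simp add: K_def)
   thus ?thesis using M by (simp add: g_def)
  qed
  ultimately show "- K * M \<le> Re (W (Complex t a)) \<and> norm (deriv W (Complex t a)) \<le> K * M" by simp
 qed
qed

lemma eventually_bounded_imp_bounded:
 fixes X :: "nat \<Rightarrow> real"
 assumes "EVN k. X k \<le> B"
 obtains B' where "\<And>k. X k \<le> B'"
proof -
 obtain N where N: "\<And>k. k \<ge> N \<Longrightarrow> X k \<le> B" using assms by (auto simp: eventually_sequentially)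
 define B' where "B' = max B (Max (X ` {..N}))"
 show thesis
 proof (rule that[of B'])
  fix k show "X k \<le> B'"
  proof (cases "k \<le> N")
   case True
   hence "X k \<le> Max (X ` {..N})" by (intro Max_ge) auto
   thus ?thesis by (simp add: B'_def)
  next
   case False thus ?thesis using N[of k] by (simp add: B'_def)
  qed
 qed
qed

text \<open>An entire function without zeros in a sector, together with its logarithm in the coordinate
 \<open>w = log z\<close>, where the sector is a strip and scaling is a translation.\<close>

locale log_side =
 fixes F G :: "complex \<Rightarrow> complex" and l u C :: real and A :: "real \<Rightarrow> real"
 assumes F: "F holomorphic_on UNIV" and F_0: "F 0 \<noteq> 0" and G: "G holomorphic_on strip l u"
  and FG: "\<And>w. w \<in> strip l u \<Longrightarrow> F (exp w) = exp (G w)"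
  and FA: "\<And>w. norm (F (exp w)) \<le> exp (A (Re w) + C)"
  and A_mono: "\<And>s t. s \<le> t \<Longrightarrow> A s \<le> A t" and A_pos: "\<And>s. A s > 0" and C: "C \<ge> 0"
begin

text \<open>A holomorphic branch of the root of order \<open>A s\<close> of
  \<open>F (exp (w + s))\<close>; in the logarithmic coordinate the dilation by \<open>exp s\<close>
  is the translation by \<open>s\<close>. Taking the root is what makes the family locally
  bounded.\<close>

definition sc :: "real \<Rightarrow> complex \<Rightarrow> complex" where
 "sc s w = exp (G (w + of_real s) / of_real (A s))"

definition lim :: "(nat \<Rightarrow> real) \<Rightarrow> (complex \<Rightarrow> complex) \<Rightarrow> bool" where
 "lim s E \<longleftrightarrow> diverges (\<lambda>k. A (s k)) \<and> E holomorphic_on strip l u \<and>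
   (\<forall>K. compact K \<longrightarrow> K \<subseteq> strip l u \<longrightarrow> uniform_limit K (\<lambda>k. sc (s k)) E sequentially)"

lemma sc_holomorphic: "sc s holomorphic_on strip l u"
 unfolding sc_def
 by (intro holomorphic_intros hol_compose[OF _ G])
   (use A_pos[of s] in auto)

lemma norm_F: "w \<in> strip l u \<Longrightarrow> norm (F (exp w)) = exp (Re (G w))"
 by (simp add: FG)

lemma Re_G_le: "w \<in> strip l u \<Longrightarrow> Re (G w) \<le> A (Re w) + C"
 using FA[of w] norm_F[of w] by simp

lemma norm_sc: "norm (sc s w) = exp (Re (G (w + of_real s)) / A s)"
 using A_pos[of s] by (simp add: sc_def Re_divide_of_real)

lemma norm_sc_le:
 assumes "w \<in> strip l u" "Re w \<le> T"
 shows "norm (sc s w) \<le> exp ((A (s + T) + C) / A s)"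
proof -
 have "Re (G (w + of_real s)) \<le> A (Re (w + of_real s)) + C"
  by (rule Re_G_le) (use assms in auto)
 also have "\<dots> \<le> A (s + T) + C" using assms A_mono[of "Re w + s" "s + T"] by simp
 finally show ?thesis unfolding norm_sc using A_pos[of s] by (simp add: divide_right_mono)
qed

lemma norm_F_sc:
 assumes "w \<in> strip l u"
 shows "norm (F (exp (w + of_real s))) powr (1 / A s) = norm (sc s w)"
 unfolding norm_sc using assms by (simp add: norm_F powr_def)

lemma lim_point:
 assumes "lim s E" "w \<in> strip l u"
 shows "(\<lambda>k. sc (s k) w) \<longlonglongrightarrow> E w"
proof -
 have "compact {w}" "{w} \<subseteq> strip l u" using assms(2) by auto
 hence "uniform_limit {w} (\<lambda>k. sc (s k)) E sequentially" using assms(1) unfolding lim_def by blast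
 thus ?thesis by (rule tendsto_uniform_limitI) simp
qed

lemma lim_subseq:
 assumes "lim s E" "strict_mono r"
 shows "lim (s \<circ> r) E"
 using assms filterlim_subseq[OF assms(2)] unfolding lim_def o_def
 by (auto intro: filterlim_compose[OF _ filterlim_subseq[OF assms(2)]])

text \<open>The hypothesis \<open>b\<close> bounds \<open>A (s k + t) / A (s k)\<close> for each
  fixed \<open>t\<close>, and \<open>norm_sc_le\<close> turns this into a bound for the rescaled
  roots on compact sets.\<close>

lemma montel:
 assumes A: "diverges (\<lambda>k. A (s k))"
  and b: "\<And>t. EVN k. A (s k + t) \<le> b t * A (s k)"
 obtains r E where "strict_mono r" "lim (s \<circ> r) E"
proof -
 have bd: "\<exists>B. \<forall>h\<in>range (\<lambda>k. sc (s k)). \<forall>z\<in>K. norm (h z) \<le> B" if K: "compact K" "K \<subseteq> strip l u" for K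
 proof -
  have "bounded K" using K by (simp add: compact_imp_bounded)
  then obtain T where T: "\<And>z. z \<in> K \<Longrightarrow> norm z \<le> T" by (auto simp: bounded_iff)
  have ReT: "Re z \<le> T" if "z \<in> K" for z using T[OF that] complex_Re_le_cmod[of z] by linarith
  have "EVN k. A (s k) \<ge> 1" using A by (simp add: filterlim_at_top)
  hence "EVN k. (A (s k + T) + C) / A (s k) \<le> b T + C"
   using b[of T]
  proof eventually_elim
   case (elim k)
   have "(A (s k + T) + C) / A (s k) = A (s k + T) / A (s k) + C / A (s k)" by (simp add: add_divide_distrib)
   also have "\<dots> \<le> b T + C / 1"
    using elim C by (intro add_mono divide_left_mono) (auto simp: divide_le_eq)
   finally show ?case by simp
  qed
  from eventually_bounded_imp_bounded[OF this]
  obtain B' where B': "\<And>k. (A (s k + T) + C) / A (s k) \<le> B'" by blast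
  show ?thesis
  proof (intro exI[of _ "exp B'"] ballI)
   fix h z assume "h \<in> range (\<lambda>k. sc (s k))" and z: "z \<in> K"
   then obtain k where k: "h = sc (s k)" by auto
   have "norm (sc (s k) z) \<le> exp ((A (s k + T) + C) / A (s k))"
    by (rule norm_sc_le) (use z K ReT in auto)
   also have "\<dots> \<le> exp B'" using B' by simp
   finally show "norm (h z) \<le> exp B'" by (simp add: k)
  qed
 qed
 obtain E r where E: "E holomorphic_on strip l u" "strict_mono (r :: nat \<Rightarrow> nat)"
   "\<And>K. compact K \<Longrightarrow> K \<subseteq> strip l u \<Longrightarrow> uniform_limit K ((\<lambda>k. sc (s k)) \<circ> r) E sequentially"
  by (rule Montel[of "strip l u" "range (\<lambda>k. sc (s k))" "\<lambda>k. sc (s k)"])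
    (use bd sc_holomorphic in auto)
 have "lim (s \<circ> r) E" unfolding lim_def
  using E filterlim_compose[OF A filterlim_subseq[OF E(2)]] by (auto simp: o_def)
 thus thesis using E(2) that by blast
qed

text \<open>The constant \<open>C\<close> leaves no trace in the bound, because
  \<open>C / A (s k)\<close> tends to 0.\<close>

lemma lim_bound:
 assumes L: "lim s E" and z: "w \<in> strip l u" and b: "EVN k. A (s k + Re w) \<le> b * A (s k)"
 shows "norm (E w) \<le> exp b"
proof -
 have A: "diverges (\<lambda>k. A (s k))" using L by (simp add: lim_def)
 have "(\<lambda>k. C / A (s k)) \<longlonglongrightarrow> 0"
  by (rule tendsto_divide_0[OF tendsto_const filterlim_mono[OF A at_top_le_at_infinity order_refl]])
 hence lim2: "(\<lambda>k. exp (b + C / A (s k))) \<longlonglongrightarrow> exp (b + 0)" by (intro tendsto_intros)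
 have "norm (E w) \<le> exp (b + 0)"
 proof (rule tendsto_le[OF _ lim2 tendsto_norm[OF lim_point[OF L z]]])
  show "EVN k. norm (sc (s k) w) \<le> exp (b + C / A (s k))"
   using b
  proof eventually_elim
   case (elim k)
   have "norm (sc (s k) w) \<le> exp ((A (s k + Re w) + C) / A (s k))"
    by (rule norm_sc_le[OF z]) simp
   also have "(A (s k + Re w) + C) / A (s k) = A (s k + Re w) / A (s k) + C / A (s k)" by (simp add: add_divide_distrib)
   also have "\<dots> \<le> b + C / A (s k)" using elim A_pos[of "s k"] by (simp add: divide_le_eq)
   finally show ?case by simp
  qed
 qed simp
 thus ?thesis by simp
qed

text \<open>Hurwitz: the approximating functions are exponentials and have no zeros.\<close>

lemma lim_zero_free:
 assumes L: "lim s E" and z0: "w0 \<in> strip l u" "E w0 \<noteq> 0" and z: "w \<in> strip l u"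
 shows "E w \<noteq> 0"
proof (cases "E constant_on strip l u")
 case True
 thus ?thesis using z0 z unfolding constant_on_def by metis
next
 case False
 show ?thesis
  by (rule Hurwitz_no_zeros[of "strip l u" "\<lambda>k. sc (s k)" E])
    (use L False z sc_holomorphic in \<open>auto simp: lim_def sc_def\<close>)
qed

text \<open>Leads from the limit back to \<open>G\<close>; the slack between \<open>a\<close> and
  \<open>b\<close> absorbs the error of the uniform convergence.\<close>

lemma lim_uniform_le:
 assumes L: "lim s E" and K: "compact K" "K \<subseteq> strip l u" and le: "\<And>w. w \<in> K \<Longrightarrow> norm (E w) \<le> exp a" and ab: "a < b"
 shows "EVN k. \<forall>w\<in>K. Re (G (w + of_real (s k))) \<le> b * A (s k)"
proof -
 have pos: "exp b - exp a > 0" using ab by simp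
 have ul: "uniform_limit K (\<lambda>k. sc (s k)) E sequentially" using L K by (auto simp: lim_def)
 from uniform_limitD[OF ul pos]
 have "EVN k. \<forall>w\<in>K. dist (sc (s k) w) (E w) < exp b - exp a" .
 thus ?thesis
 proof eventually_elim
  case (elim k)
  show ?case
  proof
   fix w assume z: "w \<in> K"
   have "norm (sc (s k) w) \<le> norm (E w) + dist (sc (s k) w) (E w)"
    unfolding dist_norm by norm
   also have "\<dots> \<le> exp b" using le[OF z] elim z by force
   finally have "Re (G (w + of_real (s k))) / A (s k) \<le> b" by (simp add: norm_sc)
   thus "Re (G (w + of_real (s k))) \<le> b * A (s k)" using A_pos[of "s k"] by (simp add: divide_le_eq)
  qed
 qed
qed

lemma lim_uniform_ge:
 assumes L: "lim s E" and K: "compact K" "K \<subseteq> strip l u" and ge: "\<And>w. w \<in> K \<Longrightarrow> norm (E w) \<ge> exp a" and ab: "b < a"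
 shows "EVN k. \<forall>w\<in>K. Re (G (w + of_real (s k))) \<ge> b * A (s k)"
proof -
 have pos: "exp a - exp b > 0" using ab by simp
 have ul: "uniform_limit K (\<lambda>k. sc (s k)) E sequentially" using L K by (auto simp: lim_def)
 from uniform_limitD[OF ul pos]
 have "EVN k. \<forall>w\<in>K. dist (sc (s k) w) (E w) < exp a - exp b" .
 thus ?thesis
 proof eventually_elim
  case (elim k)
  show ?case
  proof
   fix w assume z: "w \<in> K"
   have "norm (sc (s k) w) \<ge> norm (E w) - dist (sc (s k) w) (E w)"
    unfolding dist_norm by norm
   moreover have "norm (E w) - dist (sc (s k) w) (E w) \<ge> exp b" using ge[OF z] elim z by force
   ultimately have "exp b \<le> norm (sc (s k) w)" by linarith
   hence "Re (G (w + of_real (s k))) / A (s k) \<ge> b" by (simp add: norm_sc)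
   thus "Re (G (w + of_real (s k))) \<ge> b * A (s k)" using A_pos[of "s k"] by (simp add: pos_le_divide_eq)
  qed
 qed
qed

text \<open>Jensen's inequality in disguise: if \<open>F\<close> is small on an arc, it must be large elsewhere on the circle.\<close>

lemma lim_arc_small:
 assumes L: "lim s E" and N: "N > 0" and b: "EVN k. A (s k + t) \<le> b * A (s k)"
  and arc: "\<And>y. \<bar>y - v\<bar> \<le> pi / real N \<Longrightarrow> Complex t y \<in> strip l u \<and> norm (E (Complex t y)) \<le> exp (- m)"
 shows "m \<le> (real N - 1) * b"
proof (rule ccontr)
 assume "\<not> m \<le> (real N - 1) * b"
 define d where "d = (m - (real N - 1) * b) / 2"
 have d: "d > 0" using \<open>\<not> m \<le> (real N - 1) * b\<close> by (simp add: d_def)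
 define K where "K = Complex t ` {v - pi / real N..v + pi / real N}"
 have K: "compact K" unfolding K_def
  by (intro compact_continuous_image continuous_intros) (auto simp: Complex_eq intro!: continuous_intros)
 have KS: "K \<subseteq> strip l u"
 proof
  fix x assume "x \<in> K"
  then obtain y where "x = Complex t y" "v - pi / real N \<le> y" "y \<le> v + pi / real N" by (auto simp: K_def)
  thus "x \<in> strip l u" using arc[of y] by (simp add: abs_le_iff)
 qed
 have KE: "norm (E e) \<le> exp (- m)" if "e \<in> K" for e
 proof -
  from that obtain y where "e = Complex t y" "v - pi / real N \<le> y" "y \<le> v + pi / real N" by (auto simp: K_def)
  thus ?thesis using arc[of y] by (simp add: abs_le_iff)
 qed
 have ev1: "EVN k. \<forall>e\<in>K. Re (G (e + of_real (s k))) \<le> (- m + d) * A (s k)"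
  by (rule lim_uniform_le[OF L K KS KE]) (use d in auto)
 define c where "c = real N * ln (norm (F 0)) - (real N - 1) * C"
 have A: "diverges (\<lambda>k. A (s k))" using L by (simp add: lim_def)
 have ev2: "EVN k. A (s k) \<ge> (\<bar>c\<bar> + 1) / d" using A by (simp add: filterlim_at_top)
 have "EVN k. False"
  using ev1 ev2 b
 proof eventually_elim
  case (elim k)
  define r where "r = exp (s k + t)"
  have r: "r > 0" by (simp add: r_def)
  define a1 where "a1 = exp (b * A (s k) + C)"
  define a2 where "a2 = exp ((- m + d) * A (s k))"
  have Fle: "norm (F z) \<le> a1" if "norm z = r" for z
  proof -
   have "z \<noteq> 0" using that r by auto
   hence z: "exp (Ln z) = z" "Re (Ln z) = s k + t" using that by (auto simp: r_def)
   have "norm (F z) \<le> exp (A (s k + t) + C)" using FA[of "Ln z"] z by simp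
   also have "\<dots> \<le> a1" using elim by (simp add: a1_def)
   finally show ?thesis .
  qed
  \<comment> \<open>For every point of the circle one of its \<open>N\<close> rotates falls on the
    arc and contributes \<open>a2\<close>; the other \<open>N - 1\<close> factors are bounded by
    \<open>a1\<close>.\<close>
  have "norm (F 0) ^ N \<le> a2 * a1 ^ (N - 1)"
  proof (rule max_modulus_rotations[where r = r])
   show "F holomorphic_on ball 0 r" using F by (rule holomorphic_on_subset) auto
   show "continuous_on (cball 0 r) F"
    using holomorphic_on_imp_continuous_on[OF F] by (rule continuous_on_subset) auto
   fix z :: complex assume z: "norm z = r"
   hence "norm (z / of_real r) = 1" using r by (simp add: norm_divide)
   then obtain a where "z / of_real r = cis a" by (metis complex_norm_eq_1_exp cis_conv_exp)
   hence a: "z = of_real r * cis a" using r by (simp add: field_simps)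
   obtain j y where j: "j < N" "\<bar>y - v\<bar> \<le> pi / real N" "cis a * cis (2 * pi * real j / real N) = cis y"
    using rotation_hits_arc[OF N] by blast
   let ?w = "\<lambda>j::nat. z * cis (2 * pi * real j / real N)"
   have wj: "?w j = exp (Complex t y + of_real (s k))"
   proof -
    have "?w j = of_real r * (cis a * cis (2 * pi * real j / real N))"
     by (simp only: a mult.assoc[of "of_real r" "cis a"])
    thus ?thesis unfolding j(3) by (simp add: r_def exp_eq_polar exp_of_real add.commute)
   qed
   have inK: "Complex t y \<in> K" unfolding K_def using j(2) by (intro imageI) (auto simp: abs_le_iff)
   have "Complex t y + of_real (s k) \<in> strip l u" using inK KS by auto
   hence "norm (F (?w j)) = exp (Re (G (Complex t y + of_real (s k))))" unfolding wj by (rule norm_F)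
   hence Fj: "norm (F (?w j)) \<le> a2" using elim(1) inK by (simp add: a2_def)
   have "(\<Prod>i<N. norm (F (?w i))) = norm (F (?w j)) * (\<Prod>i\<in>{..<N} - {j}. norm (F (?w i)))"
    using j(1) by (subst prod.remove[of _ j]) auto
   also have "\<dots> \<le> a2 * (\<Prod>i\<in>{..<N} - {j}. a1)"
    by (intro mult_mono Fj prod_mono conjI prod_nonneg) (auto simp: a2_def Fle z norm_mult)
   also have "\<dots> = a2 * a1 ^ (N - 1)" using j(1) by simp
   finally show "(\<Prod>i<N. norm (F (?w i))) \<le> a2 * a1 ^ (N - 1)" .
  qed (rule r)
  also have "\<dots> = exp ((- m + d) * A (s k) + real (N - 1) * (b * A (s k) + C))"
   by (simp only: a1_def a2_def exp_add exp_of_nat_mult)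
  finally have "norm (F 0) ^ N \<le> exp ((- m + d) * A (s k) + real (N - 1) * (b * A (s k) + C))" .
  moreover have "norm (F 0) ^ N = exp (real N * ln (norm (F 0)))"
   using F_0 by (simp add: exp_of_nat_mult)
  ultimately have "real N * ln (norm (F 0)) \<le> (- m + d) * A (s k) + (real N - 1) * (b * A (s k) + C)"
   using N by (simp add: of_nat_diff)
  \<comment> \<open>By the choice of \<open>d\<close>, \<open>- m + d + (N - 1) * b = - d\<close>.
    The right-hand side tends to minus infinity while \<open>c\<close> is fixed.\<close>
  hence "c \<le> - d * A (s k)" unfolding c_def by (simp add: d_def field_simps)
  moreover have "d * A (s k) \<ge> \<bar>c\<bar> + 1" using elim(2) d by (simp add: field_simps)
  ultimately show False by linarith
 qed
 thus False by simp
qed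

end

text \<open>On \<open>strip a b\<close> the function \<open>- ln (norm E)\<close> is positive and
  harmonic, so by Harnack it decays to the left no faster than \<open>exp (- 2 * n / d)\<close> with
  \<open>d = (b - a) / 4\<close>. By \<open>lim_arc_small\<close> its lower bounds on an arc at
  abscissa \<open>- n\<close> are at most a constant times \<open>exp (- m * n)\<close>. The
  threshold \<open>8 / (b - a)\<close> is \<open>2 / d\<close>.\<close>

lemma (in log_side) no_small_peak:
 assumes L: "lim s E" and b: "\<And>t. EVN k. A (s k + t) \<le> 2 * exp (m * t) * A (s k)"
  and ab: "a < b" "strip a b \<subseteq> strip l u" and small: "\<And>j. j \<in> strip a b \<Longrightarrow> norm (E j) < 1"
  and nz: "j0 \<in> strip l u" "E j0 \<noteq> 0" and m: "m > 8 / (b - a)"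
 shows False
proof -
 define v w d where "v = (a + b) / 2" and "w = (b - a) / 2" and "d = (b - a) / 4"
 have w: "w > 0" "d > 0" "w = 2 * d" "v - w = a" "v + w = b" using ab by (auto simp: w_def d_def v_def field_simps)
 have hE: "E holomorphic_on strip a b" using L ab(2) by (auto simp: lim_def intro: holomorphic_on_subset)
 have Enz: "E z \<noteq> 0" if "z \<in> strip a b" for z using lim_zero_free[OF L nz] that ab(2) by blast
 obtain W where W: "W holomorphic_on strip a b" "\<And>z. z \<in> strip a b \<Longrightarrow> E z = exp (W z)"
  using contractible_imp_holomorphic_log[OF hE convex_imp_contractible[OF convex_strip] Enz] by blast
 have W0: "Re (W z) < 0" if "z \<in> strip a b" for z using small[OF that] W(2)[OF that] by simp
 define g where "g = (\<lambda>z. - W z)"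
 have hg: "g holomorphic_on strip a b" unfolding g_def by (intro holomorphic_intros W)
 obtain N where N: "N > 0" "pi / real N \<le> d"
 proof -
  obtain N :: nat where "real N > pi / d" using reals_Archimedean2 by blast
  moreover have "pi / d > 0" using w by simp
  ultimately have N: "real N > 0" "pi / d < real N" by linarith+
  hence "pi / real N \<le> d" using w by (simp add: pos_divide_less_eq pos_divide_le_eq mult.commute)
  thus thesis using that N by simp
 qed
 define P where "P = Re (g (Complex 0 v))"
 have P: "P > 0" using W0[of "Complex 0 v"] w by (simp add: P_def g_def)
 have main: "P * exp (- 2 * (real n + d) / d) \<le> (real N - 1) * (2 * exp (m * - real n))" for n :: nat
 proof (rule lim_arc_small[OF L N(1) b])
  fix e assume th: "\<bar>e - v\<bar> \<le> pi / real N"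
  hence th': "\<bar>e - v\<bar> \<le> d" using N(2) by linarith
  let ?q = "Complex (- real n) e" and ?p = "Complex 0 v"
  have inS: "?q \<in> strip a b" using th' w by (auto simp: abs_le_iff)
  have "Re (g ?p) \<le> exp (2 * norm (?p - ?q) / d) * Re (g ?q)"
  proof (rule harnack_segment[OF hg open_strip w(2)])
   show "Re (g z) > 0" if "z \<in> strip a b" for z using W0[OF that] by (simp add: g_def)
   fix x assume "x \<in> closed_segment ?q ?p"
   moreover have "closed_segment ?q ?p \<subseteq> {z. v - d \<le> Im z} \<inter> {z. Im z \<le> v + d}"
    by (rule closed_segment_subset)
      (use th' w in \<open>auto intro!: convex_Int convex_halfspace_Im_ge convex_halfspace_Im_le simp: abs_le_iff\<close>)
   ultimately have x: "v - d \<le> Im x" "Im x \<le> v + d" by auto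
   show "ball x d \<subseteq> strip a b"
   proof
    fix y assume "y \<in> ball x d"
    hence "norm (x - y) < d" by (simp add: dist_norm)
    hence "\<bar>Im x - Im y\<bar> < d" using abs_Im_le_cmod[of "x - y"] by simp
    thus "y \<in> strip a b" using x w by auto
   qed
  qed
  also have "\<dots> \<le> exp (2 * (real n + d) / d) * Re (g ?q)"
  proof (rule mult_right_mono)
   have "norm (?p - ?q) \<le> \<bar>Re (?p - ?q)\<bar> + \<bar>Im (?p - ?q)\<bar>" by (rule cmod_le)
   hence "norm (?p - ?q) \<le> real n + d" using th' by (simp add: abs_minus_commute)
   thus "exp (2 * norm (?p - ?q) / d) \<le> exp (2 * (real n + d) / d)" using w by (simp only: exp_le_cancel_iff) (intro divide_right_mono mult_left_mono; simp)
   show "0 \<le> Re (g ?q)" using W0[OF inS] by (simp add: g_def)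
  qed
  finally have "P \<le> exp (2 * (real n + d) / d) * Re (g ?q)" by (simp add: P_def)
  hence "P * exp (- 2 * (real n + d) / d) \<le> exp (2 * (real n + d) / d) * Re (g ?q) * exp (- 2 * (real n + d) / d)"
   by (intro mult_right_mono) auto
  also have "\<dots> = Re (g ?q) * exp (2 * (real n + d) / d + - 2 * (real n + d) / d)"
   by (simp only: exp_add mult_ac)
  also have "2 * (real n + d) / d + - 2 * (real n + d) / d = 0"
   by (simp only: mult_minus_left minus_divide_left [symmetric] add.right_inverse)
  finally have "P * exp (- 2 * (real n + d) / d) \<le> Re (g ?q)" by simp
  hence "norm (E ?q) \<le> exp (- (P * exp (- 2 * (real n + d) / d)))"
   using W(2)[OF inS] by (simp add: g_def)
  thus "?q \<in> strip l u \<and> norm (E ?q) \<le> exp (- (P * exp (- 2 * (real n + d) / d)))"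
   using inS ab(2) by blast
 qed
 define c where "c = m - 2 / d"
 have c: "c > 0" using m by (simp add: c_def d_def)
 define P' where "P' = P * exp (- 2)"
 have P': "P' > 0" using P by (simp add: P'_def)
 obtain n :: nat where n: "real n > 2 * real N / (P' * c)" using reals_Archimedean2 by blast
 have "P * exp (- 2 * (real n + d) / d) * exp (m * real n) \<le> (real N - 1) * (2 * exp (m * - real n)) * exp (m * real n)"
  by (intro mult_right_mono main) auto
 moreover have "P * exp (- 2 * (real n + d) / d) * exp (m * real n) = P' * exp (c * real n)"
 proof -
  have "- 2 * (real n + d) / d + m * real n = - 2 + c * real n" using w by (simp add: c_def field_simps)
  hence "exp (- 2 * (real n + d) / d) * exp (m * real n) = exp (- 2) * exp (c * real n)" by (metis exp_add)
  thus ?thesis by (simp add: P'_def)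
 qed
 moreover have "(real N - 1) * (2 * exp (m * - real n)) * exp (m * real n) = (real N - 1) * 2"
 proof -
  have "exp (m * - real n) * exp (m * real n) = 1" by (simp add: exp_minus)
  thus ?thesis by (simp only: mult.assoc mult_1_right)
 qed
 moreover have "(real N - 1) * 2 \<le> 2 * real N" by simp
 ultimately have "P' * exp (c * real n) \<le> 2 * real N" by linarith
 moreover have "P' * exp (c * real n) \<ge> P' * (c * real n)"
  using exp_ge_add_one_self[of "c * real n"] P' by (intro mult_left_mono) linarith+
 moreover have "P' * (c * real n) > 2 * real N" using n P' c by (simp add: field_simps)
 ultimately show False by linarith
qed

section \<open>The setting of two separated sectors and its limit functions\<close>

text \<open>The exponent exceeds the degree by one, so that for large \<open>norm z\<close> the sum
  of the coefficients is absorbed.\<close>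

lemma poly_norm_bounds:
 fixes p :: "complex poly"
 assumes "p \<noteq> 0"
 shows "\<exists>c>0. \<exists>R\<ge>1. \<exists>D. \<forall>z. norm z \<ge> R \<longrightarrow> c \<le> norm (poly p z) \<and> norm (poly p z) \<le> norm z ^ D"
proof -
 obtain R1 c where R1: "c > 0" "\<And>z. norm z \<ge> R1 \<Longrightarrow> c \<le> norm (poly p z)"
 proof (cases "degree p = 0")
  case True
  then obtain a where "p = [:a:]" by (metis degree_eq_zeroE)
  thus ?thesis using that[of "norm a" 0] assms by auto
 next
  case False
  have "filterlim (poly p) at_infinity at_infinity" using False by (intro filterlim_poly_at_infinity) auto
  hence "\<forall>\<^sub>F z in at_infinity. norm (poly p z) \<ge> 1"
   by (simp add: filterlim_at_infinity[OF order_refl])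
  then obtain b where "\<And>z. norm z \<ge> b \<Longrightarrow> norm (poly p z) \<ge> 1" by (auto simp: eventually_at_infinity)
  thus ?thesis using that[of 1 b] by auto
 qed
 define B where "B = (\<Sum>i\<le>degree p. norm (coeff p i))"
 define D where "D = Suc (degree p)"
 define R where "R = max 1 (max R1 B)"
 show ?thesis
 proof (rule exI[of _ c], rule conjI[OF R1(1)], rule exI[of _ R], rule conjI[OF _ exI[of _ D]], goal_cases)
  case 1 show ?case by (simp add: R_def)
 next
  case 2
  have "c \<le> norm (poly p z) \<and> norm (poly p z) \<le> norm z ^ D" if z: "norm z \<ge> R" for z
  proof
  show "c \<le> norm (poly p z)" using R1(2)[of z] z by (simp add: R_def)
  from z have z1: "norm z \<ge> 1" "norm z \<ge> B" by (auto simp: R_def)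
  have "norm (poly p z) \<le> (\<Sum>i\<le>degree p. norm (coeff p i) * norm z ^ i)"
   unfolding poly_altdef by (rule order.trans[OF norm_sum]) (simp add: norm_mult norm_power)
  also have "\<dots> \<le> (\<Sum>i\<le>degree p. norm (coeff p i) * norm z ^ degree p)"
   using z1 by (intro sum_mono mult_left_mono power_increasing) auto
  also have "\<dots> = B * norm z ^ degree p" by (simp add: B_def sum_distrib_right)
  also have "\<dots> \<le> norm z * norm z ^ degree p" using z1 by (intro mult_right_mono) auto
  finally show "norm (poly p z) \<le> norm z ^ D" by (simp add: D_def)
  qed
  thus ?case by blast
 qed
qed

lemma filterlim_at_top_of_ratio:
 fixes A :: "real \<Rightarrow> real"
 assumes "filterlim (\<lambda>s. A s / s) at_top at_top"
 shows "filterlim A at_top at_top"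
proof (rule filterlim_at_top_mono)
 show "filterlim (\<lambda>s::real. s) at_top at_top" by (rule filterlim_ident)
 have "EV s. A s / s \<ge> 1" using assms by (simp add: filterlim_at_top)
 thus "EV s. s \<le> A s" using eventually_gt_at_top[of 0]
  by eventually_elim (simp add: field_simps)
qed

lemma poly_mult_holomorphic:
 assumes "F holomorphic_on UNIV" "\<And>z. f z = poly p z * F z"
 shows "f holomorphic_on X"
proof -
 have "(\<lambda>z. poly p z * F z) holomorphic_on X" by (intro holomorphic_intros holomorphic_on_subset[OF assms(1)]) simp
 moreover have "f = (\<lambda>z. poly p z * F z)" by (rule ext) (rule assms(2))
 ultimately show ?thesis by simp
qed

text \<open>The sectors have the directions \<open>[a0, b0]\<close> and \<open>[a1, b1]\<close>.
  Index 1 belongs to the zeros of \<open>f\<close>: outside finitely many of them, carried by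
  \<open>p1\<close>, there are none in the complement of the first sector. Index 0 belongs likewise
  to the 1-points and the complement of the second sector. \<open>A_transc\<close> and
  \<open>A_order\<close> carry transcendence and finite order; \<open>A_max\<close> and
  \<open>A_ub\<close> together say that \<open>exp (A s)\<close> is 2 plus the maximum modulus at
  radius \<open>exp s\<close>.\<close>

locale separated =
 fixes f F1 F0 G1 G0 :: "complex \<Rightarrow> complex" and p1 p0 :: "complex poly"
  and a0 b0 a1 b1 C \<rho> :: real and A :: "real \<Rightarrow> real"
 assumes ang: "b0 < a1" "a1 < b1" "b1 < a0 + 2 * pi" "a0 < b0"
  and side1: "log_side F1 G1 b0 (a0 + 2 * pi) C A"
  and side0: "log_side F0 G0 (b1 - 2 * pi) a1 C A"
  and f1: "\<And>z. f z = poly p1 z * F1 z" and p1: "p1 \<noteq> 0"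
  and f0: "\<And>z. f z - 1 = poly p0 z * F0 z" and p0: "p0 \<noteq> 0"
  and A_order: "EV s. A s \<le> exp (\<rho> * s)" and \<rho>: "\<rho> > 0"
  and A_transc: "filterlim (\<lambda>s. A s / s) at_top at_top"
  and A_max: "\<And>s. \<exists>z. norm z = exp s \<and> exp (A s) = 2 + norm (f z)"
  and A_ub: "\<And>w. 2 + norm (f (exp w)) \<le> exp (A (Re w))"
begin

abbreviation "strip1 \<equiv> strip b0 (a0 + 2 * pi)"
abbreviation "strip0 \<equiv> strip (b1 - 2 * pi) a1"
abbreviation "gap1 \<equiv> strip b0 a1"
abbreviation "gap2 \<equiv> strip b1 (a0 + 2 * pi)"

sublocale S1: log_side F1 G1 b0 "a0 + 2 * pi" C A by (rule side1)
sublocale S0: log_side F0 G0 "b1 - 2 * pi" a1 C A by (rule side0)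

lemma A_at_top: "filterlim A at_top at_top"
 by (rule filterlim_at_top_of_ratio[OF A_transc])

text \<open>Since \<open>A s / s\<close> tends to infinity, fixed powers of the radius have roots of
  order \<open>A s\<close> tending to 1. So the polynomials split off from \<open>f\<close> and
  \<open>f - 1\<close> are invisible in the limits.\<close>

lemma poly_powr_limit:
 fixes p :: "complex poly"
 assumes p: "p \<noteq> 0" and s: "diverges s"
 shows "(\<lambda>k. norm (poly p (exp (w + of_real (s k)))) powr (1 / A (s k))) \<longlonglongrightarrow> 1"
proof -
 obtain c D R where c: "c > 0" "R \<ge> 1" "\<And>z. norm z \<ge> R \<Longrightarrow> c \<le> norm (poly p z)" "\<And>z. norm z \<ge> R \<Longrightarrow> norm (poly p z) \<le> norm z ^ D"
  using poly_norm_bounds[OF p] by metis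
 have A: "diverges (\<lambda>k. A (s k))" by (rule filterlim_compose[OF A_at_top s])
 have iA: "(\<lambda>k. 1 / A (s k)) \<longlonglongrightarrow> 0"
  by (rule tendsto_divide_0[OF tendsto_const filterlim_mono[OF A at_top_le_at_infinity order_refl]])
 have sA: "(\<lambda>k. s k / A (s k)) \<longlonglongrightarrow> 0"
 proof -
  have "filterlim (\<lambda>k. A (s k) / s k) at_infinity sequentially"
   by (rule filterlim_mono[OF filterlim_compose[OF A_transc s] at_top_le_at_infinity order_refl])
  from tendsto_inverse_0[THEN filterlim_compose, OF this] show ?thesis by simp
 qed
 have l1: "(\<lambda>k. c powr (1 / A (s k))) \<longlonglongrightarrow> 1"
 proof -
  have "(\<lambda>k. c powr (1 / A (s k))) \<longlonglongrightarrow> c powr 0" by (intro tendsto_intros iA) (use c in auto)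
  thus ?thesis using c by simp
 qed
 have l2: "(\<lambda>k. exp (real D * (Re w * (1 / A (s k)) + s k / A (s k)))) \<longlonglongrightarrow> 1"
 proof -
  have "(\<lambda>k. exp (real D * (Re w * (1 / A (s k)) + s k / A (s k)))) \<longlonglongrightarrow> exp (real D * (Re w * 0 + 0))"
   by (intro tendsto_intros iA sA)
  thus ?thesis by simp
 qed
 have ev: "EVN k. s k \<ge> ln R - Re w" using s by (simp add: filterlim_at_top)
 have big: "norm (exp (w + of_real (s k))) \<ge> R" if "s k \<ge> ln R - Re w" for k
 proof -
  have "R = exp (ln R)" using c by simp
  also have "\<dots> \<le> exp (Re w + s k)" using that by simp
  finally show ?thesis by simp
 qed
 show ?thesis
 proof (rule tendsto_sandwich[OF _ _ l1 l2])
  show "EVN k. c powr (1 / A (s k)) \<le> norm (poly p (exp (w + of_real (s k)))) powr (1 / A (s k))"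
   using ev by eventually_elim (use c S1.A_pos big in \<open>auto intro!: powr_mono2 simp: less_imp_le\<close>)
  show "EVN k. norm (poly p (exp (w + of_real (s k)))) powr (1 / A (s k)) \<le> exp (real D * (Re w * (1 / A (s k)) + s k / A (s k)))"
   using ev
  proof eventually_elim
   case (elim k)
   have "norm (poly p (exp (w + of_real (s k)))) \<le> exp (Re w + s k) ^ D"
    using c(4)[OF big[OF elim]] by simp
   hence "norm (poly p (exp (w + of_real (s k)))) powr (1 / A (s k)) \<le> (exp (Re w + s k) ^ D) powr (1 / A (s k))"
    using S1.A_pos[of "s k"] by (intro powr_mono2) auto
   also have "\<dots> = exp (real D * (Re w * (1 / A (s k)) + s k / A (s k)))"
    by (simp add: powr_def ln_realpow add_divide_distrib distrib_left)
   finally show ?case .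
  qed
 qed
qed

text \<open>\<open>w\<close> and \<open>w'\<close> are logarithms of the same number, so
  \<open>E w\<close> and \<open>H w'\<close> are limits formed from \<open>f\<close> and
  \<open>f - 1\<close> at the same points.\<close>

lemma limit_relation:
 assumes s: "diverges s" and E: "S1.lim s E" and H: "S0.lim s H"
  and z: "w \<in> strip1" "w' \<in> strip0" "exp w = exp w'"
 shows "norm (E w) > 1 \<Longrightarrow> norm (H w') = norm (E w)" "norm (E w) < 1 \<Longrightarrow> norm (H w') = 1"
  "norm (H w') > 1 \<Longrightarrow> norm (H w') = norm (E w)" "norm (H w') < 1 \<Longrightarrow> norm (E w) = 1"
proof -
 let ?z = "\<lambda>k. exp (w + of_real (s k))"
 define u where "u = (\<lambda>k. norm (f (?z k)))"
 define v where "v = (\<lambda>k. norm (f (?z k) - 1))"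
 have z': "?z k = exp (w' + of_real (s k))" for k using z(3) by (simp add: exp_add)
 have A: "diverges (\<lambda>k. A (s k))" by (rule filterlim_compose[OF A_at_top s])
 have "(\<lambda>k. norm (poly p1 (?z k)) powr (1 / A (s k)) * norm (S1.sc (s k) w)) \<longlonglongrightarrow> 1 * norm (E w)"
  by (intro tendsto_mult poly_powr_limit[OF p1 s] tendsto_norm S1.lim_point[OF E z(1)])
 hence ue: "(\<lambda>k. u k powr (1 / A (s k))) \<longlonglongrightarrow> norm (E w)"
  unfolding u_def f1 norm_mult S1.norm_F_sc[OF z(1), symmetric] by (simp add: powr_mult)
 have "(\<lambda>k. norm (poly p0 (?z k)) powr (1 / A (s k)) * norm (S0.sc (s k) w')) \<longlonglongrightarrow> 1 * norm (H w')"
  by (intro tendsto_mult poly_powr_limit[OF p0 s] tendsto_norm S0.lim_point[OF H z(2)])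
 hence vh: "(\<lambda>k. v k powr (1 / A (s k))) \<longlonglongrightarrow> norm (H w')"
  unfolding v_def f0 norm_mult S0.norm_F_sc[OF z(2), symmetric] z'[symmetric] by (simp add: powr_mult)
 have uv: "\<bar>u k - v k\<bar> \<le> 1" "u k + v k \<ge> 1" for k
 proof -
  show "\<bar>u k - v k\<bar> \<le> 1" using norm_triangle_ineq3[of "f (?z k)" "f (?z k) - 1"] by (simp add: u_def v_def)
  have "norm (1::complex) \<le> norm (f (?z k)) + norm (f (?z k) - 1)" by (metis diff_diff_eq2 add_diff_cancel_left' norm_triangle_ineq4)
  thus "u k + v k \<ge> 1" by (simp add: u_def v_def)
 qed
 have nn: "u k \<ge> 0" "v k \<ge> 0" for k by (auto simp: u_def v_def)
 show "norm (E w) > 1 \<Longrightarrow> norm (H w') = norm (E w)" "norm (E w) < 1 \<Longrightarrow> norm (H w') = 1"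
  using root_limits_aux[OF A nn uv ue vh] by auto
 have vu: "\<bar>v k - u k\<bar> \<le> 1" "v k + u k \<ge> 1" for k using uv[of k] by (auto simp: abs_minus_commute)
 show "norm (H w') > 1 \<Longrightarrow> norm (H w') = norm (E w)" "norm (H w') < 1 \<Longrightarrow> norm (E w) = 1"
  using root_limits_aux[OF A nn(2,1) vu vh ue] by auto
qed

definition "w1 = (b0 + a1) / 2"
definition "w2 = (b1 + a0 + 2 * pi) / 2"

lemma omega: "b0 < w1" "w1 < a1" "b1 < w2" "w2 < a0 + 2 * pi" "w1 < w2" "w2 - 2 * pi < w1" "b1 - 2 * pi < w2 - 2 * pi"
 using ang by (auto simp: w1_def w2_def field_simps)

lemma compact_Complex_image: "compact (Complex t ` {a..b})"
 by (intro compact_continuous_image) (auto simp: Complex_eq intro!: continuous_intros)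

text \<open>The arcs \<open>[w1, w2]\<close> and \<open>[w2 - 2 * pi, w1]\<close> cover the circle;
  the first lies in \<open>strip1\<close>, the second in \<open>strip0\<close>. Estimates on whole
  circles are proved on these two arcs.\<close>

lemma circle_cases:
 assumes "norm z = exp s"
 obtains y where "w1 \<le> y" "y \<le> w2" "z = pt s y" | y where "w2 - 2 * pi \<le> y" "y \<le> w1" "z = pt s y"
proof -
 define t where "t = Arg2pi (z / cis (w2 - 2 * pi))"
 define y where "y = w2 - 2 * pi + t"
 have t: "0 \<le> t" "t < 2 * pi" by (auto simp: t_def Arg2pi_ge_0 Arg2pi_lt_2pi)
 have "z / cis (w2 - 2 * pi) = of_real (exp s) * cis t"
  using Arg2pi_eq[of "z / cis (w2 - 2 * pi)"] assms by (simp add: t_def norm_divide cis_conv_exp)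
 hence "z = of_real (exp s) * (cis t * cis (w2 - 2 * pi))" by (simp add: field_simps)
 also have "cis t * cis (w2 - 2 * pi) = cis y" by (simp add: cis_mult y_def add.commute)
 finally have z: "z = pt s y" by (simp add: exp_eq_polar exp_of_real)
 have "w2 - 2 * pi \<le> y" "y \<le> w2" using t by (auto simp: y_def)
 thus thesis using that(1)[OF _ _ z] that(2)[OF _ _ z] by (cases "y \<le> w1") auto
qed

lemma poly_le_exp_A:
 fixes p :: "complex poly"
 assumes p: "p \<noteq> 0" and e: "d > 0"
 shows "EV s. \<forall>z. norm z = exp s \<longrightarrow> norm (poly p z) \<le> exp (d * A s)"
proof -
 obtain c D R where c: "c > 0" "R \<ge> 1" "\<And>z. norm z \<ge> R \<Longrightarrow> c \<le> norm (poly p z)" "\<And>z. norm z \<ge> R \<Longrightarrow> norm (poly p z) \<le> norm z ^ D"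
  using poly_norm_bounds[OF p] by metis
 have "EV s. A s / s \<ge> real D / d" using A_transc by (simp add: filterlim_at_top)
 thus ?thesis using eventually_gt_at_top[of 0] eventually_ge_at_top[of "ln R"]
 proof eventually_elim
  case (elim s)
  show ?case
  proof (intro allI impI)
   fix z :: complex assume z: "norm z = exp s"
   have "R = exp (ln R)" using c by simp
   also have "\<dots> \<le> norm z" using z elim by simp
   finally have "norm (poly p z) \<le> exp s ^ D" using c(4)[of z] z by simp
   also have "\<dots> = exp (real D * s)" by (simp add: exp_of_nat_mult)
   also have "\<dots> \<le> exp (d * A s)" using elim e by (simp add: field_simps)
   finally show "norm (poly p z) \<le> exp (d * A s)" .
  qed
 qed
qed

text \<open>If both limits were bounded by 1, polynomial and zero-free factor would contribute at
  most \<open>exp (A / 4)\<close> each, so \<open>norm (f z) \<le> 1 + exp (A / 2)\<close> on the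
  whole circle, against \<open>A_max\<close>.\<close>

lemma limit_nontrivial:
 assumes s: "diverges s" and E: "S1.lim s E" and H: "S0.lim s H"
 shows "(\<exists>z\<in>strip1. norm (E z) > 1) \<or> (\<exists>z\<in>strip0. norm (H z) > 1)"
proof (rule ccontr)
 assume "\<not> ?thesis"
 hence le: "\<And>z. z \<in> strip1 \<Longrightarrow> norm (E z) \<le> exp 0" "\<And>z. z \<in> strip0 \<Longrightarrow> norm (H z) \<le> exp 0"
  by force+
 let ?K1 = "Complex 0 ` {w1..w2}" and ?K0 = "Complex 0 ` {w2 - 2 * pi..w1}"
 have K: "?K1 \<subseteq> strip1" "?K0 \<subseteq> strip0" using omega by auto
 have e1: "EVN k. \<forall>w\<in>?K1. Re (G1 (w + of_real (s k))) \<le> (1/4) * A (s k)"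
  by (rule S1.lim_uniform_le[OF E compact_Complex_image K(1), of 0]) (use le K in auto)
 have e0: "EVN k. \<forall>w\<in>?K0. Re (G0 (w + of_real (s k))) \<le> (1/4) * A (s k)"
  by (rule S0.lim_uniform_le[OF H compact_Complex_image K(2), of 0]) (use le K in auto)
 have P1: "EVN k. \<forall>z. norm z = exp (s k) \<longrightarrow> norm (poly p1 z) \<le> exp (1/4 * A (s k))"
  using filterlim_iff[THEN iffD1, OF s, rule_format, OF poly_le_exp_A[OF p1, of "1/4"]] by simp
 have P0: "EVN k. \<forall>z. norm z = exp (s k) \<longrightarrow> norm (poly p0 z) \<le> exp (1/4 * A (s k))"
  using filterlim_iff[THEN iffD1, OF s, rule_format, OF poly_le_exp_A[OF p0, of "1/4"]] by simp
 have A: "diverges (\<lambda>k. A (s k))" by (rule filterlim_compose[OF A_at_top s])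
 have A4: "EVN k. A (s k) \<ge> 6" using A by (simp add: filterlim_at_top)
 have "EVN k. False"
  using e1 e0 P1 P0 A4
 proof eventually_elim
  case (elim k)
  obtain z where z: "norm z = exp (s k)" "exp (A (s k)) = 2 + norm (f z)" using A_max by blast
  have fz: "norm (f z) \<le> 1 + exp (1/2 * A (s k))"
   using z(1)
  proof (cases z rule: circle_cases)
   case (1 t)
   have e: "Complex (s k) t = Complex 0 t + of_real (s k)" by (simp add: complex_eq_iff)
   have i: "Complex 0 t + of_real (s k) \<in> strip1" using 1 omega by simp
   have "norm (F1 z) \<le> exp (1/4 * A (s k))"
    using S1.norm_F[OF i] elim(1)[rule_format, of "Complex 0 t"] 1 by (simp add: e)
   hence "norm (f z) \<le> exp (1/4 * A (s k)) * exp (1/4 * A (s k))"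
    unfolding f1 norm_mult using elim(3) z(1) by (intro mult_mono) auto
   also have "\<dots> = exp (1/2 * A (s k))" by (simp add: mult_exp_exp)
   finally show ?thesis by simp
  next
   case (2 t)
   have e: "Complex (s k) t = Complex 0 t + of_real (s k)" by (simp add: complex_eq_iff)
   have i: "Complex 0 t + of_real (s k) \<in> strip0" using 2 omega by simp
   have "norm (F0 z) \<le> exp (1/4 * A (s k))"
    using S0.norm_F[OF i] elim(2)[rule_format, of "Complex 0 t"] 2 by (simp add: e)
   hence "norm (f z - 1) \<le> exp (1/4 * A (s k)) * exp (1/4 * A (s k))"
    unfolding f0 norm_mult using elim(4) z(1) by (intro mult_mono) auto
   also have "\<dots> = exp (1/2 * A (s k))" by (simp add: mult_exp_exp)
   finally show ?thesis using norm_triangle_ineq[of "f z - 1" 1] by simp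
  qed
  define y where "y = exp (1/2 * A (s k))"
  have y: "y \<ge> 4" using exp_ge_add_one_self[of "1/2 * A (s k)"] elim(5) unfolding y_def by linarith
  have "exp (A (s k)) = y * y" by (simp add: y_def mult_exp_exp)
  hence "y * y \<le> 3 + y" using z(2) fz by (simp add: y_def)
  moreover have "y * y \<ge> 4 * y" using y by (intro mult_right_mono) auto
  ultimately show False using y by linarith
 qed
 thus False by simp
qed

lemma root_pair_limit:
 assumes s: "diverges s" and E: "S1.lim s E" and H: "S0.lim s H"
 shows "root_pair E H (strip1) (strip0) (gap1) (gap2) (- (2 * pi * \<i>))"
proof -
 have ex: "exp z = exp (z + - (2 * pi * \<i>))" for z :: complex
  by (simp add: exp_diff)
 have ne: "Complex 0 w1 \<in> gap1" "Complex 0 w2 \<in> gap2" using omega by auto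
 have sub: "z \<in> strip1" "z \<in> strip0" if "z \<in> gap1" for z
  using that ang by auto
 have sub': "z \<in> strip1" "z + - (2 * pi * \<i>) \<in> strip0" if "z \<in> gap2" for z
  using that ang by auto
 note R = limit_relation[OF s E H]
 show ?thesis
 proof (intro root_pair.intro open_strip connected_strip)
  show "E holomorphic_on strip1" using E by (simp add: S1.lim_def)
  show "H holomorphic_on strip0" using H by (simp add: S0.lim_def)
  show "gap1 \<noteq> {}" "gap2 \<noteq> {}" using ne by blast+
  show "gap1 \<subseteq> strip1" "gap1 \<subseteq> strip0"
   "gap2 \<subseteq> strip1" using sub sub' by blast+
  fix z
  show "z + - (2 * pi * \<i>) \<in> strip0" if "z \<in> gap2"
   by (rule sub'(2)[OF that])
  {
   assume z: "z \<in> gap1"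
   show "norm (E z) > 1 \<Longrightarrow> norm (H z) = norm (E z)" by (rule R(1)[OF sub[OF z] refl])
   show "norm (E z) < 1 \<Longrightarrow> norm (H z) = 1" by (rule R(2)[OF sub[OF z] refl])
   show "norm (H z) > 1 \<Longrightarrow> norm (H z) = norm (E z)" by (rule R(3)[OF sub[OF z] refl])
   show "norm (H z) < 1 \<Longrightarrow> norm (E z) = 1" by (rule R(4)[OF sub[OF z] refl])
  }
  {
   assume z: "z \<in> gap2"
   show "norm (E z) > 1 \<Longrightarrow> norm (H (z + - (2 * pi * \<i>))) = norm (E z)" by (rule R(1)[OF sub'[OF z] ex])
   show "norm (E z) < 1 \<Longrightarrow> norm (H (z + - (2 * pi * \<i>))) = 1" by (rule R(2)[OF sub'[OF z] ex])
   show "norm (H (z + - (2 * pi * \<i>))) > 1 \<Longrightarrow> norm (H (z + - (2 * pi * \<i>))) = norm (E z)" by (rule R(3)[OF sub'[OF z] ex])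
   show "norm (H (z + - (2 * pi * \<i>))) < 1 \<Longrightarrow> norm (E z) = 1" by (rule R(4)[OF sub'[OF z] ex])
  }
 qed
qed

lemma limits_exist:
 assumes s: "diverges s" and b: "\<And>t. EVN k. A (s k + t) \<le> b t * A (s k)"
 obtains r E H where "strict_mono r" "S1.lim (s \<circ> r) E" "S0.lim (s \<circ> r) H" "diverges (s \<circ> r)"
proof -
 have A: "diverges (\<lambda>k. A (s k))" by (rule filterlim_compose[OF A_at_top s])
 obtain r1 E where r1: "strict_mono r1" "S1.lim (s \<circ> r1) E" using S1.montel[OF A b] by blast
 have A1: "diverges (\<lambda>k. A ((s \<circ> r1) k))"
  using filterlim_compose[OF A filterlim_subseq[OF r1(1)]] by (simp add: o_def)
 have b1: "EVN k. A ((s \<circ> r1) k + t) \<le> b t * A ((s \<circ> r1) k)" for t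
  using filterlim_iff[THEN iffD1, OF filterlim_subseq[OF r1(1)], rule_format, OF b[of t]] by simp
 obtain r0 H where r0: "strict_mono r0" "S0.lim ((s \<circ> r1) \<circ> r0) H" using S0.montel[OF A1 b1] by blast
 show thesis
 proof (rule that[of "r1 \<circ> r0"])
  show "strict_mono (r1 \<circ> r0)" using r1 r0 by (simp add: strict_mono_o)
  show "S1.lim (s \<circ> (r1 \<circ> r0)) E" using S1.lim_subseq[OF r1(2) r0(1)] by (simp add: o_assoc)
  show "S0.lim (s \<circ> (r1 \<circ> r0)) H" using r0(2) by (simp add: o_assoc)
  show "diverges (s \<circ> (r1 \<circ> r0))"
   using filterlim_compose[OF s filterlim_subseq[of "r1 \<circ> r0"]] r1 r0 by (simp add: o_def strict_mono_o[unfolded o_def])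
 qed
qed

end

section \<open>Peaks of the growth function are impossible; the doubling property\<close>

context separated begin

text \<open>The translates of the two strips by multiples of \<open>2 * pi * \<i>\<close> cover the
  plane. Each strip is narrower than \<open>2 * pi\<close>, so a point has at most one translate in
  each; if it has one in both, these differ by 0 or \<open>2 * pi * \<i>\<close>, which is covered
  by \<open>eq1\<close> and \<open>eq2\<close>. Hence the relation \<open>P\<close> is
  single-valued.\<close>

lemma periodic_glue:
 assumes T1: "T1 holomorphic_on strip1" and T0: "T0 holomorphic_on strip0"
  and eq1: "\<And>z. z \<in> gap1 \<Longrightarrow> T1 z = T0 z"
  and eq2: "\<And>z. z \<in> gap2 \<Longrightarrow> T1 z = T0 (z - 2 * pi * \<i>)"
 obtains T where "T holomorphic_on UNIV" "\<And>z n. T (z + 2 * pi * of_int n * \<i>) = T z"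
  "\<And>z. z \<in> strip1 \<Longrightarrow> T z = T1 z"
  "\<And>z. z \<in> strip0 \<Longrightarrow> T z = T0 z"
proof -
 define sh where "sh = (\<lambda>z (n::int). z + of_real (2 * pi * of_int n) * \<i>)"
 have Re_sh: "Re (sh z n) = Re z" and Im_sh: "Im (sh z n) = Im z + 2 * pi * of_int n" for z n
  by (auto simp: sh_def)
 have sh_sh: "sh (sh z n) m = sh z (n + m)" for z n m by (simp add: sh_def algebra_simps)
 define P where "P = (\<lambda>z y. (\<exists>n. sh z n \<in> strip1 \<and> y = T1 (sh z n)) \<or>
   (\<exists>n. sh z n \<in> strip0 \<and> y = T0 (sh z n)))"
 define T where "T = (\<lambda>z. SOME y. P z y)"
 have int_lt: "n < m + 1" if "2 * pi * of_int n < 2 * pi * of_int m + 2 * pi" for n m :: int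
 proof -
  have "2 * pi * of_int n < 2 * pi * (of_int m + 1)" using that by (simp add: algebra_simps)
  hence "(of_int n :: real) < of_int m + 1" by (simp add: mult_less_cancel_left_pos)
  thus ?thesis by linarith
 qed
 have uniq: "y = y'" if "P z y" "P z y'" for z y y'
 proof -
  have u11: "n = m" if "sh z n \<in> strip1" "sh z m \<in> strip1" for n m
   using that ang int_lt[of n m] int_lt[of m n] by (simp add: Im_sh)
  have u00: "n = m" if "sh z n \<in> strip0" "sh z m \<in> strip0" for n m
   using that ang int_lt[of n m] int_lt[of m n] by (simp add: Im_sh)
  have u10: "T1 (sh z n) = T0 (sh z m)"
   if a: "sh z n \<in> strip1" and b: "sh z m \<in> strip0" for n m
  proof -
   have i: "b0 < Im z + 2 * pi * of_int n" "Im z + 2 * pi * of_int n < a0 + 2 * pi"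
     "b1 - 2 * pi < Im z + 2 * pi * of_int m" "Im z + 2 * pi * of_int m < a1" using a b by (auto simp: Im_sh)
   have "m < n + 1" using i ang by (intro int_lt) linarith
   moreover have "n < (m + 1) + 1" using i ang by (intro int_lt) (simp add: algebra_simps)
   ultimately consider "m = n" | "n = m + 1" by linarith
   thus ?thesis
   proof cases
    case 1
    thus ?thesis using eq1[of "sh z n"] a b by simp
   next
    case 2
    hence "sh z m = sh z n - 2 * pi * \<i>" by (simp add: sh_def algebra_simps)
    moreover have "sh z n \<in> gap2" using i 2 by (simp add: Im_sh algebra_simps)
    ultimately show ?thesis using eq2[of "sh z n"] by simp
   qed
  qed
  show ?thesis using that u11 u00 u10 unfolding P_def by metis
 qed
 have T: "T z = y" if "P z y" for z y
  unfolding T_def using someI[of "P z", OF that] uniq that by blast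
 have cover: "\<exists>n. sh z n \<in> strip1 \<or> sh z n \<in> strip0" for z
 proof -
  define n where "n = \<lfloor>(w2 - Im z) / (2 * pi)\<rfloor>"
  have "of_int n \<le> (w2 - Im z) / (2 * pi)" "(w2 - Im z) / (2 * pi) < of_int n + 1"
   unfolding n_def by linarith+
  hence "of_int n * (2 * pi) \<le> w2 - Im z" "w2 - Im z < (of_int n + 1) * (2 * pi)"
   by (simp_all add: pos_le_divide_eq pos_divide_less_eq)
  hence "Im (sh z n) \<le> w2" "w2 - 2 * pi < Im (sh z n)" by (simp_all add: Im_sh algebra_simps)
  thus ?thesis using omega by (intro exI[of _ n]) (cases "Im (sh z n) \<le> w1"; simp)
 qed
 have hol: "T field_differentiable at z" for z
 proof -
  have gen: "T field_differentiable at z"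
   if S: "open S" "sh z n \<in> S" and Q: "Q holomorphic_on S" and PQ: "\<And>w. sh w n \<in> S \<Longrightarrow> P w (Q (sh w n))" for S n Q
  proof -
   have os: "open ((\<lambda>w. sh w n) -` S)"
    by (rule open_vimage[OF S(1)]) (auto simp: sh_def intro!: continuous_intros)
   have "(\<lambda>w. Q (sh w n)) holomorphic_on ((\<lambda>w. sh w n) -` S)"
    by (rule hol_compose[OF _ Q]) (auto simp: sh_def intro!: holomorphic_intros)
   moreover have "(\<lambda>w. Q (sh w n)) w = T w" if "w \<in> (\<lambda>w. sh w n) -` S" for w
    using T[OF PQ[of w]] that by simp
   ultimately have "T holomorphic_on ((\<lambda>w. sh w n) -` S)" using holomorphic_transform by blast
   thus ?thesis using holomorphic_on_imp_differentiable_at[OF _ os] S(2) by simp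
  qed
  from cover obtain n where "sh z n \<in> strip1 \<or> sh z n \<in> strip0" by blast
  thus ?thesis
  proof
   assume a: "sh z n \<in> strip1"
   show ?thesis by (rule gen[OF open_strip a T1]) (auto simp: P_def)
  next
   assume a: "sh z n \<in> strip0"
   show ?thesis by (rule gen[OF open_strip a T0]) (auto simp: P_def)
  qed
 qed
 have sh0: "sh z 0 = z" for z by (simp add: sh_def)
 have "\<exists>y. P z y" for z using cover[of z] by (auto simp: P_def)
 hence PT: "P z (T z)" for z unfolding T_def by (metis someI)
 have Psh: "P (sh z n) y" if "P z y" for z n y
  using that unfolding P_def sh_sh by (metis add_minus_cancel uminus_add_conv_diff diff_add_cancel add.commute)
 show thesis
 proof (rule that[of T])
  show "T holomorphic_on UNIV"
   using hol by (simp add: holomorphic_on_def field_differentiable_at_within)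
  show "T (z + 2 * pi * of_int n * \<i>) = T z" for z n
   using T[OF Psh[OF PT[of z], of n]] by (simp add: sh_def)
  show "T z = T1 z" if "z \<in> strip1" for z
   by (rule T) (unfold P_def, rule disjI1, rule exI[of _ 0], use that sh0 in simp)
  show "T z = T0 z" if "z \<in> strip0" for z
   by (rule T) (unfold P_def, rule disjI2, rule exI[of _ 0], use that sh0 in simp)
 qed
qed

end

text \<open>\<open>W - V\<close> has real part 0. Adding \<open>e * d / 2\<close> puts it into the
  right half-plane, and \<open>deriv_le_Re\<close> bounds its derivative by \<open>e\<close>, for
  every \<open>e > 0\<close>.\<close>

lemma deriv_eq_if_norm_exp_eq:
 assumes W: "W holomorphic_on S" and V: "V holomorphic_on S" and S: "open S" and z: "z \<in> S"
  and eq: "\<And>w. w \<in> S \<Longrightarrow> norm (exp (W w)) = norm (exp (V w))"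
 shows "deriv W z = deriv V z"
proof -
 obtain d where d: "d > 0" "ball z d \<subseteq> S" using S z openE by blast
 have "norm (deriv W z - deriv V z) \<le> e" if "e > 0" for e
 proof -
  define g where "g = (\<lambda>w. W w - V w + of_real (e * d / 2))"
  have Wd: "W field_differentiable at z" and Vd: "V field_differentiable at z"
   using holomorphic_on_imp_differentiable_at[OF _ S z] W V by auto
  have Reg: "Re (g w) = e * d / 2" if "w \<in> S" for w using eq[OF that] by (simp add: g_def)
  have "norm (deriv g z) \<le> 2 * Re (g z) / d"
   by (rule deriv_le_Re[OF _ d(1)])
     (use d Reg \<open>e > 0\<close> in \<open>auto simp: g_def intro!: holomorphic_intros holomorphic_on_subset[OF W] holomorphic_on_subset[OF V]\<close>)
  moreover have "deriv g z = deriv W z - deriv V z"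
   unfolding g_def using Wd Vd by (simp add: field_differentiable_diff)
  ultimately show ?thesis using Reg[OF z] d by simp
 qed
 hence "norm (deriv W z - deriv V z) \<le> 0" using field_le_epsilon[of "norm (deriv W z - deriv V z)" 0] by simp
 thus ?thesis by simp
qed

context separated begin

text \<open>The derivatives of \<open>ln E\<close> and \<open>ln H\<close> agree in the gaps and
  glue to a periodic entire \<open>T\<close> with
  \<open>norm (T u) \<le> B * exp (m * Re u)\<close>, for all real parts of either sign. By
  Liouville \<open>T u = c * exp (m * u)\<close>, and periodicity gives \<open>c = 0\<close> because
  \<open>m\<close> is not an integer. Then \<open>E\<close> is constant of modulus above 1, which
  \<open>Ele\<close> excludes for \<open>Re u\<close> tending to minus infinity.\<close>

lemma no_large_peak:
 assumes E: "E holomorphic_on strip1" and H: "H holomorphic_on strip0"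
  and Enz: "\<And>u. u \<in> strip1 \<Longrightarrow> E u \<noteq> 0" and Hnz: "\<And>u. u \<in> strip0 \<Longrightarrow> H u \<noteq> 0"
  and eq1: "\<And>z. z \<in> gap1 \<Longrightarrow> norm (E z) > 1 \<and> norm (H z) = norm (E z)"
  and eq2: "\<And>z. z \<in> gap2 \<Longrightarrow> norm (E z) > 1 \<and> norm (H (z + - (2 * pi * \<i>))) = norm (E z)"
  and Ele: "\<And>u. u \<in> strip1 \<Longrightarrow> norm (E u) \<le> exp (2 * exp (m * Re u))"
  and Hle: "\<And>u. u \<in> strip0 \<Longrightarrow> norm (H u) \<le> exp (2 * exp (m * Re u))"
  and m: "m > 0" "m \<notin> \<int>"
 shows False
proof -
 obtain W where W: "W holomorphic_on strip1" "\<And>z. z \<in> strip1 \<Longrightarrow> E z = exp (W z)"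
  using contractible_imp_holomorphic_log[OF E convex_imp_contractible[OF convex_strip] Enz] by blast
 obtain V where V: "V holomorphic_on strip0" "\<And>z. z \<in> strip0 \<Longrightarrow> H z = exp (V z)"
  using contractible_imp_holomorphic_log[OF H convex_imp_contractible[OF convex_strip] Hnz] by blast
 have sub: "gap1 \<subseteq> strip1" "gap1 \<subseteq> strip0"
  "gap2 \<subseteq> strip1" using ang by auto
 have d1: "deriv W u = deriv V u" if "u \<in> gap1" for u
 proof (rule deriv_eq_if_norm_exp_eq[OF holomorphic_on_subset[OF W(1) sub(1)] holomorphic_on_subset[OF V(1) sub(2)] open_strip that])
  fix w assume "w \<in> gap1"
  thus "norm (exp (W w)) = norm (exp (V w))"
   using eq1[of w] W(2)[OF subsetD[OF sub(1)], of w] V(2)[OF subsetD[OF sub(2)], of w] by metis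
 qed
 have d2: "deriv W u = deriv V (u - 2 * pi * \<i>)" if z: "u \<in> gap2" for u
 proof -
  let ?V = "\<lambda>w. V (w - 2 * pi * \<i>)"
  have shm: "w - 2 * pi * \<i> \<in> strip0" if "w \<in> gap2" for w
   using that ang by auto
  have "deriv W u = deriv ?V u"
  proof (rule deriv_eq_if_norm_exp_eq[OF holomorphic_on_subset[OF W(1) sub(3)] _ open_strip z])
   show "?V holomorphic_on gap2"
    by (rule hol_compose[OF _ V(1)]) (use shm in \<open>auto intro!: holomorphic_intros\<close>)
   fix w assume w: "w \<in> gap2"
   thus "norm (exp (W w)) = norm (exp (?V w))"
    using eq2[OF w] W(2)[OF subsetD[OF sub(3) w]] V(2)[OF shm[OF w]] by simp
  qed
  also have "deriv ?V u = deriv V (u - 2 * pi * \<i>)"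
  proof -
   have "(V has_field_derivative deriv V (u - 2 * pi * \<i>)) (at (u - 2 * pi * \<i>))"
    using V(1) shm[OF z] by (simp add: holomorphic_derivI)
   hence "(?V has_field_derivative deriv V (u - 2 * pi * \<i>) * 1) (at u)"
    by (rule DERIV_chain2[where g = "\<lambda>w. w - 2 * pi * \<i>"]) (auto intro!: derivative_eq_intros)
   thus ?thesis by (intro DERIV_imp_deriv) simp
  qed
  finally show ?thesis .
 qed
 obtain T where T: "T holomorphic_on UNIV" "\<And>u n. T (u + 2 * pi * of_int n * \<i>) = T u"
  "\<And>u. u \<in> strip1 \<Longrightarrow> T u = deriv W u"
  "\<And>u. u \<in> strip0 \<Longrightarrow> T u = deriv V u"
  using periodic_glue[OF holomorphic_deriv[OF W(1) open_strip] holomorphic_deriv[OF V(1) open_strip] d1 d2] by metis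
 obtain K1 where K1: "strip_bound b0 (a0 + 2 * pi) w1 w2 K1"
  using strip_bound_exists[of b0 w1 w2 "a0 + 2 * pi"] omega by auto
 obtain K0 where K0: "strip_bound (b1 - 2 * pi) a1 (w2 - 2 * pi) w1 K0"
  using strip_bound_exists[of "b1 - 2 * pi" "w2 - 2 * pi" w1 a1] omega by auto
 have K10: "K1 > 0" "K0 > 0" using K1 K0 by (auto simp: strip_bound_def)
 have mono: "2 * exp (m * Re u) < 2 * exp (m * (t + 1))" if "\<bar>Re u - t\<bar> < 1" for u t
  using that m by (simp add: abs_less_iff)
 have b1: "norm (T (Complex t y)) \<le> K1 * (2 * exp (m * (t + 1)))" if th: "w1 \<le> y" "y \<le> w2" for t y
 proof -
  have "norm (deriv W (Complex t y)) \<le> K1 * (2 * exp (m * (t + 1)))"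
  proof (rule strip_boundD(2)[OF K1 W(1), of _ t w1])
   fix u assume z: "u \<in> strip1" "\<bar>Re u - t\<bar> < 1"
   have "Re (W u) \<le> 2 * exp (m * Re u)" using Ele[OF z(1)] W(2)[OF z(1)] by simp
   thus "Re (W u) < 2 * exp (m * (t + 1))" using mono[OF z(2)] by linarith
  next
   have "norm (E (Complex t w1)) > 1" using eq1[of "Complex t w1"] omega by simp
   thus "0 \<le> Re (W (Complex t w1))" using W(2)[of "Complex t w1"] omega by simp
  qed (use th omega in auto)
  thus ?thesis using T(3)[of "Complex t y"] th omega by simp
 qed
 have b0: "norm (T (Complex t y)) \<le> K0 * (2 * exp (m * (t + 1)))" if th: "w2 - 2 * pi \<le> y" "y \<le> w1" for t y
 proof -
  have "norm (deriv V (Complex t y)) \<le> K0 * (2 * exp (m * (t + 1)))"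
  proof (rule strip_boundD(2)[OF K0 V(1), of _ t w1])
   fix u assume z: "u \<in> strip0" "\<bar>Re u - t\<bar> < 1"
   have "Re (V u) \<le> 2 * exp (m * Re u)" using Hle[OF z(1)] V(2)[OF z(1)] by simp
   thus "Re (V u) < 2 * exp (m * (t + 1))" using mono[OF z(2)] by linarith
  next
   have "norm (H (Complex t w1)) > 1" using eq1[of "Complex t w1"] omega by simp
   thus "0 \<le> Re (V (Complex t w1))" using V(2)[of "Complex t w1"] omega by simp
  qed (use th omega in auto)
  thus ?thesis using T(4)[of "Complex t y"] th omega by simp
 qed
 define B where "B = (K0 + K1) * (2 * exp m)"
 have Tb: "norm (T u) \<le> B * exp (m * Re u)" for u
 proof -
  define n where "n = \<lfloor>(w2 - Im u) / (2 * pi)\<rfloor>"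
  define y where "y = Im u + 2 * pi * of_int n"
  have "of_int n \<le> (w2 - Im u) / (2 * pi)" "(w2 - Im u) / (2 * pi) < of_int n + 1"
   unfolding n_def by linarith+
  hence "of_int n * (2 * pi) \<le> w2 - Im u" "w2 - Im u < (of_int n + 1) * (2 * pi)"
   by (simp_all add: pos_le_divide_eq pos_divide_less_eq)
  hence th: "y \<le> w2" "w2 - 2 * pi \<le> y" by (simp_all add: y_def algebra_simps)
  have "u + 2 * pi * of_int n * \<i> = Complex (Re u) y" by (simp add: complex_eq_iff y_def)
  hence "T u = T (Complex (Re u) y)" using T(2)[of u n] by simp
  moreover have "norm (T (Complex (Re u) y)) \<le> (K0 + K1) * (2 * exp (m * (Re u + 1)))"
  proof (cases "y \<le> w1")
   case True
   have "K0 * (2 * exp (m * (Re u + 1))) \<le> (K0 + K1) * (2 * exp (m * (Re u + 1)))"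
    using K10 by (intro mult_right_mono) auto
   thus ?thesis using b0[OF th(2) True, of "Re u"] by linarith
  next
   case False
   have "K1 * (2 * exp (m * (Re u + 1))) \<le> (K0 + K1) * (2 * exp (m * (Re u + 1)))"
    using K10 by (intro mult_right_mono) auto
   thus ?thesis using b1[of y "Re u"] th False by linarith
  qed
  moreover have "(K0 + K1) * (2 * exp (m * (Re u + 1))) = B * exp (m * Re u)"
   by (simp add: B_def distrib_left exp_add)
  ultimately show ?thesis by simp
 qed
 define P where "P = (\<lambda>u. T u * exp (- of_real m * u))"
 have "P holomorphic_on UNIV" unfolding P_def by (intro holomorphic_intros T)
 moreover have "bounded (range P)"
 proof -
  have "norm (P u) \<le> B" for u
  proof -
   have "norm (P u) = norm (T u) * exp (- (m * Re u))" by (simp add: P_def norm_mult)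
   also have "\<dots> \<le> B * exp (m * Re u) * exp (- (m * Re u))" using Tb[of u] by (intro mult_right_mono) auto
   also have "\<dots> = B" by (simp add: exp_minus)
   finally show ?thesis .
  qed
  thus ?thesis by (auto simp: bounded_iff)
 qed
 ultimately have "P constant_on UNIV" by (rule Liouville_theorem)
 then obtain c where c: "\<And>u. P u = c" by (auto simp: constant_on_def)
 have Tc: "T u = c * exp (of_real m * u)" for u
 proof -
  have "T u = P u * exp (of_real m * u)" by (simp add: P_def exp_minus)
  thus ?thesis by (simp add: c)
 qed
 have "c = 0"
 proof (rule ccontr)
  assume "c \<noteq> 0"
  have "T (2 * pi * \<i>) = T 0" using T(2)[of 0 1] by simp
  hence "exp (of_real m * (2 * pi * \<i>)) = 1" using \<open>c \<noteq> 0\<close> by (simp add: Tc)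
  then obtain n :: int where "m * (2 * pi) = of_int (2 * n) * pi" by (auto simp: exp_eq_1)
  hence "m = of_int n" by simp
  thus False using m by simp
 qed
 hence W0: "deriv W u = 0" if "u \<in> strip1" for u using T(3)[OF that] Tc by simp
 have Wc: "\<exists>c. \<forall>u\<in>strip1. W u = c"
 proof (rule DERIV_zero_connected_constant[of strip1 "{}", simplified])
  show "continuous_on (strip1) W" using W by (simp add: holomorphic_on_imp_continuous_on)
  show "\<forall>x\<in>strip1. (W has_field_derivative 0) (at x)"
   using W0 holomorphic_derivI[OF W(1) open_strip] by metis
 qed auto
 then obtain w where w: "\<And>u. u \<in> strip1 \<Longrightarrow> W u = w" by blast
 have inS: "Complex t w1 \<in> strip1" for t using omega by simp
 have wpos: "Re w > 0"
  using eq1[of "Complex 0 w1"] W(2)[OF inS[of 0]] w[OF inS[of 0]] omega by simp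
 have "Re w \<le> 2 * exp (m * t)" for t
  using Ele[OF inS[of t]] W(2)[OF inS[of t]] w[OF inS[of t]] by simp
 \<comment> \<open>At this abscissa the bound is half of \<open>Re w\<close>.\<close>
 from this[of "ln (Re w / 4) / m"] have "Re w \<le> 2 * (Re w / 4)" using wpos m by simp
 thus False using wpos by simp
qed

text \<open>The lower bound on \<open>g\<close> excludes the two types with a small function in the
  gaps, by \<open>no_small_peak\<close>; that \<open>g\<close> is not an integer excludes the large
  type.\<close>

lemma no_peak:
 assumes s: "diverges s"
  and b: "\<And>t. EVN k. A (s k + t) \<le> 2 * exp (g * t) * A (s k)"
  and g: "g > 8 / (a1 - b0)" "g \<notin> \<int>"
 shows False
proof -
 have g0: "g > 0"
 proof -
  have "8 / (a1 - b0) > 0" using ang by simp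
  thus ?thesis using g by linarith
 qed
 obtain r E H where r: "strict_mono r" and E: "S1.lim (s \<circ> r) E" and H: "S0.lim (s \<circ> r) H"
  and sr: "diverges (s \<circ> r)"
  using limits_exist[OF s b] by blast
 have b': "EVN k. A ((s \<circ> r) k + t) \<le> 2 * exp (g * t) * A ((s \<circ> r) k)" for t
  using filterlim_iff[THEN iffD1, OF filterlim_subseq[OF r], rule_format, OF b[of t]] by simp
 interpret rp: root_pair E H strip1 strip0 gap1 gap2 "- (2 * pi * \<i>)"
  by (rule root_pair_limit[OF sr E H])
 note nt = limit_nontrivial[OF sr E H]
 show False
 proof (rule rp.trichotomy[OF nt])
  assume a: "\<And>z. z \<in> strip0 \<Longrightarrow> norm (H z) = 1" "\<And>z. z \<in> gap1 \<union> gap2 \<Longrightarrow> norm (E z) < 1"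
  then obtain z where "z \<in> strip1" "norm (E z) > 1" using nt by force
  thus False
   by (intro S1.no_small_peak[OF E b' ang(1) _ _ _ _ g(1), of z]) (use a(2) rp.O1 in auto)
 next
  assume a: "\<And>z. z \<in> strip1 \<Longrightarrow> norm (E z) = 1" "\<And>z. z \<in> gap1 \<Longrightarrow> norm (H z) < 1"
  then obtain z where "z \<in> strip0" "norm (H z) > 1" using nt by force
  thus False
   by (intro S0.no_small_peak[OF H b' ang(1) _ _ _ _ g(1), of z]) (use a(2) rp.O1 in auto)
 next
  assume a: "\<And>z. z \<in> gap1 \<Longrightarrow> norm (E z) > 1 \<and> norm (H z) = norm (E z)"
    "\<And>z. z \<in> gap2 \<Longrightarrow> norm (E z) > 1 \<and> norm (H (z + - (2 * pi * \<i>))) = norm (E z)"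
  let ?p = "Complex 0 w1"
  have p: "?p \<in> gap1" using omega by simp
  have E0: "E ?p \<noteq> 0" "H ?p \<noteq> 0" using a(1)[OF p] by auto
  show False
  proof (rule no_large_peak[OF rp.E rp.H _ _ a _ _ g0 g(2)])
   show "E w \<noteq> 0" if "w \<in> strip1" for w
    by (rule S1.lim_zero_free[OF E _ E0(1) that]) (use p rp.O1 in blast)
   show "H w \<noteq> 0" if "w \<in> strip0" for w
    by (rule S0.lim_zero_free[OF H _ E0(2) that]) (use p rp.O1 in blast)
   show "norm (E w) \<le> exp (2 * exp (g * Re w))" if "w \<in> strip1" for w
    by (rule S1.lim_bound[OF E that b'])
   show "norm (H w) \<le> exp (2 * exp (g * Re w))" if "w \<in> strip0" for w
    by (rule S0.lim_bound[OF H that b'])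
  qed
 qed
qed

end

context log_side begin

text \<open>On the circles belonging to abscissa \<open>t\<close> the upper bound of
  \<open>ln (norm F)\<close> is negligible against \<open>A (s k)\<close>; by
  \<open>lim_arc_small\<close> the function cannot be as small as \<open>exp (- m * A (s k))\<close>
  on a fixed arc of them.\<close>

lemma no_small_with_vanishing_growth:
 assumes L: "lim s E" and ab: "a < b" "strip a b \<subseteq> strip l u" and small: "\<And>g. g \<in> strip a b \<Longrightarrow> norm (E g) < 1"
  and b: "\<And>c. c > 0 \<Longrightarrow> EVN k. A (s k + t) \<le> c * A (s k)"
 shows False
proof -
 define w d where "w = (a + b) / 2" and "d = (b - a) / 4"
 have d: "d > 0" "w - d > a" "w + d < b" using ab by (auto simp: w_def d_def field_simps)
 obtain N :: nat where N: "real N > pi / d" using reals_Archimedean2 by blast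
 have N0: "N > 0"
 proof -
  have "pi / d > 0" using d by simp
  thus ?thesis using N by (intro Nat.gr0I) auto
 qed
 have Nd: "pi / real N \<le> d" using N N0 d by (simp add: pos_divide_less_eq pos_divide_le_eq mult.commute)
 let ?K = "Complex t ` {w - d..w + d}"
 have K: "compact ?K" by (intro compact_continuous_image) (auto simp: Complex_eq intro!: continuous_intros)
 have KS: "?K \<subseteq> strip a b" using d by auto
 have "continuous_on ?K (\<lambda>z. norm (E z))"
  using L KS ab(2) unfolding lim_def
  by (intro continuous_on_norm holomorphic_on_imp_continuous_on) (auto intro: holomorphic_on_subset)
 then obtain x where x: "x \<in> ?K" "\<And>y. y \<in> ?K \<Longrightarrow> norm (E y) \<le> norm (E x)"
  using continuous_attains_sup[OF K, of "\<lambda>z. norm (E z)"] d by auto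
 define q where "q = max (norm (E x)) (1 / 2)"
 have q: "0 < q" "q < 1" using small[of x] x(1) KS by (auto simp: q_def)
 define m where "m = - ln q"
 have m: "m > 0" "exp (- m) = q" using q by (auto simp: m_def)
 define c where "c = m / (2 * real N)"
 have e: "c > 0" using m N0 by (simp add: c_def)
 have "m \<le> (real N - 1) * c"
 proof (rule lim_arc_small[OF L N0 b[OF e]])
  fix v assume "\<bar>v - w\<bar> \<le> pi / real N"
  hence "\<bar>v - w\<bar> \<le> d" using Nd by linarith
  hence "Complex t v \<in> ?K" by (intro imageI) (auto simp: abs_le_iff)
  thus "Complex t v \<in> strip l u \<and> norm (E (Complex t v)) \<le> exp (- m)"
   using x(2) KS ab(2) unfolding m q_def by (metis max.coboundedI1 subsetD)
 qed
 also have "\<dots> \<le> real N * c" using e by (simp add: left_diff_distrib)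
 also have "\<dots> = m / 2" using N0 by (simp add: c_def)
 finally show False using m by simp
qed

lemma compact_arc: "compact (Complex t ` {a..b})"
 by (intro compact_continuous_image) (auto simp: Complex_eq intro!: continuous_intros)

lemma Complex_shift: "Complex 0 y + of_real t = Complex t y"
 by (simp add: complex_eq_iff)

text \<open>\<open>P\<close> is any factor that is negligible on the scale of \<open>A\<close>,
  later a polynomial. Half of the slack \<open>c' - c\<close> is spent on it, half on the
  convergence.\<close>

lemma prod_le:
 assumes L: "lim s E" and E: "\<And>t. t \<in> {a..b} \<Longrightarrow> Complex 0 t \<in> strip l u \<and> norm (E (Complex 0 t)) \<le> exp c"
  and P: "\<And>d. d > 0 \<Longrightarrow> EVN k. \<forall>z. norm z = exp (s k) \<longrightarrow> norm (P z) \<le> exp (d * A (s k))"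
  and c: "c < c'"
 shows "EVN k. \<forall>t\<in>{a..b}. norm (P (pt (s k) t) * F (pt (s k) t)) \<le> exp (c' * A (s k))"
proof -
 have sub: "Complex 0 ` {a..b} \<subseteq> strip l u" using E by blast
 have e: "(c' - c) / 2 > 0" using c by simp
 have "EVN k. \<forall>w\<in>Complex 0 ` {a..b}. Re (G (w + of_real (s k))) \<le> ((c + c') / 2) * A (s k)"
  by (rule lim_uniform_le[OF L compact_arc sub, of c]) (use E c in auto)
 thus ?thesis using P[OF e]
 proof eventually_elim
  case (elim k)
  show ?case
  proof
   fix t assume th: "t \<in> {a..b}"
   have i: "Complex (s k) t \<in> strip l u" using E[OF th] by simp
   have "norm (F (pt (s k) t)) \<le> exp (((c + c') / 2) * A (s k))"
    using elim(1)[rule_format, OF imageI[OF th]] norm_F[OF i] by (simp add: Complex_shift)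
   moreover have "norm (P (pt (s k) t)) \<le> exp ((c' - c) / 2 * A (s k))"
    using elim(2)[rule_format, of "pt (s k) t"] by simp
   ultimately have "norm (P (pt (s k) t) * F (pt (s k) t)) \<le> exp ((c' - c) / 2 * A (s k)) * exp (((c + c') / 2) * A (s k))"
    unfolding norm_mult by (intro mult_mono) auto
   also have "\<dots> = exp (c' * A (s k))" by (simp add: mult_exp_exp field_simps)
   finally show "norm (P (pt (s k) t) * F (pt (s k) t)) \<le> exp (c' * A (s k))" .
  qed
 qed
qed

lemma prod_ge:
 assumes L: "lim s E" and E: "\<And>t. t \<in> {a..b} \<Longrightarrow> Complex 0 t \<in> strip l u \<and> norm (E (Complex 0 t)) \<ge> exp c"
  and P: "\<And>d. d > 0 \<Longrightarrow> EVN k. \<forall>z. norm z = exp (s k) \<longrightarrow> norm (P z) \<ge> exp (- d * A (s k))"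
  and c: "c' < c"
 shows "EVN k. \<forall>t\<in>{a..b}. norm (P (pt (s k) t) * F (pt (s k) t)) \<ge> exp (c' * A (s k))"
proof -
 have sub: "Complex 0 ` {a..b} \<subseteq> strip l u" using E by blast
 have e: "(c - c') / 2 > 0" using c by simp
 have "EVN k. \<forall>w\<in>Complex 0 ` {a..b}. Re (G (w + of_real (s k))) \<ge> ((c + c') / 2) * A (s k)"
  by (rule lim_uniform_ge[OF L compact_arc sub, of c]) (use E c in auto)
 thus ?thesis using P[OF e]
 proof eventually_elim
  case (elim k)
  show ?case
  proof
   fix t assume th: "t \<in> {a..b}"
   have i: "Complex (s k) t \<in> strip l u" using E[OF th] by simp
   have 1: "norm (F (pt (s k) t)) \<ge> exp (((c + c') / 2) * A (s k))"
    using elim(1)[rule_format, OF imageI[OF th]] norm_F[OF i] by (simp add: Complex_shift)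
   have 2: "norm (P (pt (s k) t)) \<ge> exp (- ((c - c') / 2) * A (s k))"
    using elim(2)[rule_format, of "pt (s k) t"] by simp
   have "exp (c' * A (s k)) = exp (- ((c - c') / 2) * A (s k)) * exp (((c + c') / 2) * A (s k))"
    by (simp add: mult_exp_exp field_simps)
   also have "\<dots> \<le> norm (P (pt (s k) t) * F (pt (s k) t))"
    unfolding norm_mult using 1 2 by (intro mult_mono) auto
   finally show "norm (P (pt (s k) t) * F (pt (s k) t)) \<ge> exp (c' * A (s k))" .
  qed
 qed
qed

lemma arc_sup_less_1:
 assumes L: "lim s E" and E: "\<And>t. t \<in> {a..b} \<Longrightarrow> Complex 0 t \<in> strip l u \<and> norm (E (Complex 0 t)) < 1"
 shows "\<exists>e>0. \<forall>t\<in>{a..b}. norm (E (Complex 0 t)) \<le> exp (- e)"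
proof (cases "a \<le> b")
 case True
 have "continuous_on (Complex 0 ` {a..b}) (\<lambda>z. norm (E z))"
  using L E unfolding lim_def
  by (intro continuous_on_norm holomorphic_on_imp_continuous_on) (auto intro: holomorphic_on_subset)
 then obtain x where x: "x \<in> Complex 0 ` {a..b}" "\<And>y. y \<in> Complex 0 ` {a..b} \<Longrightarrow> norm (E y) \<le> norm (E x)"
  using continuous_attains_sup[OF compact_arc, of 0 a b "\<lambda>z. norm (E z)"] True by auto
 define q where "q = max (norm (E x)) (1 / 2)"
 have q: "0 < q" "q < 1" using E x(1) by (auto simp: q_def)
 show ?thesis
  by (rule exI[of _ "- ln q"]) (use q x(2) in \<open>auto simp: q_def le_max_iff_disj\<close>)
qed (auto intro: exI[of _ 1])

lemma arc_inf_greater_1: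
 assumes L: "lim s E" and E: "\<And>t. t \<in> {a..b} \<Longrightarrow> Complex 0 t \<in> strip l u \<and> norm (E (Complex 0 t)) > 1"
 shows "\<exists>e>0. \<forall>t\<in>{a..b}. norm (E (Complex 0 t)) \<ge> exp e"
proof (cases "a \<le> b")
 case True
 have "continuous_on (Complex 0 ` {a..b}) (\<lambda>z. norm (E z))"
  using L E unfolding lim_def
  by (intro continuous_on_norm holomorphic_on_imp_continuous_on) (auto intro: holomorphic_on_subset)
 then obtain x where x: "x \<in> Complex 0 ` {a..b}" "\<And>y. y \<in> Complex 0 ` {a..b} \<Longrightarrow> norm (E x) \<le> norm (E y)"
  using continuous_attains_inf[OF compact_arc, of 0 a b "\<lambda>z. norm (E z)"] True by auto
 have "norm (E x) > 1" using x(1) E by auto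
 hence "ln (norm (E x)) > 0" "exp (ln (norm (E x))) = norm (E x)" by (auto intro: ln_gt_zero simp: exp_ln_iff)
 thus ?thesis using x(2) by (intro exI[of _ "ln (norm (E x))"]) auto
qed (auto intro: exI[of _ 1])

end

context separated begin

text \<open>A one-sided form of Polya peaks: as \<open>g > \<rho>\<close>, the function
  \<open>A x * exp (- g * x)\<close> is bounded on \<open>x \<ge> s\<close>, and \<open>s'\<close>
  reaches its supremum up to the factor 2.\<close>

lemma growth_near_max:
 assumes g: "g > \<rho>"
 shows "\<exists>s'\<ge>s. \<forall>x\<ge>s. A x \<le> 2 * exp (g * (x - s')) * A s'"
proof -
 define B where "B = (\<lambda>x. A x * exp (- g * x))"
 obtain T where T: "\<And>x. x \<ge> T \<Longrightarrow> A x \<le> exp (\<rho> * x)" using A_order by (auto simp: ev_top)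
 define T' where "T' = max s T"
 have "B x \<le> max (A T' * exp (- g * s)) (exp ((\<rho> - g) * s))" if x: "x \<ge> s" for x
 proof (cases "x \<le> T'")
  case True
  have "B x \<le> A T' * exp (- g * s)" unfolding B_def
   using True x g \<rho> S1.A_mono[OF True] S1.A_pos[of T'] by (intro mult_mono) auto
  thus ?thesis by simp
 next
  case False
  have "B x \<le> exp (\<rho> * x) * exp (- g * x)" unfolding B_def using T[of x] False by (intro mult_right_mono) (auto simp: T'_def)
  also have "\<dots> = exp ((\<rho> - g) * x)" by (simp add: mult_exp_exp algebra_simps)
  also have "\<dots> \<le> exp ((\<rho> - g) * s)" using g x by (simp add: mult_left_mono_neg)
  finally show ?thesis by simp
 qed
 hence bdd: "bdd_above (B ` {s..})" by (intro bdd_aboveI2) auto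
 define S where "S = (SUP x\<in>{s..}. B x)"
 have Sge: "B x \<le> S" if "x \<ge> s" for x unfolding S_def by (rule cSUP_upper[OF _ bdd]) (use that in simp)
 have "B s > 0" using S1.A_pos by (simp add: B_def)
 hence S0: "S > 0" using Sge[of s] by simp
 hence "S / 2 < (SUP x\<in>{s..}. B x)" by (simp add: S_def)
 then obtain s' where s': "s' \<ge> s" "S / 2 < B s'"
  using less_cSUP_iff[OF _ bdd, of "S / 2"] by auto
 have "A x \<le> 2 * exp (g * (x - s')) * A s'" if "x \<ge> s" for x
 proof -
  have "B x \<le> 2 * B s'" using Sge[OF that] s' by linarith
  hence "B x * exp (g * x) \<le> 2 * B s' * exp (g * x)" by (intro mult_right_mono) auto
  moreover have "B x * exp (g * x) = A x" by (simp add: B_def exp_minus)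
  moreover have "2 * B s' * exp (g * x) = 2 * exp (g * (x - s')) * A s'"
   by (simp add: B_def exp_minus exp_diff right_diff_distrib field_simps)
  ultimately show ?thesis by simp
 qed
 thus ?thesis using s'(1) by blast
qed

text \<open>Let \<open>g s\<close> be the near maximum found from \<open>s\<close>. It stays within
  a bounded distance of \<open>s\<close>, and \<open>A (g s)\<close> is comparable to
  \<open>A s\<close>; so the comparison of \<open>A\<close> with an exponential, valid with base
  point \<open>g s\<close>, is valid with base point \<open>s\<close>.\<close>

lemma doubling: "\<exists>D>0. \<exists>m>0. \<exists>s0. \<forall>s\<ge>s0. \<forall>t\<ge>0. A (s + t) \<le> D * exp (m * t) * A s"
proof -
 define x0 where "x0 = max \<rho> (8 / (a1 - b0))"
 \<comment> \<open>Half an odd integer, above both thresholds of \<open>no_peak\<close>.\<close>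
 define m :: real where "m = of_int \<lceil>x0\<rceil> + 1 / 2"
 have "m > x0" unfolding m_def by linarith
 hence m: "m > \<rho>" "m > 8 / (a1 - b0)" "m > 0" using \<rho> by (auto simp: x0_def)
 have mZ: "m \<notin> \<int>"
 proof
  assume "m \<in> \<int>"
  then obtain n :: int where "m = of_int n" by (auto simp: Ints_def)
  hence "of_int \<lceil>x0\<rceil> + 1 / 2 = (of_int n :: real)" by (simp add: m_def)
  hence "2 * of_int n = 2 * (of_int \<lceil>x0\<rceil> :: real) + 1" by linarith
  hence "of_int (2 * n) = (of_int (2 * \<lceil>x0\<rceil> + 1) :: real)" by simp
  hence "2 * n = 2 * \<lceil>x0\<rceil> + 1" by (simp only: of_int_eq_iff)
  thus False by presburger
 qed
 obtain g where g: "\<And>s. g s \<ge> s" "\<And>s x. x \<ge> s \<Longrightarrow> A x \<le> 2 * exp (m * (x - g s)) * A (g s)"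
  using growth_near_max[OF m(1)] by metis
 \<comment> \<open>If \<open>g s - s\<close> were unbounded, the comparison around
   \<open>g (sk k)\<close> would hold on intervals reaching further and further to the left, and
   thus for every fixed \<open>t\<close> eventually; this is what \<open>no_peak\<close>
   excludes.\<close>
 have claim1: "\<exists>T s0. \<forall>s\<ge>s0. g s \<le> s + T"
 proof (rule ccontr)
  assume "\<nexists>T s0. \<forall>s\<ge>s0. g s \<le> s + T"
  hence "\<exists>s\<ge>real k. g s > s + real k" for k by (meson not_le)
  then obtain sk where sk: "\<And>k. sk k \<ge> real k" "\<And>k. g (sk k) > sk k + real k" by metis
  have lim: "diverges (\<lambda>k. g (sk k))"
  proof (rule filterlim_at_top_mono[OF filterlim_real_sequentially])
   have "real k \<le> g (sk k)" for k using sk(1)[of k] g(1)[of "sk k"] by linarith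
   thus "EVN k. real k \<le> g (sk k)" by simp
  qed
  show False
  proof (rule no_peak[OF lim _ m(2) mZ])
   fix t
   show "EVN k. A (g (sk k) + t) \<le> 2 * exp (m * t) * A (g (sk k))"
    using eventually_ge_at_top[of "nat \<lceil>- t\<rceil>"]
   proof eventually_elim
    case (elim k)
    have "real k \<ge> - t" using elim by linarith
    hence "g (sk k) + t \<ge> sk k" using sk(2)[of k] by linarith
    from g(2)[OF this] show ?case by simp
   qed
  qed
 qed
 then obtain T s1 where T: "\<And>s. s \<ge> s1 \<Longrightarrow> g s \<le> s + T" by blast
 \<comment> \<open>Otherwise \<open>A (s' k - T)\<close> is negligible against
   \<open>A (s' k)\<close> along a sequence of near maxima, and every type of limit contradicts this
   at the abscissa \<open>- T\<close>.\<close>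
 have claim2: "\<exists>c>0. \<exists>s0. \<forall>s\<ge>s0. A s \<ge> c * A (g s)"
 proof (rule ccontr)
  assume neg: "\<not> (\<exists>c>0. \<exists>s0. \<forall>s\<ge>s0. A s \<ge> c * A (g s))"
  have "\<exists>s\<ge>max s1 (real k). A s < 1 / (real k + 1) * A (g s)" for k :: nat
  proof (rule ccontr)
   assume "\<not> ?thesis"
   hence "\<forall>s\<ge>max s1 (real k). A s \<ge> 1 / (real k + 1) * A (g s)" by (metis not_le)
   moreover have "1 / (real k + 1) > 0" by simp
   ultimately show False using neg by blast
  qed
  then obtain sk where sk: "\<And>k. sk k \<ge> max s1 (real k)" "\<And>k. A (sk k) < 1 / (real k + 1) * A (g (sk k))" by metis
  define s' where "s' = (\<lambda>k. g (sk k))"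
  have lim: "diverges s'" unfolding s'_def
  proof (rule filterlim_at_top_mono[OF filterlim_real_sequentially])
   have "real k \<le> g (sk k)" for k using sk(1)[of k] g(1)[of "sk k"] by linarith
   thus "EVN k. real k \<le> g (sk k)" by simp
  qed
  have b: "A (s' k + t) \<le> 2 * exp (m * max 0 t) * A (s' k)" for k t
  proof (cases "t \<ge> 0")
   case True
   thus ?thesis using g(2)[of "sk k" "s' k + t"] g(1)[of "sk k"] by (simp add: s'_def)
  next
   case False
   hence "A (s' k + t) \<le> A (s' k)" by (intro S1.A_mono) simp
   thus ?thesis using False S1.A_pos[of "s' k"] by simp
  qed
  obtain r E H where r: "strict_mono r" and E: "S1.lim (s' \<circ> r) E" and H: "S0.lim (s' \<circ> r) H"
   and sr: "diverges (s' \<circ> r)"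
   using limits_exist[OF lim, of "\<lambda>t. 2 * exp (m * max 0 t)"] b by auto
  have van: "EVN k. A ((s' \<circ> r) k + - T) \<le> d * A ((s' \<circ> r) k)" if e: "d > 0" for d
   using eventually_ge_at_top[of "nat \<lceil>1 / d\<rceil>"]
  proof eventually_elim
   case (elim k)
   have "r k \<ge> k" using seq_suble[OF r] .
   hence "real (r k) + 1 \<ge> 1 / d" using elim by linarith
   hence e': "1 / (real (r k) + 1) \<le> d" using e by (simp add: field_simps)
   have "s' (r k) + - T \<le> sk (r k)" using T[of "sk (r k)"] sk(1)[of "r k"] by (simp add: s'_def)
   hence "A (s' (r k) + - T) \<le> A (sk (r k))" by (rule S1.A_mono)
   also have "\<dots> \<le> 1 / (real (r k) + 1) * A (s' (r k))" using sk(2)[of "r k"] by (simp add: s'_def)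
   also have "\<dots> \<le> d * A (s' (r k))" using e' S1.A_pos[of "s' (r k)"] by (intro mult_right_mono) auto
   finally show ?case by simp
  qed
  interpret rp: root_pair E H strip1 strip0 gap1 gap2 "- (2 * pi * \<i>)"
   by (rule root_pair_limit[OF sr E H])
  show False
  proof (rule rp.trichotomy[OF limit_nontrivial[OF sr E H]])
   assume "\<And>z. z \<in> gap1 \<union> gap2 \<Longrightarrow> norm (E z) < 1"
   thus False by (intro S1.no_small_with_vanishing_growth[OF E ang(1) _ _ van]) (use rp.O1 in blast)+
  next
   assume "\<And>z. z \<in> gap1 \<Longrightarrow> norm (H z) < 1"
   thus False by (intro S0.no_small_with_vanishing_growth[OF H ang(1) _ _ van]) (use rp.O1 in blast)+
  next
   assume a: "\<And>z. z \<in> gap1 \<Longrightarrow> norm (E z) > 1 \<and> norm (H z) = norm (E z)"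
   let ?p = "Complex (- T) w1"
   have p: "?p \<in> gap1" "?p \<in> strip1" using omega by auto
   have "ln (norm (E ?p)) > 0" using a[OF p(1)] by (intro ln_gt_zero) simp
   hence e: "ln (norm (E ?p)) / 2 > 0" by simp
   \<comment> \<open>The vanishing growth bounds \<open>norm (E ?p)\<close> by \<open>exp d\<close>
     for every \<open>d > 0\<close>; half of its own logarithm is a contradictory choice.\<close>
   have "norm (E ?p) \<le> exp (ln (norm (E ?p)) / 2)"
    by (rule S1.lim_bound[OF E p(2)]) (use van[OF e] in simp)
   hence "ln (norm (E ?p)) \<le> ln (norm (E ?p)) / 2"
    using a[OF p(1)] by (subst (asm) ln_le_cancel_iff[symmetric]) auto
   thus False using e by linarith
  qed
 qed
 then obtain c s2 where c: "c > 0" "\<And>s. s \<ge> s2 \<Longrightarrow> A s \<ge> c * A (g s)" by blast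
 have "A (s + t) \<le> (2 / c) * exp (m * t) * A s" if "s \<ge> s2" "t \<ge> 0" for s t
 proof -
  have "A (s + t) \<le> A (g s + t)" using g(1)[of s] by (intro S1.A_mono) simp
  also have "\<dots> \<le> 2 * exp (m * t) * A (g s)" using g(2)[of s "g s + t"] g(1)[of s] that by simp
  also have "\<dots> \<le> 2 * exp (m * t) * (A s / c)" using c(1) c(2)[OF that(1)] by (intro mult_left_mono) (auto simp: field_simps)
  finally show ?thesis by simp
 qed
 thus ?thesis using c(1) m(3) by (intro exI[of _ "2 / c"] conjI exI[of _ m] exI[of _ s2]) auto
qed

end

section \<open>The three regimes in the gaps\<close>

text \<open>An exchange of quantifiers: failures for the tolerances \<open>1 / (k + 1)\<close> can
  be collected into one sequence, and a subsequence with a fixed tolerance \<open>e\<close>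
  contradicts them by monotonicity.\<close>

lemma eventually_by_subsequences:
 fixes P :: "real \<Rightarrow> real \<Rightarrow> bool"
 assumes mono: "\<And>e e' s. 0 < e' \<Longrightarrow> e' \<le> e \<Longrightarrow> P e s \<Longrightarrow> P e' s"
  and sub: "\<And>s::nat \<Rightarrow> real. diverges s \<Longrightarrow>
    \<exists>r::nat \<Rightarrow> nat. strict_mono r \<and> (\<exists>e>0. EVN k. P e (s (r k)))"
 shows "\<exists>e>0. EV s. P e s"
proof (rule ccontr)
 assume neg: "\<not> ?thesis"
 have "\<exists>s\<ge>real k. \<not> P (1 / (real k + 1)) s" for k
 proof (rule ccontr)
  assume "\<not> ?thesis"
  hence "EV s. P (1 / (real k + 1)) s" by (auto simp: ev_top)
  moreover have "1 / (real k + 1) > 0" by simp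
  ultimately show False using neg by blast
 qed
 then obtain s where s: "\<And>k. s k \<ge> real k" "\<And>k. \<not> P (1 / (real k + 1)) (s k)" by metis
 have "diverges s"
  by (rule filterlim_at_top_mono[OF filterlim_real_sequentially]) (use s(1) in simp)
 then obtain r :: "nat \<Rightarrow> nat" and e where r: "strict_mono r" "e > 0" "EVN k. P e (s (r k))"
  using sub by blast
 have "EVN k. False" using r(3) eventually_ge_at_top[of "nat \<lceil>1 / e\<rceil>"]
 proof eventually_elim
  case (elim k)
  have "r k \<ge> k" using seq_suble[OF r(1)] .
  hence "real (r k) + 1 \<ge> 1 / e" using elim by linarith
  hence "1 / (real (r k) + 1) \<le> e" using r(2) by (simp add: field_simps)
  hence "P (1 / (real (r k) + 1)) (s (r k))" by (intro mono[OF _ _ elim(1)]) auto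
  thus False using s(2) by simp
 qed
 thus False by simp
qed

text \<open>\<open>strip_bound\<close> for \<open>G\<close> with \<open>M = B * A s\<close>; the
  hypothesis on \<open>A (s + 1)\<close> controls \<open>A\<close> in the window of half-width
  1.\<close>

lemma (in log_side) eventually_deriv_bound:
 assumes ab: "l < a" "a \<le> b" "b < u" and D: "EV s. A (s + 1) \<le> D * A s"
  and A: "filterlim A at_top at_top" and pt: "EV s. \<exists>t\<in>{a..b}. Re (G (Complex s t)) \<ge> 0"
 shows "\<exists>K>0. EV s. \<forall>t\<in>{a..b}. norm (deriv G (Complex s t)) \<le> K * A s"
proof -
 obtain K where K: "strip_bound l u a b K" using strip_bound_exists[OF ab] by blast
 have K0: "K > 0" using K by (simp add: strip_bound_def)
 define B where "B = \<bar>D\<bar> + C + 1"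
 have B: "B > 0" using C by (simp add: B_def)
 have A1: "EV s. A s \<ge> 1" using A by (simp add: filterlim_at_top)
 have "EV s. \<forall>t\<in>{a..b}. norm (deriv G (Complex s t)) \<le> (K * B) * A s"
  using D A1 pt
 proof eventually_elim
  case (elim s)
  obtain t0 where th0: "t0 \<in> {a..b}" "Re (G (Complex s t0)) \<ge> 0" using elim(3) by blast
  show ?case
  proof
   fix t assume th: "t \<in> {a..b}"
   have "norm (deriv G (Complex s t)) \<le> K * (B * A s)"
   proof (rule strip_boundD(2)[OF K G _ _ th0 th])
    show "0 < B * A s" using B A_pos by simp
    fix w assume z: "w \<in> strip l u" "\<bar>Re w - s\<bar> < 1"
    have "Re (G w) \<le> A (Re w) + C" by (rule Re_G_le[OF z(1)])
    also have "A (Re w) \<le> A (s + 1)" using z(2) by (intro A_mono) linarith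
    also have "\<dots> \<le> \<bar>D\<bar> * A s" using elim(1) A_pos[of s] abs_ge_self[of D] mult_right_mono[of D "\<bar>D\<bar>" "A s"] by linarith
    also have "\<bar>D\<bar> * A s + C < \<bar>D\<bar> * A s + C * A s + A s"
    proof -
     have "C * 1 \<le> C * A s" using elim(2) C by (intro mult_left_mono) auto
     thus ?thesis using elim(2) by linarith
    qed
    also have "\<dots> = B * A s" by (simp add: B_def algebra_simps)
    finally show "Re (G w) < B * A s" by simp
   qed
   thus "norm (deriv G (Complex s t)) \<le> (K * B) * A s" by (simp add: mult.assoc)
  qed
 qed
 thus ?thesis using K0 B by (intro exI[of _ "K * B"]) auto
qed

context separated begin

lemma poly_ge_exp_A:
 fixes p :: "complex poly"
 assumes p: "p \<noteq> 0" and e: "d > 0"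
 shows "EV s. \<forall>z. norm z = exp s \<longrightarrow> norm (poly p z) \<ge> exp (- d * A s)"
proof -
 obtain c D R where c: "c > 0" "R \<ge> 1" "\<And>z. norm z \<ge> R \<Longrightarrow> c \<le> norm (poly p z)"
  using poly_norm_bounds[OF p] by metis
 have "EV s. A s \<ge> - ln c / d" using A_at_top by (simp add: filterlim_at_top)
 thus ?thesis using eventually_ge_at_top[of "ln R"]
 proof eventually_elim
  case (elim s)
  have "- d * A s \<le> ln c" using elim(1) e by (simp add: field_simps)
  hence "exp (- d * A s) \<le> exp (ln c)" by (simp only: exp_le_cancel_iff)
  hence le: "exp (- d * A s) \<le> c" using c by simp
  have R: "R \<le> exp s" using elim(2) c by (metis exp_le_cancel_iff exp_ln less_le_trans zero_less_one)
  show ?case using le c(3) R by (metis order_trans)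
 qed
qed

lemma poly_seq:
 fixes p :: "complex poly"
 assumes s: "diverges s" and p: "p \<noteq> 0" and e: "d > 0"
 shows "EVN k. \<forall>z. norm z = exp (s k) \<longrightarrow> norm (poly p z) \<le> exp (d * A (s k))"
  "EVN k. \<forall>z. norm z = exp (s k) \<longrightarrow> norm (poly p z) \<ge> exp (- d * A (s k))"
 using filterlim_iff[THEN iffD1, OF s, rule_format, OF poly_le_exp_A[OF p e]]
  filterlim_iff[THEN iffD1, OF s, rule_format, OF poly_ge_exp_A[OF p e]] by auto

lemma pt_shift: "pt s (t - 2 * pi) = pt s t"
proof -
 have "Complex s (t - 2 * pi) = Complex s t - 2 * pi * \<i>" by (simp add: complex_eq_iff)
 thus ?thesis by (simp add: exp_diff)
qed

lemma f_holomorphic: "f holomorphic_on X"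
 by (rule poly_mult_holomorphic[OF S1.F f1])

definition gap_arc :: "real \<Rightarrow> real \<Rightarrow> bool" where
 "gap_arc a b \<longleftrightarrow> (b0 < a \<and> b < a1) \<or> (b1 < a \<and> b < a0 + 2 * pi)"

abbreviation "lo a b c s \<equiv> \<forall>t\<in>{a..b}. norm (f (pt s t)) \<le> exp (c * A s)"
abbreviation "lo1 a b c s \<equiv> \<forall>t\<in>{a..b}. norm (f (pt s t) - 1) \<le> exp (c * A s)"
abbreviation "hi a b c s \<equiv> \<forall>t\<in>{a..b}. exp (c * A s) \<le> norm (f (pt s t))"

definition lim_small :: "(complex \<Rightarrow> complex) \<Rightarrow> (complex \<Rightarrow> complex) \<Rightarrow> bool" where
 "lim_small E H \<longleftrightarrow> (\<forall>z\<in>strip0. norm (H z) = 1) \<and> (\<forall>z\<in>gap1 \<union> gap2. norm (E z) < 1)"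

definition lim_near1 :: "(complex \<Rightarrow> complex) \<Rightarrow> (complex \<Rightarrow> complex) \<Rightarrow> bool" where
 "lim_near1 E H \<longleftrightarrow> (\<forall>z\<in>strip1. norm (E z) = 1) \<and> (\<forall>z\<in>gap1. norm (H z) < 1)
   \<and> (\<forall>z\<in>gap2. norm (H (z - 2 * pi * \<i>)) < 1)"

definition lim_large :: "(complex \<Rightarrow> complex) \<Rightarrow> (complex \<Rightarrow> complex) \<Rightarrow> bool" where
 "lim_large E H \<longleftrightarrow> (\<forall>z\<in>gap1 \<union> gap2. norm (E z) > 1)"

text \<open>Numbering the types allows one index to be fixed for all sequences; every
  \<open>i \<ge> 2\<close> denotes the large type.\<close>

definition "lim_type i = (if i = 0 then lim_small else if i = (1::nat) then lim_near1 else lim_large)"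

text \<open>\<open>doubling\<close> supplies the hypothesis of \<open>montel\<close> for every
  divergent sequence, so no peaks have to be chosen any more.\<close>

lemma typed_limits_exist:
 assumes s: "diverges s"
 obtains r E H i where "strict_mono r" "S1.lim (s \<circ> r) E" "S0.lim (s \<circ> r) H" "diverges (s \<circ> r)"
  "i < 3" "lim_type i E H"
proof -
 obtain D g s0 where D: "D > 0" "g > 0" "\<And>s t. s \<ge> s0 \<Longrightarrow> t \<ge> 0 \<Longrightarrow> A (s + t) \<le> D * exp (g * t) * A s"
  using doubling by blast
 have "EVN k. A (s k + t) \<le> D * exp (g * max 0 t) * A (s k)" for t
 proof -
  have "EVN k. s k \<ge> s0" using s by (simp add: filterlim_at_top)
  thus ?thesis
  proof eventually_elim
   case (elim k)
   have "A (s k + t) \<le> A (s k + max 0 t)" by (rule S1.A_mono) simp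
   also have "\<dots> \<le> D * exp (g * max 0 t) * A (s k)" using D(3)[OF elim] by simp
   finally show ?case .
  qed
 qed
 then obtain r E H where r: "strict_mono r" and E: "S1.lim (s \<circ> r) E" and H: "S0.lim (s \<circ> r) H"
  and sr: "diverges (s \<circ> r)"
  using limits_exist[OF s, of "\<lambda>t. D * exp (g * max 0 t)"] by blast
 interpret rp: root_pair E H strip1 strip0 gap1 gap2 "- (2 * pi * \<i>)"
  by (rule root_pair_limit[OF sr E H])
 have "lim_type 0 E H \<or> lim_type 1 E H \<or> lim_type 2 E H" unfolding lim_type_def
 proof (rule rp.trichotomy[OF limit_nontrivial[OF sr E H]], goal_cases)
  case 1 thus ?case unfolding lim_small_def by simp
 next
  case 2 thus ?case unfolding lim_near1_def by simp
 next
  case 3 thus ?case unfolding lim_large_def by auto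
 qed
 thus thesis using that[OF r E H sr, of 0] that[OF r E H sr, of 1] that[OF r E H sr, of 2] by linarith
qed

lemma arc_f_le:
 assumes s: "diverges s" and E: "S1.lim s E" and ab: "b0 < a" "b < a0 + 2 * pi"
  and le: "\<And>t. t \<in> {a..b} \<Longrightarrow> norm (E (Complex 0 t)) \<le> exp c" and c: "c < c'"
 shows "EVN k. lo a b c' (s k)"
 using S1.prod_le[OF E, of a b c "poly p1" c'] ab le c poly_seq(1)[OF s p1] by (simp add: f1)

lemma arc_f_ge:
 assumes s: "diverges s" and E: "S1.lim s E" and ab: "b0 < a" "b < a0 + 2 * pi"
  and ge: "\<And>t. t \<in> {a..b} \<Longrightarrow> norm (E (Complex 0 t)) \<ge> exp c" and c: "c' < c"
 shows "EVN k. hi a b c' (s k)"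
 using S1.prod_ge[OF E, of a b c "poly p1" c'] ab ge c poly_seq(2)[OF s p1] by (simp add: f1)

lemma arc_f0_le:
 assumes s: "diverges s" and E: "S0.lim s H" and ab: "b1 - 2 * pi < a" "b < a1"
  and le: "\<And>t. t \<in> {a..b} \<Longrightarrow> norm (H (Complex 0 t)) \<le> exp c" and c: "c < c'"
 shows "EVN k. lo1 a b c' (s k)"
 using S0.prod_le[OF E, of a b c "poly p0" c'] ab le c poly_seq(1)[OF s p0] by (simp add: f0)

lemma gap_arc_strip: "gap_arc a b \<Longrightarrow> t \<in> {a..b} \<Longrightarrow> Complex 0 t \<in> gap1 \<union> gap2"
 by (auto simp: gap_arc_def)

lemma gap_arc_bounds: "gap_arc a b \<Longrightarrow> b0 < a" "gap_arc a b \<Longrightarrow> b < a0 + 2 * pi"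
 using ang by (auto simp: gap_arc_def)

lemma small_arc:
 assumes s: "diverges s" and E: "S1.lim s E" and sm: "lim_small E H" and ab: "gap_arc a b"
 shows "\<exists>d>0. EVN k. lo a b (- d) (s k)"
proof -
 have "Complex 0 t \<in> strip1 \<and> norm (E (Complex 0 t)) < 1" if "t \<in> {a..b}" for t
  using gap_arc_strip[OF ab that] gap_arc_bounds[OF ab] that sm by (auto simp: lim_small_def)
 from S1.arc_sup_less_1[OF E this] obtain d where e: "d > 0" "\<And>t. t \<in> {a..b} \<Longrightarrow> norm (E (Complex 0 t)) \<le> exp (- d)" by blast
 from arc_f_le[OF s E gap_arc_bounds[OF ab] e(2), of "- (d / 2)"] e(1) show ?thesis
  by (intro exI[of _ "d / 2"]) auto
qed

lemma large_arc:
 assumes s: "diverges s" and E: "S1.lim s E" and la: "lim_large E H" and ab: "gap_arc a b"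
 shows "\<exists>d>0. EVN k. hi a b d (s k)"
proof -
 have "Complex 0 t \<in> strip1 \<and> norm (E (Complex 0 t)) > 1" if "t \<in> {a..b}" for t
  using gap_arc_strip[OF ab that] gap_arc_bounds[OF ab] that la by (auto simp: lim_large_def)
 from S1.arc_inf_greater_1[OF E this] obtain d where e: "d > 0" "\<And>t. t \<in> {a..b} \<Longrightarrow> norm (E (Complex 0 t)) \<ge> exp d" by blast
 from arc_f_ge[OF s E gap_arc_bounds[OF ab] e(2), of "d / 2"] e(1) show ?thesis
  by (intro exI[of _ "d / 2"]) auto
qed

lemma lo1_shift: "lo1 (a - 2 * pi) (b - 2 * pi) c s \<Longrightarrow> lo1 a b c s"
proof
 fix t assume a: "lo1 (a - 2 * pi) (b - 2 * pi) c s" "t \<in> {a..b}"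
 thus "norm (f (pt s t) - 1) \<le> exp (c * A s)" using a(1)[rule_format, of "t - 2 * pi"] by (simp add: pt_shift)
qed

text \<open>\<open>H\<close> lives on \<open>strip0\<close>, where the second gap appears lowered by
  \<open>2 * pi\<close>; \<open>lo1_shift\<close> brings the estimate back.\<close>

lemma near1_arc:
 assumes s: "diverges s" and H: "S0.lim s H" and ne: "lim_near1 E H" and ab: "gap_arc a b"
 shows "\<exists>w>0. EVN k. lo1 a b (- w) (s k)"
proof -
 have gen: "\<exists>w>0. EVN k. lo1 c d (- w) (s k)"
  if cd: "b1 - 2 * pi < c" "d < a1" "\<And>t. t \<in> {c..d} \<Longrightarrow> norm (H (Complex 0 t)) < 1" for c d
 proof -
  have "Complex 0 t \<in> strip0 \<and> norm (H (Complex 0 t)) < 1" if "t \<in> {c..d}" for t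
   using cd that by auto
  from S0.arc_sup_less_1[OF H this] obtain w where e: "w > 0" "\<And>t. t \<in> {c..d} \<Longrightarrow> norm (H (Complex 0 t)) \<le> exp (- w)" by blast
  from arc_f0_le[OF s H cd(1,2) e(2), of "- (w / 2)"] e(1) show ?thesis
   by (intro exI[of _ "w / 2"]) auto
 qed
 from ab consider (1) "b0 < a" "b < a1" | (2) "b1 < a" "b < a0 + 2 * pi" by (auto simp: gap_arc_def)
 thus ?thesis
 proof cases
  case 1
  show ?thesis by (rule gen) (use 1 ang ne in \<open>auto simp: lim_near1_def\<close>)
 next
  case 2
  have "\<exists>w>0. EVN k. lo1 (a - 2 * pi) (b - 2 * pi) (- w) (s k)"
  proof (rule gen)
   fix t assume th: "t \<in> {a - 2 * pi..b - 2 * pi}"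
   have "Complex 0 (t + 2 * pi) \<in> gap2" using th 2 by auto
   hence "norm (H (Complex 0 (t + 2 * pi) - 2 * pi * \<i>)) < 1" using ne by (simp add: lim_near1_def)
   moreover have "Complex 0 (t + 2 * pi) - 2 * pi * \<i> = Complex 0 t" by (simp add: complex_eq_iff)
   ultimately show "norm (H (Complex 0 t)) < 1" by simp
  qed (use 2 ang in auto)
  then obtain w where w: "w > 0" "EVN k. lo1 (a - 2 * pi) (b - 2 * pi) (- w) (s k)" by blast
  from w(2) have "EVN k. lo1 a b (- w) (s k)" by eventually_elim (rule lo1_shift)
  thus ?thesis using w(1) by blast
 qed
qed

definition Large where
 "Large \<longleftrightarrow> (\<forall>a b. gap_arc a b \<longrightarrow> (\<exists>e>0. EV s. hi a b e s))"

text \<open>The second part says that \<open>f - 1\<close> is of size \<open>exp (o(A))\<close> in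
  all directions of \<open>strip0\<close>. Together with the decay in the gaps it will force
  \<open>f\<close> to decay between them as well.\<close>

definition Small where
 "Small \<longleftrightarrow> (\<forall>a b. gap_arc a b \<longrightarrow> (\<exists>e>0. EV s. lo a b (- e) s)) \<and>
   (\<forall>a b d. b1 - 2 * pi < a \<longrightarrow> b < a1 \<longrightarrow> d > 0 \<longrightarrow> (EV s. lo1 a b d s))"

definition Near1 where
 "Near1 \<longleftrightarrow> (\<forall>a b. gap_arc a b \<longrightarrow> (\<exists>e>0. EV s. lo1 a b (- e) s)) \<and>
   (\<forall>a b d. b0 < a \<longrightarrow> b < a0 + 2 * pi \<longrightarrow> d > 0 \<longrightarrow> (EV s. lo a b d s))"

lemma exp_A_small:
 assumes s: "diverges s" and e: "d > 0"
 shows "EVN k. exp (- d * A (s k)) < 1 / 4" "EVN k. exp (d * A (s k)) > 2"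
proof -
 have "diverges (\<lambda>k. A (s k))" by (rule filterlim_compose[OF A_at_top s])
 hence ev: "EVN k. A (s k) \<ge> 4 / d" by (simp add: filterlim_at_top)
 have big: "exp (d * A (s k)) > 4" if "A (s k) \<ge> 4 / d" for k
 proof -
  have "d * A (s k) \<ge> 4" using that e by (simp add: field_simps)
  thus ?thesis using exp_ge_add_one_self[of "d * A (s k)"] by linarith
 qed
 show "EVN k. exp (d * A (s k)) > 2" using ev by eventually_elim (use big in force)
 show "EVN k. exp (- d * A (s k)) < 1 / 4" using ev
 proof eventually_elim
  case (elim k)
  show ?case using big[OF elim] by (simp add: exp_minus inverse_eq_divide divide_less_eq)
 qed
qed

text \<open>Open and pairwise disjoint for \<open>i < 3\<close>: the set that \<open>f\<close>
  finally enters on the middle ray of the first gap reveals the type of the limit.\<close>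

definition limit_value :: "nat \<Rightarrow> complex set" where
 "limit_value i = (if i = 0 then ball 0 (1/4) else if i = 1 then ball 1 (1/4) else {z. norm z > 2})"

lemma limit_values_disjoint: "z \<in> limit_value i \<Longrightarrow> z \<in> limit_value j \<Longrightarrow> i < 3 \<Longrightarrow> j < 3 \<Longrightarrow> i = j"
 using norm_triangle_ineq2[of 1 z] norm_triangle_ineq2[of z 1]
 by (cases "i = 0"; cases "i = 1"; cases "j = 0"; cases "j = 1") (simp_all add: limit_value_def dist_norm norm_minus_commute[of z 1])

lemma eventually_limit_value:
 assumes s: "diverges s" and E: "S1.lim s E" and H: "S0.lim s H" and i: "lim_type i E H"
 shows "EVN k. f (pt (s k) w1) \<in> limit_value i"
proof -
 have g: "gap_arc w1 w1" using omega by (simp add: gap_arc_def)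
 consider "i = 0" | "i = 1" | "i \<noteq> 0" "i \<noteq> 1" by blast
 thus ?thesis
 proof cases
  case 1
  then obtain d where e: "d > 0" "EVN k. lo w1 w1 (- d) (s k)"
   using small_arc[where H = H, OF s E _ g] i by (auto simp: lim_type_def)
  show ?thesis using e(2) exp_A_small(1)[OF s e(1)] by eventually_elim (simp add: limit_value_def 1)
 next
  case 2
  then obtain d where e: "d > 0" "EVN k. lo1 w1 w1 (- d) (s k)"
   using near1_arc[where E = E, OF s H _ g] i by (auto simp: lim_type_def)
  show ?thesis using e(2) exp_A_small(1)[OF s e(1)]
   by eventually_elim (simp add: limit_value_def 2 dist_norm norm_minus_commute)
 next
  case 3
  then obtain d where e: "d > 0" "EVN k. hi w1 w1 d (s k)"
   using large_arc[where H = H, OF s E _ g] i by (auto simp: lim_type_def)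
  show ?thesis using e(2) exp_A_small(2)[OF s e(1)] by eventually_elim (use 3 in \<open>simp add: limit_value_def\<close>)
 qed
qed

text \<open>Since \<open>f\<close> is continuous along the ray of direction \<open>w1\<close>, all limits are of the same type.\<close>

lemma fixed_type:
 obtains i where "\<And>s. diverges s \<Longrightarrow>
  \<exists>r E H. strict_mono r \<and> S1.lim (s \<circ> r) E \<and> S0.lim (s \<circ> r) H \<and> diverges (s \<circ> r) \<and> lim_type i E H"
proof -
 define h where "h = (\<lambda>s. f (pt s w1))"
 have op: "open (limit_value i)" for i
  unfolding limit_value_def by (auto intro!: open_Collect_less continuous_intros)
 \<comment> \<open>The tolerance is a dummy here; only the passage from subsequences to all large
   \<open>s\<close> is wanted.\<close>
 have "\<exists>e::real>0. EV s. \<exists>i<3. h s \<in> limit_value i"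
 proof (rule eventually_by_subsequences[where P = "\<lambda>_ s. \<exists>i<3. h s \<in> limit_value i"])
  fix s :: "nat \<Rightarrow> real" assume s: "diverges s"
  obtain r E H i where r: "strict_mono r" "S1.lim (s \<circ> r) E" "S0.lim (s \<circ> r) H" "diverges (s \<circ> r)"
   "i < 3" "lim_type i E H" using typed_limits_exist[OF s] by blast
  from eventually_limit_value[OF r(4,2,3,6)] have "EVN k. \<exists>i<3. h (s (r k)) \<in> limit_value i"
   by eventually_elim (use r(5) in \<open>auto simp: h_def\<close>)
  thus "\<exists>r. strict_mono r \<and> (\<exists>e::real>0. EVN k. \<exists>i<3. h (s (r k)) \<in> limit_value i)"
   using r(1) zero_less_one by blast
 qed
 then obtain s0 where s0: "\<And>s. s \<ge> s0 \<Longrightarrow> \<exists>i<3. h s \<in> limit_value i" by (auto simp: ev_top)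
 have "continuous_on {s0..} h" unfolding h_def
  by (rule continuous_on_compose2[OF holomorphic_on_imp_continuous_on[OF f_holomorphic[of UNIV]]])
    (auto simp: Complex_eq intro!: continuous_intros)
 hence conn: "connected (h ` {s0..})" by (intro connected_continuous_image) auto
 obtain i where i: "i < 3" "h s0 \<in> limit_value i" using s0 by blast
 let ?V = "\<Union>j\<in>{..<3} - {i}. limit_value j"
 have "limit_value i \<inter> h ` {s0..} = {} \<or> ?V \<inter> h ` {s0..} = {}"
 proof (rule connectedD[OF conn op])
  show "open ?V" using op by blast
  show "limit_value i \<inter> ?V \<inter> h ` {s0..} = {}" using limit_values_disjoint[OF _ _ i(1)] by blast
  show "h ` {s0..} \<subseteq> limit_value i \<union> ?V" using s0 by fastforce
 qed
 hence V: "h s \<notin> ?V" if "s \<ge> s0" for s using i(2) that by fastforce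
 have hV: "h s \<in> limit_value i" if "s \<ge> s0" for s using s0[OF that] V[OF that] by blast
 show thesis
 proof (rule that[of i])
  fix s :: "nat \<Rightarrow> real" assume s: "diverges s"
  obtain r E H j where r: "strict_mono r" "S1.lim (s \<circ> r) E" "S0.lim (s \<circ> r) H" "diverges (s \<circ> r)"
   "j < 3" "lim_type j E H" using typed_limits_exist[OF s] by blast
  have "EVN k. (s \<circ> r) k \<ge> s0" using r(4) by (simp add: filterlim_at_top)
  with eventually_limit_value[OF r(4,2,3,6)] have "EVN k. i = j"
   by eventually_elim (use hV limit_values_disjoint[OF _ _ i(1) r(5)] in \<open>auto simp: h_def\<close>)
  hence "i = j" by simp
  thus "\<exists>r E H. strict_mono r \<and> S1.lim (s \<circ> r) E \<and> S0.lim (s \<circ> r) H \<and> diverges (s \<circ> r) \<and> lim_type i E H"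
   using r by blast
 qed
qed

lemma exp_A_mono: "e' \<le> e \<Longrightarrow> exp (e' * A s) \<le> exp (e * A s)"
 using S1.A_pos[of s] by (simp add: mult_right_mono)

lemma eventually_by_limits:
 assumes Q: "\<And>s. diverges s \<Longrightarrow>
   \<exists>r E H. strict_mono r \<and> S1.lim (s \<circ> r) E \<and> S0.lim (s \<circ> r) H \<and> diverges (s \<circ> r) \<and> Q E H"
  and P: "\<And>s E H. diverges s \<Longrightarrow> S1.lim s E \<Longrightarrow> S0.lim s H \<Longrightarrow> Q E H \<Longrightarrow>
   \<exists>e>0. EVN k. P e (s k)"
  and mono: "\<And>e e' s. e' \<le> e \<Longrightarrow> P e s \<Longrightarrow> P e' s"
 shows "\<exists>e::real>0. EV s. P e s"
proof (rule eventually_by_subsequences[where P = P])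
 fix s :: "nat \<Rightarrow> real" assume s: "diverges s"
 obtain r E H where r: "strict_mono r" "S1.lim (s \<circ> r) E" "S0.lim (s \<circ> r) H" "diverges (s \<circ> r)" "Q E H"
  using Q[OF s] by blast
 from P[OF r(4,2,3,5), unfolded o_def] r(1) show "\<exists>r. strict_mono r \<and> (\<exists>e>0. EVN k. P e (s (r k)))" by blast
qed (rule mono)

text \<open>With the type of the limits fixed, every arc estimate holds along a subsequence of each
  sequence, with a tolerance that may depend on it; \<open>eventually_by_limits\<close> makes it
  hold for all large \<open>s\<close> with one tolerance.\<close>

theorem regime: "Large \<or> Small \<or> Near1"
proof -
 obtain i where i: "\<And>s. diverges s \<Longrightarrow>
  \<exists>r E H. strict_mono r \<and> S1.lim (s \<circ> r) E \<and> S0.lim (s \<circ> r) H \<and> diverges (s \<circ> r) \<and> lim_type i E H"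
  using fixed_type by blast
 have le: "x \<le> exp (- e * A s) \<Longrightarrow> x \<le> exp (- e' * A s)" if "e' \<le> e" for x e e' s
  using exp_A_mono[of "- e" "- e'" s] that by linarith
 consider "i = 0" | "i = 1" | "i \<noteq> 0" "i \<noteq> 1" by blast
 thus ?thesis
 proof cases
  case 1
  have ty: "lim_type i = lim_small" by (simp add: lim_type_def 1)
  have "\<exists>e>0. EV s. lo a b (- e) s" if ab: "gap_arc a b" for a b
  proof (rule eventually_by_limits[OF i])
   show "\<exists>e>0. EVN k. lo a b (- e) (s k)" if "diverges s" "S1.lim s E" "lim_type i E H" for s E H
    by (rule small_arc[OF that(1,2) that(3)[unfolded ty] ab])
   show "lo a b (- e') s" if "e' \<le> e" "lo a b (- e) s" for e e' s using le[OF that(1)] that(2) by blast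
  qed
  moreover have "EV s. lo1 a b d s" if ab: "b1 - 2 * pi < a" "b < a1" "d > 0" for a b d
  proof -
   have "\<exists>e::real>0. EV s. lo1 a b d s"
   proof (rule eventually_by_limits[OF i, where P = "\<lambda>_ s. lo1 a b d s"])
    fix s E H assume a: "diverges s" "S0.lim s H" "lim_type i E H"
    have "norm (H (Complex 0 t)) \<le> exp 0" if "t \<in> {a..b}" for t
     using a(3) that ab by (auto simp: lim_small_def ty)
    from arc_f0_le[OF a(1,2) ab(1,2) this ab(3)]
    show "\<exists>e::real>0. EVN k. lo1 a b d (s k)" using zero_less_one by blast
   qed
   thus ?thesis by blast
  qed
  ultimately show ?thesis by (simp add: Small_def)
 next
  case 2
  have ty: "lim_type i = lim_near1" by (simp add: lim_type_def 2)
  have "\<exists>e>0. EV s. lo1 a b (- e) s" if ab: "gap_arc a b" for a b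
  proof (rule eventually_by_limits[OF i])
   show "\<exists>e>0. EVN k. lo1 a b (- e) (s k)" if "diverges s" "S0.lim s H" "lim_type i E H" for s E H
    by (rule near1_arc[OF that(1,2) that(3)[unfolded ty] ab])
   show "lo1 a b (- e') s" if "e' \<le> e" "lo1 a b (- e) s" for e e' s using le[OF that(1)] that(2) by blast
  qed
  moreover have "EV s. lo a b d s" if ab: "b0 < a" "b < a0 + 2 * pi" "d > 0" for a b d
  proof -
   have "\<exists>e::real>0. EV s. lo a b d s"
   proof (rule eventually_by_limits[OF i, where P = "\<lambda>_ s. lo a b d s"])
    fix s E H assume a: "diverges s" "S1.lim s E" "lim_type i E H"
    have "norm (E (Complex 0 t)) \<le> exp 0" if "t \<in> {a..b}" for t
     using a(3) that ab by (auto simp: lim_near1_def ty)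
    from arc_f_le[OF a(1,2) ab(1,2) this ab(3)]
    show "\<exists>e::real>0. EVN k. lo a b d (s k)" using zero_less_one by blast
   qed
   thus ?thesis by blast
  qed
  ultimately show ?thesis by (simp add: Near1_def)
 next
  case 3
  have ty: "lim_type i = lim_large" using 3 by (simp add: lim_type_def)
  have "\<exists>e>0. EV s. hi a b e s" if ab: "gap_arc a b" for a b
  proof (rule eventually_by_limits[OF i])
   show "\<exists>e>0. EVN k. hi a b e (s k)" if "diverges s" "S1.lim s E" "lim_type i E H" for s E H
    by (rule large_arc[OF that(1,2) that(3)[unfolded ty] ab])
   show "hi a b e' s" if "e' \<le> e" "hi a b e s" for e e' s using exp_A_mono[OF that(1), of s] that(2) order_trans by blast
  qed
  thus ?thesis by (auto simp: Large_def)
 qed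
qed

end

section \<open>A periodic Cauchy kernel\<close>

lemma contour_integral_horizontal:
 assumes "a < b"
 shows "contour_integral (linepath (Complex a y) (Complex b y)) g = integral {a..b} (\<lambda>t. g (Complex t y))"
proof -
 have l: "linepath (Complex a y) (Complex b y) x = linepath (of_real a) (of_real b) x + \<i> * of_real y" for x
  by (simp add: linepath_def complex_eq_iff algebra_simps)
 have d: "Complex b y - Complex a y = of_real b - of_real a" by (simp add: complex_eq_iff)
 have "contour_integral (linepath (Complex a y) (Complex b y)) g
   = contour_integral (linepath (of_real a) (of_real b)) (\<lambda>z. g (z + \<i> * of_real y))"
  unfolding contour_integral_integral vector_derivative_linepath_at l d ..
 also have "\<dots> = integral {a..b} (\<lambda>t. g (of_real t + \<i> * of_real y))"
  using contour_integral_linepath_Reals_eq[of "of_real a" "of_real b" "\<lambda>z. g (z + \<i> * of_real y)"] assms by simp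
 also have "(\<lambda>t. g (of_real t + \<i> * of_real y)) = (\<lambda>t. g (Complex t y))" by (simp add: Complex_eq)
 finally show ?thesis .
qed

lemma contour_integral_rectpath:
 fixes g :: "complex \<Rightarrow> complex"
 assumes cont: "continuous_on S g" and S: "cbox (Complex a c) (Complex b d) - box (Complex a c) (Complex b d) \<subseteq> S"
  and ab: "a < b" "c < d"
 shows "contour_integral (rectpath (Complex a c) (Complex b d)) g =
   integral {a..b} (\<lambda>t. g (Complex t c)) - integral {a..b} (\<lambda>t. g (Complex t d))
   + contour_integral (linepath (Complex b c) (Complex b d)) g - contour_integral (linepath (Complex a c) (Complex a d)) g"
proof -
 have i: "g contour_integrable_on linepath x y" if "closed_segment x y \<subseteq> cbox (Complex a c) (Complex b d) - box (Complex a c) (Complex b d)" for x y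
  by (rule contour_integrable_continuous_linepath[OF continuous_on_subset[OF cont]]) (use that S in blast)
 have pi: "path_image (rectpath (Complex a c) (Complex b d)) = cbox (Complex a c) (Complex b d) - box (Complex a c) (Complex b d)"
  using ab by (intro path_image_rectpath_cbox_minus_box) auto
 have segs: "closed_segment (Complex a c) (Complex b c) \<subseteq> path_image (rectpath (Complex a c) (Complex b d))"
  "closed_segment (Complex b c) (Complex b d) \<subseteq> path_image (rectpath (Complex a c) (Complex b d))"
  "closed_segment (Complex b d) (Complex a d) \<subseteq> path_image (rectpath (Complex a c) (Complex b d))"
  "closed_segment (Complex a d) (Complex a c) \<subseteq> path_image (rectpath (Complex a c) (Complex b d))"
  by (auto simp: rectpath_def Let_def path_image_join)
 note I = segs[unfolded pi, THEN i]
 have r1: "contour_integral (linepath (Complex b d) (Complex a d)) g = - contour_integral (linepath (Complex a d) (Complex b d)) g"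
  using contour_integral_reversepath[of "linepath (Complex a d) (Complex b d)" g] by simp
 have r2: "contour_integral (linepath (Complex a d) (Complex a c)) g = - contour_integral (linepath (Complex a c) (Complex a d)) g"
  using contour_integral_reversepath[of "linepath (Complex a c) (Complex a d)" g] by simp
 show ?thesis
  unfolding rectpath_def Let_def
  using I by (simp add: contour_integral_join contour_integrable_join r1 r2 contour_integral_horizontal[OF ab(1)])
qed

lemma exp_neq_one:
 assumes "\<bar>Im w\<bar> < 2 * pi" "w \<noteq> 0"
 shows "exp (w::complex) \<noteq> 1"
proof
 assume "exp w = 1"
 then obtain n :: int where n: "Re w = 0" "Im w = of_int (2 * n) * pi" by (auto simp: exp_eq_1)
 hence "\<bar>of_int (2 * n) * pi\<bar> < 2 * pi" using assms by simp
 hence "\<bar>of_int n :: real\<bar> < 1" by (simp add: abs_mult)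
 hence "n = 0" by linarith
 thus False using n assms by (simp add: complex_eq_iff)
qed

lemma exp_minus_one_quotient_holomorphic:
 defines "q \<equiv> \<lambda>w::complex. if w = 0 then 1 else w / (exp w - 1)"
 shows "q holomorphic_on {w. \<bar>Im w\<bar> < 2 * pi}"
proof -
 let ?S = "{w::complex. \<bar>Im w\<bar> < 2 * pi}"
 have eq: "?S = {w. Im w < 2 * pi} \<inter> {w. - (2 * pi) < Im w}" by auto
 have oS: "open ?S" unfolding eq by (intro open_Int open_halfspace_Im_lt open_halfspace_Im_gt)
 have nz: "exp w \<noteq> 1" if "w \<in> ?S - {0}" for w using that by (intro exp_neq_one) auto
 have hol: "q holomorphic_on ?S - {0}"
 proof -
  have "(\<lambda>w. w / (exp w - 1)) holomorphic_on ?S - {0}" by (intro holomorphic_intros) (use nz in auto)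
  thus ?thesis by (rule holomorphic_transform) (auto simp: q_def)
 qed
 have lim: "(q \<longlongrightarrow> q 0) (at 0)"
 proof -
  have "((\<lambda>w::complex. (exp w - 1) / w) \<longlongrightarrow> 1) (at 0)"
   using DERIV_exp[of "0::complex"] by (simp add: has_field_derivative_iff)
  hence "((\<lambda>w::complex. inverse ((exp w - 1) / w)) \<longlongrightarrow> inverse 1) (at 0)" by (rule tendsto_inverse) simp
  hence "((\<lambda>w::complex. w / (exp w - 1)) \<longlongrightarrow> 1) (at 0)" by simp
  moreover have "\<forall>\<^sub>F w in at 0. w / (exp w - 1) = q w" by (auto simp: q_def eventually_at_filter)
  ultimately show ?thesis by (simp add: tendsto_cong q_def)
 qed
 have "continuous_on ?S q"
 proof (rule continuous_at_imp_continuous_on, rule ballI)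
  fix w assume w: "w \<in> ?S"
  show "isCont q w"
  proof (cases "w = 0")
   case True
   thus ?thesis using lim by (simp add: isCont_def)
  next
   case False
   have "open (?S - {0})" using oS by (rule open_delete)
   hence "continuous_on (?S - {0}) q \<Longrightarrow> isCont q w" using w False continuous_on_eq_continuous_at by blast
   thus ?thesis using hol holomorphic_on_imp_continuous_on by blast
  qed
 qed
 thus ?thesis by (rule no_isolated_singularity[of _ _ "{0}"]) (use hol oS in auto)
qed

text \<open>The kernel is \<open>q (u - z) / (u - z)\<close> with
  \<open>q w = w / (exp w - 1)\<close> and \<open>q 0 = 1\<close>. Since the height is below
  \<open>2 * pi\<close>, \<open>q (u - z)\<close> is holomorphic near the rectangle, and Cauchy's
  formula applies.\<close>

lemma rect_kernel_integral:
 assumes hol: "P holomorphic_on U" and U: "convex U" "open U" and sub: "cbox (Complex a c) (Complex b d) \<subseteq> U"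
  and z: "a < Re z" "Re z < b" "c < Im z" "Im z < d" and cd: "d - c < 2 * pi"
 shows "contour_integral (rectpath (Complex a c) (Complex b d)) (\<lambda>u. P u * (1 / (exp (u - z) - 1))) = 2 * pi * \<i> * P z"
proof -
 define q where "q = (\<lambda>w::complex. if w = 0 then 1 else w / (exp w - 1))"
 define V where "V = U \<inter> {u. Im u < Im z + 2 * pi} \<inter> {u. Im z - 2 * pi < Im u}"
 have V: "convex V" "open V" unfolding V_def
  by (intro convex_Int U convex_halfspace_Im_lt convex_halfspace_Im_gt open_Int open_halfspace_Im_lt open_halfspace_Im_gt)+
 have hq: "q holomorphic_on {w. \<bar>Im w\<bar> < 2 * pi}" unfolding q_def by (rule exp_minus_one_quotient_holomorphic)
 have hq: "(\<lambda>u. q (u - z)) holomorphic_on V"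
  by (rule hol_compose[OF _ hq])
    (auto simp: V_def abs_less_iff intro!: holomorphic_intros)
 have hV: "(\<lambda>u. P u * q (u - z)) holomorphic_on V"
  by (intro holomorphic_on_mult hq holomorphic_on_subset[OF hol]) (auto simp: V_def)
 have boxV: "cbox (Complex a c) (Complex b d) \<subseteq> V"
  using sub z cd by (auto simp: V_def in_cbox_complex_iff)
 let ?g = "rectpath (Complex a c) (Complex b d)"
 have zb: "z \<in> box (Complex a c) (Complex b d)" using z by (simp add: in_box_complex_iff)
 have pi: "path_image ?g = cbox (Complex a c) (Complex b d) - box (Complex a c) (Complex b d)"
  using z by (intro path_image_rectpath_cbox_minus_box) auto
 have "((\<lambda>u. P u * q (u - z) / (u - z)) has_contour_integral (2 * pi * \<i> * winding_number ?g z * (P z * q (z - z)))) ?g"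
 proof (rule Cauchy_integral_formula_convex_simple[OF V(1) hV])
  show "z \<in> interior V" using zb boxV V(2) box_subset_cbox by (metis interior_open subsetD)
  show "path_image ?g \<subseteq> V - {z}" using pi boxV zb by auto
 qed auto
 hence "((\<lambda>u. P u * q (u - z) / (u - z)) has_contour_integral (2 * pi * \<i> * P z)) ?g"
  using winding_number_rectpath[OF zb] by (simp add: q_def)
 hence "((\<lambda>u. P u * (1 / (exp (u - z) - 1))) has_contour_integral (2 * pi * \<i> * P z)) ?g"
  by (rule has_contour_integral_eq) (use pi zb in \<open>auto simp: q_def\<close>)
 thus ?thesis by (rule contour_integral_unique)
qed

lemma rect_integral_zero:
 assumes hol: "g holomorphic_on U" and U: "open U" "cbox (Complex a c) (Complex b d) \<subseteq> U" and ab: "a \<le> b" "c \<le> d"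
 shows "contour_integral (rectpath (Complex a c) (Complex b d)) g = 0"
proof -
 have "(g has_contour_integral 0) (rectpath (Complex a c) (Complex b d))"
  by (rule Cauchy_theorem_convex_simple[of g "cbox (Complex a c) (Complex b d)"])
    (use hol U ab path_image_rectpath_subset_cbox[of "Complex a c" "Complex b d"] in \<open>auto intro: holomorphic_on_subset\<close>)
 thus ?thesis by (rule contour_integral_unique)
qed

lemma kernel_zero:
 assumes hol: "P holomorphic_on U" and U: "open U" and ab: "a \<le> b" "c \<le> d"
  and sub: "\<And>u. u \<in> cbox (Complex a c) (Complex b d) \<Longrightarrow> u \<in> U \<and> \<bar>Im (u - z)\<bar> < 2 * pi \<and> Im u \<noteq> Im z"
 shows "contour_integral (rectpath (Complex a c) (Complex b d)) (\<lambda>u. P u * (1 / (exp (u - z) - 1))) = 0"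
proof (rule rect_integral_zero[of _ "U \<inter> {u. exp (u - z) \<noteq> 1}"])
 show "(\<lambda>u. P u * (1 / (exp (u - z) - 1))) holomorphic_on U \<inter> {u. exp (u - z) \<noteq> 1}"
  by (intro holomorphic_intros holomorphic_on_subset[OF hol]) auto
 show "open (U \<inter> {u. exp (u - z) \<noteq> 1})" by (intro open_Int U open_Collect_neq continuous_intros)
 show "cbox (Complex a c) (Complex b d) \<subseteq> U \<inter> {u. exp (u - z) \<noteq> 1}" using sub exp_neq_one by fastforce
qed (use ab in auto)

text \<open>With \<open>r = exp (Re w)\<close> the squared norm is at least
  \<open>(r - cos d)\<^sup>2 + (sin d)\<^sup>2\<close>. The bound is uniform in \<open>r\<close>, so
  the kernel stays bounded along whole horizontal lines that keep away from its poles.\<close>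

lemma norm_exp_minus_one_ge_sin:
 assumes "cos (Im w) \<le> cos d" "0 < d" "d < pi"
 shows "norm (exp w - 1) \<ge> sin d"
proof -
 let ?r = "exp (Re w)"
 have "(norm (exp w - 1))\<^sup>2 = ?r\<^sup>2 - 2 * ?r * cos (Im w) + 1"
 proof -
  have "(norm (exp w - 1))\<^sup>2 = (?r * cos (Im w) - 1)\<^sup>2 + (?r * sin (Im w))\<^sup>2"
   unfolding cmod_power2 by (simp add: Re_exp Im_exp)
  also have "\<dots> = ?r\<^sup>2 * ((sin (Im w))\<^sup>2 + (cos (Im w))\<^sup>2) - 2 * ?r * cos (Im w) + 1"
   by algebra
  finally show ?thesis by (simp only: sin_cos_squared_add mult_1_right)
 qed
 also have "\<dots> \<ge> ?r\<^sup>2 - 2 * ?r * cos d + 1" using assms(1) by simp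
 also have "?r\<^sup>2 - 2 * ?r * cos d + 1 = (?r - cos d)\<^sup>2 + (sin d)\<^sup>2"
  using sin_cos_squared_add[of d] by (simp add: power2_eq_square algebra_simps)
 finally have "(sin d)\<^sup>2 \<le> (norm (exp w - 1))\<^sup>2" using zero_le_power2[of "?r - cos d"] by linarith
 thus ?thesis by (rule power2_le_imp_le) simp
qed

lemma inverse_minus_one_expansion:
 fixes y :: complex
 assumes y: "norm y \<ge> 2"
 shows "norm (1 / (y - 1) - (\<Sum>i=1..K. (1 / y) ^ i)) \<le> 2 / norm y ^ Suc K"
proof -
 have nz: "y \<noteq> 0" "y \<noteq> 1" using y by auto
 have "1 / (y - 1) - (\<Sum>i=1..K. (1 / y) ^ i) = (1 / y) ^ K / (y - 1)"
 proof (induction K)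
  case (Suc K)
  have "1 / (y - 1) - (\<Sum>i=1..Suc K. (1 / y) ^ i) = (1 / y) ^ K / (y - 1) - (1 / y) ^ Suc K"
   using Suc by (simp add: algebra_simps)
  also have "\<dots> = (1 / y) ^ Suc K / (y - 1)" using nz by (simp add: divide_simps)
  finally show ?case .
 qed simp
 moreover have "norm ((1 / y) ^ K / (y - 1)) \<le> 2 / norm y ^ Suc K"
 proof -
  have "norm y / 2 \<le> norm (y - 1)" using norm_triangle_ineq2[of y 1] y by simp
  hence "norm ((1 / y) ^ K / (y - 1)) \<le> (1 / norm y ^ K) / (norm y / 2)"
   unfolding norm_divide norm_power using y by (intro divide_mono) (auto simp: power_one_over)
  thus ?thesis by (simp add: field_simps)
 qed
 ultimately show ?thesis by simp
qed

lemma exp_decay_integral_bound: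
 fixes g :: "real \<Rightarrow> complex"
 assumes cont: "continuous_on {a..b} g" and ab: "a \<le> b" and le: "\<And>t. a \<le> t \<Longrightarrow> t \<le> b \<Longrightarrow> norm (g t) \<le> M * exp (- t)"
 shows "norm (integral {a..b} g) \<le> M * exp (- a)"
proof -
 have "0 \<le> M * exp (- a)" using le[of a] ab norm_ge_zero[of "g a"] by linarith
 hence M: "M \<ge> 0" by (simp add: zero_le_mult_iff)
 have i: "((\<lambda>t. M * exp (- t)) has_integral (- M * exp (- b) - (- M * exp (- a)))) {a..b}"
  by (rule fundamental_theorem_of_calculus[OF ab])
    (auto intro!: derivative_eq_intros simp: has_real_derivative_iff_has_vector_derivative[symmetric])
 have "norm (integral {a..b} g) \<le> integral {a..b} (\<lambda>t. M * exp (- t))"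
  by (rule integral_norm_bound_integral[OF integrable_continuous_real[OF cont] has_integral_integrable[OF i]]) (use le in auto)
 also have "\<dots> = M * exp (- a) - M * exp (- b)" using integral_unique[OF i] by simp
 also have "\<dots> \<le> M * exp (- a)" using M by simp
 finally show ?thesis .
qed

lemma exp_decay_integral_convergent:
 fixes g :: "real \<Rightarrow> complex"
 assumes cont: "continuous_on {a..} g" and le: "\<And>t. a \<le> t \<Longrightarrow> norm (g t) \<le> M * exp (- t)"
 shows "convergent (\<lambda>n. integral {a..a + real n} g)"
proof (rule Cauchy_convergent, rule metric_CauchyI)
 fix e :: real assume e: "e > 0"
 have "(\<lambda>n. M * exp (- (a + real n))) \<longlonglongrightarrow> 0" by real_asymp
 hence "EVN n. M * exp (- (a + real n)) < e" using e by (rule order_tendstoD)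
 then obtain N where N: "\<And>n. n \<ge> N \<Longrightarrow> M * exp (- (a + real n)) < e" by (auto simp: eventually_sequentially)
 have main: "dist (integral {a..a + real m} g) (integral {a..a + real n} g) < e" if "N \<le> n" "n \<le> m" for m n
 proof -
  have c: "continuous_on {x..y} g" if "a \<le> x" for x y using cont by (rule continuous_on_subset) (use that in auto)
  have "integral {a..a + real n} g + integral {a + real n..a + real m} g = integral {a..a + real m} g"
   by (rule Henstock_Kurzweil_Integration.integral_combine)
     (use that integrable_continuous_real[OF c[of a]] in auto)
  hence "dist (integral {a..a + real m} g) (integral {a..a + real n} g) = norm (integral {a + real n..a + real m} g)"
   by (metis add_diff_cancel_left' dist_norm)
  also have "\<dots> \<le> M * exp (- (a + real n))"
   by (rule exp_decay_integral_bound[OF c]) (use that le in auto)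
  finally show ?thesis using N[OF that(1)] by simp
 qed
 show "\<exists>N. \<forall>m\<ge>N. \<forall>n\<ge>N. dist (integral {a..a + real m} g) (integral {a..a + real n} g) < e"
  by (intro exI[of _ N]) (metis dist_commute linear main)
qed

text \<open>\<open>V1\<close> and \<open>V0\<close> will be the logarithmic derivatives of
  \<open>f\<close> and \<open>f - 1\<close> in the logarithmic coordinate. The half-strips over
  \<open>[k1, k2]\<close> and \<open>[k2 - 2 * pi, k1]\<close> make up one period; across the lines
  where they meet, up to the period, the two functions differ by an exponentially small
  jump.\<close>

locale split_pair =
 fixes V1 V0 :: "complex \<Rightarrow> complex" and k1 k2 s0 :: real and K :: nat and U1 U0 :: "complex set"
 assumes heights: "k1 < k2" "k2 < k1 + 2 * pi" and s0: "s0 \<ge> 0"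
  and U1: "convex U1" "open U1" "{w. s0 \<le> Re w \<and> k1 \<le> Im w \<and> Im w \<le> k2} \<subseteq> U1" "V1 holomorphic_on U1"
  and U0: "convex U0" "open U0" "{w. s0 \<le> Re w \<and> k2 - 2 * pi \<le> Im w \<and> Im w \<le> k1} \<subseteq> U0" "V0 holomorphic_on U0"
  and V1_le: "\<And>w. s0 \<le> Re w \<Longrightarrow> k1 \<le> Im w \<Longrightarrow> Im w \<le> k2 \<Longrightarrow> norm (V1 w) \<le> exp (real K * Re w)"
  and V0_le: "\<And>w. s0 \<le> Re w \<Longrightarrow> k2 - 2 * pi \<le> Im w \<Longrightarrow> Im w \<le> k1 \<Longrightarrow> norm (V0 w) \<le> exp (real K * Re w)"
  and jump1: "\<And>t. s0 \<le> t \<Longrightarrow> norm (V1 (Complex t k1) - V0 (Complex t k1)) \<le> exp (- t)"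
  and jump2: "\<And>t. s0 \<le> t \<Longrightarrow> norm (V1 (Complex t k2) - V0 (Complex t (k2 - 2 * pi))) \<le> exp (- t)"
begin

definition edge :: "real \<Rightarrow> (complex \<Rightarrow> complex) \<Rightarrow> complex" where
 "edge x h = contour_integral (linepath (Complex x k1) (Complex x k2)) (\<lambda>w. V1 w * h w)
      + contour_integral (linepath (Complex x (k2 - 2 * pi)) (Complex x k1)) (\<lambda>w. V0 w * h w)"

definition jumps :: "real \<Rightarrow> (complex \<Rightarrow> complex) \<Rightarrow> complex" where
 "jumps x h = integral {s0..x} (\<lambda>t. (V1 (Complex t k1) - V0 (Complex t k1)) * h (Complex t k1))
       - integral {s0..x} (\<lambda>t. (V1 (Complex t k2) - V0 (Complex t (k2 - 2 * pi))) * h (Complex t k2))"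

definition boundaries :: "real \<Rightarrow> (complex \<Rightarrow> complex) \<Rightarrow> complex" where
 "boundaries x h = contour_integral (rectpath (Complex s0 k1) (Complex x k2)) (\<lambda>w. V1 w * h w)
         + contour_integral (rectpath (Complex s0 (k2 - 2 * pi)) (Complex x k1)) (\<lambda>w. V0 w * h w)"

text \<open>Contains the boundaries of both rectangles and is the only set on which a kernel has to
  be continuous; its pole lies inside one of them.\<close>

definition rims :: "real \<Rightarrow> complex set" where
 "rims x = {w. s0 \<le> Re w \<and> Re w \<le> x \<and> k2 - 2 * pi \<le> Im w \<and> Im w \<le> k2 \<and>
   (Re w = s0 \<or> Re w = x \<or> Im w = k1 \<or> Im w = k2 \<or> Im w = k2 - 2 * pi)}"

lemma continuous_sides:
 shows "continuous_on {w. s0 \<le> Re w \<and> k1 \<le> Im w \<and> Im w \<le> k2} V1"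
  and "continuous_on {w. s0 \<le> Re w \<and> k2 - 2 * pi \<le> Im w \<and> Im w \<le> k1} V0"
 using U1(3,4) U0(3,4) by (auto intro: holomorphic_on_imp_continuous_on holomorphic_on_subset)

lemma continuous_horizontal:
 shows "k1 \<le> y \<Longrightarrow> y \<le> k2 \<Longrightarrow> continuous_on {s0..} (\<lambda>t. V1 (Complex t y))"
  and "k2 - 2 * pi \<le> y \<Longrightarrow> y \<le> k1 \<Longrightarrow> continuous_on {s0..} (\<lambda>t. V0 (Complex t y))"
proof -
 have c: "continuous_on A (\<lambda>t. Complex t y)" for A unfolding Complex_eq by (intro continuous_intros)
 show "k1 \<le> y \<Longrightarrow> y \<le> k2 \<Longrightarrow> continuous_on {s0..} (\<lambda>t. V1 (Complex t y))"
  by (rule continuous_on_compose2[OF continuous_sides(1) c]) auto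
 show "k2 - 2 * pi \<le> y \<Longrightarrow> y \<le> k1 \<Longrightarrow> continuous_on {s0..} (\<lambda>t. V0 (Complex t y))"
  by (rule continuous_on_compose2[OF continuous_sides(2) c]) auto
qed

text \<open>The horizontal sides of the two rectangles match at height \<open>k1\<close> and, by
  periodicity of \<open>h\<close>, at \<open>k2\<close> and \<open>k2 - 2 * pi\<close>. They are
  traversed in opposite directions, so they leave only the jumps, and the vertical edges
  remain.\<close>

lemma boundaries_eq:
 assumes h: "continuous_on (rims x) h" and per: "\<And>t. h (Complex t (k2 - 2 * pi)) = h (Complex t k2)" and x: "s0 < x"
 shows "boundaries x h = jumps x h + edge x h - edge s0 h"
proof -
 let ?r1 = "cbox (Complex s0 k1) (Complex x k2) - box (Complex s0 k1) (Complex x k2)"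
 let ?r0 = "cbox (Complex s0 (k2 - 2*pi)) (Complex x k1) - box (Complex s0 (k2 - 2*pi)) (Complex x k1)"
 have r: "?r1 \<subseteq> rims x" "?r0 \<subseteq> rims x"
  using heights by (auto simp: rims_def in_cbox_complex_iff in_box_complex_iff)
 have c1: "continuous_on ?r1 (\<lambda>w. V1 w * h w)"
  by (intro continuous_on_mult continuous_on_subset[OF h r(1)] continuous_on_subset[OF continuous_sides(1)])
    (auto simp: in_cbox_complex_iff)
 have c0: "continuous_on ?r0 (\<lambda>w. V0 w * h w)"
  by (intro continuous_on_mult continuous_on_subset[OF h r(2)] continuous_on_subset[OF continuous_sides(2)])
    (auto simp: in_cbox_complex_iff)
 have cc: "continuous_on A (\<lambda>t. Complex t y)" for A y unfolding Complex_eq by (intro continuous_intros)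
 have hh: "continuous_on {s0..x} (\<lambda>t. h (Complex t y))" if "y \<in> {k1, k2, k2 - 2*pi}" for y
  by (rule continuous_on_compose2[OF h cc]) (use that heights in \<open>auto simp: rims_def\<close>)
 have i1: "(\<lambda>t. V1 (Complex t y) * h (Complex t y)) integrable_on {s0..x}" if "y \<in> {k1, k2}" for y
  by (intro integrable_continuous_real continuous_on_mult continuous_on_subset[OF continuous_horizontal(1)] hh)
    (use that heights in auto)
 have i0: "(\<lambda>t. V0 (Complex t y) * h (Complex t y)) integrable_on {s0..x}" if "y \<in> {k1, k2 - 2*pi}" for y
  by (intro integrable_continuous_real continuous_on_mult continuous_on_subset[OF continuous_horizontal(2)] hh)
    (use that heights in auto)
 have j1: "integral {s0..x} (\<lambda>t. (V1 (Complex t k1) - V0 (Complex t k1)) * h (Complex t k1))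
   = integral {s0..x} (\<lambda>t. V1 (Complex t k1) * h (Complex t k1)) - integral {s0..x} (\<lambda>t. V0 (Complex t k1) * h (Complex t k1))"
  unfolding left_diff_distrib by (rule Henstock_Kurzweil_Integration.integral_diff[OF i1 i0]) auto
 have j2: "integral {s0..x} (\<lambda>t. (V1 (Complex t k2) - V0 (Complex t (k2 - 2 * pi))) * h (Complex t k2))
   = integral {s0..x} (\<lambda>t. V1 (Complex t k2) * h (Complex t k2))
    - integral {s0..x} (\<lambda>t. V0 (Complex t (k2 - 2*pi)) * h (Complex t (k2 - 2*pi)))"
  unfolding left_diff_distrib per[symmetric]
  by (subst Henstock_Kurzweil_Integration.integral_diff[symmetric]) (use i1[of k2] i0[of "k2 - 2*pi"] per in simp_all)
 have l: "k2 - 2 * pi < k1" using heights by simp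
 show ?thesis
  unfolding boundaries_def jumps_def edge_def j1 j2 contour_integral_rectpath[OF c1 order_refl x heights(1)]
   contour_integral_rectpath[OF c0 order_refl x l] by (simp add: algebra_simps)
qed

lemma closed_segment_vertical:
 "a \<le> b \<Longrightarrow> closed_segment (Complex x a) (Complex x b) = {w. Re w = x \<and> a \<le> Im w \<and> Im w \<le> b}"
 using closed_segment_same_Re[of "Complex x a" "Complex x b"] by (auto simp: closed_segment_eq_real_ivl)

lemmas edge_segments = closed_segment_vertical[OF less_imp_le[OF heights(1)]]
 closed_segment_vertical[of "k2 - 2 * pi" k1, OF less_imp_le[OF heights(2)[folded diff_less_eq]]]

lemma edge_integrable:
 assumes h: "continuous_on {w. Re w = x} h" and x: "s0 \<le> x"
 shows "(\<lambda>w. V1 w * h w) contour_integrable_on linepath (Complex x k1) (Complex x k2)"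
  and "(\<lambda>w. V0 w * h w) contour_integrable_on linepath (Complex x (k2 - 2 * pi)) (Complex x k1)"
 using x by (intro contour_integrable_continuous_linepath continuous_on_mult continuous_on_subset[OF h]
  continuous_on_subset[OF continuous_sides(1)] continuous_on_subset[OF continuous_sides(2)]; auto simp: edge_segments)+

lemma edge_bound:
 assumes le: "\<And>w. Re w = x \<Longrightarrow> k2 - 2 * pi \<le> Im w \<Longrightarrow> Im w \<le> k2 \<Longrightarrow> norm (h w) \<le> M"
  and x: "s0 \<le> x" and h: "continuous_on {w. Re w = x} h" and M: "M \<ge> 0"
 shows "norm (edge x h) \<le> 2 * pi * exp (real K * x) * M"
proof -
 have n: "norm (Complex x b - Complex x a) = b - a" if "a \<le> b" for a b
  using that by (simp add: cmod_def)
 have l: "k2 - 2 * pi \<le> k1" using heights by simp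
 have b1: "norm (contour_integral (linepath (Complex x k1) (Complex x k2)) (\<lambda>w. V1 w * h w))
   \<le> exp (real K * x) * M * norm (Complex x k2 - Complex x k1)"
  by (rule contour_integral_bound_linepath[OF edge_integrable(1)[OF h x]])
   (use M V1_le le x heights in \<open>auto simp: edge_segments norm_mult intro!: mult_mono\<close>)
 have b0: "norm (contour_integral (linepath (Complex x (k2 - 2 * pi)) (Complex x k1)) (\<lambda>w. V0 w * h w))
   \<le> exp (real K * x) * M * norm (Complex x k1 - Complex x (k2 - 2 * pi))"
  by (rule contour_integral_bound_linepath[OF edge_integrable(2)[OF h x]])
   (use M V0_le le x heights in \<open>auto simp: edge_segments norm_mult intro!: mult_mono\<close>)
 have "norm (edge x h) \<le> exp (real K * x) * M * (k2 - k1) + exp (real K * x) * M * (k1 - (k2 - 2 * pi))"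
  unfolding edge_def
  by (rule order_trans[OF norm_triangle_ineq add_mono[OF b1[unfolded n[OF less_imp_le[OF heights(1)]]] b0[unfolded n[OF l]]]])
 also have "\<dots> = 2 * pi * exp (real K * x) * M" by (simp add: algebra_simps)
 finally show ?thesis .
qed

lemma jump_integrands:
 assumes h: "continuous_on {s0..x} (\<lambda>t. h (Complex t k1))" "continuous_on {s0..x} (\<lambda>t. h (Complex t k2))"
 shows "continuous_on {s0..x} (\<lambda>t. (V1 (Complex t k1) - V0 (Complex t k1)) * h (Complex t k1))"
  and "continuous_on {s0..x} (\<lambda>t. (V1 (Complex t k2) - V0 (Complex t (k2 - 2 * pi))) * h (Complex t k2))"
 by (intro continuous_on_mult continuous_on_diff h continuous_on_subset[OF continuous_horizontal(1)]
    continuous_on_subset[OF continuous_horizontal(2)]; use heights in auto)+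

lemma jumps_bound:
 assumes h: "continuous_on {s0..x} (\<lambda>t. h (Complex t k1))" "continuous_on {s0..x} (\<lambda>t. h (Complex t k2))" and x: "s0 \<le> x"
  and le: "\<And>t. s0 \<le> t \<Longrightarrow> t \<le> x \<Longrightarrow> norm (h (Complex t k1)) \<le> M" "\<And>t. s0 \<le> t \<Longrightarrow> t \<le> x \<Longrightarrow> norm (h (Complex t k2)) \<le> M"
 shows "norm (jumps x h) \<le> 2 * M"
proof -
 have M: "M \<ge> 0" using le(1)[of s0] x norm_ge_zero order_trans by blast
 have "norm (integral {s0..x} (\<lambda>t. (V1 (Complex t k1) - V0 (Complex t k1)) * h (Complex t k1))) \<le> M * exp (- s0)"
  by (rule exp_decay_integral_bound[OF jump_integrands(1)[OF h] x])
    (use jump1 le(1) M in \<open>auto simp: norm_mult mult.commute[of M] intro!: mult_mono\<close>)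
 moreover have "norm (integral {s0..x} (\<lambda>t. (V1 (Complex t k2) - V0 (Complex t (k2 - 2 * pi))) * h (Complex t k2))) \<le> M * exp (- s0)"
  by (rule exp_decay_integral_bound[OF jump_integrands(2)[OF h] x])
    (use jump2 le(2) M in \<open>auto simp: norm_mult mult.commute[of M] intro!: mult_mono\<close>)
 moreover have "M * exp (- s0) \<le> M" using s0 M by (simp add: mult_left_le)
 ultimately show ?thesis unfolding jumps_def
  using norm_triangle_ineq4[of "integral {s0..x} (\<lambda>t. (V1 (Complex t k1) - V0 (Complex t k1)) * h (Complex t k1))"
   "integral {s0..x} (\<lambda>t. (V1 (Complex t k2) - V0 (Complex t (k2 - 2 * pi))) * h (Complex t k2))"] by linarith
qed

lemma jumps_convergent:
 assumes h: "continuous_on {s0..} (\<lambda>t. h (Complex t k1))" "continuous_on {s0..} (\<lambda>t. h (Complex t k2))"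
  and le: "\<And>t. s0 \<le> t \<Longrightarrow> norm (h (Complex t k1)) \<le> 1" "\<And>t. s0 \<le> t \<Longrightarrow> norm (h (Complex t k2)) \<le> 1"
 shows "convergent (\<lambda>n. jumps (s0 + real n) h)"
proof -
 have m: "x \<le> a \<Longrightarrow> y \<le> 1 \<Longrightarrow> 0 \<le> a \<Longrightarrow> 0 \<le> y \<Longrightarrow> x * y \<le> a" for x y a :: real
  by (metis mult.right_neutral mult_mono)
 have c: "continuous_on {s0..} (\<lambda>t. (V1 (Complex t k1) - V0 (Complex t k1)) * h (Complex t k1))"
  "continuous_on {s0..} (\<lambda>t. (V1 (Complex t k2) - V0 (Complex t (k2 - 2 * pi))) * h (Complex t k2))"
  by (intro continuous_on_mult continuous_on_diff h continuous_horizontal; use heights in auto)+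
 show ?thesis unfolding jumps_def
  by (intro convergent_diff exp_decay_integral_convergent[where M = 1] c)
    (use le jump1 jump2 in \<open>auto simp: norm_mult intro!: m\<close>)
qed

text \<open>By Cauchy's theorem \<open>boundaries\<close> vanishes for this \<open>h\<close>, so the
  edge integral is a constant minus \<open>jumps\<close>, whose integrals converge because the jumps
  decay. The limits are the moments that become the coefficients of the polynomial in
  \<open>split\<close>.\<close>

lemma edge_power_convergent:
 assumes "i \<ge> 1"
 shows "convergent (\<lambda>n. edge (s0 + real n) (\<lambda>w. exp (- of_nat i * w)))"
proof -
 let ?h = "\<lambda>w::complex. exp (- of_nat i * w)"
 have nh: "norm (?h (Complex t y)) \<le> 1" if "s0 \<le> t" for t y using that s0 by simp
 have ch: "continuous_on A (\<lambda>t. ?h (Complex t y))" for A y unfolding Complex_eq by (intro continuous_intros)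
 have cv: "convergent (\<lambda>n. jumps (s0 + real n) ?h)" by (rule jumps_convergent) (use ch nh in auto)
 have per: "?h (Complex t (k2 - 2*pi)) = ?h (Complex t k2)" for t
 proof -
  have "- of_nat i * Complex t (k2 - 2*pi) = - of_nat i * Complex t k2 + (2 * of_nat i) * of_real pi * \<i>"
   by (simp add: complex_eq_iff algebra_simps)
  moreover have "exp ((2 * of_nat i) * of_real pi * \<i>) = 1"
   using exp_integer_2pi[of "of_nat i"] by (simp add: mult_ac)
  ultimately show ?thesis by (simp only: exp_add mult_1_right)
 qed
 have e: "edge (s0 + real n) ?h = edge s0 ?h - jumps (s0 + real n) ?h" if "n \<ge> 1" for n
 proof -
  have "boundaries (s0 + real n) ?h = 0"
   unfolding boundaries_def
   using rect_integral_zero[OF _ U1(2), of "\<lambda>w. V1 w * ?h w" s0 k1 "s0 + real n" k2]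
      rect_integral_zero[OF _ U0(2), of "\<lambda>w. V0 w * ?h w" s0 "k2 - 2*pi" "s0 + real n" k1]
      U1(3) U0(3) heights by (force intro!: holomorphic_intros U1(4) U0(4) simp: in_cbox_complex_iff)
  moreover have "boundaries (s0 + real n) ?h = jumps (s0 + real n) ?h + edge (s0 + real n) ?h - edge s0 ?h"
   by (rule boundaries_eq) (use per that in \<open>auto intro!: continuous_intros\<close>)
  ultimately show ?thesis by (simp add: algebra_simps)
 qed
 have "convergent (\<lambda>n. edge s0 ?h - jumps (s0 + real n) ?h)" using cv by (intro convergent_diff convergent_const)
 then obtain L where "(\<lambda>n. edge s0 ?h - jumps (s0 + real n) ?h) \<longlonglongrightarrow> L" by (auto simp: convergent_def)
 hence "(\<lambda>n. edge (s0 + real n) ?h) \<longlonglongrightarrow> L"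
  by (rule Lim_transform_eventually) (use e in \<open>auto simp: eventually_sequentially intro!: exI[of _ 1]\<close>)
 thus ?thesis by (auto simp: convergent_def)
qed

lemma edge_add:
 assumes "continuous_on {w. Re w = x} g" "continuous_on {w. Re w = x} h" and x: "s0 \<le> x"
 shows "edge x (\<lambda>w. g w + h w) = edge x g + edge x h"
 unfolding edge_def distrib_left by (simp add: contour_integral_add edge_integrable assms)

lemma edge_cmult:
 assumes "continuous_on {w. Re w = x} h" and x: "s0 \<le> x"
 shows "edge x (\<lambda>w. c * h w) = c * edge x h"
proof -
 have m: "a * (c * b) = c * (a * b)" for a b :: complex by simp
 show ?thesis unfolding edge_def m by (simp add: contour_integral_lmul edge_integrable assms distrib_left)
qed

lemma edge_sum:
 assumes "\<And>i. i \<in> I \<Longrightarrow> continuous_on {w. Re w = x} (h i)" and x: "s0 \<le> x" and "finite I"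
 shows "edge x (\<lambda>w. \<Sum>i\<in>I. c i * h i w) = (\<Sum>i\<in>I. c i * edge x (h i))"
 using assms(3,1)
proof (induction I rule: finite_induct)
 case empty
 show ?case by (simp add: edge_def)
next
 case (insert j I)
 have "edge x (\<lambda>w. c j * h j w + (\<Sum>i\<in>I. c i * h i w)) = edge x (\<lambda>w. c j * h j w) + edge x (\<lambda>w. \<Sum>i\<in>I. c i * h i w)"
  using insert x by (intro edge_add continuous_on_sum continuous_on_mult continuous_on_const) auto
 thus ?case using insert x by (simp add: edge_cmult)
qed

lemma kernel_exp_neq:
 assumes "Re w \<noteq> Re z \<or> cos (Im w - Im z) < 1"
 shows "exp (w - z) \<noteq> 1"
proof
 assume "exp (w - z) = 1"
 then obtain n :: int where "Re (w - z) = 0" "Im (w - z) = of_int (2 * n) * pi" by (auto simp: exp_eq_1)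
 hence "Re w = Re z" "cos (Im w - Im z) = 1" using cos_int_2pin[of n] by (simp_all add: mult_ac)
 thus False using assms by simp
qed

text \<open>The kernel \<open>1/(e\<^bsup>w-z\<^esup> - 1)\<close> is \<open>2\<pi>i\<close>-periodic with a single pole of residue 1 in a period strip.
 Expanding it at the far edge leaves, up to a bounded error, a polynomial in \<open>e\<^bsup>z\<^esup>\<close>.\<close>

theorem split:
 "\<exists>q. \<forall>d. 0 < d \<and> d < pi \<longrightarrow> (\<exists>B. \<forall>z. s0 + 1 \<le> Re z \<and> cos (k1 - Im z) \<le> cos d \<and> cos (k2 - Im z) \<le> cos d \<longrightarrow>
   (k1 < Im z \<and> Im z < k2 \<longrightarrow> norm (V1 z - poly q (exp z)) \<le> B) \<and>
   (k2 - 2 * pi < Im z \<and> Im z < k1 \<longrightarrow> norm (V0 z - poly q (exp z)) \<le> B))"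
proof -
 define L where "L i = lim (\<lambda>n. edge (s0 + real n) (\<lambda>u. exp (- of_nat i * u)))" for i
 have L: "(\<lambda>n. edge (s0 + real n) (\<lambda>u. exp (- of_nat i * u))) \<longlonglongrightarrow> L i" if "i \<ge> 1" for i
  using edge_power_convergent[OF that] unfolding L_def convergent_LIMSEQ_iff .
 \<comment> \<open>The geometric expansion of the kernel starts with \<open>i = 1\<close>, so there
   is no constant term; \<open>2 * pi * \<i>\<close> is the normalisation of Cauchy's
   formula.\<close>
 define q where "q = (\<Sum>i=1..K. monom (L i / (2 * pi * \<i>)) i)"
 show ?thesis
 proof (intro exI[of _ q] allI impI)
  fix d :: real assume d: "0 < d \<and> d < pi"
  have sin_pos: "sin d > 0" using d by (simp add: sin_gt_zero)
  have cos1: "cos d < 1" using d cos_monotone_0_pi[of 0 d] by simp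
  \<comment> \<open>The first summand bounds the jumps, the second the near edge, where
    \<open>Re (u - z) \<le> - 1\<close> makes the kernel at most 2.\<close>
  define B where "B = 2 / sin d + 2 * pi * exp (real K * s0) * 2"
  have key: "norm (2 * pi * \<i> * w - (\<Sum>i=1..K. exp (of_nat i * z) * L i)) \<le> B"
   if z: "s0 + 1 \<le> Re z" "cos (k1 - Im z) \<le> cos d" "cos (k2 - Im z) \<le> cos d"
    and w: "\<And>x. x > Re z \<Longrightarrow> boundaries x (\<lambda>u. 1 / (exp (u - z) - 1)) = 2 * pi * \<i> * w" for z w
  proof -
   let ?k = "\<lambda>u. 1 / (exp (u - z) - 1)"
   let ?S = "\<lambda>u. \<Sum>i=1..K. exp (of_nat i * z) * exp (- of_nat i * u)"
   let ?E = "\<lambda>n. \<Sum>i=1..K. exp (of_nat i * z) * edge (s0 + real n) (\<lambda>u. exp (- of_nat i * u))"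
   have ck: "continuous_on {u. Re u = x} ?k" if "x \<noteq> Re z" for x
    using that kernel_exp_neq[of _ z] by (intro continuous_intros) auto
   have per: "?k (Complex t (k2 - 2*pi)) = ?k (Complex t k2)" for t
   proof -
    have "Complex t (k2 - 2*pi) - z = (Complex t k2 - z) - 2 * of_real pi * \<i>" by (simp add: complex_eq_iff)
    thus ?thesis by (simp only: exp_diff exp_two_pi_i div_by_1)
   qed
   have cosy: "cos (k2 - 2*pi - Im z) = cos (k2 - Im z)"
    using cos_periodic[of "k2 - 2*pi - Im z"] by (simp add: algebra_simps)
   have hor: "norm (?k (Complex t y)) \<le> 1 / sin d" if "y = k1 \<or> y = k2" for t y
   proof -
    have "norm (exp (Complex t y - z) - 1) \<ge> sin d"
     by (rule norm_exp_minus_one_ge_sin) (use d z that in auto)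
    thus ?thesis using sin_pos by (simp add: norm_divide frac_le)
   qed
   have chor: "continuous_on A (\<lambda>t. ?k (Complex t y))" if "y = k1 \<or> y = k2" for A y
   proof -
    have "exp (Complex t y - z) - 1 \<noteq> 0" for t using kernel_exp_neq[of "Complex t y" z] that z cos1 by auto
    thus ?thesis unfolding Complex_eq by (intro continuous_intros) (auto simp: Complex_eq)
   qed
   have left: "norm (edge s0 ?k) \<le> 2 * pi * exp (real K * s0) * 2"
   proof (rule edge_bound)
    fix u assume "Re u = s0"
    hence "norm (exp (u - z)) \<le> exp (-1)" using z by simp
    moreover have "exp (-1::real) \<le> 1 / 2" using exp_ge_add_one_self[of "1::real"] by (simp add: exp_minus field_simps)
    moreover have "norm (exp (u - z) - 1) \<ge> 1 - norm (exp (u - z))"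
     using norm_triangle_ineq2[of 1 "exp (u - z)"] by (simp only: norm_one norm_minus_commute[of 1])
    ultimately have "norm (exp (u - z) - 1) \<ge> 1 / 2" by linarith
    hence "1 / norm (exp (u - z) - 1) \<le> 1 / (1 / 2)" by (intro divide_left_mono) auto
    thus "norm (?k u) \<le> 2" by (simp add: norm_divide)
   qed (use ck z in auto)
   have shift: "a - E = j + r - l" if "a = j + e - l" "e = E + r" for a j e l E r :: complex
    using that by simp
   have bd: "norm (2 * pi * \<i> * w - ?E n) \<le> B + 4 * pi * exp (real (Suc K) * Re z) * exp (- (s0 + real n))"
    if n: "s0 + real n \<ge> Re z + 1" for n
   proof -
    let ?x = "s0 + real n"
    have xs: "s0 < ?x" "Re z < ?x" using n z by auto
    have split: "edge ?x ?k = ?E n + edge ?x (\<lambda>u. ?k u - ?S u)"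
    proof -
     have cS: "continuous_on A ?S" for A by (intro continuous_intros)
     have "edge ?x (\<lambda>u. ?S u + (?k u - ?S u)) = edge ?x ?S + edge ?x (\<lambda>u. ?k u - ?S u)"
      using xs by (intro edge_add continuous_on_diff ck cS) auto
     also have "edge ?x ?S = ?E n" using xs by (intro edge_sum continuous_intros) auto
     finally show ?thesis by simp
    qed
    \<comment> \<open>\<open>K\<close> terms of the expansion leave a remainder of order
      \<open>exp (- (K + 1) * x)\<close> on the far edge, one power better than the growth
      \<open>exp (K * x)\<close> of \<open>V1\<close> and \<open>V0\<close>; so it vanishes as the
      edge moves to infinity.\<close>
    have rem: "norm (edge ?x (\<lambda>u. ?k u - ?S u)) \<le> 2 * pi * exp (real K * ?x) * (2 * exp (- real (Suc K) * (?x - Re z)))"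
    proof (rule edge_bound)
     fix u assume re: "Re u = ?x"
     have ny: "norm (exp (u - z)) = exp (?x - Re z)" using re by simp
     have "exp (1::real) \<le> exp (?x - Re z)" using n by simp
     hence "norm (exp (u - z)) \<ge> 2" using exp_ge_add_one_self[of "1::real"] unfolding ny by linarith
     from inverse_minus_one_expansion[OF this, of K]
     have "norm (?k u - (\<Sum>i=1..K. (1 / exp (u - z)) ^ i)) \<le> 2 / exp (?x - Re z) ^ Suc K" unfolding ny .
     moreover have "(\<Sum>i=1..K. (1 / exp (u - z)) ^ i) = ?S u"
     proof (rule sum.cong[OF refl])
      fix i :: nat
      have "(1 / exp (u - z)) ^ i = exp (of_nat i * (z - u))"
       by (simp add: exp_of_nat_mult exp_diff)
      also have "of_nat i * (z - u) = of_nat i * z + - of_nat i * u" by (simp add: algebra_simps)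
      finally show "(1 / exp (u - z)) ^ i = exp (of_nat i * z) * exp (- of_nat i * u)" by (simp only: exp_add)
     qed
     moreover have "2 / exp (?x - Re z) ^ Suc K = 2 * exp (- real (Suc K) * (?x - Re z))"
      by (simp only: exp_of_nat_mult[symmetric] exp_minus divide_inverse mult_minus_left)
     ultimately show "norm (?k u - ?S u) \<le> 2 * exp (- real (Suc K) * (?x - Re z))" by simp
    qed (use xs in \<open>auto intro!: continuous_on_diff ck continuous_intros\<close>)
    also have "\<dots> = 4 * pi * exp (real (Suc K) * Re z) * exp (- ?x)"
     by (simp add: mult_exp_exp algebra_simps)
    finally have rem: "norm (edge ?x (\<lambda>u. ?k u - ?S u)) \<le> 4 * pi * exp (real (Suc K) * Re z) * exp (- ?x)" .
    have j: "norm (jumps ?x ?k) \<le> 2 * (1 / sin d)"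
     by (rule jumps_bound) (use xs chor hor in auto)
    have "boundaries ?x ?k = jumps ?x ?k + edge ?x ?k - edge s0 ?k"
    proof (rule boundaries_eq[OF _ per xs(1)])
     have "exp (u - z) \<noteq> 1" if "u \<in> rims ?x" for u
     proof (rule kernel_exp_neq)
      have "cos (Im u - Im z) \<le> cos d" if "Re u = Re z"
      proof -
       have "Re u \<noteq> s0" "Re u \<noteq> ?x" using that z(1) xs by linarith+
       hence "Im u = k1 \<or> Im u = k2 \<or> Im u = k2 - 2*pi" using \<open>u \<in> rims ?x\<close> unfolding rims_def by blast
       thus ?thesis using z(2,3) cosy by (elim disjE) simp_all
      qed
      thus "Re u \<noteq> Re z \<or> cos (Im u - Im z) < 1" using cos1 by linarith
     qed
     thus "continuous_on (rims ?x) ?k" by (intro continuous_intros) auto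
    qed
    from this[unfolded w[OF xs(2)]] split
    have e: "2 * pi * \<i> * w - ?E n = jumps ?x ?k + edge ?x (\<lambda>u. ?k u - ?S u) - edge s0 ?k"
     by (rule shift)
    have "norm (2 * pi * \<i> * w - ?E n) \<le> norm (jumps ?x ?k) + norm (edge ?x (\<lambda>u. ?k u - ?S u)) + norm (edge s0 ?k)"
     unfolding e by (rule order_trans[OF norm_triangle_ineq4 add_mono[OF norm_triangle_ineq order_refl]])
    also have "\<dots> \<le> B + 4 * pi * exp (real (Suc K) * Re z) * exp (- ?x)"
     using add_mono[OF add_mono[OF j rem] left] unfolding B_def times_divide_eq_right mult_1_right by (simp only: add_ac)
    finally show ?thesis .
   qed
   have l1: "(\<lambda>n. norm (2 * pi * \<i> * w - ?E n)) \<longlonglongrightarrow> norm (2 * pi * \<i> * w - (\<Sum>i=1..K. exp (of_nat i * z) * L i))"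
    by (intro tendsto_intros L) auto
   have l2: "(\<lambda>n. B + 4 * pi * exp (real (Suc K) * Re z) * exp (- (s0 + real n))) \<longlonglongrightarrow> B" by real_asymp
   have "EVN n. s0 + real n \<ge> Re z + 1" by real_asymp
   hence "EVN n. norm (2 * pi * \<i> * w - ?E n) \<le> B + 4 * pi * exp (real (Suc K) * Re z) * exp (- (s0 + real n))"
    by eventually_elim (rule bd)
   thus ?thesis by (rule tendsto_le[OF _ l2 l1, rotated]) simp
  qed
  have fin: "norm (w - poly q (exp z)) \<le> B"
   if "s0 + 1 \<le> Re z" "cos (k1 - Im z) \<le> cos d" "cos (k2 - Im z) \<le> cos d"
    "\<And>x. x > Re z \<Longrightarrow> boundaries x (\<lambda>u. 1 / (exp (u - z) - 1)) = 2 * pi * \<i> * w" for z w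
  proof -
   have "poly q (exp z) = (\<Sum>i=1..K. exp (of_nat i * z) * L i) / (2 * pi * \<i>)"
    unfolding q_def poly_sum poly_monom sum_divide_distrib by (intro sum.cong refl) (simp add: exp_of_nat_mult)
   hence "2 * pi * \<i> * w - (\<Sum>i=1..K. exp (of_nat i * z) * L i) = 2 * pi * \<i> * (w - poly q (exp z))"
    by (simp add: right_diff_distrib)
   hence "2 * pi * norm (w - poly q (exp z)) \<le> B" using key[OF that] by (simp add: norm_mult)
   moreover have "norm (w - poly q (exp z)) \<le> 2 * pi * norm (w - poly q (exp z))"
    using pi_gt3 mult_right_mono[of 1 "2 * pi" "norm (w - poly q (exp z))"] by simp
   ultimately show ?thesis by linarith
  qed
  show "\<exists>B. \<forall>z. s0 + 1 \<le> Re z \<and> cos (k1 - Im z) \<le> cos d \<and> cos (k2 - Im z) \<le> cos d \<longrightarrow>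
   (k1 < Im z \<and> Im z < k2 \<longrightarrow> norm (V1 z - poly q (exp z)) \<le> B) \<and>
   (k2 - 2 * pi < Im z \<and> Im z < k1 \<longrightarrow> norm (V0 z - poly q (exp z)) \<le> B)"
  proof (intro exI[of _ B] allI impI conjI; elim conjE)
   fix z assume z: "s0 + 1 \<le> Re z" "cos (k1 - Im z) \<le> cos d" "cos (k2 - Im z) \<le> cos d" and im: "k1 < Im z" "Im z < k2"
   show "norm (V1 z - poly q (exp z)) \<le> B"
   proof (rule fin[OF z])
    fix x assume x: "x > Re z"
    have "contour_integral (rectpath (Complex s0 (k2 - 2 * pi)) (Complex x k1)) (\<lambda>u. V0 u * (1 / (exp (u - z) - 1))) = 0"
     by (rule kernel_zero[OF U0(4,2)]) (use U0(3) z x im heights in \<open>auto simp: in_cbox_complex_iff\<close>)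
    moreover have "contour_integral (rectpath (Complex s0 k1) (Complex x k2)) (\<lambda>u. V1 u * (1 / (exp (u - z) - 1))) = 2 * pi * \<i> * V1 z"
     by (rule rect_kernel_integral[OF U1(4,1,2)]) (use U1(3) z x im heights in \<open>auto simp: in_cbox_complex_iff\<close>)
    ultimately show "boundaries x (\<lambda>u. 1 / (exp (u - z) - 1)) = 2 * pi * \<i> * V1 z"
     unfolding boundaries_def by simp
   qed
  next
   fix z assume z: "s0 + 1 \<le> Re z" "cos (k1 - Im z) \<le> cos d" "cos (k2 - Im z) \<le> cos d" and im: "k2 - 2 * pi < Im z" "Im z < k1"
   show "norm (V0 z - poly q (exp z)) \<le> B"
   proof (rule fin[OF z])
    fix x assume x: "x > Re z"
    have "contour_integral (rectpath (Complex s0 k1) (Complex x k2)) (\<lambda>u. V1 u * (1 / (exp (u - z) - 1))) = 0"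
     by (rule kernel_zero[OF U1(4,2)]) (use U1(3) z x im heights in \<open>auto simp: in_cbox_complex_iff\<close>)
    moreover have "contour_integral (rectpath (Complex s0 (k2 - 2*pi)) (Complex x k1)) (\<lambda>u. V0 u * (1 / (exp (u - z) - 1))) = 2 * pi * \<i> * V0 z"
     by (rule rect_kernel_integral[OF U0(4,1,2)]) (use U0(3) z x im heights in \<open>auto simp: in_cbox_complex_iff\<close>)
    ultimately show "boundaries x (\<lambda>u. 1 / (exp (u - z) - 1)) = 2 * pi * \<i> * V0 z"
     unfolding boundaries_def by simp
   qed
  qed
 qed
qed

end

section \<open>The large case\<close>

lemma pderiv_surj: "\<exists>Q. pderiv Q = (p :: complex poly)"
proof -
 have "\<exists>Q. pderiv Q = (\<Sum>i\<in>I. monom (coeff p i) i)" if "finite I" for I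
  using that
 proof (induction I rule: finite_induct)
  case empty
  show ?case by (intro exI[of _ 0]) simp
 next
  case (insert i I)
  then obtain Q where "pderiv Q = (\<Sum>i\<in>I. monom (coeff p i) i)" by blast
  moreover have "pderiv (monom (coeff p i / of_nat (Suc i)) (Suc i)) = monom (coeff p i) i"
   unfolding pderiv_monom by (simp del: of_nat_Suc)
  ultimately show ?case using insert by (intro exI[of _ "monom (coeff p i / of_nat (Suc i)) (Suc i) + Q"]) (simp add: pderiv_add)
 qed
 from this[of "{..degree p}"] show ?thesis by (simp add: poly_as_sum_of_monoms)
qed

lemma entire_poly_growth_imp_poly:
 assumes g: "g holomorphic_on UNIV" and bd: "\<And>z. R \<le> norm z \<Longrightarrow> norm (g z) \<le> B * norm z ^ n"
 shows "\<exists>p. \<forall>z. g z = poly p z"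
proof (intro exI allI)
 fix z
 show "g z = poly (\<Sum>k\<le>n. monom ((deriv ^^ k) g 0 / fact k) k) z"
  using Liouville_polynomial[OF g bd, where \<xi> = z] by (simp add: poly_sum poly_monom)
qed

text \<open>Writing \<open>u = exp W\<close> turns the hypothesis into a bound for the derivative of
  \<open>W\<close>, which is integrated along the segment.\<close>

lemma norm_le_of_log_deriv:
 assumes u: "u holomorphic_on U" and U: "convex U" "open U" and nz: "\<And>z. z \<in> U \<Longrightarrow> u z \<noteq> 0"
  and s: "s \<le> S" and seg: "\<And>t. s \<le> t \<Longrightarrow> t \<le> S \<Longrightarrow> Complex t y \<in> U \<and> norm (deriv u (Complex t y) / u (Complex t y)) \<le> B"
 shows "norm (u (Complex S y)) \<le> norm (u (Complex s y)) * exp (B * (S - s))"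
proof -
 obtain W where W: "W holomorphic_on U" "\<And>z. z \<in> U \<Longrightarrow> u z = exp (W z)"
  using contractible_imp_holomorphic_log[OF u convex_imp_contractible[OF U(1)] nz] by blast
 have sg: "closed_segment (Complex s y) (Complex S y) = {z. Im z = y \<and> Re z \<in> {s..S}}"
  using s closed_segment_same_Im[of "Complex s y" "Complex S y"] by (auto simp: closed_segment_eq_real_ivl)
 have d: "(W has_field_derivative deriv u z / u z) (at z)" if z: "z \<in> U" for z
 proof -
  have W': "(W has_field_derivative deriv W z) (at z)" using W(1) U(2) z holomorphic_derivI by blast
  have "((\<lambda>z. exp (W z)) has_field_derivative exp (W z) * deriv W z) (at z)" by (rule DERIV_chain'[OF W' DERIV_exp])
  hence "(u has_field_derivative exp (W z) * deriv W z) (at z)"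
   by (rule has_field_derivative_transform_within_open[OF _ U(2) z]) (use W(2) in auto)
  hence "deriv u z = u z * deriv W z" using W(2)[OF z] by (simp add: DERIV_imp_deriv)
  thus ?thesis using W' nz[OF z] by simp
 qed
 have i: "z \<in> U \<and> norm (deriv u z / u z) \<le> B" if "z \<in> closed_segment (Complex s y) (Complex S y)" for z
 proof -
  have "z = Complex (Re z) y" "s \<le> Re z" "Re z \<le> S" using that sg by (auto simp: complex_eq_iff)
  thus ?thesis using seg by metis
 qed
 have "norm (W (Complex S y) - W (Complex s y)) \<le> B * norm (Complex S y - Complex s y)"
  by (rule field_differentiable_bound[of "closed_segment (Complex s y) (Complex S y)"])
    (use i d in \<open>auto intro: has_field_derivative_at_within\<close>)
 also have "norm (Complex S y - Complex s y) = S - s" using s by (simp add: cmod_def)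
 finally have "Re (W (Complex S y)) \<le> Re (W (Complex s y)) + B * (S - s)"
  using complex_Re_le_cmod[of "W (Complex S y) - W (Complex s y)"] by simp
 hence "exp (Re (W (Complex S y))) \<le> exp (Re (W (Complex s y))) * exp (B * (S - s))"
  by (simp only: mult_exp_exp exp_le_cancel_iff)
 thus ?thesis using seg[of s] seg[of S] W(2) s by simp
qed

text \<open>In the logarithmic coordinate \<open>z * g' / g\<close> is the derivative of
  \<open>G\<close> plus \<open>z * p' / p\<close>. Finite order makes the first of size
  \<open>exp (\<rho> * s)\<close>, and the second is at most a power of
  \<open>exp s\<close>.\<close>

lemma (in log_side) log_deriv_bound:
 assumes ab: "l < a" "b < u" and g: "\<And>z. g z = poly p z * F z" and p: "p \<noteq> 0"
  and K: "EV s. \<forall>t\<in>{a..b}. norm (deriv G (Complex s t)) \<le> K * A s"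
  and ord: "EV s. A s \<le> exp (\<rho> * s)"
 shows "\<exists>N::nat. EV s. \<forall>t\<in>{a..b}.
  norm (pt s t * deriv g (pt s t) / g (pt s t)) \<le> exp (real N * s)"
proof -
 obtain c D R where c: "c > 0" "R \<ge> 1" "\<And>z. norm z \<ge> R \<Longrightarrow> c \<le> norm (poly p z)"
  using poly_norm_bounds[OF p] by metis
 obtain D' R' where D': "\<And>z. norm z \<ge> R' \<Longrightarrow> norm (poly (pderiv p) z) \<le> norm z ^ D'"
 proof (cases "pderiv p = 0")
  case True thus thesis using that[of 0 0] by simp
 next
  case False thus thesis using poly_norm_bounds[OF False] that by metis
 qed
 define N where "N = nat \<lceil>\<rho>\<rceil> + D' + 2"
 have "EV s. \<bar>K\<bar> * exp (\<rho> * s) + exp s * exp s ^ D' / c \<le> exp (real N * s)"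
 proof -
  have "real N \<ge> \<rho> + 1" "real N \<ge> real D' + 2" unfolding N_def by linarith+
  note N = this
  have l: "EV s. 2 * \<bar>K\<bar> \<le> exp s" "EV s. 2 / c \<le> exp s" by real_asymp+
  show ?thesis using l eventually_ge_at_top[of 0]
  proof eventually_elim
   case (elim s)
   have "2 * \<bar>K\<bar> * exp (\<rho> * s) \<le> exp s * exp (\<rho> * s)" using elim by (intro mult_right_mono) auto
   also have "\<dots> \<le> exp (real N * s)" using mult_right_mono[OF N(1) elim(3)] by (simp add: mult_exp_exp algebra_simps)
   finally have 1: "2 * (\<bar>K\<bar> * exp (\<rho> * s)) \<le> exp (real N * s)" by simp
   have "2 / c * (exp s * exp s ^ D') \<le> exp s * (exp s * exp s ^ D')" using elim by (intro mult_right_mono) auto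
   also have "\<dots> = exp ((real D' + 2) * s)" by (simp add: mult_exp_exp exp_of_nat_mult[symmetric] algebra_simps)
   also have "\<dots> \<le> exp (real N * s)" using mult_right_mono[OF N(2) elim(3)] by simp
   finally have 2: "2 * (exp s * exp s ^ D' / c) \<le> exp (real N * s)" by simp
   show ?case using 1 2 by linarith
  qed
 qed
 moreover have "EV s. exp s \<ge> max R R'" by real_asymp
 ultimately have "EV s. \<forall>t\<in>{a..b}.
  norm (pt s t * deriv g (pt s t) / g (pt s t)) \<le> exp (real N * s)"
  using K ord
 proof eventually_elim
  case (elim s)
  show ?case
  proof
   fix t assume th: "t \<in> {a..b}"
   let ?w = "Complex s t" let ?z = "exp ?w"
   have inS: "?w \<in> strip l u" using th ab by auto
   have nz: "norm ?z \<ge> R" "norm ?z \<ge> R'" using elim(2) by auto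
   have pz: "c \<le> norm (poly p ?z)" "poly p ?z \<noteq> 0" using c(1) c(3)[OF nz(1)] by auto
   have Fz: "F ?z \<noteq> 0" using FG[OF inS] by simp
   have dF: "(F has_field_derivative deriv F ?z) (at ?z)" using F holomorphic_derivI by blast
   have "((\<lambda>z. poly p z * F z) has_field_derivative poly (pderiv p) ?z * F ?z + poly p ?z * deriv F ?z) (at ?z)"
    by (auto intro!: derivative_eq_intros dF poly_DERIV)
   moreover have "g = (\<lambda>z. poly p z * F z)" by (rule ext) (rule g)
   ultimately have dg: "deriv g ?z = poly (pderiv p) ?z * F ?z + poly p ?z * deriv F ?z"
    by (simp add: DERIV_imp_deriv)
   have G': "?z * deriv F ?z = F ?z * deriv G ?w"
   proof -
    have dG: "(G has_field_derivative deriv G ?w) (at ?w)" using G inS open_strip holomorphic_derivI by blast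
    have "((\<lambda>w. exp (G w)) has_field_derivative exp (G ?w) * deriv G ?w) (at ?w)" by (rule DERIV_chain'[OF dG DERIV_exp])
    hence "((\<lambda>w. F (exp w)) has_field_derivative exp (G ?w) * deriv G ?w) (at ?w)"
     by (rule has_field_derivative_transform_within_open[OF _ open_strip inS]) (use FG in auto)
    moreover have "((\<lambda>w. F (exp w)) has_field_derivative deriv F ?z * ?z) (at ?w)"
     by (rule DERIV_chain'[OF DERIV_exp dF])
    ultimately show ?thesis using DERIV_unique FG[OF inS] by (metis mult.commute)
   qed
   have "?z * deriv g ?z / g ?z = deriv G ?w + ?z * poly (pderiv p) ?z / poly p ?z"
   proof -
    have "?z * deriv g ?z = poly p ?z * (?z * deriv F ?z) + ?z * poly (pderiv p) ?z * F ?z" unfolding dg by (simp add: algebra_simps)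
    also have "\<dots> = (deriv G ?w + ?z * poly (pderiv p) ?z / poly p ?z) * g ?z"
     unfolding G' g using pz(2) by (simp add: field_simps)
    finally show ?thesis using pz Fz g[of ?z] by (simp add: eq_divide_imp)
   qed
   hence "norm (?z * deriv g ?z / g ?z) \<le> norm (deriv G ?w) + norm (?z * poly (pderiv p) ?z / poly p ?z)"
    using norm_triangle_ineq by metis
   also have "norm (deriv G ?w) \<le> \<bar>K\<bar> * exp (\<rho> * s)"
   proof -
    have "norm (deriv G ?w) \<le> K * A s" using elim(3) th by blast
    also have "\<dots> \<le> \<bar>K\<bar> * exp (\<rho> * s)" using elim(4) A_pos[of s] by (intro mult_mono) auto
    finally show ?thesis .
   qed
   also have "norm (?z * poly (pderiv p) ?z / poly p ?z) \<le> exp s * exp s ^ D' / c"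
    unfolding norm_divide norm_mult using D'[OF nz(2)] pz(1) c(1) by (intro frac_le mult_mono) auto
   also note elim(1)
   finally show "norm (?z * deriv g ?z / g ?z) \<le> exp (real N * s)" by simp
  qed
 qed
 thus ?thesis by blast
qed

lemma cos_le_cos_of_mem:
 assumes "0 < d" "d \<le> x" "x \<le> 2 * pi - d"
 shows "cos x \<le> cos d"
proof (cases "x \<le> pi")
 case True
 thus ?thesis using assms by (intro cos_monotone_0_pi_le) auto
next
 case False
 have "cos (2 * pi - x) \<le> cos d" using assms False by (intro cos_monotone_0_pi_le) auto
 thus ?thesis by (simp add: cos_diff)
qed

context separated begin

lemma nonzero_far: "EV s. \<forall>w. Re w = s \<longrightarrow>
  (w \<in> strip1 \<longrightarrow> f (exp w) \<noteq> 0) \<and> (w \<in> strip0 \<longrightarrow> f (exp w) \<noteq> 1)"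
 using poly_ge_exp_A[OF p1 zero_less_one] poly_ge_exp_A[OF p0 zero_less_one]
proof eventually_elim
 case (elim s)
 have z: "poly p1 (exp w) \<noteq> 0" "poly p0 (exp w) \<noteq> 0" if "Re w = s" for w
  using elim[rule_format, of "exp w"] that exp_gt_zero[of "- 1 * A s"] by (auto simp del: exp_gt_zero)
 show ?case
 proof (intro allI impI conjI)
  fix w assume r: "Re w = s"
  { assume "w \<in> strip1"
   hence "F1 (exp w) \<noteq> 0" using S1.FG by simp
   thus "f (exp w) \<noteq> 0" using z[OF r] by (simp add: f1) }
  { assume "w \<in> strip0"
   hence "F0 (exp w) \<noteq> 0" using S0.FG by simp
   hence "f (exp w) - 1 \<noteq> 0" using z[OF r] by (simp add: f0)
   thus "f (exp w) \<noteq> 1" by simp }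
 qed
qed

text \<open>\<open>ld1\<close> and \<open>ld0\<close> are the derivatives of \<open>ln f\<close> and
  \<open>ln (f - 1)\<close> with respect to \<open>w\<close>, at \<open>z = exp w\<close>.\<close>

definition "ld1 w = exp w * deriv f (exp w) / f (exp w)"
definition "ld0 w = exp w * deriv f (exp w) / (f (exp w) - 1)"

lemma growth_step: "\<exists>D. EV s. A (s + 1) \<le> D * A s"
proof -
 obtain D g s0 where "\<And>s t. s \<ge> s0 \<Longrightarrow> t \<ge> 0 \<Longrightarrow> A (s + t) \<le> D * exp (g * t) * A s" using doubling by blast
 hence "A (s + 1) \<le> D * exp (g * 1) * A s" if "s \<ge> s0" for s using that zero_le_one by blast
 thus ?thesis using ev_top by blast
qed

text \<open>In the large case \<open>f\<close> beats both polynomials in the direction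
  \<open>w1\<close>, so \<open>Re G1\<close> and \<open>Re G0\<close> are nonnegative there; this is
  the point that \<open>eventually_deriv_bound\<close> asks for. The margin \<open>d\<close> leaves
  room for cuts at shifted directions.\<close>

lemma large_log_derivs:
 assumes Large and d: "0 \<le> d" "w1 + d < a1" "w2 + d < a0 + 2 * pi"
 shows "\<exists>N::nat. EV s. (\<forall>t\<in>{w1..w2 + d}. norm (ld1 (Complex s t)) \<le> exp (real N * s)) \<and>
   (\<forall>t\<in>{w2 - 2 * pi..w1 + d}. norm (ld0 (Complex s t)) \<le> exp (real N * s))"
proof -
 obtain D where D: "EV s. A (s + 1) \<le> D * A s" using growth_step by blast
 have "gap_arc w1 w1" using omega by (simp add: gap_arc_def)
 then obtain c where e: "c > 0" "EV s. hi w1 w1 c s"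
  using assms(1) unfolding Large_def by blast
 have e2: "c / 2 > 0" using e by simp
 have A2: "EV s. A s \<ge> 4 / c" using A_at_top by (simp add: filterlim_at_top)
 have R: "EV s. Re (G1 (Complex s w1)) \<ge> 0 \<and> Re (G0 (Complex s w1)) \<ge> 0"
  using e(2) poly_le_exp_A[OF p1 e2] poly_le_exp_A[OF p0 e2] A2
 proof eventually_elim
  case (elim s)
  let ?z = "pt s w1"
  have in1: "Complex s w1 \<in> strip1" "Complex s w1 \<in> strip0" using omega ang by auto
  have big: "exp (c / 2 * A s) \<ge> 2"
  proof -
   have "c / 2 * A s \<ge> 2" using elim(4) e(1) by (simp add: field_simps)
   thus ?thesis using exp_ge_add_one_self[of "c / 2 * A s"] by linarith
  qed
  have sq: "exp (c * A s) = exp (c / 2 * A s) * exp (c / 2 * A s)" by (simp add: mult_exp_exp field_simps)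
  have "exp (c / 2 * A s) * 1 \<le> exp (c / 2 * A s) * norm (F1 ?z)"
  proof -
   have "exp (c / 2 * A s) * 1 \<le> exp (c / 2 * A s) * exp (c / 2 * A s)" using big by (intro mult_left_mono) linarith+
   also have "\<dots> \<le> norm (poly p1 ?z) * norm (F1 ?z)" using elim(1) unfolding sq[symmetric] by (simp add: f1 norm_mult)
   also have "\<dots> \<le> exp (c / 2 * A s) * norm (F1 ?z)" using elim(2) by (intro mult_right_mono) auto
   finally show ?thesis .
  qed
  hence F1: "norm (F1 ?z) \<ge> 1" by (simp only: mult_le_cancel_left_pos exp_gt_zero)
  have "exp (c / 2 * A s) * 1 \<le> exp (c / 2 * A s) * norm (F0 ?z)"
  proof -
   have "2 * exp (c / 2 * A s) \<le> exp (c / 2 * A s) * exp (c / 2 * A s)" using big by (intro mult_right_mono) auto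
   moreover have "norm (f ?z) - 1 \<le> norm (f ?z - 1)" using norm_triangle_ineq2[of "f ?z" 1] by simp
   moreover have "exp (c * A s) \<le> norm (f ?z)" using elim(1) by simp
   ultimately have "exp (c / 2 * A s) * 1 \<le> norm (f ?z - 1)" using big unfolding sq by linarith
   also have "\<dots> = norm (poly p0 ?z) * norm (F0 ?z)" by (simp add: f0 norm_mult)
   also have "\<dots> \<le> exp (c / 2 * A s) * norm (F0 ?z)" using elim(3) by (intro mult_right_mono) auto
   finally show ?thesis .
  qed
  hence F0: "norm (F0 ?z) \<ge> 1" by (simp only: mult_le_cancel_left_pos exp_gt_zero)
  show ?case using F1 F0 S1.FG[OF in1(1)] S0.FG[OF in1(2)] by simp
 qed
 have ev1: "EV s. \<exists>t\<in>{w1..w2 + d}. Re (G1 (Complex s t)) \<ge> 0"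
  using R by eventually_elim (use omega d in force)
 have ev0: "EV s. \<exists>t\<in>{w2 - 2 * pi..w1 + d}. Re (G0 (Complex s t)) \<ge> 0"
  using R by eventually_elim (use omega d in force)
 obtain K1 where K1: "EV s. \<forall>t\<in>{w1..w2 + d}. norm (deriv G1 (Complex s t)) \<le> K1 * A s"
  using S1.eventually_deriv_bound[OF _ _ _ D A_at_top ev1] omega d by force
 obtain K0 where K0: "EV s. \<forall>t\<in>{w2 - 2 * pi..w1 + d}. norm (deriv G0 (Complex s t)) \<le> K0 * A s"
  using S0.eventually_deriv_bound[OF _ _ _ D A_at_top ev0] omega d by force
 obtain N1 :: nat where N1: "EV s. \<forall>t\<in>{w1..w2 + d}. norm (ld1 (Complex s t)) \<le> exp (real N1 * s)"
  using S1.log_deriv_bound[OF omega(1) d(3) f1 p1 K1 A_order] unfolding ld1_def by blast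
 obtain N0 :: nat where N0: "EV s. \<forall>t\<in>{w2 - 2 * pi..w1 + d}. norm (ld0 (Complex s t)) \<le> exp (real N0 * s)"
 proof -
  have "deriv (\<lambda>z. f z - 1) = deriv f"
   by (rule ext) (auto intro!: DERIV_imp_deriv derivative_eq_intros holomorphic_derivI[OF f_holomorphic[of UNIV]])
  thus thesis using S0.log_deriv_bound[OF omega(7) d(2) f0 p0 K0 A_order] that unfolding ld0_def by (auto simp: o_def)
 qed
 have "EV s. (\<forall>t\<in>{w1..w2 + d}. norm (ld1 (Complex s t)) \<le> exp (real (max N1 N0) * s)) \<and>
   (\<forall>t\<in>{w2 - 2 * pi..w1 + d}. norm (ld0 (Complex s t)) \<le> exp (real (max N1 N0) * s))"
  using N1 N0 eventually_ge_at_top[of 0]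
 proof eventually_elim
  case (elim s)
  have "exp (real N1 * s) \<le> exp (real (max N1 N0) * s)" "exp (real N0 * s) \<le> exp (real (max N1 N0) * s)"
   using elim(3) by (auto intro!: mult_right_mono)
  thus ?case using elim(1,2) by (meson order_trans)
 qed
 thus ?thesis by blast
qed

text \<open>\<open>ld1 - ld0 = - ld1 / (f - 1)\<close>, and \<open>f\<close> exceeds every power of
  \<open>exp s\<close>, because \<open>A s / s\<close> tends to infinity.\<close>

lemma large_jump:
 assumes Large and "gap_arc t t" and N: "EV s. norm (ld1 (Complex s t)) \<le> exp (real N * s)"
 shows "EV s. \<forall>w. exp w = pt s t \<longrightarrow> norm (ld1 (Complex s t) - ld0 w) \<le> exp (- s)"
proof -
 obtain d where e: "d > 0" "EV s. hi t t d s"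
  using assms unfolding Large_def by blast
 have A1: "EV s. A s / s \<ge> (real N + 2) / d" using A_transc by (simp add: filterlim_at_top)
 show ?thesis using e(2) N A1 eventually_ge_at_top[of 1]
 proof eventually_elim
  case (elim s)
  let ?z = "pt s t"
  have "(real N + 2) * s \<le> d * A s" using elim(3,4) e(1) by (simp add: field_simps)
  hence le: "exp ((real N + 2) * s) \<le> norm (f ?z)" using elim(1) by (meson atLeastAtMost_iff exp_le_cancel_iff order_refl order_trans)
  have "exp s \<ge> 2" using elim(4) exp_ge_add_one_self[of s] by linarith
  hence "2 * exp ((real N + 1) * s) \<le> exp s * exp ((real N + 1) * s)" by (intro mult_right_mono) auto
  also have "\<dots> = exp ((real N + 2) * s)" by (simp add: mult_exp_exp algebra_simps)
  finally have "2 * exp ((real N + 1) * s) \<le> norm (f ?z)" using le by linarith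
  moreover have "exp ((real N + 1) * s) \<ge> 1" using elim(4) by simp
  moreover have "norm (f ?z) - 1 \<le> norm (f ?z - 1)" using norm_triangle_ineq2[of "f ?z" 1] by simp
  ultimately have g: "exp ((real N + 1) * s) \<le> norm (f ?z - 1)" by linarith
  have nz: "f ?z \<noteq> 0" "f ?z - 1 \<noteq> 0" using le g exp_gt_zero[of "(real N + 2) * s"] exp_gt_zero[of "(real N + 1) * s"] by (auto simp del: exp_gt_zero)
  show ?case
  proof (intro allI impI)
   fix w assume "exp w = ?z"
   hence "ld1 (Complex s t) - ld0 w = - (ld1 (Complex s t) / (f ?z - 1))"
    using nz by (simp add: ld1_def ld0_def divide_simps) (simp add: algebra_simps)
   hence "norm (ld1 (Complex s t) - ld0 w) \<le> exp (real N * s) / exp ((real N + 1) * s)"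
    using elim(2) g by (simp add: norm_divide) (intro frac_le; simp)
   also have "\<dots> = exp (- s)" by (simp add: exp_diff[symmetric] algebra_simps)
   finally show "norm (ld1 (Complex s t) - ld0 w) \<le> exp (- s)" .
  qed
 qed
qed

abbreviation "near q B a b c d s \<equiv> (\<forall>t\<in>{a..b}. norm (ld1 (Complex s t) - poly q (pt s t)) \<le> B) \<and>
 (\<forall>t\<in>{c..d}. norm (ld0 (Complex s t) - poly q (pt s t)) \<le> B)"

text \<open>\<open>split\<close> with cuts in the directions \<open>w1 + d\<close> and
  \<open>w2 + d\<close>. The estimate is lost within the angle \<open>e\<close> of a cut;
  \<open>d\<close> is a parameter so that other cuts can cover these angles. The polynomial does not
  depend on \<open>e\<close>.\<close>

lemma large_split:
 assumes Large and d: "0 \<le> d" "w1 + d < a1" "w2 + d < a0 + 2 * pi"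
 shows "\<exists>q. \<forall>e. 0 < e \<and> e < pi \<longrightarrow> (\<exists>B. EV s.
   near q B (w1 + d + e) (w2 + d - e) (w2 + d - 2 * pi + e) (w1 + d - e) s)"
proof -
 define k1 k2 where "k1 = w1 + d" and "k2 = w2 + d"
 note om = omega
 obtain N :: nat where N: "EV s. (\<forall>y\<in>{w1..w2 + d}. norm (ld1 (Complex s y)) \<le> exp (real N * s)) \<and>
   (\<forall>y\<in>{w2 - 2 * pi..w1 + d}. norm (ld0 (Complex s y)) \<le> exp (real N * s))"
  using large_log_derivs[OF assms] by blast
 have N1: "EV s. norm (ld1 (Complex s k1)) \<le> exp (real N * s)" "EV s. norm (ld1 (Complex s k2)) \<le> exp (real N * s)"
  using N by (eventually_elim, use om d in \<open>simp add: k1_def k2_def\<close>)+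
 have ga: "gap_arc k1 k1" "gap_arc k2 k2" using om d by (auto simp: gap_arc_def k1_def k2_def)
 obtain s1 where s1: "\<And>s. s \<ge> s1 \<Longrightarrow> (\<forall>y\<in>{w1..w2 + d}. norm (ld1 (Complex s y)) \<le> exp (real N * s)) \<and>
   (\<forall>y\<in>{w2 - 2 * pi..w1 + d}. norm (ld0 (Complex s y)) \<le> exp (real N * s))" using N by (auto simp: ev_top)
 obtain s2 where s2: "\<And>s w. s \<ge> s2 \<Longrightarrow> exp w = pt s k1 \<Longrightarrow> norm (ld1 (Complex s k1) - ld0 w) \<le> exp (- s)"
  using large_jump[OF assms(1) ga(1) N1(1)] by (auto simp: ev_top)
 obtain s3 where s3: "\<And>s w. s \<ge> s3 \<Longrightarrow> exp w = pt s k2 \<Longrightarrow> norm (ld1 (Complex s k2) - ld0 w) \<le> exp (- s)"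
  using large_jump[OF assms(1) ga(2) N1(2)] by (auto simp: ev_top)
 obtain s4 where s4: "\<And>s. s \<ge> s4 \<Longrightarrow> \<forall>w. Re w = s \<longrightarrow>
  (w \<in> strip1 \<longrightarrow> f (exp w) \<noteq> 0) \<and> (w \<in> strip0 \<longrightarrow> f (exp w) \<noteq> 1)"
  using nonzero_far by (auto simp: ev_top)
 define s0 where "s0 = max 0 (max (max s1 s2) (max s3 s4)) + 1"
 have s0: "s0 \<ge> 0" "s0 \<ge> s1" "s0 \<ge> s2" "s0 \<ge> s3" "s0 - 1 \<ge> s4" by (auto simp: s0_def)
 let ?U1 = "strip1 \<inter> {w. s0 - 1 < Re w}" and ?U0 = "strip0 \<inter> {w. s0 - 1 < Re w}"
 have df: "deriv f holomorphic_on X" for X using holomorphic_deriv[OF f_holomorphic open_UNIV] holomorphic_on_subset by blast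
 have cx: "(\<lambda>w. g (exp w)) holomorphic_on X" if "g holomorphic_on UNIV" for g :: "complex \<Rightarrow> complex" and X
  by (rule hol_compose[OF _ that]) (auto intro: holomorphic_intros)
 interpret split_pair ld1 ld0 k1 k2 s0 N ?U1 ?U0
 proof
  show "k1 < k2" "k2 < k1 + 2 * pi" using om by (auto simp: k1_def k2_def)
  show "0 \<le> s0" by (rule s0)
  show "convex ?U1" "convex ?U0" by (intro convex_Int convex_strip convex_halfspace_Re_gt)+
  show "open ?U1" "open ?U0" by (intro open_Int open_strip open_halfspace_Re_gt)+
  show "{w. s0 \<le> Re w \<and> k1 \<le> Im w \<and> Im w \<le> k2} \<subseteq> ?U1" "{w. s0 \<le> Re w \<and> k2 - 2 * pi \<le> Im w \<and> Im w \<le> k1} \<subseteq> ?U0"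
   using om d by (auto simp: k1_def k2_def)
  have "f (exp w) \<noteq> 0" if "w \<in> ?U1" for w using s4[of "Re w"] s0(5) that by auto
  thus "ld1 holomorphic_on ?U1" unfolding ld1_def
   by (intro holomorphic_intros cx df f_holomorphic) auto
  have "f (exp w) - 1 \<noteq> 0" if "w \<in> ?U0" for w using s4[of "Re w"] s0(5) that by auto
  thus "ld0 holomorphic_on ?U0" unfolding ld0_def
   by (intro holomorphic_intros cx df f_holomorphic) auto
  show "norm (ld1 w) \<le> exp (real N * Re w)" if "s0 \<le> Re w" "k1 \<le> Im w" "Im w \<le> k2" for w
   using s1[of "Re w", THEN conjunct1, rule_format, of "Im w"] that s0 d by (simp add: k1_def k2_def complex_surj)
  show "norm (ld0 w) \<le> exp (real N * Re w)" if "s0 \<le> Re w" "k2 - 2 * pi \<le> Im w" "Im w \<le> k1" for w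
   using s1[of "Re w", THEN conjunct2, rule_format, of "Im w"] that s0 d by (simp add: k1_def k2_def complex_surj)
  show "norm (ld1 (Complex t k1) - ld0 (Complex t k1)) \<le> exp (- t)" if "s0 \<le> t" for t
   using s2[of t "Complex t k1"] that s0 by simp
  show "norm (ld1 (Complex t k2) - ld0 (Complex t (k2 - 2 * pi))) \<le> exp (- t)" if "s0 \<le> t" for t
   using s3[of t "Complex t (k2 - 2 * pi)"] that s0 pt_shift by simp
 qed
 from split obtain q where q: "\<And>e. 0 < e \<and> e < pi \<Longrightarrow> \<exists>B. \<forall>z. s0 + 1 \<le> Re z \<and> cos (k1 - Im z) \<le> cos e \<and> cos (k2 - Im z) \<le> cos e \<longrightarrow>
   (k1 < Im z \<and> Im z < k2 \<longrightarrow> norm (ld1 z - poly q (exp z)) \<le> B) \<and>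
   (k2 - 2 * pi < Im z \<and> Im z < k1 \<longrightarrow> norm (ld0 z - poly q (exp z)) \<le> B)" by blast
 show ?thesis
 proof (intro exI[of _ q] allI impI)
  fix e :: real assume eta: "0 < e \<and> e < pi"
  from q[OF this] obtain B where B: "\<And>z. s0 + 1 \<le> Re z \<Longrightarrow> cos (k1 - Im z) \<le> cos e \<Longrightarrow> cos (k2 - Im z) \<le> cos e \<Longrightarrow>
   (k1 < Im z \<and> Im z < k2 \<longrightarrow> norm (ld1 z - poly q (exp z)) \<le> B) \<and>
   (k2 - 2 * pi < Im z \<and> Im z < k1 \<longrightarrow> norm (ld0 z - poly q (exp z)) \<le> B)" by blast
  show "\<exists>B. EV s.
   near q B (w1 + d + e) (w2 + d - e) (w2 + d - 2 * pi + e) (w1 + d - e) s"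
  proof (rule exI[of _ B])
   show "EV s.
   near q B (w1 + d + e) (w2 + d - e) (w2 + d - 2 * pi + e) (w1 + d - e) s"
    using eventually_ge_at_top[of "s0 + 1"]
   proof eventually_elim
    case (elim s)
    show ?case
    proof (intro conjI ballI)
     fix y assume "y \<in> {w1 + d + e..w2 + d - e}"
     hence th: "k1 + e \<le> y" "y \<le> k2 - e" by (auto simp: k1_def k2_def)
     have "cos (y - k1) \<le> cos e" "cos (k2 - y) \<le> cos e" using th heights eta by (intro cos_le_cos_of_mem; simp)+
     hence "cos (k1 - y) \<le> cos e" "cos (k2 - y) \<le> cos e" by (metis cos_minus minus_diff_eq)+
     thus "norm (ld1 (Complex s y) - poly q (pt s y)) \<le> B" using B[of "Complex s y"] elim th eta by simp
    next
     fix y assume "y \<in> {w2 + d - 2 * pi + e..w1 + d - e}"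
     hence th: "k2 - 2 * pi + e \<le> y" "y \<le> k1 - e" by (auto simp: k1_def k2_def)
     have "cos (k1 - y) \<le> cos e" "cos (k2 - y) \<le> cos e" using th heights eta by (intro cos_le_cos_of_mem; simp)+
     thus "norm (ld0 (Complex s y) - poly q (pt s y)) \<le> B" using B[of "Complex s y"] elim th eta by simp
    qed
   qed
  qed
 qed
qed

end

lemma poly_bounded_on_ray:
 fixes r :: "complex poly"
 assumes "EV s. norm (poly r (pt s m)) \<le> M"
 shows "\<exists>c. r = [:c:]"
proof (rule ccontr)
 assume "\<not> ?thesis"
 hence "degree r \<noteq> 0" by (metis degree_eq_zeroE)
 hence "filterlim (poly r) at_infinity at_infinity" by (intro filterlim_poly_at_infinity) auto
 moreover have "filterlim (\<lambda>s. pt s m) at_infinity at_top"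
  by (rule filterlim_norm_at_top_imp_at_infinity) (simp add: exp_at_top)
 ultimately have "filterlim (\<lambda>s. poly r (pt s m)) at_infinity at_top" by (rule filterlim_compose)
 hence "EV s. norm (poly r (pt s m)) \<ge> \<bar>M\<bar> + 1"
  by (simp add: filterlim_at_infinity[OF order_refl])
 with assms have "\<forall>\<^sub>F s in at_top :: real filter. False" by eventually_elim linarith
 thus False by simp
qed

text \<open>For \<open>v = h * exp (- Q)\<close> the logarithmic derivative with respect to
  \<open>w\<close> is that of \<open>h\<close> minus \<open>q\<close> plus \<open>c0\<close>, hence
  bounded. So \<open>ln (norm v)\<close> grows at most linearly in \<open>s\<close>, and
  \<open>v\<close> is at most a power of \<open>exp s\<close>. The constant term \<open>c0\<close>
  cannot be part of \<open>z * Q'\<close> and is carried along as an error.\<close>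

lemma log_deriv_near_poly_growth:
 fixes h :: "complex \<Rightarrow> complex" and q Q :: "complex poly"
 assumes h: "h holomorphic_on UNIV" and ab: "l < a" "b < u"
  and nz: "EV s. \<forall>w. Re w = s \<longrightarrow> w \<in> strip l u \<longrightarrow> h (exp w) \<noteq> 0"
  and q: "q = pCons c0 (pderiv Q)"
  and ld: "EV s. \<forall>x\<in>{a..b}. norm (pt s x * deriv h (pt s x) / h (pt s x) - poly q (pt s x)) \<le> B"
 shows "\<exists>n::nat. EV s. \<forall>x\<in>{a..b}. norm (deriv h (pt s x) * exp (- poly Q (pt s x))) \<le> exp (real n * s)"
proof -
 obtain s1 where s1: "\<And>w. Re w \<ge> s1 \<Longrightarrow> w \<in> strip l u \<Longrightarrow> h (exp w) \<noteq> 0" using nz by (auto simp: ev_top)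
 obtain s2 where s2: "\<And>s x. s \<ge> s2 \<Longrightarrow> x \<in> {a..b} \<Longrightarrow> norm (pt s x * deriv h (pt s x) / h (pt s x) - poly q (pt s x)) \<le> B"
  using ld unfolding ev_top by blast
 define s0 where "s0 = max 0 (max s1 s2) + 1"
 have s0: "s0 \<ge> 0" "s0 - 1 \<ge> s1" "s0 \<ge> s2" by (auto simp: s0_def)
 define v where "v = (\<lambda>z. h z * exp (- poly Q z))"
 define u' where "u' = (\<lambda>w. v (exp w))"
 define U where "U = strip l u \<inter> {w. s0 - 1 < Re w}"
 have U: "convex U" "open U" unfolding U_def
  by (intro convex_Int convex_strip convex_halfspace_Re_gt open_Int open_strip open_halfspace_Re_gt)+
 have hv: "v holomorphic_on UNIV" unfolding v_def by (intro holomorphic_intros h)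
 have hu: "u' holomorphic_on U" unfolding u'_def
  by (rule hol_compose[OF _ hv]) (auto intro: holomorphic_intros)
 have hnz: "h (exp w) \<noteq> 0" if "w \<in> U" for w using s1[of w] that s0 by (auto simp: U_def)
 have unz: "u' w \<noteq> 0" if "w \<in> U" for w using hnz[OF that] by (simp add: u'_def v_def)
 have du: "deriv u' w / u' w = exp w * deriv h (exp w) / h (exp w) - poly q (exp w) + c0" if "w \<in> U" for w
 proof -
  let ?z = "exp w"
  have dh: "(h has_field_derivative deriv h ?z) (at ?z)" using h holomorphic_derivI by blast
  have dv: "(v has_field_derivative deriv h ?z * exp (- poly Q ?z) + h ?z * (exp (- poly Q ?z) * (- poly (pderiv Q) ?z))) (at ?z)"
   unfolding v_def by (auto intro!: derivative_eq_intros dh poly_DERIV)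
  have "(u' has_field_derivative (deriv h ?z * exp (- poly Q ?z) + h ?z * (exp (- poly Q ?z) * (- poly (pderiv Q) ?z))) * ?z) (at w)"
   unfolding u'_def by (rule DERIV_chain'[OF DERIV_exp dv])
  hence "deriv u' w = exp (- poly Q ?z) * (?z * deriv h ?z - h ?z * (?z * poly (pderiv Q) ?z))"
   by (simp add: DERIV_imp_deriv algebra_simps)
  also have "\<dots> = u' w * (?z * deriv h ?z / h ?z - ?z * poly (pderiv Q) ?z)"
   unfolding u'_def v_def using hnz[OF that] by (simp add: field_simps)
  finally show ?thesis using unz[OF that] by (simp add: q)
 qed
 have "bounded (v ` sphere 0 (exp s0))"
  by (intro compact_imp_bounded compact_continuous_image holomorphic_on_imp_continuous_on holomorphic_on_subset[OF hv]) auto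
 then obtain M where "\<forall>y\<in>v ` sphere 0 (exp s0). norm y \<le> M" unfolding bounded_iff by blast
 hence M: "norm (v z) \<le> M" if "norm z = exp s0" for z using that by simp
 define B1 where "B1 = \<bar>B\<bar> + norm c0"
 have bound: "norm (v (pt s x)) \<le> M * exp (B1 * s)" if s: "s \<ge> s0" and th: "x \<in> {a..b}" for s x
 proof -
  have "norm (u' (Complex s x)) \<le> norm (u' (Complex s0 x)) * exp (B1 * (s - s0))"
  proof (rule norm_le_of_log_deriv[OF hu U unz s])
   fix t assume t: "s0 \<le> t" "t \<le> s"
   have i: "Complex t x \<in> U" using t th ab by (auto simp: U_def)
   have "norm (deriv u' (Complex t x) / u' (Complex t x)) \<le> B1"
    unfolding du[OF i] B1_def using s2[of t x] t s0 th by (intro norm_triangle_le add_mono) auto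
   thus "Complex t x \<in> U \<and> norm (deriv u' (Complex t x) / u' (Complex t x)) \<le> B1" using i by simp
  qed
  also have "\<dots> \<le> M * exp (B1 * s)"
  proof (rule mult_mono)
   show "norm (u' (Complex s0 x)) \<le> M" unfolding u'_def by (rule M) simp
   thus "0 \<le> M" using norm_ge_zero order_trans by blast
   have "B1 \<ge> 0" by (simp add: B1_def)
   thus "exp (B1 * (s - s0)) \<le> exp (B1 * s)" using s0(1) by (simp add: mult_left_mono)
  qed auto
  finally show ?thesis by (simp add: u'_def)
 qed
 obtain D R where D: "\<And>z. norm z \<ge> R \<Longrightarrow> norm (poly q z) \<le> norm z ^ D"
 proof (cases "q = 0")
  case True thus thesis using that[of 0 0] by simp
 next
  case False thus thesis using poly_norm_bounds[OF False] that by metis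
 qed
 define n where "n = D + 2 + nat \<lceil>B1\<rceil>"
 have n: "real n \<ge> real D + 2 + B1" unfolding n_def by linarith
 have "EV s. exp s \<ge> \<bar>M\<bar>" "EV s. exp s \<ge> \<bar>B\<bar> + 1" "EV s. exp s \<ge> R" by real_asymp+
 hence "EV s. \<forall>x\<in>{a..b}. norm (deriv h (pt s x) * exp (- poly Q (pt s x))) \<le> exp (real n * s)"
  using eventually_ge_at_top[of s0]
 proof eventually_elim
  case (elim s)
  have s: "s \<ge> 0" using elim s0 by simp
  show ?case
  proof
   fix x assume th: "x \<in> {a..b}"
   let ?w = "Complex s x" let ?z = "exp ?w"
   have i: "?w \<in> U" using elim th ab by (auto simp: U_def)
   let ?L = "?z * deriv h ?z / h ?z"
   have "norm ?L \<le> norm (?L - poly q ?z) + norm (poly q ?z)" by (metis norm_triangle_sub add.commute)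
   also have "norm (?L - poly q ?z) \<le> \<bar>B\<bar>" using s2[of s x] elim s0 th by simp
   also have "norm (poly q ?z) \<le> exp s ^ D" using D[of ?z] elim by simp
   also have "\<bar>B\<bar> + exp s ^ D \<le> \<bar>B\<bar> * exp s ^ D + exp s ^ D" using s by (simp add: mult_le_cancel_left1 one_le_power)
   also have "\<dots> = (\<bar>B\<bar> + 1) * exp s ^ D" by (simp add: algebra_simps)
   also have "\<dots> \<le> exp s * exp s ^ D" using elim by (intro mult_right_mono) auto
   finally have L: "norm ?L \<le> exp s * exp s ^ D" by simp
   have "deriv h ?z * exp (- poly Q ?z) = ?L * v ?z / ?z" using hnz[OF i] by (simp add: v_def)
   hence "norm (deriv h ?z * exp (- poly Q ?z)) = norm ?L * norm (v ?z) / exp s" by (simp add: norm_mult norm_divide)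
   also have "\<dots> \<le> norm ?L * norm (v ?z) / 1" using s by (intro divide_left_mono) auto
   also have "\<dots> \<le> (exp s * exp s ^ D) * (exp s * exp (B1 * s))"
   proof -
    have "norm (v ?z) \<le> M * exp (B1 * s)" using bound elim th by blast
    also have "\<dots> \<le> exp s * exp (B1 * s)" using elim by (intro mult_right_mono) auto
    finally show ?thesis using L by (simp only: div_by_1) (intro mult_mono; simp)
   qed
   also have "\<dots> = exp ((real D + 2 + B1) * s)" by (simp add: mult_exp_exp exp_of_nat_mult[symmetric] algebra_simps)
   also have "\<dots> \<le> exp (real n * s)" using mult_right_mono[OF n s] by simp
   finally show "norm (deriv h ?z * exp (- poly Q ?z)) \<le> exp (real n * s)" .
  qed
 qed
 thus ?thesis by blast
qed

context separated begin

text \<open>Two splittings with cuts shifted by \<open>2 * e\<close> give polynomials that are both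
  close to \<open>ld1\<close> on a common ray, so they differ by a constant. One polynomial then
  serves for all directions, with arcs that meet at \<open>w1 + j\<close> and
  \<open>w2 + j\<close>.\<close>

lemma large_bounded:
 assumes Large
 shows "\<exists>q j B. 0 < j \<and> w1 + j < a1 \<and> w2 + j < a0 + 2 * pi \<and> (EV s.
   near q B (w1 + j) (w2 + j) (w2 - 2 * pi + j) (w1 + j) s)"
proof -
 \<comment> \<open>An eighth of the smallest margin: arcs shifted by up to \<open>3 * e\<close>
   still lie in the gaps and overlap.\<close>
 define e where "e = Min {a1 - w1, a0 + 2 * pi - w2, w2 - w1, w1 - (w2 - 2 * pi), pi} / 8"
 have e: "e > 0" "8 * e \<le> a1 - w1" "8 * e \<le> a0 + 2 * pi - w2" "8 * e \<le> w2 - w1" "8 * e \<le> w1 - (w2 - 2 * pi)" "8 * e \<le> pi"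
  using omega by (auto simp: e_def)
 have d: "0 < e \<and> e < pi" using e pi_gt_zero by linarith
 obtain q B where q: "EV s.
   near q B (w1 + e) (w2 - e) (w2 - 2 * pi + e) (w1 - e) s"
 proof -
  have "0 \<le> (0::real)" "w1 + 0 < a1" "w2 + 0 < a0 + 2 * pi" using omega by auto
  from large_split[OF assms this] d that show thesis by (auto simp only: add_0_right)
 qed
 have d2: "0 \<le> 2 * e" "w1 + 2 * e < a1" "w2 + 2 * e < a0 + 2 * pi" using e by linarith+
 obtain q' B' where q': "EV s.
   near q' B' (w1 + 2 * e + e) (w2 + 2 * e - e) (w2 + 2 * e - 2 * pi + e) (w1 + 2 * e - e) s"
  using large_split[OF assms d2] d by blast
 have "EV s. norm (poly (q - q') (pt s ((w1 + w2) / 2))) \<le> B + B'"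
  using q q'
 proof eventually_elim
  case (elim s)
  let ?m = "(w1 + w2) / 2"
  have "norm (ld1 (Complex s ?m) - poly q (pt s ?m)) \<le> B" using elim(1) e by (auto simp: field_simps)
  moreover have "norm (ld1 (Complex s ?m) - poly q' (pt s ?m)) \<le> B'" using elim(2) e by (auto simp: field_simps)
  moreover have "poly (q - q') (pt s ?m) = (ld1 (Complex s ?m) - poly q' (pt s ?m)) - (ld1 (Complex s ?m) - poly q (pt s ?m))" by simp
  ultimately show ?case by (metis (no_types, lifting) add.commute add_mono norm_triangle_le_diff)
 qed
 then obtain c where c: "q - q' = [:c:]" using poly_bounded_on_ray by blast
 define B2 where "B2 = max B (B' + norm c)"
 have conv: "norm (x - poly q w) \<le> B2" if "norm (x - poly q' w) \<le> B'" for x w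
 proof -
  have "poly q w = poly q' w + c" using arg_cong[OF c, of "\<lambda>p. poly p w"] by (simp add: diff_eq_eq add.commute)
  hence "x - poly q w = (x - poly q' w) - c" by simp
  hence "norm (x - poly q w) \<le> norm (x - poly q' w) + norm c" by (metis norm_triangle_ineq4)
  thus ?thesis using that by (simp add: B2_def)
 qed
 have "EV s. (\<forall>t\<in>{w1 + e..w2 + e}. norm (ld1 (Complex s t) - poly q (pt s t)) \<le> B2) \<and>
   (\<forall>t\<in>{w2 - 2 * pi + e..w1 + e}. norm (ld0 (Complex s t) - poly q (pt s t)) \<le> B2)"
  using q q'
 proof eventually_elim
  case (elim s)
  show ?case
  proof (intro conjI ballI)
   fix t assume th: "t \<in> {w1 + e..w2 + e}"
   show "norm (ld1 (Complex s t) - poly q (pt s t)) \<le> B2"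
   proof (cases "t \<le> w2 - e")
    case True
    hence "norm (ld1 (Complex s t) - poly q (pt s t)) \<le> B" using elim(1) th by simp
    thus ?thesis by (simp add: B2_def)
   next
    case False
    hence "t \<in> {w1 + 2 * e + e..w2 + 2 * e - e}" using th e by simp
    thus ?thesis using elim(2) conv by blast
   qed
  next
   fix t assume th: "t \<in> {w2 - 2 * pi + e..w1 + e}"
   show "norm (ld0 (Complex s t) - poly q (pt s t)) \<le> B2"
   proof (cases "t \<le> w1 - e")
    case True
    hence "norm (ld0 (Complex s t) - poly q (pt s t)) \<le> B" using elim(1) th by simp
    thus ?thesis by (simp add: B2_def)
   next
    case False
    hence "t \<in> {w2 + 2 * e - 2 * pi + e..w1 + 2 * e - e}" using th e by simp
    thus ?thesis using elim(2) conv by blast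
   qed
  qed
 qed
 moreover have "w1 + e < a1" "w2 + e < a0 + 2 * pi" using e by linarith+
 ultimately show ?thesis using e(1) by blast
qed

text \<open>\<open>f\<close> and \<open>f - 1\<close> have the same derivative, so the estimates on
  the two arcs concern one entire function \<open>deriv f * exp (- Q)\<close>; by its polynomial
  growth it is a polynomial.\<close>

theorem large_case:
 assumes Large
 shows "\<exists>p q. \<forall>z. deriv f z = poly p z * exp (poly q z)"
proof -
 obtain q j B where eta: "0 < j" "w1 + j < a1" "w2 + j < a0 + 2 * pi" and q: "EV s.
   near q B (w1 + j) (w2 + j) (w2 - 2 * pi + j) (w1 + j) s"
  using large_bounded[OF assms] by blast
 obtain c0 q1 where q1: "q = pCons c0 q1" by (cases q)
 obtain Q where Q: "pderiv Q = q1" using pderiv_surj by blast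
 have qQ: "q = pCons c0 (pderiv Q)" using q1 Q by simp
 have d: "deriv (\<lambda>z. f z - 1) = deriv f"
  by (rule ext) (auto intro!: DERIV_imp_deriv derivative_eq_intros holomorphic_derivI[OF f_holomorphic[of UNIV]])
 have a1: "EV s. \<forall>t\<in>{w1 + j..w2 + j}. norm (pt s t * deriv f (pt s t) / f (pt s t) - poly q (pt s t)) \<le> B"
  using q by eventually_elim (simp add: ld1_def)
 have a0: "EV s. \<forall>t\<in>{w2 - 2 * pi + j..w1 + j}. norm (pt s t * deriv (\<lambda>z. f z - 1) (pt s t) / (f (pt s t) - 1) - poly q (pt s t)) \<le> B"
  unfolding d using q by eventually_elim (simp add: ld0_def)
 have n1: "EV s. \<forall>w. Re w = s \<longrightarrow> w \<in> strip1 \<longrightarrow> f (exp w) \<noteq> 0" using nonzero_far by eventually_elim blast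
 have n0: "EV s. \<forall>w. Re w = s \<longrightarrow> w \<in> strip0 \<longrightarrow> f (exp w) - 1 \<noteq> 0" using nonzero_far by eventually_elim auto
 have l1: "b0 < w1 + j" "b1 - 2 * pi < w2 - 2 * pi + j" using omega eta by linarith+
 have hf: "(\<lambda>z. f z - 1) holomorphic_on UNIV" by (intro holomorphic_intros f_holomorphic)
 obtain m1 :: nat where m1: "EV s. \<forall>t\<in>{w1 + j..w2 + j}. norm (deriv f (pt s t) * exp (- poly Q (pt s t))) \<le> exp (real m1 * s)"
  using log_deriv_near_poly_growth[OF f_holomorphic l1(1) eta(3) n1 qQ a1] by blast
 obtain m0 :: nat where m0: "EV s. \<forall>t\<in>{w2 - 2 * pi + j..w1 + j}. norm (deriv f (pt s t) * exp (- poly Q (pt s t))) \<le> exp (real m0 * s)"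
  using log_deriv_near_poly_growth[OF hf l1(2) eta(2) n0 qQ a0] unfolding d by blast
 define g where "g = (\<lambda>z. deriv f z * exp (- poly Q z))"
 have hg: "g holomorphic_on UNIV" unfolding g_def
  by (intro holomorphic_intros holomorphic_deriv[OF f_holomorphic]) auto
 have "EV s. \<forall>z. norm z = exp s \<longrightarrow> norm (g z) \<le> exp (real (max m1 m0) * s)"
  using m1 m0 eventually_ge_at_top[of 0]
 proof eventually_elim
  case (elim s)
  have le: "exp (real m1 * s) \<le> exp (real (max m1 m0) * s)" "exp (real m0 * s) \<le> exp (real (max m1 m0) * s)"
   using elim(3) by (auto intro!: mult_right_mono)
  show ?case
  proof (intro allI impI)
   fix z :: complex assume "norm z = exp s"
   hence "norm (z * cis (- j)) = exp s" by (simp add: norm_mult)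
   moreover have rot: "z = pt s (t + j)" if "z * cis (- j) = pt s t" for t
   proof -
    have "z * (cis (- j) * cis j) = pt s t * cis j" using that by (metis mult.assoc)
    also have "\<dots> = pt s (t + j)" by (simp add: cis_conv_exp mult_exp_exp Complex_eq algebra_simps)
    finally show ?thesis by (simp add: cis_mult)
   qed
   ultimately show "norm (g z) \<le> exp (real (max m1 m0) * s)"
   proof (cases "z * cis (- j)" rule: circle_cases)
    case (1 t)
    hence "t + j \<in> {w1 + j..w2 + j}" by simp
    from elim(1)[rule_format, OF this] le(1) show ?thesis unfolding g_def rot[OF 1(3)] by (rule order_trans)
   next
    case (2 t)
    hence "t + j \<in> {w2 - 2 * pi + j..w1 + j}" by simp
    from elim(2)[rule_format, OF this] le(2) show ?thesis unfolding g_def rot[OF 2(3)] by (rule order_trans)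
   qed
  qed
 qed
 then obtain s0 where s0: "\<And>s z. s \<ge> s0 \<Longrightarrow> norm z = exp s \<Longrightarrow> norm (g z) \<le> exp (real (max m1 m0) * s)"
  by (auto simp: ev_top)
 have "norm (g z) \<le> 1 * norm z ^ max m1 m0" if "exp s0 \<le> norm z" for z
 proof -
  have "norm z > 0" using that exp_gt_zero[of s0] by linarith
  hence e: "norm z = exp (ln (norm z))" by simp
  hence "s0 \<le> ln (norm z)" using that by (metis exp_le_cancel_iff)
  hence "norm (g z) \<le> exp (real (max m1 m0) * ln (norm z))" using s0 e by blast
  also have "\<dots> = norm z ^ max m1 m0" by (subst exp_of_nat_mult) (simp add: e[symmetric])
  finally show ?thesis by simp
 qed
 then obtain p where p: "\<And>z. g z = poly p z" using entire_poly_growth_imp_poly[OF hg] by blast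
 have "deriv f z = poly p z * exp (poly Q z)" for z
  using p[of z, symmetric] by (simp add: g_def exp_minus)
 thus ?thesis by blast
qed

end

section \<open>Decay in the left half-plane\<close>

text \<open>The Moebius map \<open>g\<close> takes the unit disc to the half-plane and 0 to
  \<open>R * w\<close>; the disc of radius \<open>k\<close> goes into the disc of radius
  \<open>4 * k * R\<close> about \<open>R * w\<close>. \<open>two_constants_disc\<close> passes
  smallness on to \<open>z\<close> with the exponent \<open>c * R * k * (1 - norm x)\<close>, and
  \<open>1 - norm x\<close> is at least of order \<open>1 / R\<close>. So \<open>R\<close> cancels,
  and smallness at arbitrarily distant places yields a fixed exponential rate.\<close>

lemma halfplane_decay:
 assumes hol: "F holomorphic_on {z. Re z < 0}" and bd: "\<And>z. Re z < 0 \<Longrightarrow> norm (F z) \<le> M" and M: "M > 0"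
  and k: "0 < k" "k \<le> 1 / 2" and c: "c \<ge> 0" and w: "norm w = 1" "Re w < 0"
  and small: "\<And>T. \<exists>R\<ge>T. \<forall>y. norm (y - of_real R * w) \<le> 4 * k * R \<longrightarrow> norm (F y) \<le> M * exp (- c * R)"
  and z: "Re z < 0"
 shows "norm (F z) \<le> M * exp (c * k * (- Re w) / 2 * Re z)"
proof -
 obtain R where R: "R \<ge> max 1 (norm z)" and small: "\<And>y. norm (y - of_real R * w) \<le> 4 * k * R \<Longrightarrow> norm (F y) \<le> M * exp (- c * R)"
  using small by blast
 have R0: "R > 0" "norm z \<le> R" using R by auto
 define W where "W = of_real R * w"
 have W: "Re W = R * Re w" "Re W < 0" "norm W = R" using w R0 by (auto simp: W_def norm_mult mult_pos_neg)
 define g where "g u = (W + u * cnj W) / (1 - u)" for u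
 have nz: "1 - u \<noteq> 0" if "norm u < 1" for u :: complex using that by auto
 have re: "Re (g u) < 0" if u: "norm u < 1" for u
 proof -
  have "Re (g u) = Re ((W + u * cnj W) * cnj (1 - u)) / (norm (1 - u))\<^sup>2"
   unfolding g_def by (simp only: complex_div_cnj[of _ "1 - u"] Re_divide_of_real flip: of_real_power)
  also have "Re ((W + u * cnj W) * cnj (1 - u)) = Re W * (1 - (norm u)\<^sup>2)"
   unfolding cmod_power2 by (simp add: algebra_simps power2_eq_square)
  finally have "Re (g u) = Re W * (1 - (norm u)\<^sup>2) / (norm (1 - u))\<^sup>2" .
  moreover have "(norm u)\<^sup>2 < 1" using u by (simp add: power_less_one_iff)
  ultimately show ?thesis using W nz[OF u] by (simp add: divide_neg_pos mult_neg_pos)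
 qed
 have holg: "g holomorphic_on ball 0 1" unfolding g_def using nz by (intro holomorphic_intros) auto
 have hol': "(\<lambda>u. F (g u)) holomorphic_on ball 0 1"
  by (rule hol_compose[OF holg hol]) (use re in auto)
 have near: "norm (F (g u)) \<le> M * exp (- (c * R))" if u: "norm u \<le> k" for u
 proof -
  have u1: "norm (1 - u) \<ge> 1 / 2" using norm_triangle_ineq2[of 1 u] u k by simp
  have "W + cnj W = of_real (2 * Re W)" by (simp add: complex_eq_iff)
  moreover have "g u - W = (W + cnj W) * u / (1 - u)" using nz[of u] u k by (simp add: g_def divide_simps) (simp add: algebra_simps)
  ultimately have "g u - W = of_real (2 * Re W) * u / (1 - u)" by (simp only:)
  hence "norm (g u - W) = 2 * \<bar>Re W\<bar> * norm u / norm (1 - u)" by (simp add: norm_mult norm_divide)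
  also have "\<dots> \<le> 2 * R * k / (1 / 2)" using u u1 abs_Re_le_cmod[of W] W k R0 by (intro frac_le mult_mono) auto
  finally show ?thesis using small[of "g u"] by (simp add: W_def mult_ac)
 qed
 define d where "d = norm (z + cnj W)"
 have "Re (z + cnj W) < 0" using z W by simp
 hence d0: "d > 0" unfolding d_def by (metis less_irrefl zero_complex.simps(1) zero_less_norm_iff)
 have d: "d \<le> 2 * R" using norm_triangle_ineq[of z "cnj W"] R0 W by (simp add: d_def)
 define x where "x = (z - W) / (z + cnj W)"
 have x2: "1 - (norm x)\<^sup>2 = 4 * (Re z * Re W) / d\<^sup>2"
 proof -
  have "d\<^sup>2 - (norm (z - W))\<^sup>2 = 4 * (Re z * Re W)" unfolding d_def cmod_power2 by (simp add: power2_eq_square algebra_simps)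
  moreover have "1 - (norm x)\<^sup>2 = (d\<^sup>2 - (norm (z - W))\<^sup>2) / d\<^sup>2"
   using d0 unfolding x_def norm_divide power_divide d_def[symmetric] by (simp add: diff_divide_distrib)
  ultimately show ?thesis by simp
 qed
 have p: "Re z * Re W > 0" using z W by (simp add: mult_neg_neg)
 have "4 * (Re z * Re W) / d\<^sup>2 > 0" using p d0 by simp
 hence "(norm x)\<^sup>2 < 1" using x2 by linarith
 hence x1: "norm x < 1" by (simp add: power_less_one_iff)
 have gx: "g x = z"
 proof -
  have z0: "z + cnj W \<noteq> 0" using d0 by (auto simp: d_def)
  have w0: "W + cnj W \<noteq> 0" using W(2) by (auto simp: complex_eq_iff)
  have "1 - x = (W + cnj W) / (z + cnj W)" "W + x * cnj W = z * (W + cnj W) / (z + cnj W)" using z0 by (auto simp: x_def divide_simps algebra_simps)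
  thus ?thesis using z0 w0 by (simp add: g_def)
 qed
 have "norm (F (g x)) \<le> M * exp (- (c * R) * k * (1 - norm x))"
  by (rule two_constants_disc[OF hol' _ M k(1) _ _ near x1]) (use bd re c R0 k in auto)
 also have "\<dots> \<le> M * exp (c * k * (- Re w) / 2 * Re z)"
 proof -
  define q where "q = Re z * Re W / d\<^sup>2"
  have "(1 - norm x) * (1 + norm x) \<le> (1 - norm x) * 2" using x1 by (intro mult_left_mono) auto
  also have "(1 - norm x) * (1 + norm x) = 4 * q" using x2 by (simp add: q_def power2_eq_square algebra_simps)
  finally have le: "t \<le> 1 - norm x" if "t / 2 \<le> q" for t using that by simp
  moreover have "Re z * Re W / (2 * R)\<^sup>2 \<le> q" unfolding q_def using d d0 p by (intro divide_left_mono power_mono) auto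
  moreover have "Re z * Re W / (2 * R)\<^sup>2 = Re z * Re w / (2 * R) / 2" using R0 unfolding W(1) by (simp add: power2_eq_square)
  ultimately have "Re z * Re w / (2 * R) \<le> 1 - norm x" by (intro le) (simp only:)
  hence "c * R * k * (Re z * Re w / (2 * R)) \<le> c * R * k * (1 - norm x)" using c R0 k by (intro mult_left_mono) auto
  moreover have "c * R * k * (Re z * Re w / (2 * R)) = c * k * Re w / 2 * Re z" using R0 by simp
  ultimately show ?thesis using M by simp
 qed
 finally show ?thesis by (simp only: gx)
qed

text \<open>If \<open>A\<close> outgrew every \<open>B e\<^bsup>s\<^esup>\<close>, the function would decay faster than every exponential.\<close>

lemma decay_imp_exp_type:
 fixes F :: "complex \<Rightarrow> complex" and A :: "real \<Rightarrow> real"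
 assumes hol: "F holomorphic_on {z. Re z < 0}" and bd: "\<And>z. Re z < 0 \<Longrightarrow> norm (F z) \<le> M" and M: "M > 0" and A_mono: "\<And>s t. s \<le> t \<Longrightarrow> A s \<le> A t"
  and d: "d > 0" and small: "\<And>z. norm z \<ge> r \<Longrightarrow> Re z \<le> - (3/4) * norm z \<Longrightarrow> norm (F z) \<le> 2 * exp (- d * A (ln (norm z)))"
  and nz: "Re z0 < 0" "F z0 \<noteq> 0"
 shows "\<exists>B>0. EV s. A s \<le> B * exp s"
proof (rule ccontr)
 assume neg: "\<not> ?thesis"
 \<comment> \<open>The disc of radius \<open>R / 8\<close> about \<open>- R\<close> lies in the
   sector where \<open>small\<close> applies, whence \<open>k = 1 / 32\<close>. Taking
   \<open>R = 2 * exp s\<close> keeps it outside the circle of radius \<open>exp s\<close>, so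
   \<open>A s\<close> bounds \<open>A\<close> from below there.\<close>
 have decay: "norm (F z0) \<le> M * exp (c * (1/32) * (- Re (-1)) / 2 * Re z0)" if c: "c > 0" for c
 proof (rule halfplane_decay[OF hol bd M _ _ _ _ _ _ nz(1)])
  fix T :: real
  define T' where "T' = ln (max 1 (max T (max r (\<bar>ln (2 / M)\<bar> / c))))"
  have "4 * c / d > 0" using c d by simp
  with neg obtain s where s: "s \<ge> T'" "A s > 4 * c / d * exp s" unfolding ev_top by (meson not_le)
  define R where "R = 2 * exp s"
  have "exp s \<ge> exp T'" using s by simp
  hence "max 1 (max T (max r (\<bar>ln (2 / M)\<bar> / c))) \<le> exp s" by (simp add: T'_def)
  hence R: "R > 0" "R \<ge> T" "exp s \<ge> r" "R \<ge> \<bar>ln (2 / M)\<bar> / c" unfolding R_def by (auto intro: order_trans[of _ "exp s"])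
  have "norm (F w) \<le> M * exp (- c * R)" if w: "norm (w - of_real R * (-1)) \<le> 4 * (1/32) * R" for w
  proof -
   have "norm (w + of_real R) \<le> 1/8 * R" using w by simp
   hence rw: "Re w + R \<le> 1/8 * R" and "norm w \<le> 9/8 * R"
    using complex_Re_le_cmod[of "w + of_real R"] norm_triangle_ineq4[of "w + of_real R" "of_real R"] R(1) by auto
   hence rw2: "Re w \<le> - (3/4) * norm w" using R(1) by linarith
   have nw2: "norm w \<ge> exp s" using rw abs_Re_le_cmod[of w] R(1) unfolding R_def by linarith
   hence "norm w \<ge> r" using R by linarith
   from small[OF this rw2] have "norm (F w) \<le> 2 * exp (- d * A (ln (norm w)))" .
   also have "\<dots> \<le> 2 * exp (- (2 * c * R))"
   proof -
    have "norm w > 0" using nw2 exp_gt_zero[of s] by linarith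
    hence "s \<le> ln (norm w)" using nw2 by (simp add: ln_ge_iff)
    hence "A s \<le> A (ln (norm w))" by (rule A_mono)
    hence "d * A s \<le> d * A (ln (norm w))" using d by simp
    moreover have "2 * c * R \<le> d * A s" using s(2) d by (simp add: R_def field_simps)
    ultimately show ?thesis by simp
   qed
   also have "\<dots> \<le> M * exp (c * R) * exp (- (2 * c * R))"
   proof (rule mult_right_mono)
    have "ln (2 / M) \<le> c * R" using R(4) c by (simp add: field_simps)
    hence "exp (ln (2 / M)) \<le> exp (c * R)" by (simp only: exp_le_cancel_iff)
    thus "2 \<le> M * exp (c * R)" using M by (simp add: field_simps)
   qed simp
   also have "\<dots> = M * exp (- c * R)" by (simp add: mult_exp_exp mult.assoc algebra_simps)
   finally show ?thesis .
  qed
  thus "\<exists>R\<ge>T. \<forall>w. norm (w - of_real R * (-1)) \<le> 4 * (1/32) * R \<longrightarrow> norm (F w) \<le> M * exp (- c * R)" using R(2) by blast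
 qed (use c in auto)
 hence "EV c. norm (F z0) \<le> M * exp (c * (Re z0 / 64))"
  by (intro eventually_at_top_linorderI[of 1]) auto
 moreover have "((\<lambda>c. M * exp (c * (Re z0 / 64))) \<longlongrightarrow> 0) at_top" using nz(1) by real_asymp
 ultimately have "norm (F z0) \<le> 0" by (intro tendsto_lowerbound) auto
 thus False using nz by simp
qed


abbreviation "log_near f h X e \<equiv> \<exists>r. \<forall>z. norm z \<ge> r \<and> Re z \<le> - e * norm z \<longrightarrow> Re z < - X \<and> norm (h z) \<le> 2 * norm (f z)"

text \<open>A function that is small in the left half-plane, normalised by a rotation, whose zeros stay away
 from the closed right half-plane and whose 1-points stay away from the open left half-plane.\<close>

locale decaying = log_side F G l u C A
 for F G :: "complex \<Rightarrow> complex" and l u C :: real and A :: "real \<Rightarrow> real" +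
 fixes f :: "complex \<Rightarrow> complex" and p :: "complex poly" and \<rho> :: real
 assumes lu: "l < - (pi / 2)" "pi / 2 < u"
  and f_eq: "\<And>z. f z = poly p z * F z" and p: "p \<noteq> 0"
  and A_step: "\<exists>D. EV s. A (s + 1) \<le> D * A s"
  and A_transc: "filterlim (\<lambda>s. A s / s) at_top at_top"
  and A_order: "EV s. A s \<le> exp (\<rho> * s)"
  and f_le: "\<And>w. norm (f (exp w)) \<le> exp (A (Re w))"
  and f_big: "EV s. \<exists>z. norm z = exp s \<and> exp (A s / 2) \<le> norm (f z)"
  and left: "\<And>d. d > 0 \<Longrightarrow> \<exists>e>0. EV s. \<forall>z. norm z = exp s \<and> Re z \<le> - d * exp s \<longrightarrow> norm (f z) \<le> exp (- e * A s)"
  and ones: "\<exists>X. \<forall>z. Re z \<le> - X \<longrightarrow> f z \<noteq> 1"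
begin

lemma A_top: "filterlim A at_top at_top"
 by (rule filterlim_at_top_of_ratio[OF A_transc])

lemma f_hol: "f holomorphic_on X"
 by (rule poly_mult_holomorphic[OF F f_eq])

lemma norm_f_le: "z \<noteq> 0 \<Longrightarrow> norm (f z) \<le> exp (A (ln (norm z)))"
 using f_le[of "Ln z"] by simp

lemma left_small:
 assumes "j > 0"
 shows "\<exists>d>0. \<exists>r\<ge>1. \<forall>z. norm z \<ge> r \<and> Re z \<le> - j * norm z \<longrightarrow> norm (f z) \<le> exp (- d * A (ln (norm z))) \<and> norm (f z) \<le> 1 / 3"
proof -
 obtain d where e: "d > 0" "EV s. \<forall>z. norm z = exp s \<and> Re z \<le> - j * exp s \<longrightarrow> norm (f z) \<le> exp (- d * A s)"
  using left[OF assms] by blast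
 have "EV s. A s \<ge> 2 / d" using A_top by (simp add: filterlim_at_top)
 with e(2) have "EV s. \<forall>z. norm z = exp s \<and> Re z \<le> - j * exp s \<longrightarrow> norm (f z) \<le> exp (- d * A s) \<and> norm (f z) \<le> 1 / 3"
 proof eventually_elim
  case (elim s)
  have "d * A s \<ge> 2" using elim(2) e(1) by (simp add: field_simps)
  hence "exp (d * A s) \<ge> 3" using exp_ge_add_one_self[of "d * A s"] by linarith
  hence "exp (- d * A s) \<le> 1 / 3" by (simp add: exp_minus inverse_eq_divide divide_le_eq)
  thus ?case using elim(1) by fastforce
 qed
 then obtain s0 where s0: "\<And>s z. s \<ge> s0 \<Longrightarrow> norm z = exp s \<Longrightarrow> Re z \<le> - j * exp s \<Longrightarrow> norm (f z) \<le> exp (- d * A s) \<and> norm (f z) \<le> 1 / 3"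
  unfolding ev_top by blast
 have "norm (f z) \<le> exp (- d * A (ln (norm z))) \<and> norm (f z) \<le> 1 / 3" if "norm z \<ge> max 1 (exp s0)" "Re z \<le> - j * norm z" for z
 proof -
  have pos: "norm z > 0" using that by linarith
  hence "s0 \<le> ln (norm z)" using that by (simp add: ln_ge_iff)
  thus ?thesis using s0[of "ln (norm z)" z] pos that by simp
 qed
 thus ?thesis using e(1) by (intro exI[of _ d] conjI exI[of _ "max 1 (exp s0)"]) auto
qed

text \<open>The branch \<open>h\<close> of \<open>ln (1 - f)\<close> has to be the one that is small
  where \<open>f\<close> is small. The difference \<open>h0 - Ln (1 - f)\<close> takes its values in
  the multiples of \<open>2 * pi * \<i>\<close>, so it is constant on the convex far part of each
  sector about the negative axis, and one constant corrects all of them.\<close>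

lemma log_one_minus_f:
 "\<exists>X h. X > 0 \<and> h holomorphic_on {z. Re z < - X} \<and> (\<forall>z. Re z < - X \<longrightarrow> exp (h z) = 1 - f z) \<and>
   (\<forall>e>0. log_near f h X e)"
proof -
 obtain X0 where X0: "\<And>z. Re z \<le> - X0 \<Longrightarrow> f z \<noteq> 1" using ones by blast
 define X where "X = max X0 1"
 have X: "X > 0" by (simp add: X_def)
 let ?U = "{z. Re z < - X}"
 have "(\<lambda>z. 1 - f z) holomorphic_on ?U" by (intro holomorphic_intros f_hol)
 moreover have "contractible ?U" by (intro convex_imp_contractible convex_halfspace_Re_lt)
 moreover have "1 - f z \<noteq> 0" if "z \<in> ?U" for z using X0[of z] that by (auto simp: X_def)
 ultimately obtain h0 where h0: "h0 holomorphic_on ?U" "\<And>z. z \<in> ?U \<Longrightarrow> 1 - f z = exp (h0 z)"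
  using contractible_imp_holomorphic_log by blast
 define d where "d = (\<lambda>z. h0 z - Ln (1 - f z))"
 have const: "\<exists>r\<ge>X + 1. \<exists>c. \<forall>z. Re z \<le> - r \<and> e * norm z \<le> - Re z \<longrightarrow> d z = c \<and> norm (f z) \<le> 1 / 3" if "e > 0" for e
 proof -
  obtain r0 where r0: "r0 \<ge> 1" "\<And>z. norm z \<ge> r0 \<Longrightarrow> Re z \<le> - e * norm z \<Longrightarrow> norm (f z) \<le> 1 / 3"
   using left_small[OF \<open>e > 0\<close>] by blast
  define r where "r = max r0 (X + 1)"
  define W where "W = {z. Re z \<le> - r} \<inter> {z. e * norm z + Re z \<le> 0}"
  have "convex {z::complex. e * norm z + Re z \<le> 0}"
  proof (rule convexI)
   fix x y :: complex and v w :: real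
   assume x: "x \<in> {z. e * norm z + Re z \<le> 0}" and y: "y \<in> {z. e * norm z + Re z \<le> 0}" and vw: "0 \<le> v" "0 \<le> w"
   have "norm (v *\<^sub>R x + w *\<^sub>R y) \<le> v * norm x + w * norm y"
    using vw norm_triangle_ineq[of "v *\<^sub>R x" "w *\<^sub>R y"] by simp
   hence "e * norm (v *\<^sub>R x + w *\<^sub>R y) \<le> e * (v * norm x + w * norm y)"
    using \<open>e > 0\<close> by simp
   moreover have "v * (e * norm x + Re x) \<le> 0" by (rule mult_nonneg_nonpos) (use x vw in auto)
   moreover have "w * (e * norm y + Re y) \<le> 0" by (rule mult_nonneg_nonpos) (use y vw in auto)
   ultimately show "v *\<^sub>R x + w *\<^sub>R y \<in> {z. e * norm z + Re z \<le> 0}" by (simp add: algebra_simps)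
  qed
  hence "convex W" unfolding W_def by (intro convex_Int convex_halfspace_Re_le)
  hence cW: "connected W" by (rule convex_connected)
  have inU: "z \<in> ?U" and fs: "norm (f z) \<le> 1 / 3" if "z \<in> W" for z
  proof -
   show "z \<in> ?U" using that X by (auto simp: W_def r_def)
   have "norm z \<ge> r0" using that abs_Re_le_cmod[of z] by (auto simp: W_def r_def)
   thus "norm (f z) \<le> 1 / 3" using that by (intro r0(2)) (auto simp: W_def)
  qed
  have np: "1 - f z \<notin> \<real>\<^sub>\<le>\<^sub>0" if "z \<in> W" for z
  proof
   assume "1 - f z \<in> \<real>\<^sub>\<le>\<^sub>0"
   hence "Re (f z) \<ge> 1" by (simp add: complex_nonpos_Reals_iff)
   thus False using fs[OF that] complex_Re_le_cmod[of "f z"] by linarith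
  qed
  have "continuous_on W d" unfolding d_def
   by (intro continuous_intros continuous_on_subset[OF holomorphic_on_imp_continuous_on[OF h0(1)]]
      holomorphic_on_imp_continuous_on[OF f_hol]) (use inU np in auto)
  moreover have ed: "exp (d z) = 1" if "z \<in> W" for z
  proof -
   have "1 - f z \<noteq> 0" using np[OF that] by auto
   thus ?thesis using h0(2)[OF inU[OF that]] by (simp add: d_def exp_diff)
  qed
  moreover have "2 * pi \<le> norm (d y - d x)" if "x \<in> W" "y \<in> W" "d y \<noteq> d x" for x y
  proof -
   have "exp (d y - d x) = 1" using ed that by (simp add: exp_diff)
   then obtain n :: int where n: "Re (d y - d x) = 0" "Im (d y - d x) = of_int (2 * n) * pi" by (auto simp: exp_eq_1)
   have "n \<noteq> 0" using n that(3) by (auto simp: complex_eq_iff)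
   hence "\<bar>real_of_int n\<bar> \<ge> 1" by linarith
   hence "2 * pi \<le> \<bar>Im (d y - d x)\<bar>" unfolding n(2) by (simp add: abs_mult)
   thus ?thesis using abs_Im_le_cmod[of "d y - d x"] by linarith
  qed
  ultimately have "d constant_on W"
   by (intro continuous_discrete_range_constant[OF cW] exI[of _ "2 * pi"]) auto
  then obtain c where "\<And>z. z \<in> W \<Longrightarrow> d z = c" by (auto simp: constant_on_def)
  thus ?thesis using fs by (intro exI[of _ r] conjI exI[of _ c]) (auto simp: W_def r_def)
 qed
 \<comment> \<open>For \<open>e = 1\<close> the region is a piece of the negative real axis; far out
   it is contained in the regions of all other sectors.\<close>
 obtain r1 c where r1: "r1 \<ge> X + 1" "\<And>z. Re z \<le> - r1 \<Longrightarrow> 1 * norm z \<le> - Re z \<Longrightarrow> d z = c" using const[of 1] by auto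
 define h where "h = (\<lambda>z. h0 z - c)"
 have ec: "exp c = 1"
 proof -
  let ?z = "- of_real r1 :: complex"
  obtain r2 c2 where r2: "r2 \<ge> X + 1" "\<And>z. Re z \<le> - r2 \<Longrightarrow> 1 * norm z \<le> - Re z \<Longrightarrow> d z = c2 \<and> norm (f z) \<le> 1 / 3" using const[of 1] by auto
  let ?y = "- of_real (max r1 r2) :: complex"
  have y: "Re ?y \<le> - r1" "Re ?y \<le> - r2" "1 * norm ?y \<le> - Re ?y" using r1 X by auto
  have "norm (f ?y) \<le> 1 / 3" using r2(2) y by blast
  hence "1 - f ?y \<noteq> 0" by auto
  moreover have "1 - f ?y = exp (h0 ?y)" by (rule h0(2)) (use y r1 in auto)
  ultimately have "exp (d ?y) = 1" by (simp add: d_def exp_diff)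
  thus ?thesis using r1(2)[OF y(1,3)] by simp
 qed
 have H1: "log_near f h X e" if "e > 0" for e
 proof -
  obtain r c' where r: "r \<ge> X + 1" "\<And>z. Re z \<le> - r \<Longrightarrow> min e 1 * norm z \<le> - Re z \<Longrightarrow> d z = c' \<and> norm (f z) \<le> 1 / 3"
   using const[of "min e 1"] \<open>e > 0\<close> unfolding min_less_iff_conj by (metis zero_less_one)
  let ?y = "- of_real (max r1 r) :: complex"
  have ny: "norm ?y = max r1 r" using r1 X by simp
  hence "min e 1 * norm ?y \<le> 1 * max r1 r" using r1 X by (intro mult_mono) auto
  hence y: "Re ?y \<le> - r1" "Re ?y \<le> - r" "1 * norm ?y \<le> - Re ?y" "min e 1 * norm ?y \<le> - Re ?y" using ny by auto
  have cc: "c' = c" using r(2)[OF y(2,4)] r1(2)[OF y(1,3)] by simp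
  have "Re z < - X \<and> norm (h z) \<le> 2 * norm (f z)" if z: "norm z \<ge> r / e" "Re z \<le> - e * norm z" for z
  proof -
   have "r \<le> e * norm z" using z(1) \<open>e > 0\<close> by (simp add: field_simps)
   hence rz: "Re z \<le> - r" using z(2) by linarith
   have "min e 1 * norm z \<le> e * norm z" by (intro mult_right_mono) auto
   hence dz: "d z = c" "norm (f z) \<le> 1 / 3" using r(2)[OF rz] z(2) cc by auto
   have "h z = Ln (1 + (- f z))" using dz(1) by (simp add: h_def d_def algebra_simps)
   also have "norm \<dots> \<le> 2 * norm (- f z)" by (rule norm_Ln_le) (use dz(2) in auto)
   finally show ?thesis using rz r(1) by simp
  qed
  thus ?thesis by blast
 qed
 have H2: "h holomorphic_on ?U" unfolding h_def by (intro holomorphic_intros h0)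
 have H3: "exp (h z) = 1 - f z" if "Re z < - X" for z
  using h0(2)[of z] that ec by (simp add: h_def exp_diff)
 show ?thesis by (rule exI[of _ X], rule exI[of _ h], intro conjI allI impI) (use X H1 H2 H3 in \<open>simp_all only:\<close>)
qed

text \<open>\<open>Re h\<close> is bounded by \<open>A\<close> up to a constant, so
  \<open>B - h\<close> has positive real part in a disc about \<open>z0 = - r + \<i> * Im w\<close>
  that contains \<open>w\<close>. At \<open>z0\<close> the function \<open>f\<close>, hence
  \<open>h\<close>, is small. \<open>norm_le_halfplane_disc\<close> gives a bound of order
  \<open>r * B\<close> at \<open>w\<close>, and finite order makes \<open>B\<close> a power of
  \<open>r\<close>.\<close>

lemma log_poly_bound:
 "\<exists>X h K. X \<ge> 1 \<and> h holomorphic_on {z. Re z < - X + 1} \<and> (\<forall>z. Re z \<le> - X \<longrightarrow> exp (h z) = 1 - f z) \<and>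
   (\<forall>z. Re z \<le> - X \<longrightarrow> norm (h z) \<le> norm z ^ K) \<and>
   (\<forall>e>0. log_near f h X e)"
proof -
 obtain X0 h where X0: "X0 > 0" and hh: "h holomorphic_on {z. Re z < - X0}" and eh: "\<And>z. Re z < - X0 \<Longrightarrow> exp (h z) = 1 - f z"
  and hs: "\<And>e. e > 0 \<Longrightarrow> log_near f h X0 e"
  using log_one_minus_f by blast
 have half: "(1/2::real) > 0" by simp
 obtain r1 where r1: "\<And>z. norm z \<ge> r1 \<Longrightarrow> Re z \<le> - (1/2) * norm z \<Longrightarrow> norm (h z) \<le> 2 * norm (f z)"
  using hs[OF half] by blast
 obtain r2 where r2: "\<And>z. norm z \<ge> r2 \<Longrightarrow> Re z \<le> - (1/2) * norm z \<Longrightarrow> norm (f z) \<le> 1 / 3"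
  using left_small[OF half] by blast
 obtain s0 where s0: "\<And>s. s \<ge> s0 \<Longrightarrow> A s \<le> exp (\<rho> * s)" using A_order by (auto simp: ev_top)
 define N where "N = nat \<lceil>\<rho>\<rceil>"
 have N: "real N \<ge> \<rho>" unfolding N_def by linarith
 \<comment> \<open>The two factors of the bound satisfy \<open>B + 1 \<le> r ^ (2 * N + 1)\<close>
   and \<open>2 * r + 1 \<le> r\<^sup>2\<close>.\<close>
 define K where "K = 2 * N + 3"
 define X where "X = max (X0 + 1) (max (max r1 r2) (max 4 (exp s0)))"
 have X: "X \<ge> X0 + 1" "X \<ge> r1" "X \<ge> r2" "X \<ge> 4" "X \<ge> exp s0" by (auto simp: X_def)
 have bound: "norm (h w) \<le> norm w ^ K" if w: "Re w \<le> - X" for w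
 proof -
  define r where "r = norm w"
  have r: "r \<ge> - Re w" "r \<ge> \<bar>Im w\<bar>" "r \<ge> X" using abs_Re_le_cmod[of w] abs_Im_le_cmod[of w] w by (auto simp: r_def)
  define z0 where "z0 = Complex (- r) (Im w)"
  define d where "d = r - X0"
  have d: "d > 0" using r X by (simp add: d_def)
  have nz0: "norm z0 \<ge> r" "norm z0 \<le> 2 * r"
   using abs_Re_le_cmod[of z0] cmod_le[of z0] r X X0 by (auto simp: z0_def)
  have h0: "norm (h z0) \<le> 1" using r1[of z0] r2[of z0] nz0 r X by (simp add: z0_def)
  define B where "B = A (ln (3 * r)) + 2"
  define g where "g = (\<lambda>z. of_real B - h z)"
  have inb: "Re y < - X0 \<and> norm y \<le> 3 * r" if "y \<in> ball z0 d" for y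
  proof -
   have "norm (y - z0) < d" using that by (simp add: dist_norm norm_minus_commute)
   moreover have "Re y - Re z0 \<le> norm (y - z0)" using complex_Re_le_cmod[of "y - z0"] by simp
   moreover have "norm y \<le> norm z0 + norm (y - z0)" by (metis norm_triangle_sub)
   ultimately show ?thesis using nz0 X0 by (simp add: d_def z0_def)
  qed
  have pos: "Re (g y) > 0" if "y \<in> ball z0 d" for y
  proof -
   have y: "Re y < - X0" "norm y \<le> 3 * r" using inb[OF that] by auto
   have y0: "y \<noteq> 0" using y X0 by auto
   have "norm (f y) \<le> exp (A (ln (norm y)))" by (rule norm_f_le[OF y0])
   also have "\<dots> \<le> exp (A (ln (3 * r)))"
   proof -
    have "ln (norm y) \<le> ln (3 * r)" using y y0 X r by (subst ln_le_cancel_iff) auto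
    thus ?thesis using A_mono by simp
   qed
   finally have "norm (1 - f y) \<le> 1 + exp (A (ln (3 * r)))" using norm_triangle_ineq4[of 1 "f y"] by simp
   also have "\<dots> \<le> exp (A (ln (3 * r)) + 1)"
   proof -
    have "1 \<le> exp (A (ln (3 * r)))" using A_pos[of "ln (3 * r)"] by simp
    hence "1 + exp (A (ln (3 * r))) \<le> exp (A (ln (3 * r))) * 2" by simp
    also have "\<dots> \<le> exp (A (ln (3 * r))) * exp 1" using exp_ge_add_one_self[of "1::real"] by (intro mult_left_mono) auto
    finally show ?thesis by (simp add: exp_add)
   qed
   finally have "exp (Re (h y)) \<le> exp (A (ln (3 * r)) + 1)" using eh[OF y(1)] by (metis norm_exp_eq_Re)
   thus ?thesis by (simp add: g_def B_def)
  qed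
  have dw: "dist z0 w = r + Re w"
  proof -
   have "z0 - w = of_real (- r - Re w)" by (simp add: z0_def complex_eq_iff)
   thus ?thesis using r(1) by (simp add: dist_norm del: of_real_diff of_real_minus)
  qed
  have wb: "w \<in> ball z0 d" using dw w X by (simp add: d_def)
  have "g holomorphic_on ball z0 d" unfolding g_def
   by (intro holomorphic_intros holomorphic_on_subset[OF hh]) (use inb in auto)
  from norm_le_halfplane_disc[OF this d pos wb]
  have le: "norm (g w) * (d - dist z0 w) \<le> norm (g z0) * (d + dist z0 w)" .
  have B1: "B \<ge> 1" using A_pos[of "ln (3 * r)"] by (simp add: B_def)
  \<comment> \<open>Here \<open>X \<ge> X0 + 1\<close> enters: \<open>w\<close> has distance at
    least 1 from the boundary of the disc.\<close>
  have "norm (g w) * 1 \<le> norm (g w) * (d - dist z0 w)" using dw w X by (intro mult_left_mono) (auto simp: d_def)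
  also note le
  also have "norm (g z0) * (d + dist z0 w) \<le> (B + 1) * (2 * r)"
  proof (rule mult_mono)
   show "norm (g z0) \<le> B + 1" unfolding g_def using norm_triangle_ineq4[of "of_real B" "h z0"] h0 B1 by simp
   show "d + dist z0 w \<le> 2 * r" using dw w X X0 by (simp add: d_def)
  qed (use d B1 in auto)
  finally have "norm (g w) \<le> (B + 1) * (2 * r)" by simp
  moreover have "norm (h w) \<le> B + norm (g w)" using norm_triangle_ineq4[of "of_real B" "g w"] B1 by (simp add: g_def)
  ultimately have "norm (h w) \<le> (B + 1) * (2 * r + 1)" by (simp add: algebra_simps)
  also have "B + 1 \<le> r ^ (2 * N + 1)"
  proof -
   have "exp s0 \<le> 3 * r" using X r by linarith
   hence s: "ln (3 * r) \<ge> s0" using X r by (subst ln_ge_iff) auto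
   have ge0: "ln (3 * r) \<ge> 0" using X r by (intro ln_ge_zero) linarith
   have "A (ln (3 * r)) \<le> exp (\<rho> * ln (3 * r))" by (rule s0[OF s])
   also have "\<dots> \<le> exp (real N * ln (3 * r))" using mult_right_mono[OF N ge0] by simp
   also have "\<dots> = (3 * r) ^ N" using X r by (subst exp_of_nat_mult) simp
   also have "\<dots> \<le> (r\<^sup>2) ^ N"
   proof (rule power_mono)
    have "3 * r \<le> r * r" using X r by (intro mult_right_mono) linarith+
    thus "3 * r \<le> r\<^sup>2" by (simp add: power2_eq_square)
   qed (use X r in linarith)
   also have "\<dots> = r ^ (2 * N)" by (simp add: power_mult)
   finally have "B + 1 \<le> r ^ (2 * N) + 3" by (simp add: B_def)
   also have "1 \<le> r ^ (2 * N)" using X r by (intro one_le_power) linarith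
   hence "r ^ (2 * N) + 3 \<le> 4 * r ^ (2 * N)" by linarith
   also have "\<dots> \<le> r * r ^ (2 * N)" using X r by (intro mult_right_mono) auto
   finally show ?thesis by simp
  qed
  hence "(B + 1) * (2 * r + 1) \<le> r ^ (2 * N + 1) * r\<^sup>2"
  proof (rule mult_mono)
   have "3 * r \<le> r * r" using X r by (intro mult_right_mono) linarith+
   thus "2 * r + 1 \<le> r\<^sup>2" using X r unfolding power2_eq_square by linarith
  qed (use X r in auto)
  also have "r ^ (2 * N + 1) * r\<^sup>2 = r ^ K" unfolding K_def by (simp add: power_add[symmetric] eval_nat_numeral)
  finally show ?thesis by (simp add: r_def)
 qed
 have hs': "log_near f h X e" if de: "e > 0" for e
 proof -
  obtain r where r: "\<And>z. norm z \<ge> r \<Longrightarrow> Re z \<le> - e * norm z \<Longrightarrow> norm (h z) \<le> 2 * norm (f z)" using hs[OF de] by blast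
  have "Re z < - X \<and> norm (h z) \<le> 2 * norm (f z)" if z: "norm z \<ge> max r ((X + 1) / e)" "Re z \<le> - e * norm z" for z
  proof -
   have "X + 1 \<le> e * norm z" using z(1) de by (simp add: field_simps)
   thus ?thesis using r z by auto
  qed
  thus ?thesis by blast
 qed
 have "X \<ge> 1" using X by linarith
 moreover have "h holomorphic_on {z. Re z < - X + 1}" by (rule holomorphic_on_subset[OF hh]) (use X in auto)
 moreover have "\<forall>z. Re z \<le> - X \<longrightarrow> exp (h z) = 1 - f z" using eh X by auto
 ultimately show ?thesis using bound hs' by metis
qed

end

locale decaying_log = decaying F G l u C A f p \<rho>
 for F G :: "complex \<Rightarrow> complex" and l u C :: real and A :: "real \<Rightarrow> real" and f p \<rho> +
 fixes h :: "complex \<Rightarrow> complex" and X :: real and K :: nat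
 assumes X: "X \<ge> 1" and h_hol: "h holomorphic_on {z. Re z < - X + 1}"
  and exp_h: "\<And>z. Re z \<le> - X \<Longrightarrow> exp (h z) = 1 - f z"
  and h_le: "\<And>z. Re z \<le> - X \<Longrightarrow> norm (h z) \<le> norm z ^ K"
  and h_small: "\<And>d. d > 0 \<Longrightarrow> log_near f h X d"
begin

text \<open>Normalised to be bounded by 1 in the half-plane, while no smallness of \<open>h\<close>
  is lost.\<close>

definition "h1 z = h z / z ^ K"

lemma norm_h1_le: "Re z \<le> - X \<Longrightarrow> norm (h1 z) \<le> 1"
proof -
 assume z: "Re z \<le> - X"
 hence "norm z > 0" using abs_Re_le_cmod[of z] X by linarith
 hence "norm z ^ K > 0" by (rule zero_less_power)
 thus ?thesis using h_le[OF z] by (simp add: h1_def norm_divide norm_power)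
qed

lemma norm_h1_le_h: "Re z \<le> - X \<Longrightarrow> norm (h1 z) \<le> norm (h z)"
proof -
 assume z: "Re z \<le> - X"
 hence "norm z \<ge> 1" using abs_Re_le_cmod[of z] X by linarith
 hence "norm z ^ K \<ge> 1" by simp
 hence "norm (h z) / norm z ^ K \<le> norm (h z) / 1" by (intro divide_left_mono) (auto intro: less_le_trans)
 thus ?thesis by (simp add: h1_def norm_divide norm_power)
qed

lemma h1_hol: "h1 holomorphic_on {z. Re z < - X + 1}"
 unfolding h1_def by (intro holomorphic_intros h_hol) (use X in auto)

lemma h1_shift: "(\<lambda>z. h1 (z - of_real X)) holomorphic_on {z. Re z < 0}"
 by (rule hol_compose[OF _ h1_hol]) (auto intro!: holomorphic_intros)

text \<open>The strip extends beyond \<open>pi / 2\<close>, so some direction \<open>t\<close> in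
  the open left half-plane carries no zeros of \<open>F\<close>.\<close>

lemma f_nonzero_left: "\<exists>z. Re z < - X \<and> f z \<noteq> 0"
proof -
 obtain c R where c: "c > 0" "\<And>z. norm z \<ge> R \<Longrightarrow> c \<le> norm (poly p z)" using poly_norm_bounds[OF p] by metis
 define t where "t = min ((pi / 2 + u) / 2) (3 * pi / 4)"
 have th: "pi / 2 < t" "t < u" "t < pi" using lu pi_gt_zero by (auto simp: t_def min_def field_simps)
 have "cos t < 0" using cos_monotone_0_pi[of "pi/2" t] th by simp
 hence "EV s. exp s * cos t < - X" by real_asymp
 moreover have "EV s. exp s \<ge> R" by real_asymp
 ultimately have "EV s. exp s * cos t < - X \<and> exp s \<ge> R" by eventually_elim auto
 then obtain s where s: "exp s * cos t < - X" "exp s \<ge> R" by (auto simp: ev_top)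
 let ?z = "pt s t"
 have "F ?z = exp (G (Complex s t))" by (rule FG) (use th lu pi_gt_zero in auto)
 moreover have "poly p ?z \<noteq> 0" using c(1) c(2)[of ?z] s(2) by auto
 ultimately have "f ?z \<noteq> 0" by (simp add: f_eq)
 moreover have "Re ?z < - X" using s(1) by (simp add: Re_exp)
 ultimately show ?thesis by blast
qed

text \<open>\<open>decay_imp_exp_type\<close> for \<open>h1\<close>, moved to the half-plane
  \<open>Re z < 0\<close>. In the sector about the negative axis \<open>h1\<close> inherits the
  decay \<open>exp (- e * A)\<close> from \<open>f\<close>, and it does not vanish where
  \<open>f\<close> does not.\<close>

lemma A_exp_type: "\<exists>B>0. EV s. A s \<le> B * exp s"
proof -
 have half: "(1/2::real) > 0" by simp
 obtain r1 where r1: "\<And>z. norm z \<ge> r1 \<Longrightarrow> Re z \<le> - (1/2) * norm z \<Longrightarrow> Re z < - X \<and> norm (h z) \<le> 2 * norm (f z)"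
  using h_small[OF half] by blast
 obtain e r2 where r2: "e > 0" "\<And>z. norm z \<ge> r2 \<Longrightarrow> Re z \<le> - (1/2) * norm z \<Longrightarrow> norm (f z) \<le> exp (- e * A (ln (norm z)))"
  using left_small[OF half] by blast
 obtain z0 where z0: "Re z0 < - X" "f z0 \<noteq> 0" using f_nonzero_left by blast
 have "z0 \<noteq> 0" using z0 X by auto
 moreover have "h z0 \<noteq> 0" using exp_h[of z0] z0 by auto
 ultimately have h0: "h1 (z0 + of_real X - of_real X) \<noteq> 0" by (simp add: h1_def)
 show ?thesis
 proof (rule decay_imp_exp_type[OF h1_shift _ zero_less_one A_mono r2(1) _ _ h0])
  show "norm (h1 (z - of_real X)) \<le> 1" if "Re z < 0" for z using norm_h1_le that by simp
  show "Re (z0 + of_real X) < 0" using z0 by simp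
  fix z :: complex assume z: "norm z \<ge> max X (max r1 r2)" "Re z \<le> - (3/4) * norm z"
  let ?z = "z - of_real X"
  have "norm z > 0" using z(1) X by linarith
  have "(norm ?z)\<^sup>2 = (norm z)\<^sup>2 - 2 * (X * Re z) + X\<^sup>2" unfolding cmod_power2 by (simp add: power2_eq_square algebra_simps)
  moreover have "X * Re z \<le> 0" by (rule mult_nonneg_nonpos) (use z(2) X \<open>norm z > 0\<close> in linarith)+
  ultimately have "(norm z)\<^sup>2 \<le> (norm ?z)\<^sup>2" using zero_le_power2[of X] by linarith
  hence nz: "norm z \<le> norm ?z" by (rule power2_le_imp_le) simp
  have "norm ?z \<le> norm z + X" using norm_triangle_ineq4[of z "of_real X"] X by simp
  hence rz: "Re ?z \<le> - (1/2) * norm ?z" using z X by simp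
  have nn: "norm ?z \<ge> r1" "norm ?z \<ge> r2" using nz z(1) by auto
  have "norm (h1 ?z) \<le> norm (h ?z)" using r1[OF nn(1) rz] by (intro norm_h1_le_h) simp
  also have "\<dots> \<le> 2 * norm (f ?z)" using r1[OF nn(1) rz] by simp
  also have "\<dots> \<le> 2 * exp (- e * A (ln (norm ?z)))" using r2(2)[OF nn(2) rz] by simp
  also have "\<dots> \<le> 2 * exp (- e * A (ln (norm z)))"
  proof -
   have "ln (norm z) \<le> ln (norm ?z)" using nz \<open>norm z > 0\<close> by (subst ln_le_cancel_iff) auto
   hence "A (ln (norm z)) \<le> A (ln (norm ?z))" by (rule A_mono)
   thus ?thesis using r2(1) by simp
  qed
  finally show "norm (h1 ?z) \<le> 2 * exp (- e * A (ln (norm z)))" .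
 qed
qed

end

lemma sin_ge_half:
 fixes x :: real
 assumes "0 \<le> x" "x \<le> 1"
 shows "x / 2 \<le> sin x"
proof -
 have "\<bar>sin x - (\<Sum>m<3. sin_coeff m * x ^ m)\<bar> \<le> inverse (fact 3) * \<bar>x\<bar> ^ 3" by (rule Maclaurin_sin_bound)
 moreover have "(\<Sum>m<3. sin_coeff m * x ^ m) = x" by (simp add: eval_nat_numeral sin_coeff_def)
 moreover have "\<bar>x\<bar> ^ 3 \<le> x"
 proof -
  have "x ^ 3 \<le> x ^ 1" using assms by (intro power_decreasing) auto
  thus ?thesis using assms by simp
 qed
 moreover have "inverse (fact 3 :: real) = 1 / 6" by (simp add: eval_nat_numeral)
 ultimately have "\<bar>sin x - x\<bar> \<le> 1 / 6 * \<bar>x\<bar> ^ 3" "\<bar>x\<bar> ^ 3 \<le> x" by simp_all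
 hence "\<bar>sin x - x\<bar> \<le> x / 6" by linarith
 thus ?thesis using assms by linarith
qed

section \<open>Polynomial growth up to the imaginary axis\<close>

context decaying_log begin

lemma cos_side: "t = 1 \<or> t = -1 \<Longrightarrow> cos (t * (pi / 2 + q)) = - sin q"
 by (metis cos_minus cos_add cos_pi_half sin_pi_half mult_1 mult_minus1 mult_zero_left diff_0)

lemma cos_side': "t = 1 \<or> t = -1 \<Longrightarrow> cos y = - sin (t * y - pi / 2)"
 by (metis cos_minus sin_diff cos_pi_half sin_pi_half mult_1 mult_minus1 mult_zero_right mult_1_right diff_0 minus_minus)

text \<open>The two-constants theorem in a disc of the logarithmic plane that almost touches the line
 corresponding to the imaginary axis.\<close>

lemma h1_polar:
 "\<exists>c>0. \<exists>M. \<exists>B>0. EV s. \<forall>t\<in>{1, -1}. \<forall>q. B * exp (- s) < q \<and> q \<le> 1 / 2 \<longrightarrow>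
   Re (pt s (t * (pi / 2 + q))) \<le> - X \<and> norm (h1 (pt s (t * (pi / 2 + q)))) \<le> exp (M - c * A s * q)"
proof -
 obtain B where B: "B > 0" "EV s. A s \<le> B * exp s" using A_exp_type by blast
 obtain D where D: "EV s. A (s + 1) \<le> D * A s" using A_step by blast
 have eighth: "(1/8::real) > 0" by simp
 obtain r1 where r1: "\<And>z. norm z \<ge> r1 \<Longrightarrow> Re z \<le> - (1/8) * norm z \<Longrightarrow> Re z < - X \<and> norm (h z) \<le> 2 * norm (f z)"
  using h_small[OF eighth] by blast
 obtain e0 r2 where r2: "e0 > 0" "\<And>z. norm z \<ge> r2 \<Longrightarrow> Re z \<le> - (1/8) * norm z \<Longrightarrow> norm (f z) \<le> exp (- e0 * A (ln (norm z)))"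
  using left_small[OF eighth] by blast
 define D' where "D' = \<bar>D\<bar> + 1"
 define c where "c = e0 / (4 * D')"
 have D': "D' > 0" by (simp add: D'_def)
 have c: "c > 0" using r2 D' by (simp add: c_def)
 have step: "EV s. A s \<le> D' * A (s - 1)"
 proof -
  obtain N where N: "\<And>s. s \<ge> N \<Longrightarrow> A (s + 1) \<le> D * A s" using D by (auto simp: ev_top)
  have "EV s. A (s - 1 + 1) \<le> D * A (s - 1)"
   using eventually_ge_at_top[of "N + 1"] by eventually_elim (rule N, simp)
  thus ?thesis
  proof eventually_elim
   case (elim s)
   have "D * A (s - 1) \<le> D' * A (s - 1)" using A_pos[of "s - 1"] by (intro mult_right_mono) (auto simp: D'_def)
   thus ?case using elim by simp
  qed
 qed
 have A2: "EV s. A s \<ge> 2 * D' / e0" using A_top by (simp add: filterlim_at_top)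
 have Xs: "EV s. 4 * X * exp (- s) < 1 / 4" "EV s. exp (s - 1) \<ge> max r1 r2" by real_asymp+
 have "EV s. \<forall>t\<in>{1, -1}. \<forall>q. 4 * X * exp (- s) < q \<and> q \<le> 1 / 2 \<longrightarrow>
   Re (pt s (t * (pi / 2 + q))) \<le> - X \<and> norm (h1 (pt s (t * (pi / 2 + q)))) \<le> exp (4 * X * c * B - c * A s * q)"
  using B(2) step A2 Xs
 proof eventually_elim
  case (elim s)
  \<comment> \<open>At angular distance \<open>e\<close> from the imaginary axis and radius about
    \<open>exp s\<close> the real part is at most \<open>- X\<close>; the factor 4 pays for
    \<open>sin x \<ge> x / 2\<close> and for \<open>exp (- (1 / 2)) \<ge> 1 / 2\<close>.\<close>
  define e where "e = 4 * X * exp (- s)"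
  define R where "R = 1 / 2 - e"
  have e: "0 < e" "e < 1 / 4" using elim(4) X by (auto simp: e_def)
  have R: "1 / 4 < R" "R < 1 / 2" using e by (auto simp: R_def)
  show ?case
  proof (intro ballI allI impI)
   fix t q :: real assume tau: "t \<in> {1, -1}" and psi: "4 * X * exp (- s) < q \<and> q \<le> 1 / 2"
   have tau': "t = 1 \<or> t = -1" "\<bar>t\<bar> = 1" "t * t = 1" using tau by auto
   define c0 where "c0 = Complex s (t * (pi / 2 + 1 / 2))"
   define z where "z = Complex s (t * (pi / 2 + q))"
   have far: "Re (exp y) \<le> - exp (Re y) * (x / 2)" if "t * Im y - pi / 2 = x'" "x \<le> x'" "0 \<le> x" "x' \<le> 1" for y x x'
   proof -
    have "x / 2 \<le> sin x'" using sin_ge_half[of x'] that by linarith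
    hence "exp (Re y) * (x / 2) \<le> exp (Re y) * sin x'" by (intro mult_left_mono) auto
    thus ?thesis using cos_side'[OF tau'(1), of "Im y"] that(1) by (simp add: Re_exp)
   qed
   have disc: "Re (exp y) \<le> - X" if d: "dist c0 y \<le> R" for y
   proof -
    have "norm (y - c0) \<le> R" using d by (simp add: dist_norm norm_minus_commute)
    hence "\<bar>Re (y - c0)\<bar> \<le> R" "\<bar>Im (y - c0)\<bar> \<le> R" using abs_Re_le_cmod[of "y - c0"] abs_Im_le_cmod[of "y - c0"] by linarith+
    hence 1: "\<bar>Re y - s\<bar> \<le> R" "\<bar>t * Im y - (pi / 2 + 1 / 2)\<bar> \<le> R" using tau by (auto simp: c0_def)
    have "Re (exp y) \<le> - exp (Re y) * (e / 2)" by (rule far[OF refl]) (use 1 e in \<open>auto simp: R_def abs_le_iff\<close>)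
    also have "\<dots> \<le> - exp (s - 1 / 2) * (e / 2)"
    proof -
     have "exp (s - 1 / 2) \<le> exp (Re y)" using 1 R by simp
     hence "exp (s - 1 / 2) * (e / 2) \<le> exp (Re y) * (e / 2)" using e by (intro mult_right_mono) auto
     thus ?thesis by simp
    qed
    finally have "Re (exp y) \<le> - exp (s - 1 / 2) * (e / 2)" .
    moreover have "exp (s - 1 / 2) * exp (- s) = exp (- (1 / 2))" by (simp add: mult_exp_exp)
    hence "exp (s - 1 / 2) * (e / 2) = 2 * X * exp (- (1 / 2))" by (simp add: e_def)
    moreover have "exp (- (1 / 2) :: real) \<ge> 1 / 2" using exp_ge_add_one_self[of "- (1/2)::real"] by simp
    hence "X \<le> 2 * X * exp (- (1 / 2))" using X mult_left_mono[of "1/2" "exp (- (1 / 2))" "2 * X"] by simp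
    ultimately show ?thesis by simp
   qed
   have cz: "dist c0 z = 1 / 2 - q"
   proof -
    have "c0 - z = of_real (t * (1 / 2 - q)) * \<i>" by (simp add: c0_def z_def complex_eq_iff algebra_simps)
    hence "norm (c0 - z) = \<bar>t\<bar> * \<bar>1 / 2 - q\<bar>" by (simp add: norm_mult abs_mult del: of_real_mult of_real_diff)
    thus ?thesis using psi tau' by (simp add: dist_norm)
   qed
   have dz: "dist c0 z < R" using cz psi by (simp add: R_def e_def)
   define g where "g u = c0 + of_real R * u" for u
   have gd: "norm (g u - c0) = R * norm u" for u using R by (simp add: g_def norm_mult)
   have gin: "Re (exp (g u)) \<le> - X" if "norm u < 1" for u
    using that R gd[of u] by (intro disc) (simp add: dist_norm norm_minus_commute)
   have hol: "(\<lambda>u. h1 (exp (g u))) holomorphic_on ball 0 1"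
    by (rule hol_compose[OF _ h1_hol]) (use gin in \<open>force simp: g_def intro!: holomorphic_intros\<close>)+
   define m where "m = e0 / (2 * D') * A s"
   have m: "m \<ge> 1"
   proof -
    have "2 * D' \<le> e0 * A s" using elim(3) r2 by (simp add: field_simps)
    thus ?thesis using D' by (simp add: m_def field_simps)
   qed
   have small: "norm (h1 (exp (g u))) \<le> 1 * exp (- m)" if u: "norm u \<le> 1/2" for u
   proof -
    let ?w = "g u"
    have "norm (?w - c0) \<le> 1 / 4" using u R mult_mono[of R "1/2" "norm u" "1/2"] by (simp add: gd)
    hence "\<bar>Re (?w - c0)\<bar> \<le> 1 / 4" "\<bar>Im (?w - c0)\<bar> \<le> 1 / 4"
     using abs_Re_le_cmod[of "?w - c0"] abs_Im_le_cmod[of "?w - c0"] by linarith+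
    hence 1: "\<bar>Re ?w - s\<bar> \<le> 1 / 4" "\<bar>t * Im ?w - (pi / 2 + 1 / 2)\<bar> \<le> 1 / 4" using tau unfolding c0_def abs_le_iff by (auto simp: algebra_simps)
    have "Re (exp ?w) \<le> - exp (Re ?w) * ((1 / 4) / 2)" by (rule far[OF refl]) (use 1[unfolded abs_le_iff] in auto)
    hence rw: "Re (exp ?w) \<le> - (1/8) * norm (exp ?w)" by simp
    have re: "s - 1 \<le> Re ?w" using 1 R by linarith
    hence "exp (s - 1) \<le> norm (exp ?w)" by simp
    hence nw: "norm (exp ?w) \<ge> r1" "norm (exp ?w) \<ge> r2" using elim(5) by linarith+
    have "norm (h1 (exp ?w)) \<le> norm (h (exp ?w))" using r1[OF nw(1) rw] by (intro norm_h1_le_h) simp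
    also have "\<dots> \<le> 2 * norm (f (exp ?w))" using r1[OF nw(1) rw] by simp
    also have "\<dots> \<le> 2 * exp (- e0 * A (Re ?w))" using r2(2)[OF nw(2) rw] by simp
    also have "\<dots> \<le> 2 * exp (- e0 * A (s - 1))" using A_mono[OF re] r2(1) by simp
    also have "\<dots> \<le> 2 * exp (- (2 * m))"
    proof -
     have "e0 * A s \<le> e0 * (D' * A (s - 1))" using elim(2) r2(1) by (intro mult_left_mono) auto
     hence "2 * m \<le> e0 * A (s - 1)" using D' by (simp add: m_def field_simps)
     thus ?thesis by simp
    qed
    also have "2 \<le> exp m" using exp_ge_add_one_self[of m] m by linarith
    hence "2 * exp (- (2 * m)) \<le> exp m * exp (- (2 * m))" by (rule mult_right_mono) simp
    also have "\<dots> = exp (- m)" by (simp add: mult_exp_exp)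
    finally show ?thesis by simp
   qed
   define x where "x = (z - c0) / of_real R"
   have gx: "g x = z" using R by (simp add: g_def x_def)
   have nx: "norm x = (1 / 2 - q) / R" using R cz by (simp add: x_def norm_divide dist_norm norm_minus_commute)
   have "norm (h1 (exp (g x))) \<le> 1 * exp (- m * (1 / 2) * (1 - norm x))"
    by (rule two_constants_disc[OF hol _ _ _ _ _ small]) (use gin norm_h1_le m dz R cz nx in auto)
   \<comment> \<open>The disc stops short of the axis by \<open>e\<close>. This costs
     \<open>c * A s * e\<close>, which stays bounded because of
     \<open>A s \<le> B * exp s\<close>.\<close>
   also have "\<dots> \<le> exp (4 * X * c * B - c * A s * q)"
   proof -
    have "1 - norm x = (q - e) / R" using R by (simp add: nx R_def field_simps)
    also have "\<dots> \<ge> q - e"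
    proof -
     have "q - e > 0" using psi by (simp add: e_def)
     thus ?thesis using R mult_left_mono[of R 1 "q - e"] by (simp add: pos_le_divide_eq)
    qed
    finally have "m / 2 * (q - e) \<le> m / 2 * (1 - norm x)" using m by (intro mult_left_mono) auto
    moreover have "m / 2 = c * A s" using D' by (simp add: m_def c_def)
    moreover have "c * A s * e \<le> 4 * X * c * B"
    proof -
     have "c * A s * e \<le> c * (B * exp s) * e" using elim(1) c e by (intro mult_right_mono mult_left_mono) auto
     also have "\<dots> = 4 * X * c * B" by (simp add: e_def exp_minus)
     finally show ?thesis .
    qed
    ultimately have "c * A s * q - 4 * X * c * B \<le> m / 2 * (1 - norm x)" by (simp add: algebra_simps)
    moreover have "- m * (1 / 2) * (1 - norm x) = - (m / 2 * (1 - norm x))" by simp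
    ultimately show ?thesis by (simp only: exp_le_cancel_iff mult_1)
   qed
   finally show "Re (pt s (t * (pi / 2 + q))) \<le> - X \<and> norm (h1 (pt s (t * (pi / 2 + q)))) \<le> exp (4 * X * c * B - c * A s * q)"
    using disc[of z] dz unfolding gx by (simp add: z_def)
  qed
 qed
 moreover have "4 * X > 0" using X by simp
 ultimately show ?thesis using c by blast
qed

lemma polar_form:
 assumes "norm z = exp s"
 shows "z = pt s (Arg z)"
proof -
 have "z \<noteq> 0" using assms by auto
 hence "z = of_real (exp s) * exp (\<i> * of_real (Arg z))" using Arg_eq[of z] assms by simp
 thus ?thesis by (simp add: Complex_eq exp_add exp_of_real mult.commute)
qed

text \<open>A point with \<open>norm (f z) \<ge> exp (A s / 2)\<close> cannot lie in the directions
  where \<open>f\<close> is small, so it lies on the arc, and there \<open>Re G \<ge> 0\<close>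
  because the polynomial factor is negligible. This is the point that
  \<open>eventually_deriv_bound\<close> asks for.\<close>

lemma deriv_G_bound:
 "\<exists>q0 K2. 0 < q0 \<and> q0 \<le> 1 / 2 \<and> l < - (pi / 2 + q0) \<and> pi / 2 + q0 < u \<and> K2 > 0 \<and>
   (EV s. \<forall>t\<in>{- (pi / 2 + q0)..pi / 2 + q0}. norm (deriv G (Complex s t)) \<le> K2 * A s)"
proof -
 define q0 where "q0 = min (1 / 2) (min ((u - pi / 2) / 2) ((- (pi / 2) - l) / 2))"
 have le: "q0 \<le> (u - pi / 2) / 2" "q0 \<le> (- (pi / 2) - l) / 2" unfolding q0_def by (meson min.cobounded1 min.cobounded2 order_trans)+
 have p0: "0 < q0" "q0 \<le> 1 / 2" using lu by (auto simp: q0_def)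
 have "pi / 2 + q0 < u" "q0 + pi / 2 < - l" using lu le by (simp_all add: field_simps)
 with p0 have p0: "0 < q0" "q0 \<le> 1 / 2" "l < - (pi / 2 + q0)" "pi / 2 + q0 < u" by simp_all
 have sp: "sin q0 > 0" using p0 pi_gt3 by (intro sin_gt_zero) auto
 obtain r where r: "\<And>z. norm z \<ge> r \<Longrightarrow> Re z \<le> - sin q0 * norm z \<Longrightarrow> norm (f z) \<le> 1 / 3" using left_small[OF sp] by blast
 obtain R D where D: "R \<ge> 1" "\<And>z. norm z \<ge> R \<Longrightarrow> norm (poly p z) \<le> norm z ^ D" using poly_norm_bounds[OF p] by metis
 obtain D1 where D1: "EV s. A (s + 1) \<le> D1 * A s" using A_step by blast
 have ev: "EV s. A s / s \<ge> 2 * real D" using A_transc by (simp add: filterlim_at_top)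
 have ev2: "EV s. exp s \<ge> max r R" by real_asymp
 have "EV s. \<exists>t\<in>{- (pi / 2 + q0)..pi / 2 + q0}. Re (G (Complex s t)) \<ge> 0"
  using f_big ev ev2 eventually_gt_at_top[of 0]
 proof eventually_elim
  case (elim s)
  obtain z where z: "norm z = exp s" "exp (A s / 2) \<le> norm (f z)" using elim(1) by blast
  define t where "t = Arg z"
  have zz: "z = pt s t" unfolding t_def by (rule polar_form[OF z(1)])
  have ge1: "exp (A s / 2) \<ge> 1" using A_pos[of s] by simp
  have th: "\<bar>t\<bar> \<le> pi / 2 + q0"
  proof (rule ccontr)
   assume n: "\<not> \<bar>t\<bar> \<le> pi / 2 + q0"
   have "\<bar>t\<bar> \<le> pi" using Arg_bounded[of z] by (auto simp: t_def)
   hence "cos \<bar>t\<bar> \<le> cos (pi / 2 + q0)" using n p0 pi_gt_zero by (intro cos_monotone_0_pi_le) auto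
   hence "cos t \<le> - sin q0" by (simp add: cos_add)
   hence "Re z \<le> - sin q0 * norm z" using mult_left_mono[of "cos t" "- sin q0" "exp s"] by (simp add: zz Re_exp mult.commute)
   hence "norm (f z) \<le> 1 / 3" using r[of z] z elim(3) by simp
   thus False using z(2) ge1 by linarith
  qed
  have inS: "Complex s t \<in> strip l u" using th p0 by (auto simp: abs_le_iff)
  have "2 * real D * s \<le> A s" using elim(2,4) by (simp add: field_simps)
  hence "exp (real D * s) \<le> exp (A s / 2)" by simp
  hence "norm (poly p z) \<le> exp (A s / 2)" using D(2)[of z] z elim(3) by (simp add: exp_of_nat_mult)
  hence "exp (A s / 2) * 1 \<le> exp (A s / 2) * norm (F z)"
   using z(2) mult_right_mono[of "norm (poly p z)" "exp (A s / 2)" "norm (F z)"] unfolding f_eq norm_mult mult_1_right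
   by (meson norm_ge_zero order_trans)
  hence "1 \<le> norm (F z)" by (simp only: mult_le_cancel_left_pos exp_gt_zero)
  hence "Re (G (Complex s t)) \<ge> 0" using FG[OF inS] by (simp add: zz)
  thus ?case using th by (intro bexI[of _ t]) (auto simp: abs_le_iff)
 qed
 moreover have "- (pi / 2 + q0) \<le> pi / 2 + q0" using p0(1) pi_gt_zero by linarith
 ultimately obtain K2 where "K2 > 0" "EV s. \<forall>t\<in>{- (pi / 2 + q0)..pi / 2 + q0}. norm (deriv G (Complex s t)) \<le> K2 * A s"
  using eventually_deriv_bound[OF p0(3) _ p0(4) D1 A_top] by blast
 thus ?thesis using p0 by blast
qed

text \<open>The angle \<open>q\<close> beyond the imaginary axis is cut at
  \<open>qs = N1 * s / A s\<close>. For \<open>q > 1 / 2\<close> the function is small anyway. For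
  \<open>qs \<le> q \<le> 1 / 2\<close>, \<open>h1_polar\<close> makes \<open>h\<close> small and
  \<open>f\<close> bounded. For \<open>q < qs\<close> the bound \<open>K2 * A s\<close> for the
  derivative of \<open>G\<close> is integrated over an angle of at most \<open>qs\<close>, which
  costs only \<open>K2 * N1 * s\<close>.\<close>

lemma left_growth:
 "\<exists>N::nat. EV s. \<forall>z. norm z = exp s \<and> Re z \<le> 0 \<longrightarrow> norm (f z) \<le> exp (real N * s)"
proof -
 obtain c M B where c: "c > 0" "B > 0" and hp: "EV s. \<forall>t\<in>{1, -1}. \<forall>q. B * exp (- s) < q \<and> q \<le> 1 / 2 \<longrightarrow>
   Re (pt s (t * (pi / 2 + q))) \<le> - X \<and> norm (h1 (pt s (t * (pi / 2 + q)))) \<le> exp (M - c * A s * q)"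
  using h1_polar by blast
 obtain q0 K2 where p0: "0 < q0" "q0 \<le> 1 / 2" "l < - (pi / 2 + q0)" "pi / 2 + q0 < u" "K2 > 0"
   and dG: "EV s. \<forall>y\<in>{- (pi / 2 + q0)..pi / 2 + q0}. norm (deriv G (Complex s y)) \<le> K2 * A s"
  using deriv_G_bound by blast
 obtain B0 where B0: "B0 > 0" "EV s. A s \<le> B0 * exp s" using A_exp_type by blast
 obtain c0 R D where D: "c0 > 0" "R \<ge> 1" "\<And>z. norm z \<ge> R \<Longrightarrow> c0 \<le> norm (poly p z)" "\<And>z. norm z \<ge> R \<Longrightarrow> norm (poly p z) \<le> norm z ^ D"
  using poly_norm_bounds[OF p] by metis
 have quarter: "(1/4::real) > 0" by simp
 obtain r where r: "\<And>z. norm z \<ge> r \<Longrightarrow> Re z \<le> - (1/4) * norm z \<Longrightarrow> norm (f z) \<le> 1 / 3" using left_small[OF quarter] by blast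
 \<comment> \<open>Then \<open>c * A s * qs = (K + 1) * s\<close>: \<open>K\<close> powers of
   \<open>exp s\<close> pay for the passage from \<open>h1\<close> to \<open>h\<close>, the last one
   makes \<open>h\<close> small.\<close>
 define N1 where "N1 = (real K + 1) / c"
 have N1: "N1 > 0" using c by (simp add: N1_def)
 define N where "N = D + 1 + nat \<lceil>K2 * N1\<rceil>"
 have N: "real N \<ge> real D + 1 + K2 * N1" unfolding N_def by linarith
 have evA: "EV s. A s / s \<ge> N1 / q0" using A_transc by (simp add: filterlim_at_top)
 have evs: "EV s. N1 * s > B * B0" "EV s. exp (M - s) \<le> 1 / 2" "EV s. exp s \<ge> max r R"
  "EV s. s \<ge> - ln c0"
  using N1 by real_asymp+
 have "EV s. \<forall>z. norm z = exp s \<and> Re z \<le> 0 \<longrightarrow> norm (f z) \<le> exp (real N * s)"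
  using hp dG B0(2) evA evs eventually_gt_at_top[of 0]
 proof eventually_elim
  case (elim s)
  define qs where "qs = N1 * s / A s"
  have s0: "s > 0" by (rule elim(9))
  have As: "A s > 0" by (rule A_pos)
  have psA: "qs * A s = N1 * s" using As by (simp add: qs_def)
  have ps: "qs > 0" using N1 s0 As by (simp add: qs_def)
  have ps0: "qs \<le> q0" using elim(4) s0 As p0(1) by (simp add: qs_def field_simps)
  have psB: "B * exp (- s) < qs"
  proof -
   have "B * exp (- s) * A s \<le> B * exp (- s) * (B0 * exp s)" using elim(3) c(2) by (intro mult_left_mono) auto
   also have "\<dots> = B * B0" by (simp add: exp_minus)
   also have "\<dots> < qs * A s" using elim(5) psA by simp
   finally show ?thesis using As by (simp only: mult_less_cancel_right_pos)
  qed
  have one: "1 \<le> exp (real N * s)" using s0 by simp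
  have mid: "norm (f (pt s (t * (pi / 2 + q)))) \<le> 1" if tau: "t \<in> {1, -1}" and psi: "qs \<le> q" "q \<le> 1 / 2" for t q
  proof -
   let ?z = "pt s (t * (pi / 2 + q))"
   have h: "Re ?z \<le> - X" "norm (h1 ?z) \<le> exp (M - c * A s * q)" using elim(1) tau psi psB by auto
   have "(real K + 1) * s = c * (qs * A s)" using c by (simp add: psA N1_def)
   also have "\<dots> \<le> c * (q * A s)" using psi c As by (intro mult_left_mono mult_right_mono) auto
   finally have "(real K + 1) * s \<le> c * A s * q" by (simp add: mult_ac)
   hence e: "exp (M - c * A s * q) \<le> exp (M - (real K + 1) * s)" by simp
   hence "norm (h1 ?z) * exp s ^ K \<le> exp (M - (real K + 1) * s) * exp s ^ K" using order_trans[OF h(2) e] by (intro mult_right_mono) auto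
   also have "\<dots> = exp (M - s)" by (simp add: exp_of_nat_mult[symmetric] mult_exp_exp algebra_simps)
   also have "norm (h1 ?z) * exp s ^ K = norm (h ?z)" by (simp add: h1_def norm_divide norm_power)
   finally have nh: "norm (h ?z) \<le> 1 / 2" using elim(6) by linarith
   have "norm (f ?z) = norm (exp (h ?z) - 1)" using exp_h[OF h(1)] by (simp add: norm_minus_commute)
   also have "\<dots> \<le> 3 / 2 * norm (h ?z)" by (rule norm_exp_bounds(2)[OF nh])
   finally show ?thesis using nh by linarith
  qed
  show ?case
  proof (intro allI impI; elim conjE)
   fix z :: complex assume z: "norm z = exp s" "Re z \<le> 0"
   define y where "y = Arg z"
   have zz: "z = pt s y" unfolding y_def by (rule polar_form[OF z(1)])
   define t :: real where "t = (if y \<ge> 0 then 1 else -1)"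
   define q where "q = \<bar>y\<bar> - pi / 2"
   have tau: "t \<in> {1, -1}" and th: "y = t * (pi / 2 + q)" by (auto simp: t_def q_def)
   have "\<bar>y\<bar> \<le> pi" using Arg_bounded[of z] by (auto simp: y_def)
   hence psi2: "q \<le> pi / 2" by (simp add: q_def)
   have psi0: "q \<ge> 0"
   proof (rule ccontr)
    assume "\<not> q \<ge> 0"
    hence "cos y > 0" by (intro cos_gt_zero_pi) (auto simp: q_def abs_if split: if_splits)
    thus False using z(2) by (auto simp: zz Re_exp mult_le_0_iff)
   qed
   consider "q > 1 / 2" | "qs \<le> q" "q \<le> 1 / 2" | "q < qs" by linarith
   thus "norm (f z) \<le> exp (real N * s)"
   proof cases
    case 1
    have "1 / 4 \<le> sin (1 / 2 :: real)" using sin_ge_half[of "1/2"] by simp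
    also have "\<dots> \<le> sin q" using 1 psi2 by (intro sin_monotone_2pi_le) auto
    finally have "exp s * (1/4) \<le> exp s * sin q" by (intro mult_left_mono) auto
    hence "Re z \<le> - (1/4) * norm z" using cos_side[of t q] tau by (simp add: zz Re_exp th)
    hence "norm (f z) \<le> 1 / 3" using r[of z] z elim(7) by simp
    thus ?thesis using one by linarith
   next
    case 2
    thus ?thesis using order_trans[OF mid[OF tau 2] one] by (simp only: zz th)
   next
    case 3
    let ?a = "Complex s (t * (pi / 2 + qs))" and ?b = "Complex s (t * (pi / 2 + q))"
    have seg: "Re w = s \<and> \<bar>Im w\<bar> \<le> pi / 2 + q0" if "w \<in> closed_segment ?a ?b" for w
    proof -
     have conv: "convex {w. Re w = s \<and> \<bar>Im w\<bar> \<le> pi / 2 + q0}"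
     proof -
      have "{w. Re w = s \<and> \<bar>Im w\<bar> \<le> pi / 2 + q0} = {w. Re w \<le> s} \<inter> {w. s \<le> Re w} \<inter> {w. Im w \<le> pi / 2 + q0} \<inter> {w. - (pi / 2 + q0) \<le> Im w}"
       by (auto simp: abs_le_iff)
      thus ?thesis by (simp only: convex_Int convex_halfspace_Re_le convex_halfspace_Re_ge convex_halfspace_Im_le convex_halfspace_Im_ge)
     qed
     have "closed_segment ?a ?b \<subseteq> {w. Re w = s \<and> \<bar>Im w\<bar> \<le> pi / 2 + q0}"
      by (rule closed_segment_subset[OF _ _ conv]) (use tau ps ps0 psi0 3 pi_gt_zero in \<open>auto simp: abs_mult\<close>)
     thus ?thesis using that by blast
    qed
    have inS: "w \<in> strip l u" if "w \<in> closed_segment ?a ?b" for w using seg[OF that] p0 by (auto simp: abs_le_iff)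
    have "norm (G ?b - G ?a) \<le> K2 * A s * norm (?b - ?a)"
    proof (rule field_differentiable_bound[of "closed_segment ?a ?b"])
     fix w assume z': "w \<in> closed_segment ?a ?b"
     show "(G has_field_derivative deriv G w) (at w within closed_segment ?a ?b)"
      using holomorphic_derivI[OF G open_strip inS[OF z']] has_field_derivative_at_within by blast
     have "w = Complex s (Im w)" using seg[OF z'] by (simp add: complex_eq_iff)
     thus "norm (deriv G w) \<le> K2 * A s" using elim(2)[rule_format, of "Im w"] seg[OF z'] by (simp add: abs_le_iff)
    qed auto
    also have "norm (?b - ?a) \<le> qs"
    proof -
     have "?b - ?a = of_real (t * (q - qs)) * \<i>" by (simp add: complex_eq_iff algebra_simps)
     hence "norm (?b - ?a) = \<bar>t\<bar> * \<bar>q - qs\<bar>" by (simp add: norm_mult abs_mult del: of_real_mult of_real_diff)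
     thus ?thesis using tau 3 psi0 by auto
    qed
    finally have "norm (G ?b - G ?a) \<le> K2 * (qs * A s)" using p0(5) As by (simp add: mult_left_mono mult_ac)
    hence Gb: "Re (G ?b) \<le> Re (G ?a) + K2 * (N1 * s)" using complex_Re_le_cmod[of "G ?b - G ?a"] psA by simp
    have "norm (exp ?a) \<ge> R" using elim(7) by simp
    hence "c0 * norm (F (exp ?a)) \<le> norm (f (exp ?a))" unfolding f_eq norm_mult by (intro mult_right_mono D) auto
    also have "\<dots> \<le> 1" using mid[OF tau, of qs] ps0 p0(2) by simp
    finally have "c0 * exp (Re (G ?a)) \<le> 1" using FG[OF inS[OF ends_in_segment(1)]] by simp
    hence "ln (c0 * exp (Re (G ?a))) \<le> 0" using D(1) by (subst ln_le_zero_iff) auto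
    hence Ga: "Re (G ?a) \<le> - ln c0" using D(1) by (simp add: ln_mult)
    have "norm (F z) = exp (Re (G ?b))" using FG[OF inS[OF ends_in_segment(2)]] by (simp add: zz th)
    also have "\<dots> \<le> exp (s + K2 * N1 * s)" using Gb Ga elim(8) by simp
    finally have nF: "norm (F z) \<le> exp (s + K2 * N1 * s)" .
    have "norm (poly p z) \<le> exp (real D * s)" using D(4)[of z] z elim(7) by (simp add: exp_of_nat_mult)
    hence "norm (f z) \<le> exp (real D * s) * exp (s + K2 * N1 * s)" unfolding f_eq norm_mult using nF by (intro mult_mono) auto
    also have "\<dots> = exp ((real D + 1 + K2 * N1) * s)" by (simp add: mult_exp_exp algebra_simps)
    also have "\<dots> \<le> exp (real N * s)" using mult_right_mono[OF N, of s] s0 by simp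
    finally show ?thesis .
   qed
  qed
 qed
 thus ?thesis by blast
qed

end

context decaying begin

lemma not_poly_growth: "\<not> (EV s. \<forall>z. norm z = exp s \<longrightarrow> norm (f z) \<le> exp (N * s))"
proof
 assume a: "EV s. \<forall>z. norm z = exp s \<longrightarrow> norm (f z) \<le> exp (N * s)"
 have "EV s. A s / s \<ge> 2 * N + 1" using A_transc by (simp add: filterlim_at_top)
 with a f_big have "\<forall>\<^sub>F s in at_top :: real filter. False" using eventually_gt_at_top[of 0]
 proof eventually_elim
  case (elim s)
  obtain z where "norm z = exp s" "exp (A s / 2) \<le> norm (f z)" using elim(2) by blast
  hence "exp (A s / 2) \<le> exp (N * s)" using elim(1) by (meson order_trans)
  hence "A s \<le> 2 * N * s" by simp
  moreover have "(2 * N + 1) * s \<le> A s" using elim(3,4) by (simp add: field_simps)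
  ultimately show False using elim(4) by (simp add: distrib_right)
 qed
 thus False by simp
qed

end

section \<open>The exact exponential type and the form \<open>P * exp (a * z)\<close>\<close>

context decaying_log begin

lemma exp_type_bound: "\<exists>B>0. \<exists>r\<ge>1. \<forall>z. norm z \<ge> r \<longrightarrow> norm (f z) \<le> exp (B * norm z)"
proof -
 obtain B where B: "B > 0" "EV s. A s \<le> B * exp s" using A_exp_type by blast
 then obtain s0 where s0: "\<And>s. s \<ge> s0 \<Longrightarrow> A s \<le> B * exp s" by (auto simp: ev_top)
 have "norm (f z) \<le> exp (B * norm z)" if "norm z \<ge> max 1 (exp s0)" for z
 proof -
  have z: "norm z > 0" "norm z \<ge> exp s0" using that by auto
  hence "ln (norm z) \<ge> s0" by (simp add: ln_ge_iff)
  hence le: "exp (A (ln (norm z))) \<le> exp (B * norm z)" using s0[of "ln (norm z)"] z by simp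
  have "z \<noteq> 0" using z by auto
  from order_trans[OF norm_f_le[OF this] le] show ?thesis .
 qed
 thus ?thesis using B(1) by (intro exI[of _ B] conjI exI[of _ "max 1 (exp s0)"]) auto
qed

lemma left_poly_bound: "\<exists>N r. r \<ge> 1 \<and> (\<forall>z. norm z \<ge> r \<and> Re z \<le> 0 \<longrightarrow> norm (f z) \<le> norm z ^ N)"
proof -
 obtain N :: nat where "EV s. \<forall>z. norm z = exp s \<and> Re z \<le> 0 \<longrightarrow> norm (f z) \<le> exp (real N * s)" using left_growth by blast
 then obtain s0 where s0: "\<And>s z. s \<ge> s0 \<Longrightarrow> norm z = exp s \<Longrightarrow> Re z \<le> 0 \<Longrightarrow> norm (f z) \<le> exp (real N * s)"
  unfolding ev_top by blast
 have "norm (f z) \<le> norm z ^ N" if "norm z \<ge> max 1 (exp s0)" "Re z \<le> 0" for z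
 proof -
  have z: "norm z > 0" "norm z \<ge> exp s0" using that by auto
  hence "ln (norm z) \<ge> s0" by (simp add: ln_ge_iff)
  hence "norm (f z) \<le> exp (real N * ln (norm z))" using s0[of "ln (norm z)" z] z that by simp
  thus ?thesis using z by (simp add: exp_of_nat_mult)
 qed
 thus ?thesis by (intro exI[of _ N] exI[of _ "max 1 (exp s0)"]) auto
qed

text \<open>Phragmen-Lindelof twice for \<open>H z = f z * exp (- b * z) / z ^ N\<close>: in the two
  quadrants, where exponential type is below the critical order 2, with a crude bound on the
  positive axis; then in the half-plane, where boundedness is below the critical order 1. The second
  application removes the crude bound, so that \<open>M\<close> depends neither on \<open>b\<close>
  nor on \<open>T\<close>.\<close>

lemma right_bound:
 assumes B0: "B0 > 0" "\<And>z. norm z \<ge> r0 \<Longrightarrow> norm (f z) \<le> exp (B0 * norm z)"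
  and r0: "r0 \<ge> 1" and left: "\<And>z. norm z \<ge> r0 \<Longrightarrow> Re z \<le> 0 \<Longrightarrow> norm (f z) \<le> norm z ^ N"
  and M: "M \<ge> 1" "\<And>z. norm z = r0 \<Longrightarrow> norm (f z) \<le> M"
  and b: "b \<ge> 0" "\<And>x. x \<ge> T \<Longrightarrow> norm (f (of_real x)) \<le> exp (b * x)"
  and z: "Re z \<ge> 0" "norm z \<ge> r0"
 shows "norm (f z) \<le> M * norm z ^ N * exp (b * Re z)"
proof -
 define H where "H = (\<lambda>z. f z * exp (- of_real b * z) / z ^ N)"
 have hol: "H holomorphic_on - {0}" unfolding H_def by (intro holomorphic_intros f_hol) auto
 have nH: "norm (H z) = norm (f z) * exp (- b * Re z) / norm z ^ N" for z
  by (simp add: H_def norm_mult norm_divide norm_power)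
 have H_le_f: "norm (H z) \<le> norm (f z)" if "norm z \<ge> 1" "Re z \<ge> 0" for z
 proof -
  have "norm (f z) * exp (- b * Re z) \<le> norm (f z)" using that b by (intro mult_left_le) auto
  moreover have "norm z ^ N \<ge> 1" using that by simp
  ultimately show ?thesis unfolding nH using frac_le[of "norm (f z)" "norm (f z) * exp (- b * Re z)" 1 "norm z ^ N"] by simp
 qed
 have imag: "norm (H z) \<le> 1" if "norm z \<ge> r0" "Re z = 0" for z
 proof -
  have "norm z ^ N > 0" using that r0 by (intro zero_less_power) linarith
  thus ?thesis unfolding nH using left[of z] that by simp
 qed
 have arc: "norm (H z) \<le> M" if "norm z = r0" "Re z \<ge> 0" for z
  using H_le_f[of z] M(2)[of z] that r0 by linarith
 have "continuous_on {r0..max r0 T} (\<lambda>x. norm (H (of_real x)))"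
 proof -
  have "continuous_on {r0..max r0 T} (\<lambda>x. H (of_real x))"
   by (rule continuous_on_compose2[OF holomorphic_on_imp_continuous_on[OF hol]]) (use r0 in \<open>auto intro!: continuous_intros\<close>)
  thus ?thesis by (rule continuous_on_norm)
 qed
 hence "bounded ((\<lambda>x. norm (H (of_real x))) ` {r0..max r0 T})" by (intro compact_imp_bounded compact_continuous_image) auto
 then obtain M0 where M0: "\<And>x. x \<in> {r0..max r0 T} \<Longrightarrow> norm (H (of_real x)) \<le> M0" unfolding bounded_iff by fastforce
 define Mb where "Mb = max M M0"
 have Mb: "Mb \<ge> 1" "Mb \<ge> M" "Mb \<ge> M0" using M by (auto simp: Mb_def)
 have pos: "norm (H (of_real x)) \<le> Mb" if "x \<ge> r0" for x
 proof (cases "x \<le> max r0 T")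
  case True
  thus ?thesis using M0[of x] that Mb by simp
 next
  case False
  hence "norm (f (of_real x)) \<le> exp (b * x)" by (intro b) auto
  hence "norm (f (of_real x)) * exp (- b * x) \<le> exp (b * x) * exp (- b * x)" by (intro mult_right_mono) auto
  hence le: "norm (f (of_real x)) * exp (- b * x) \<le> 1" by (simp add: exp_minus)
  have x1: "x ^ N \<ge> 1" using that r0 by (intro one_le_power) linarith
  have "norm (H (of_real x)) = norm (f (of_real x)) * exp (- b * x) / x ^ N" unfolding nH using that r0 by simp
  also have "\<dots> \<le> 1" using le x1 by (subst pos_divide_le_eq) linarith+
  finally have "norm (H (of_real x)) \<le> 1" .
  thus ?thesis using Mb by linarith
 qed
 have re_cis: "Re (of_real r * cis t) = r * cos t" for r t by simp
 have growth: "norm (H (of_real r * cis t)) \<le> exp (B0 * r)" if "r \<ge> r0" "\<bar>t\<bar> \<le> pi / 2" for r t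
 proof -
  have "cos t \<ge> 0" using that by (intro cos_ge_zero) (auto simp: abs_le_iff)
  hence "Re (of_real r * cis t) \<ge> 0" using that r0 by simp
  hence "norm (H (of_real r * cis t)) \<le> norm (f (of_real r * cis t))"
   using that r0 by (intro H_le_f) (auto simp: norm_mult)
  also have "\<dots> \<le> exp (B0 * norm (of_real r * cis t))" using that r0 by (intro B0) (auto simp: norm_mult)
  finally show ?thesis using that r0 by (simp add: norm_mult)
 qed
 have oH: "open (- {0::complex})" by auto
 have quarter_turn: "\<bar>t\<bar> \<le> pi / 2" if "g = 1 \<or> g = -1" "\<bar>t - g * (pi / 4)\<bar> \<le> pi / 4" for g t :: real
 proof -
  have "\<bar>g * (pi / 4)\<bar> = pi / 4" using that(1) by (auto simp: abs_mult)
  thus ?thesis using that(2) by linarith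
 qed
 have quad: "norm (H (of_real r * cis t)) \<le> Mb" if sg: "g = 1 \<or> g = -1" and rt: "r \<ge> r0" "\<bar>t - g * (pi / 4)\<bar> \<le> pi / 4" for r t g :: real
 proof (rule phragmen_lindelof_sector[OF hol oH _ _ _ _ _ _ _ _ rt])
  show "r0 > 0" using r0 by linarith
  show "of_real r * cis t \<in> - {0}" if "r0 \<le> r" for r t using that r0 by simp
  show "pi / 4 > 0" "(0::real) \<le> 1" "1 * (pi / 4) < pi / 2" by auto
  show "norm (H (of_real r * cis t)) \<le> Mb" if "r0 \<le> r" "\<bar>t - g * (pi / 4)\<bar> = pi / 4" for r t
  proof -
   have "t = 0 \<or> t = pi / 2 \<or> t = - (pi / 2)" using that(2) sg by (auto simp: abs_if split: if_splits)
   thus ?thesis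
   proof (elim disjE)
    assume "t = 0" thus ?thesis using pos[OF that(1)] by simp
   next
    assume th: "t = pi / 2"
    have "norm (H (of_real r * cis (pi / 2))) \<le> 1" using that(1) r0 by (intro imag) (auto simp: norm_mult)
    thus ?thesis unfolding th using Mb by linarith
   next
    assume th: "t = - (pi / 2)"
    have "norm (H (of_real r * cis (- (pi / 2)))) \<le> 1" using that(1) r0 by (intro imag) (auto simp: norm_mult)
    thus ?thesis unfolding th using Mb by linarith
   qed
  qed
  show "norm (H (of_real r0 * cis t)) \<le> Mb" if "\<bar>t - g * (pi / 4)\<bar> \<le> pi / 4" for t
  proof -
   have "\<bar>t\<bar> \<le> pi / 2" using quarter_turn[OF sg that] .
   hence "cos t \<ge> 0" by (intro cos_ge_zero) (auto simp: abs_le_iff)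
   hence "norm (H (of_real r0 * cis t)) \<le> M" using r0 by (intro arc) (auto simp: norm_mult)
   thus ?thesis using Mb by linarith
  qed
  show "\<exists>r\<ge>T. \<forall>t. \<bar>t - g * (pi / 4)\<bar> \<le> pi / 4 \<longrightarrow> norm (H (of_real r * cis t)) \<le> exp (B0 * r powr 1)" for T
  proof (intro exI[of _ "max T r0"] conjI allI impI)
   fix t assume "\<bar>t - g * (pi / 4)\<bar> \<le> pi / 4"
   hence "\<bar>t\<bar> \<le> pi / 2" by (rule quarter_turn[OF sg])
   thus "norm (H (of_real (max T r0) * cis t)) \<le> exp (B0 * max T r0 powr 1)" using growth[of "max T r0" t] r0 by simp
  qed auto
 qed
 have half: "norm (H (of_real r * cis t)) \<le> Mb" if "r \<ge> r0" "\<bar>t\<bar> \<le> pi / 2" for r t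
 proof (cases "t \<ge> 0")
  case True
  have "\<bar>t - 1 * (pi / 4)\<bar> \<le> pi / 4" by (rule abs_leI) (use True that in linarith)+
  thus ?thesis using quad[of 1 r t] that by blast
 next
  case False
  have "\<bar>t - (-1) * (pi / 4)\<bar> \<le> pi / 4" by (rule abs_leI) (use False that in linarith)+
  thus ?thesis using quad[of "-1" r t] that by blast
 qed
 have fin: "norm (H (of_real r * cis t)) \<le> M" if rt: "r \<ge> r0" "\<bar>t - 0\<bar> \<le> pi / 2" for r t
 proof (rule phragmen_lindelof_sector[OF hol oH _ _ _ _ _ _ _ _ rt])
  show "r0 > 0" using r0 by linarith
  show "of_real r * cis t \<in> - {0}" if "r0 \<le> r" for r t using that r0 by simp
  show "pi / 2 > 0" "(0::real) \<le> 0" "0 * (pi / 2) < pi / 2" by auto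
  show "norm (H (of_real r * cis t)) \<le> M" if "r0 \<le> r" "\<bar>t - 0\<bar> = pi / 2" for r t
  proof -
   have "cos \<bar>t\<bar> = 0" using that(2) by (simp only: diff_zero cos_pi_half)
   hence "cos t = 0" by simp
   hence "norm (H (of_real r * cis t)) \<le> 1" using that(1) r0 by (intro imag) (auto simp: norm_mult)
   thus ?thesis using M by linarith
  qed
  show "norm (H (of_real r0 * cis t)) \<le> M" if "\<bar>t - 0\<bar> \<le> pi / 2" for t
  proof -
   have "cos t \<ge> 0" using that by (intro cos_ge_zero) (auto simp: abs_le_iff)
   thus ?thesis using r0 by (intro arc) (auto simp: norm_mult)
  qed
  show "\<exists>r\<ge>T. \<forall>t. \<bar>t - 0\<bar> \<le> pi / 2 \<longrightarrow> norm (H (of_real r * cis t)) \<le> exp (ln Mb * r powr 0)" for T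
   using half Mb r0 by (intro exI[of _ "max T r0"]) auto
 qed
 have "z = of_real (norm z) * cis (Arg z)" using Arg_eq[of z] r0 z by (cases "z = 0") (auto simp: cis_conv_exp)
 moreover have "\<bar>Arg z - 0\<bar> \<le> pi / 2"
 proof (rule ccontr)
  assume n: "\<not> ?thesis"
  have "cos (Arg z) < 0"
  proof -
   have "cos \<bar>Arg z\<bar> < cos (pi / 2)" using n Arg_bounded[of z] by (intro cos_monotone_0_pi) auto
   thus ?thesis by simp
  qed
  moreover have "norm z > 0" using z r0 by linarith
  ultimately have "norm z * cos (Arg z) < 0" by (simp add: mult_pos_neg)
  moreover have "Re z = norm z * cos (Arg z)" using \<open>z = of_real (norm z) * cis (Arg z)\<close> re_cis by metis
  ultimately show False using z by linarith
 qed
 ultimately have "norm (H z) \<le> M" using fin[of "norm z" "Arg z"] z by simp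
 moreover have zN: "norm z ^ N > 0" using z r0 by (intro zero_less_power) linarith
 ultimately have "norm (f z) * exp (- b * Re z) \<le> M * norm z ^ N" unfolding nH by (simp add: divide_le_eq)
 hence "norm (f z) * exp (- b * Re z) * exp (b * Re z) \<le> M * norm z ^ N * exp (b * Re z)" by (intro mult_right_mono) auto
 moreover have "exp (- b * Re z) * exp (b * Re z) = 1" by (simp add: mult_exp_exp)
 ultimately show ?thesis by (simp only: mult.assoc mult_1_right)
qed

text \<open>\<open>a\<close> is the infimum of the exponents that are valid on the positive axis.
  The constant of \<open>right_bound\<close> does not depend on the exponent, so the estimate passes
  to the infimum itself. For \<open>a = 0\<close>, \<open>f\<close> would have polynomial growth in
  both half-planes.\<close>

lemma right_growth:
 "\<exists>a>0. \<exists>N r M. r \<ge> 1 \<and> M \<ge> 1 \<and> (\<forall>z. norm z \<ge> r \<and> Re z \<ge> 0 \<longrightarrow> norm (f z) \<le> M * norm z ^ N * exp (a * Re z)) \<and>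
   (\<forall>b T. 0 \<le> b \<and> b < a \<longrightarrow> (\<exists>x\<ge>T. norm (f (of_real x)) > exp (b * x)))"
proof -
 obtain B0 r1 where B0: "B0 > 0" "r1 \<ge> 1" "\<And>z. norm z \<ge> r1 \<Longrightarrow> norm (f z) \<le> exp (B0 * norm z)" using exp_type_bound by blast
 obtain N r2 where r2: "r2 \<ge> 1" "\<And>z. norm z \<ge> r2 \<Longrightarrow> Re z \<le> 0 \<Longrightarrow> norm (f z) \<le> norm z ^ N" using left_poly_bound by blast
 define r0 where "r0 = max r1 r2"
 have "bounded (f ` sphere 0 r0)" by (intro compact_imp_bounded compact_continuous_image holomorphic_on_imp_continuous_on f_hol) auto
 then obtain M0 where "\<forall>y\<in>f ` sphere 0 r0. norm y \<le> M0" unfolding bounded_iff by blast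
 hence M0: "norm (f z) \<le> max 1 M0" if "norm z = r0" for z using that by (simp add: le_max_iff_disj)
 define Bs where "Bs = {b. 0 \<le> b \<and> (\<exists>T. \<forall>x\<ge>T. norm (f (of_real x)) \<le> exp (b * x))}"
 define a where "a = Inf Bs"
 have "norm (f (of_real x)) \<le> exp (B0 * x)" if "x \<ge> r1" for x using B0(3)[of "of_real x"] that B0(2) by simp
 hence B0B: "B0 \<in> Bs" using B0(1) by (auto simp: Bs_def)
 have bdd: "bdd_below Bs" by (rule bdd_belowI[of _ 0]) (auto simp: Bs_def)
 have beta0: "a \<ge> 0" unfolding a_def by (rule cInf_greatest) (use B0B in \<open>auto simp: Bs_def\<close>)
 have bd: "norm (f z) \<le> max 1 M0 * norm z ^ N * exp (b * Re z)" if "b \<in> Bs" "norm z \<ge> r0" "Re z \<ge> 0" for b z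
 proof -
  obtain T where T: "0 \<le> b" "\<And>x. x \<ge> T \<Longrightarrow> norm (f (of_real x)) \<le> exp (b * x)" using \<open>b \<in> Bs\<close> by (auto simp: Bs_def)
  show ?thesis
   by (rule right_bound[where ?B0.0 = B0 and ?r0.0 = r0 and T = T]) (use B0 r2 M0 T that in \<open>auto simp: r0_def\<close>)
 qed
 have bdf: "norm (f z) \<le> max 1 M0 * norm z ^ N * exp (a * Re z)" if z: "norm z \<ge> r0" "Re z \<ge> 0" for z
 proof -
  have "norm (f z) \<le> max 1 M0 * norm z ^ N * exp (b * Re z)" if "b > a" for b
  proof -
   obtain b' where b': "b' \<in> Bs" "b' < b" using \<open>b > a\<close> cInf_lessD[of Bs b] B0B unfolding a_def by blast
   have "norm (f z) \<le> max 1 M0 * norm z ^ N * exp (b' * Re z)" by (rule bd[OF b'(1) z])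
   also have "\<dots> \<le> max 1 M0 * norm z ^ N * exp (b * Re z)"
    using b'(2) z(2) by (intro mult_left_mono) (auto intro!: mult_right_mono)
   finally show ?thesis .
  qed
  hence "\<forall>\<^sub>F b in at_right a. norm (f z) \<le> max 1 M0 * norm z ^ N * exp (b * Re z)"
   by (intro eventually_at_rightI[of a "a + 1"]) auto
  moreover have "((\<lambda>b. max 1 M0 * norm z ^ N * exp (b * Re z)) \<longlongrightarrow> max 1 M0 * norm z ^ N * exp (a * Re z)) (at_right a)"
   by (intro tendsto_intros)
  ultimately show ?thesis by (intro tendsto_lowerbound) auto
 qed
 have beta_pos: "a > 0"
 proof (rule ccontr)
  assume "\<not> a > 0"
  hence b0: "a = 0" using beta0 by simp
  have "EV s. exp s \<ge> max r0 (max 1 M0)" by real_asymp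
  hence "EV s. \<forall>z. norm z = exp s \<longrightarrow> norm (f z) \<le> exp (real (N + 1) * s)"
  proof eventually_elim
   case (elim s)
   show ?case
   proof (intro allI impI)
    fix z :: complex assume z: "norm z = exp s"
    have "norm (f z) \<le> max 1 M0 * norm z ^ N"
    proof (cases "Re z \<ge> 0")
     case True thus ?thesis using bdf[of z] z elim by (simp add: b0)
    next
     case False
     hence "norm (f z) \<le> 1 * norm z ^ N" using r2(2)[of z] z elim by (simp add: r0_def)
     also have "\<dots> \<le> max 1 M0 * norm z ^ N" by (intro mult_right_mono) auto
     finally show ?thesis .
    qed
    also have "\<dots> \<le> exp s * exp s ^ N" unfolding z using elim by (intro mult_right_mono) auto
    also have "\<dots> = exp (real (N + 1) * s)" by (simp add: exp_of_nat_mult[symmetric] mult_exp_exp algebra_simps)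
    finally show "norm (f z) \<le> exp (real (N + 1) * s)" .
   qed
  qed
  thus False using not_poly_growth by blast
 qed
 have freq: "\<exists>x\<ge>T. norm (f (of_real x)) > exp (b * x)" if "0 \<le> b" "b < a" for b T
 proof (rule ccontr)
  assume "\<not> ?thesis"
  hence "b \<in> Bs" using that unfolding Bs_def by (auto simp: not_less)
  hence "a \<le> b" unfolding a_def using bdd by (intro cInf_lower)
  thus False using that by simp
 qed
 have r01: "r0 \<ge> 1" using B0 by (simp add: r0_def)
 have "\<forall>z. norm z \<ge> r0 \<and> Re z \<ge> 0 \<longrightarrow> norm (f z) \<le> max 1 M0 * norm z ^ N * exp (a * Re z)" using bdf by blast
 moreover have "\<forall>b T. 0 \<le> b \<and> b < a \<longrightarrow> (\<exists>x\<ge>T. norm (f (of_real x)) > exp (b * x))" using freq by blast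
 ultimately show ?thesis
  by (rule_tac exI[of _ a], intro conjI[OF beta_pos], rule_tac exI[of _ N], rule_tac exI[of _ r0], rule_tac exI[of _ "max 1 M0"])
    (intro conjI r01 max.cobounded1; assumption)
qed

text \<open>The rescaling is repeated for \<open>F * exp (- a * z)\<close> with the growth function
  \<open>C2 * exp s\<close>, at radii where \<open>f\<close> nearly reaches the rate
  \<open>a\<close> on the positive axis. The limit is bounded by 1 over the right half-plane and has
  modulus at least 1 at 0, so it is constant on the whole strip, which extends beyond the
  half-plane. Thus \<open>exp (a * Re z)\<close>, up to \<open>exp (d * x k)\<close>, bounds
  \<open>f\<close> also slightly to the left of the imaginary axis.\<close>

lemma regular_growth:
 assumes a: "a > 0" and r0: "r0 \<ge> 1" and M: "M \<ge> 1"
  and right: "\<And>z. norm z \<ge> r0 \<Longrightarrow> Re z \<ge> 0 \<Longrightarrow> norm (f z) \<le> M * norm z ^ N * exp (a * Re z)"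
  and freq: "\<And>b T. 0 \<le> b \<Longrightarrow> b < a \<Longrightarrow> \<exists>x\<ge>T. norm (f (of_real x)) > exp (b * x)"
 shows "\<exists>x::nat \<Rightarrow> real. diverges x \<and> (\<forall>k. x k \<ge> 1) \<and> (\<forall>L d. compact L \<longrightarrow> L \<subseteq> strip l u \<longrightarrow> d > 0 \<longrightarrow>
  (EVN k. \<forall>w\<in>L. norm (f (of_real (x k) * exp w)) * exp (- a * x k * Re (exp w)) \<le> exp (d * x k)))"
proof -
 obtain c0 R D where D: "c0 > 0" "R \<ge> 1" "\<And>z. norm z \<ge> R \<Longrightarrow> c0 \<le> norm (poly p z)" "\<And>z. norm z \<ge> R \<Longrightarrow> norm (poly p z) \<le> norm z ^ D"
  using poly_norm_bounds[OF p] by metis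
 obtain B where B: "B > 0" "EV s. A s \<le> B * exp s" using A_exp_type by blast
 then obtain sA where sA: "\<And>s. s \<ge> sA \<Longrightarrow> A s \<le> B * exp s" by (auto simp: ev_top)
 define bk where "bk k = a * (1 - 1 / (real k + 1))" for k :: nat
 have bk: "0 \<le> bk k" "bk k < a" for k using a by (auto simp: bk_def field_simps)
 have "\<exists>x. x \<ge> max 1 (real k) \<and> norm (f (of_real x)) > exp (bk k * x)" for k using freq[OF bk] by blast
 then obtain x where x: "\<And>k. x k \<ge> max 1 (real k)" "\<And>k. norm (f (of_real (x k))) > exp (bk k * x k)" by metis
 have x1: "x k \<ge> 1" for k using x(1)[of k] by simp
 have xtop: "diverges x" by (rule filterlim_at_top_mono[OF filterlim_real_sequentially]) (use x(1) in simp)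
 define s where "s k = ln (x k)" for k
 have es: "exp (s k) = x k" for k using x1[of k] by (simp add: s_def)
 have stop: "diverges s" unfolding s_def by (rule filterlim_compose[OF ln_at_top xtop])
 define C2 where "C2 = B + a"
 have C2: "C2 > 0" using B a by (simp add: C2_def)
 define A2 where "A2 s = C2 * exp s" for s :: real
 define G2 where "G2 w = G w - of_real a * exp w" for w
 define F2 where "F2 z = F z * exp (- of_real a * z)" for z
 interpret L: log_side F2 G2 l u "C + A sA" A2
 proof
  show "F2 holomorphic_on UNIV" unfolding F2_def by (intro holomorphic_intros F)
  show "F2 0 \<noteq> 0" using F_0 by (simp add: F2_def)
  show "G2 holomorphic_on strip l u" unfolding G2_def by (intro holomorphic_intros G)
  show "F2 (exp w) = exp (G2 w)" if "w \<in> strip l u" for w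
   using FG[OF that] by (simp add: F2_def G2_def exp_diff exp_minus field_simps)
  show "norm (F2 (exp w)) \<le> exp (A2 (Re w) + (C + A sA))" for w
  proof -
   have "A (Re w) \<le> B * exp (Re w) + A sA"
   proof (cases "Re w \<ge> sA")
    case True thus ?thesis using sA[OF True] A_pos[of sA] by linarith
   next
    case False
    hence "A (Re w) \<le> A sA" by (intro A_mono) auto
    moreover have "B * exp (Re w) \<ge> 0" using B by simp
    ultimately show ?thesis by linarith
   qed
   moreover have "- a * Re (exp w) \<le> a * exp (Re w)"
   proof -
    have "- Re (exp w) \<le> exp (Re w)" using abs_Re_le_cmod[of "exp w"] by simp
    thus ?thesis using a mult_left_mono[of "- Re (exp w)" "exp (Re w)" a] by simp
   qed
   ultimately have le: "(A (Re w) + C) + - a * Re (exp w) \<le> A2 (Re w) + (C + A sA)"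
    by (simp add: A2_def C2_def algebra_simps)
   have "norm (F2 (exp w)) = norm (F (exp w)) * exp (- a * Re (exp w))" by (simp add: F2_def norm_mult)
   also have "\<dots> \<le> exp (A (Re w) + C) * exp (- a * Re (exp w))" by (intro mult_right_mono FA) auto
   also have "\<dots> = exp ((A (Re w) + C) + - a * Re (exp w))" by (simp only: exp_add)
   also have "\<dots> \<le> exp (A2 (Re w) + (C + A sA))" using le by (simp only: exp_le_cancel_iff)
   finally show ?thesis .
  qed
  show "A2 s \<le> A2 t" if "s \<le> t" for s t using that C2 by (simp add: A2_def)
  show "A2 s > 0" for s using C2 by (simp add: A2_def)
  show "C + A sA \<ge> 0" using C A_pos[of sA] by linarith
 qed
 have A2s: "A2 (s k) = C2 * x k" for k by (simp add: A2_def es)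
 have A2top: "diverges (\<lambda>k. A2 (s k))"
  unfolding A2s by (rule filterlim_tendsto_pos_mult_at_top[OF tendsto_const C2 xtop])
 obtain r E where r: "strict_mono r" "L.lim (s \<circ> r) E"
  by (rule L.montel[OF A2top, of "\<lambda>t. exp t"]) (auto simp: A2_def exp_add)
 define y where "y k = x (r k)" for k
 have ytop: "diverges y" unfolding y_def using filterlim_compose[OF xtop filterlim_subseq[OF r(1)]] by simp
 have y1: "y k \<ge> 1" for k using x1 by (simp add: y_def)
 have sy: "(s \<circ> r) k = ln (y k)" for k by (simp add: s_def y_def)
 have A2y: "A2 (ln (y k)) = C2 * y k" for k using y1[of k] by (simp add: A2_def)
 have ey: "exp (w + of_real (ln (y k))) = of_real (y k) * exp w" for w :: complex and k
 proof -
  have "exp (of_real (ln (y k)) :: complex) = of_real (y k)" using y1[of k] by (simp add: exp_of_real)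
  thus ?thesis by (simp add: exp_add mult.commute)
 qed
 have limE: "(\<lambda>k. exp (Re (G2 (w + of_real (ln (y k)))) / (C2 * y k))) \<longlonglongrightarrow> norm (E w)" if "w \<in> strip l u" for w
  using tendsto_norm[OF L.lim_point[OF r(2) that]] unfolding L.norm_sc sy A2y .
 have ReG2: "exp (Re (G2 (w + of_real (ln (y k))))) = norm (F (of_real (y k) * exp w)) * exp (- a * y k * Re (exp w))" if "w \<in> strip l u" for w k
 proof -
  have "w + of_real (ln (y k)) \<in> strip l u" using that by simp
  from L.FG[OF this] have "norm (F2 (of_real (y k) * exp w)) = exp (Re (G2 (w + of_real (ln (y k)))))" by (simp add: ey)
  thus ?thesis by (simp add: F2_def norm_mult mult.assoc)
 qed
 have big_y: "EVN k. y k \<ge> T" for T using ytop by (simp add: filterlim_at_top)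
 have ln_y: "(\<lambda>k. ln (y k) / y k) \<longlonglongrightarrow> 0"
 proof -
  have "((\<lambda>x::real. ln x / x) \<longlongrightarrow> 0) at_top" by real_asymp
  from filterlim_compose[OF this ytop] show ?thesis .
 qed
 have inv_y: "(\<lambda>k. 1 / y k) \<longlonglongrightarrow> 0"
  by (rule tendsto_divide_0[OF tendsto_const filterlim_mono[OF ytop at_top_le_at_infinity order_refl]])
 have le1: "norm (E w) \<le> 1" if z: "\<bar>Im w\<bar> < pi / 2" for w
 proof -
  have inS: "w \<in> strip l u" using z lu by (auto simp: abs_less_iff)
  have cp: "Re (exp w) > 0" using z cos_gt_zero_pi[of "Im w"] by (auto simp: Re_exp abs_less_iff)
  have e1: "EVN k. exp (Re (G2 (w + of_real (ln (y k)))) / (C2 * y k)) \<le>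
    exp ((ln (M / c0) + real N * Re w) / C2 * (1 / y k) + real N / C2 * (ln (y k) / y k))"
   using big_y[of "max R r0 / exp (Re w)"]
  proof eventually_elim
   case (elim k)
   let ?z = "of_real (y k) * exp w"
   have nz: "norm ?z = exp (ln (y k) + Re w)" using y1[of k] by (simp add: norm_mult exp_add)
   have "max R r0 \<le> y k * exp (Re w)" using elim by (simp add: field_simps)
   hence big: "norm ?z \<ge> R" "norm ?z \<ge> r0" using y1[of k] by (auto simp: norm_mult)
   have rez: "Re ?z = y k * Re (exp w)" by simp
   have "c0 * norm (F ?z) \<le> norm (f ?z)" unfolding f_eq norm_mult using D(3)[OF big(1)] by (intro mult_right_mono) (auto simp: norm_mult)
   also have "\<dots> \<le> M * norm ?z ^ N * exp (a * Re ?z)" by (rule right[OF big(2)]) (use y1[of k] cp in \<open>simp only: rez\<close>; simp)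
   finally have "norm (F ?z) \<le> M / c0 * norm ?z ^ N * exp (a * Re ?z)" using D(1) by (simp add: field_simps)
   hence "norm (F ?z) * exp (- a * y k * Re (exp w)) \<le> M / c0 * norm ?z ^ N * exp (a * Re ?z) * exp (- a * y k * Re (exp w))"
    by (intro mult_right_mono) auto
   also have "\<dots> = M / c0 * norm ?z ^ N * exp (a * Re ?z + - a * y k * Re (exp w))" by (simp only: exp_add mult.assoc)
   also have "a * Re ?z + - a * y k * Re (exp w) = 0" unfolding rez by simp
   also have "M / c0 * norm ?z ^ N * exp 0 = exp (ln (M / c0) + real N * (ln (y k) + Re w))"
    using M D(1) unfolding nz by (simp add: exp_add exp_of_nat_mult)
   finally have "exp (Re (G2 (w + of_real (ln (y k))))) \<le> exp (ln (M / c0) + real N * (ln (y k) + Re w))" unfolding ReG2[OF inS] .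
   hence "Re (G2 (w + of_real (ln (y k)))) \<le> ln (M / c0) + real N * (ln (y k) + Re w)" by simp
   hence "Re (G2 (w + of_real (ln (y k)))) / (C2 * y k) \<le> (ln (M / c0) + real N * (ln (y k) + Re w)) / (C2 * y k)"
    using C2 y1[of k] by (intro divide_right_mono) auto
   also have "\<dots> = (ln (M / c0) + real N * Re w) / C2 * (1 / y k) + real N / C2 * (ln (y k) / y k)"
    using C2 y1[of k] by (simp add: field_simps)
   finally show ?case by simp
  qed
  have "(\<lambda>k. exp ((ln (M / c0) + real N * Re w) / C2 * (1 / y k) + real N / C2 * (ln (y k) / y k))) \<longlonglongrightarrow> exp ((ln (M / c0) + real N * Re w) / C2 * 0 + real N / C2 * 0)"
   by (intro tendsto_intros inv_y ln_y)
  hence "norm (E w) \<le> exp ((ln (M / c0) + real N * Re w) / C2 * 0 + real N / C2 * 0)"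
   by (rule tendsto_le[OF _ _ limE[OF inS] e1, rotated]) simp
  thus ?thesis by simp
 qed
 have "l < 0" "0 < u" using lu pi_gt_zero by linarith+
 hence in0: "(0::complex) \<in> strip l u" by simp
 have ge1: "norm (E 0) \<ge> 1"
 proof -
  have e1: "EVN k. exp (- (a / C2) * (1 / (real (r k) + 1)) - real D / C2 * (ln (y k) / y k)) \<le> exp (Re (G2 (0 + of_real (ln (y k)))) / (C2 * y k))"
   using big_y[of R]
  proof eventually_elim
   case (elim k)
   let ?z = "of_real (y k) :: complex"
   have nz: "norm ?z = exp (ln (y k))" "norm ?z \<ge> R" using y1[of k] elim by auto
   have "exp (bk (r k) * y k) \<le> norm (f ?z)" using x(2)[of "r k"] by (simp add: y_def)
   also have "\<dots> \<le> exp (real D * ln (y k)) * norm (F ?z)" unfolding f_eq norm_mult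
    using D(4)[OF nz(2)] unfolding nz(1) by (intro mult_right_mono) (auto simp: exp_of_nat_mult)
   finally have "exp (bk (r k) * y k) * exp (- a * y k) \<le> exp (real D * ln (y k)) * norm (F ?z) * exp (- a * y k)" by (intro mult_right_mono) auto
   also have "\<dots> = exp (real D * ln (y k)) * exp (Re (G2 (0 + of_real (ln (y k)))))" unfolding ReG2[OF in0] by simp
   finally have "exp (bk (r k) * y k + - a * y k) \<le> exp (real D * ln (y k) + Re (G2 (0 + of_real (ln (y k)))))" by (simp only: exp_add)
   hence "bk (r k) * y k - a * y k - real D * ln (y k) \<le> Re (G2 (0 + of_real (ln (y k))))" by simp
   hence "(bk (r k) * y k - a * y k - real D * ln (y k)) / (C2 * y k) \<le> Re (G2 (0 + of_real (ln (y k)))) / (C2 * y k)"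
    using C2 y1[of k] by (intro divide_right_mono) auto
   moreover have "bk (r k) * y k - a * y k = - a * (1 / (real (r k) + 1)) * y k" by (simp add: bk_def algebra_simps)
   moreover have "(- a * (1 / (real (r k) + 1)) * y k - real D * ln (y k)) / (C2 * y k) = - (a / C2) * (1 / (real (r k) + 1)) - real D / C2 * (ln (y k) / y k)"
   proof -
    have "y k \<noteq> 0" using y1[of k] by simp
    thus ?thesis by (simp add: diff_divide_distrib)
   qed
   ultimately show ?case by simp
  qed
  have "(\<lambda>k. 1 / (real (r k) + 1)) \<longlonglongrightarrow> 0"
  proof -
   have "(\<lambda>k. 1 / (real k + 1)) \<longlonglongrightarrow> 0" by real_asymp
   from filterlim_compose[OF this filterlim_subseq[OF r(1)]] show ?thesis .
  qed
  hence "(\<lambda>k. exp (- (a / C2) * (1 / (real (r k) + 1)) - real D / C2 * (ln (y k) / y k))) \<longlonglongrightarrow> exp (- (a / C2) * 0 - real D / C2 * 0)"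
   by (intro tendsto_intros ln_y)
  hence "exp (- (a / C2) * 0 - real D / C2 * 0) \<le> norm (E 0)"
   by (rule tendsto_le[OF _ limE[OF in0] _ e1, rotated]) simp
  thus ?thesis by simp
 qed
 have Ehol: "E holomorphic_on strip l u" using r(2) by (simp add: L.lim_def)
 have "E constant_on strip l u"
 proof (rule maximum_modulus_principle[OF Ehol open_strip connected_strip open_strip])
  show "strip (- (pi / 2)) (pi / 2) \<subseteq> strip l u" "0 \<in> strip (- (pi / 2)) (pi / 2)" using lu pi_gt_zero by auto
  show "norm (E z) \<le> norm (E 0)" if "z \<in> strip (- (pi / 2)) (pi / 2)" for z
  proof -
   have "\<bar>Im z\<bar> < pi / 2" using that unfolding in_strip abs_less_iff by linarith
   thus ?thesis using le1[of z] ge1 by linarith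
  qed
 qed
 then obtain e where e: "\<And>w. w \<in> strip l u \<Longrightarrow> E w = e" by (auto simp: constant_on_def)
 have Ele: "norm (E w) \<le> exp 0" if "w \<in> strip l u" for w
  using le1[of 0] e[OF that] e[OF in0] by simp
 have "EVN k. \<forall>w\<in>L. norm (f (of_real (y k) * exp w)) * exp (- a * y k * Re (exp w)) \<le> exp (d * y k)"
  if L: "compact L" "L \<subseteq> strip l u" and eta: "d > 0" for L d
 proof -
  have eta2: "0 < d / (2 * C2)" using eta C2 by simp
  have e1: "EVN k. \<forall>w\<in>L. Re (G2 (w + of_real ((s \<circ> r) k))) \<le> d / (2 * C2) * A2 ((s \<circ> r) k)"
   by (rule L.lim_uniform_le[OF r(2) L _ eta2]) (use Ele L in blast)
  have "bounded L" using L by (simp add: compact_imp_bounded)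
  then obtain T where T: "\<And>w. w \<in> L \<Longrightarrow> norm w \<le> T" by (auto simp: bounded_iff)
  have "(\<lambda>k. real D * (T * (1 / y k) + ln (y k) / y k)) \<longlonglongrightarrow> real D * (T * 0 + 0)" by (intro tendsto_intros inv_y ln_y)
  hence e2: "EVN k. real D * (T * (1 / y k) + ln (y k) / y k) < d / 2"
   using eta by (intro order_tendstoD) auto
  show ?thesis using e1 e2 big_y[of "R * exp T"]
  proof eventually_elim
   case (elim k)
   show ?case
   proof
    fix w assume zL: "w \<in> L"
    hence inS: "w \<in> strip l u" using L by blast
    let ?z = "of_real (y k) * exp w"
    have reT: "\<bar>Re w\<bar> \<le> T" using T[OF zL] abs_Re_le_cmod[of w] by linarith
    have nz: "norm ?z = exp (ln (y k) + Re w)" using y1[of k] by (simp add: norm_mult exp_add)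
    have "R = R * exp T * exp (- T)" by (simp add: exp_minus)
    also have "\<dots> \<le> y k * exp (Re w)" using elim(3) reT y1[of k] D(2) by (intro mult_mono) auto
    finally have "norm ?z \<ge> R" using y1[of k] by (simp add: norm_mult)
    from D(4)[OF this] have "norm (poly p ?z) \<le> exp (real D * (ln (y k) + Re w))" unfolding nz by (simp add: exp_of_nat_mult)
    also have "\<dots> \<le> exp (d / 2 * y k)"
    proof -
     have "real D * (ln (y k) + Re w) \<le> real D * (ln (y k) + T)" using reT by (intro mult_left_mono) auto
     also have "\<dots> = real D * (T * (1 / y k) + ln (y k) / y k) * y k" using y1[of k] by (simp add: field_simps)
     also have "\<dots> \<le> d / 2 * y k" using elim(2) y1[of k] by (intro mult_right_mono) auto
     finally show ?thesis by simp
    qed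
    finally have P: "norm (poly p ?z) \<le> exp (d / 2 * y k)" .
    have "Re (G2 (w + of_real (ln (y k)))) \<le> d / (2 * C2) * A2 (ln (y k))" using elim(1) zL unfolding sy by blast
    also have "\<dots> = d / 2 * y k" using C2 by (simp add: A2y)
    finally have "exp (Re (G2 (w + of_real (ln (y k))))) \<le> exp (d / 2 * y k)" by simp
    hence "norm (F ?z) * exp (- a * y k * Re (exp w)) \<le> exp (d / 2 * y k)" unfolding ReG2[OF inS] .
    hence "norm (poly p ?z) * (norm (F ?z) * exp (- a * y k * Re (exp w))) \<le> exp (d / 2 * y k) * exp (d / 2 * y k)"
     using P by (intro mult_mono) auto
    also have "\<dots> = exp (d * y k)" by (simp add: mult_exp_exp)
    finally show "norm (f ?z) * exp (- a * y k * Re (exp w)) \<le> exp (d * y k)" by (simp only: f_eq norm_mult mult.assoc)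
   qed
  qed
 qed
 thus ?thesis using ytop y1 by blast
qed

text \<open>A disc about a point of the unit circle slightly to the left of the imaginary axis,
  whose logarithms form a compact set in the strip. There the information of
  \<open>regular_growth\<close> meets the half-plane on which \<open>h\<close> lives.\<close>

lemma arc_compact:
 "\<exists>w0 c L. norm w0 = 1 \<and> Re w0 < 0 \<and> 0 < c \<and> c \<le> 1 \<and> c \<le> - Re w0 / 2 \<and> compact L \<and> L \<subseteq> strip l u \<and>
   (\<forall>w. norm (w - w0) \<le> 2 * c \<longrightarrow> (\<exists>y\<in>L. exp y = w))"
proof -
 define a where "a = min ((u - pi / 2) / 2) 1"
 have al: "0 < a" "a \<le> 1" "pi / 2 + a < u" using lu by (auto simp: a_def min_def field_simps)
 define w0 where "w0 = cis (pi / 2 + a)"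
 have "sin a > 0" "cos a > 0" using al pi_gt3 by (auto intro: sin_gt_zero cos_gt_zero_pi)
 hence Re0: "Re w0 < 0" and Im0: "Im w0 > 0" by (simp_all add: w0_def cos_add sin_add)
 define V where "V = {z. 0 < Im z} \<inter> Ln -` strip (pi / 2) u"
 have "open V" unfolding V_def
  by (intro continuous_open_preimage open_halfspace_Im_gt open_strip continuous_on_Ln continuous_on_id) (auto simp: complex_nonpos_Reals_iff)
 moreover have "w0 \<in> V"
 proof -
  have "Ln w0 = Complex 0 (pi / 2 + a)"
   by (rule Ln_unique) (use al pi_gt3 in \<open>auto simp: w0_def exp_eq_polar\<close>)
  thus ?thesis using al Im0 by (simp add: V_def)
 qed
 ultimately obtain e where e: "e > 0" "ball w0 e \<subseteq> V" by (auto simp: open_contains_ball)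
 define c where "c = min (e / 4) (min 1 (- Re w0 / 2))"
 have k: "0 < c" "c \<le> 1" "c \<le> - Re w0 / 2" "2 * c < e" using e(1) Re0 by (auto simp: c_def min_def)
 have cb: "cball w0 (2 * c) \<subseteq> V" using e(2) k by (auto simp: subset_eq)
 define L where "L = Ln ` cball w0 (2 * c)"
 have "compact L" unfolding L_def
  by (intro compact_continuous_image continuous_on_Ln continuous_on_id compact_cball) (use cb in \<open>auto simp: V_def complex_nonpos_Reals_iff\<close>)
 moreover have "L \<subseteq> strip l u"
 proof
  fix y assume "y \<in> L"
  then obtain w where "w \<in> cball w0 (2 * c)" "y = Ln w" by (auto simp: L_def)
  hence "Ln w \<in> strip (pi / 2) u" "y = Ln w" using cb by (auto simp: V_def)
  hence "pi / 2 < Im y" "Im y < u" by auto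
  thus "y \<in> strip l u" using lu pi_gt_zero unfolding in_strip by linarith
 qed
 moreover have "\<exists>y\<in>L. exp y = w" if "norm (w - w0) \<le> 2 * c" for w
 proof -
  have m: "w \<in> cball w0 (2 * c)" using that by (simp add: dist_norm norm_minus_commute)
  hence "w \<in> V" using cb by blast
  hence "w \<noteq> 0" by (auto simp: V_def)
  thus ?thesis using m by (intro bexI[of _ "Ln w"]) (auto simp: L_def)
 qed
 moreover have "norm w0 = 1" by (simp add: w0_def)
 ultimately show ?thesis using Re0 k by blast
qed

text \<open>Let \<open>t\<close> be the best rate of decay. If \<open>t < y\<close>, the function
  \<open>h1 (z - X) * exp (- t * z)\<close> is still bounded by 1, and near the points
  \<open>x k * w0\<close> it is exponentially small, since \<open>f\<close> is at most about
  \<open>exp (y * Re z)\<close> there. \<open>halfplane_decay\<close> then improves the rate by a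
  fixed amount.\<close>

lemma h1_decay:
 assumes y: "y > 0" and x: "diverges x" "\<And>k::nat. x k \<ge> 1"
  and reg: "\<And>L e. compact L \<Longrightarrow> L \<subseteq> strip l u \<Longrightarrow> e > 0 \<Longrightarrow>
  EVN k. \<forall>g\<in>L. norm (f (of_real (x k) * exp g)) * exp (- y * x k * Re (exp g)) \<le> exp (e * x k)"
  and z: "Re z \<le> - X"
 shows "norm (h1 z) \<le> exp (y * (Re z + X))"
proof -
 obtain w0 d L where w0: "norm w0 = 1" "Re w0 < 0" and k: "0 < d" "d \<le> 1" "d \<le> - Re w0 / 2"
  and L: "compact L" "L \<subseteq> strip l u" "\<And>w. norm (w - w0) \<le> 2 * d \<Longrightarrow> \<exists>g\<in>L. exp g = w"
  using arc_compact by blast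
 define a where "a = - Re w0 / 2"
 have a: "a > 0" using w0 by (simp add: a_def)
 define T where "T = {j. 0 \<le> j \<and> j \<le> y \<and> (\<forall>z. Re z \<le> - X \<longrightarrow> norm (h1 z) \<le> exp (j * (Re z + X)))}"
 have T0: "0 \<in> T" using norm_h1_le y by (simp add: T_def)
 have bdd: "bdd_above T" by (rule bdd_aboveI[of _ y]) (auto simp: T_def)
 define t where "t = Sup T"
 have "t \<le> y" unfolding t_def by (rule cSup_least) (use T0 in blast, simp add: T_def)
 moreover have "0 \<le> t" unfolding t_def by (rule cSup_upper[OF T0 bdd])
 ultimately have t: "0 \<le> t" "t \<le> y" by auto
 have t_le: "norm (h1 z) \<le> exp (t * (Re z + X))" if z: "Re z \<le> - X" for z
 proof -
  have "norm (h1 z) \<le> exp (b * (Re z + X))" if "b < t" for b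
  proof -
   obtain b' where b': "b' \<in> T" "b < b'" using \<open>b < t\<close> less_cSupD[of T b] T0 unfolding t_def by blast
   have "norm (h1 z) \<le> exp (b' * (Re z + X))" using b'(1) z by (simp add: T_def)
   also have "\<dots> \<le> exp (b * (Re z + X))" using b'(2) z by (simp add: mult_right_mono_neg)
   finally show ?thesis .
  qed
  hence "\<forall>\<^sub>F b in at_left t. norm (h1 z) \<le> exp (b * (Re z + X))"
   by (intro eventually_at_leftI[of "t - 1" t]) auto
  moreover have "((\<lambda>b. exp (b * (Re z + X))) \<longlongrightarrow> exp (t * (Re z + X))) (at_left t)" by (intro tendsto_intros)
  ultimately show ?thesis by (intro tendsto_lowerbound) auto
 qed
 have "t = y"
 proof (rule ccontr)
  assume "t \<noteq> y"
  hence lt: "t < y" using t by simp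
  \<comment> \<open>In the discs used below \<open>Re w \<le> - a * R\<close>, so the exponents add
    up to \<open>e * R - (y - t) * a * R = - 2 * c * R\<close>; half of this pays for the factor
    2.\<close>
  define e where "e = (y - t) * a / 2"
  define c where "c = (y - t) * a / 4"
  have eta: "e > 0" "c > 0" using lt a by (auto simp: e_def c_def)
  define F2 where "F2 z = h1 (z - of_real X) * exp (- of_real t * z)" for z
  have a3: "a / 3 > 0" using a by simp
  obtain r where r: "\<And>z. norm z \<ge> r \<Longrightarrow> Re z \<le> - (a / 3) * norm z \<Longrightarrow> Re z < - X \<and> norm (h z) \<le> 2 * norm (f z)"
   using h_small[OF a3] by blast
  have dec: "norm (F2 z) \<le> 1 * exp (c * (d / 4) * (- Re w0) / 2 * Re z)" if z: "Re z < 0" for z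
  proof (rule halfplane_decay[OF _ _ _ _ _ _ w0 _ z])
   show "F2 holomorphic_on {z. Re z < 0}" unfolding F2_def by (intro holomorphic_intros h1_shift)
   show "norm (F2 z) \<le> 1" if "Re z < 0" for z
   proof -
    have "norm (F2 z) \<le> exp (t * Re z) * exp (- t * Re z)" unfolding F2_def norm_mult
     using t_le[of "z - of_real X"] that by (intro mult_mono) auto
    also have "\<dots> = 1" by (simp add: mult_exp_exp)
    finally show ?thesis .
   qed
   fix T :: real
   have big: "EVN k. x k \<ge> max T (max (X / d) (max (r / a) (1 / c)))" using x(1) unfolding filterlim_at_top by blast
   have "EVN k. x k \<ge> T \<and> (\<forall>w. norm (w - of_real (x k) * w0) \<le> 4 * (d / 4) * x k \<longrightarrow> norm (F2 w) \<le> 1 * exp (- c * x k))"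
    using reg[OF L(1,2) eta(1)] big
   proof eventually_elim
    case (elim n)
    let ?R = "x n"
    have R: "?R \<ge> 1" "?R \<ge> T" "X \<le> d * ?R" "r \<le> a * ?R" "1 \<le> c * ?R" using elim(2) x(2)[of n] k a eta by (auto simp: field_simps)
    show ?case
    proof (intro conjI R(2) allI impI)
     fix w assume "norm (w - of_real ?R * w0) \<le> 4 * (d / 4) * ?R"
     hence w: "norm (w - of_real ?R * w0) \<le> d * ?R" by simp
     define v where "v = (w - of_real X) / of_real ?R"
     have wv: "w - of_real X = of_real ?R * v" using R(1) by (simp add: v_def)
     have "v - w0 = ((w - of_real ?R * w0) - of_real X) / of_real ?R" using R(1) by (simp add: v_def field_simps)
     hence "norm (v - w0) = norm ((w - of_real ?R * w0) - of_real X) / ?R" using R(1) by (simp add: norm_divide)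
     also have "\<dots> \<le> (d * ?R + X) / ?R"
      using norm_triangle_ineq4[of "w - of_real ?R * w0" "of_real X"] w X R(1) by (intro divide_right_mono) auto
     also have "\<dots> \<le> (d * ?R + d * ?R) / ?R" using R by (intro divide_right_mono) auto
     also have "\<dots> = 2 * d" using R(1) by simp
     finally have vw: "norm (v - w0) \<le> 2 * d" .
     obtain g where zt: "g \<in> L" "exp g = v" using L(3)[OF vw] by blast
     have rew: "Re w \<le> - a * ?R"
     proof -
      have "Re w - ?R * Re w0 \<le> d * ?R" using complex_Re_le_cmod[of "w - of_real ?R * w0"] w by simp
      moreover have "d * ?R \<le> a * ?R" using k(3) R(1) by (intro mult_right_mono) (auto simp: a_def)
      moreover have "?R * Re w0 = - 2 * (a * ?R)" by (simp add: a_def)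
      ultimately show ?thesis by linarith
     qed
     let ?z = "w - of_real X"
     have rez: "Re ?z \<le> - a * ?R" using rew X by simp
     have "norm v \<le> 3" using norm_triangle_ineq2[of v w0] vw w0(1) k(2) by linarith
     hence "norm ?z \<le> 3 * ?R" using R(1) by (simp add: wv norm_mult mult.commute)
     hence "a / 3 * norm ?z \<le> a / 3 * (3 * ?R)" using a by (intro mult_left_mono) auto
     hence rez2: "Re ?z \<le> - (a / 3) * norm ?z" using rez by simp
     have nz: "norm ?z \<ge> r" using abs_Re_le_cmod[of ?z] rez R(4) by linarith
     have hz: "Re ?z < - X" "norm (h ?z) \<le> 2 * norm (f ?z)" using r[OF nz rez2] by auto
     have "norm (f (of_real ?R * exp g)) * exp (- y * ?R * Re (exp g)) \<le> exp (e * ?R)" using elim(1) zt(1) by blast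
     hence "norm (f ?z) * exp (- y * Re ?z) \<le> exp (e * ?R)" unfolding zt(2) wv by (simp add: mult.assoc)
     hence "norm (f ?z) * exp (- y * Re ?z) * exp (y * Re ?z) \<le> exp (e * ?R) * exp (y * Re ?z)" by (intro mult_right_mono) auto
     moreover have "exp (- y * Re ?z) * exp (y * Re ?z) = 1" by (simp add: mult_exp_exp)
     ultimately have fz: "norm (f ?z) \<le> exp (e * ?R) * exp (y * Re ?z)" by (simp only: mult.assoc mult_1_right)
     have "norm (F2 w) = norm (h1 ?z) * exp (- t * Re w)" by (simp add: F2_def norm_mult)
     also have "\<dots> \<le> (2 * (exp (e * ?R) * exp (y * Re w))) * exp (- t * Re w)"
     proof (rule mult_right_mono)
      have "norm (h1 ?z) \<le> norm (h ?z)" using hz by (intro norm_h1_le_h) simp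
      also have "\<dots> \<le> 2 * norm (f ?z)" by (rule hz)
      also have "norm (f ?z) \<le> exp (e * ?R) * exp (y * Re w)"
      proof -
       have "exp (y * Re ?z) \<le> exp (y * Re w)" using X y by simp
       thus ?thesis by (intro order_trans[OF fz] mult_left_mono) auto
      qed
      finally show "norm (h1 ?z) \<le> 2 * (exp (e * ?R) * exp (y * Re w))" by simp
     qed simp
     also have "\<dots> = 2 * exp (e * ?R + (y - t) * Re w)" by (simp add: mult_exp_exp algebra_simps)
     also have "\<dots> \<le> 2 * exp (- (2 * c * ?R))"
     proof -
      have "(y - t) * Re w \<le> (y - t) * (- a * ?R)" using rew lt by (intro mult_left_mono) auto
      moreover have "e * ?R + (y - t) * (- a * ?R) = - (2 * c * ?R)" by (simp add: e_def c_def field_simps)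
      ultimately show ?thesis by simp
     qed
     also have "\<dots> \<le> exp (c * ?R) * exp (- (2 * c * ?R))"
     proof (rule mult_right_mono)
      show "2 \<le> exp (c * ?R)" using R(5) exp_ge_add_one_self[of "c * ?R"] by linarith
     qed simp
     also have "\<dots> = exp (- c * ?R)" by (simp add: mult_exp_exp algebra_simps)
     finally show "norm (F2 w) \<le> 1 * exp (- c * ?R)" by simp
    qed
   qed
   then obtain n where "x n \<ge> T" "\<forall>w. norm (w - of_real (x n) * w0) \<le> 4 * (d / 4) * x n \<longrightarrow> norm (F2 w) \<le> 1 * exp (- c * x n)"
    unfolding eventually_sequentially by blast
   thus "\<exists>R\<ge>T. \<forall>w. norm (w - of_real R * w0) \<le> 4 * (d / 4) * R \<longrightarrow> norm (F2 w) \<le> 1 * exp (- c * R)" by blast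
  qed (use eta k in auto)
  define m where "m = c * (d / 4) * (- Re w0) / 2"
  have m: "m > 0" using eta k w0 by (simp add: m_def mult_pos_neg)
  define t' where "t' = min y (t + m)"
  have "t' > t" using lt m by (simp add: t'_def)
  moreover have "t' \<in> T"
  proof -
   have "norm (h1 z) \<le> exp (t' * (Re z + X))" if z: "Re z \<le> - X" for z
   proof (cases "Re z = - X")
    case True
    thus ?thesis using norm_h1_le[OF z] by simp
   next
    case False
    hence neg: "Re (z + of_real X) < 0" using z by simp
    have "norm (h1 z) * exp (- t * Re (z + of_real X)) \<le> exp (m * Re (z + of_real X))"
     using dec[OF neg] by (simp add: F2_def m_def norm_mult)
    hence "norm (h1 z) * exp (- t * Re (z + of_real X)) * exp (t * Re (z + of_real X)) \<le> exp (m * Re (z + of_real X)) * exp (t * Re (z + of_real X))"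
     by (intro mult_right_mono) auto
    moreover have "exp (- t * Re (z + of_real X)) * exp (t * Re (z + of_real X)) = 1" by (simp add: mult_exp_exp)
    ultimately have "norm (h1 z) \<le> exp (m * Re (z + of_real X)) * exp (t * Re (z + of_real X))" by (simp only: mult.assoc mult_1_right)
    also have "\<dots> = exp ((t + m) * (Re z + X))" by (simp add: mult_exp_exp algebra_simps)
    also have "\<dots> \<le> exp (t' * (Re z + X))" using neg by (simp add: t'_def mult_right_mono_neg)
    finally show ?thesis .
   qed
   thus ?thesis using t \<open>t' > t\<close> by (auto simp: T_def t'_def)
  qed
  ultimately show False using cSup_upper[OF _ bdd, of t'] by (simp add: t_def)
 qed
 thus ?thesis using t_le[OF z] by simp
qed

text \<open>\<open>f * exp (- a * z)\<close> has polynomial growth. For \<open>Re z \<ge> 0\<close>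
  this is the choice of \<open>a\<close>, and for \<open>- X \<le> Re z \<le> 0\<close> the
  exponential is bounded. Further left the decay of \<open>h1\<close> outweighs
  \<open>exp (- a * Re z)\<close> where \<open>norm (h z) \<le> 1 / 2\<close>; where
  \<open>norm (h z) > 1 / 2\<close> the same decay bounds \<open>exp (- a * Re z)\<close> by a power
  of \<open>norm z\<close>.\<close>

theorem exponential_form: "\<exists>P a. \<forall>z. f z = poly P z * exp (a * z)"
proof -
 obtain a N r0 M where a: "a > 0" and r0: "r0 \<ge> 1" and M: "M \<ge> 1"
  and right: "\<And>z. norm z \<ge> r0 \<Longrightarrow> Re z \<ge> 0 \<Longrightarrow> norm (f z) \<le> M * norm z ^ N * exp (a * Re z)"
  and freq: "\<And>b T. 0 \<le> b \<Longrightarrow> b < a \<Longrightarrow> \<exists>x\<ge>T. norm (f (of_real x)) > exp (b * x)"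
  using right_growth by blast
 obtain x where x: "diverges x" "\<And>k::nat. x k \<ge> 1" "\<And>L d. compact L \<Longrightarrow> L \<subseteq> strip l u \<Longrightarrow> d > 0 \<Longrightarrow>
  EVN k. \<forall>w\<in>L. norm (f (of_real (x k) * exp w)) * exp (- a * x k * Re (exp w)) \<le> exp (d * x k)"
  using regular_growth[OF a r0 M right freq] by blast
 have dec: "norm (h1 z) \<le> exp (a * (Re z + X))" if "Re z \<le> - X" for z
  by (rule h1_decay[OF a x(1,2) _ that]) (rule x(3))
 obtain N2 r2 where r2: "r2 \<ge> 1" "\<And>z. norm z \<ge> r2 \<Longrightarrow> Re z \<le> 0 \<Longrightarrow> norm (f z) \<le> norm z ^ N2" using left_poly_bound by blast
 define g where "g = (\<lambda>z. f z * exp (- of_real a * z))"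
 have hg: "g holomorphic_on UNIV" unfolding g_def by (intro holomorphic_intros f_hol)
 have ng: "norm (g z) = norm (f z) * exp (- a * Re z)" for z by (simp add: g_def norm_mult)
 define C2 where "C2 = M + 2 * exp (a * X)"
 define m where "m = N + N2 + K"
 have "norm (g z) \<le> C2 * norm z ^ m" if z: "norm z \<ge> max r0 r2" for z
 proof -
  have z1: "norm z \<ge> 1" using z r0 by simp
  have pw: "norm z ^ i \<le> norm z ^ m" if "i \<le> m" for i using z1 that by (intro power_increasing)
  have eX: "exp (a * X) \<ge> 1" using a X by simp
  consider "Re z \<ge> 0" | "Re z \<le> 0" "- X \<le> Re z" | "Re z \<le> - X" "norm (h z) \<le> 1 / 2" | "Re z \<le> - X" "norm (h z) > 1 / 2" by linarith
  thus ?thesis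
  proof cases
   case 1
   have "norm (g z) \<le> M * norm z ^ N * exp (a * Re z) * exp (- a * Re z)" unfolding ng using right[of z] z 1 by (intro mult_right_mono) auto
   also have "\<dots> = M * norm z ^ N * exp (a * Re z + - a * Re z)" by (simp only: exp_add mult.assoc)
   also have "\<dots> = M * norm z ^ N" by simp
   also have "\<dots> \<le> C2 * norm z ^ m" using pw[of N] M by (intro mult_mono) (auto simp: C2_def m_def)
   finally show ?thesis .
  next
   case 2
   have "norm (g z) \<le> norm z ^ N2 * exp (a * X)" unfolding ng
   proof (rule mult_mono)
    show "norm (f z) \<le> norm z ^ N2" using r2(2)[of z] z 2 by simp
    have "a * (- Re z) \<le> a * X" using 2 a by (intro mult_left_mono) auto
    thus "exp (- a * Re z) \<le> exp (a * X)" by simp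
   qed auto
   also have "\<dots> \<le> norm z ^ m * C2" using pw[of N2] eX M by (intro mult_mono) (auto simp: C2_def m_def)
   finally show ?thesis by (simp add: mult.commute)
  next
   case 3
   have zK: "norm z ^ K > 0" using z1 by (intro zero_less_power) linarith
   have "norm (h z) = norm (h1 z) * norm z ^ K" using z1 by (auto simp: h1_def norm_divide norm_power)
   also have "\<dots> \<le> exp (a * (Re z + X)) * norm z ^ K" using dec[OF 3(1)] zK by (intro mult_right_mono) auto
   finally have hz: "norm (h z) \<le> exp (a * (Re z + X)) * norm z ^ K" .
   have "norm (f z) = norm (exp (h z) - 1)" using exp_h[OF 3(1)] by (simp add: norm_minus_commute)
   also have "\<dots> \<le> 3 / 2 * norm (h z)" by (rule norm_exp_bounds(2)[OF 3(2)])
   also have "\<dots> \<le> 2 * (exp (a * (Re z + X)) * norm z ^ K)" using hz norm_ge_zero[of "h z"] by linarith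
   finally have "norm (g z) \<le> 2 * (exp (a * (Re z + X)) * norm z ^ K) * exp (- a * Re z)" unfolding ng by (intro mult_right_mono) auto
   also have "\<dots> = 2 * (exp (a * (Re z + X)) * exp (- a * Re z)) * norm z ^ K" by (simp only: mult_ac)
   also have "exp (a * (Re z + X)) * exp (- a * Re z) = exp (a * X)" by (simp add: mult_exp_exp algebra_simps)
   also have "2 * exp (a * X) * norm z ^ K \<le> C2 * norm z ^ m" using pw[of K] M eX by (intro mult_mono) (auto simp: C2_def m_def)
   finally show ?thesis .
  next
   case 4
   have zK: "norm z ^ K > 0" using z1 by (intro zero_less_power) linarith
   have "norm (h z) = norm (h1 z) * norm z ^ K" using z1 by (auto simp: h1_def norm_divide norm_power)
   also have "\<dots> \<le> exp (a * (Re z + X)) * norm z ^ K" using dec[OF 4(1)] zK by (intro mult_right_mono) auto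
   finally have "1 / 2 \<le> exp (a * (Re z + X)) * norm z ^ K" using 4(2) by linarith
   hence "1 / 2 * exp (- a * Re z) \<le> exp (a * (Re z + X)) * norm z ^ K * exp (- a * Re z)" by (intro mult_right_mono) auto
   also have "\<dots> = (exp (a * (Re z + X)) * exp (- a * Re z)) * norm z ^ K" by (simp only: mult_ac)
   also have "exp (a * (Re z + X)) * exp (- a * Re z) = exp (a * X)" by (simp add: mult_exp_exp algebra_simps)
   finally have ex: "exp (- a * Re z) \<le> 2 * exp (a * X) * norm z ^ K" by linarith
   have "norm (g z) \<le> norm z ^ N2 * (2 * exp (a * X) * norm z ^ K)" unfolding ng
    using r2(2)[of z] z 4 X ex by (intro mult_mono) auto
   also have "\<dots> = 2 * exp (a * X) * norm z ^ (N2 + K)" by (simp add: power_add mult_ac)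
   also have "\<dots> \<le> C2 * norm z ^ m" using pw[of "N2 + K"] M by (intro mult_mono) (auto simp: C2_def m_def)
   finally show ?thesis .
  qed
 qed
 then obtain P where P: "\<And>z. g z = poly P z" using entire_poly_growth_imp_poly[OF hg] by blast
 have "f z = poly P z * exp (of_real a * z)" for z
  using P[of z, symmetric] by (simp add: g_def exp_minus)
 thus ?thesis by blast
qed

end

section \<open>Functions that are small outside a sector of opening at most pi\<close>

text \<open>\<open>two_constants_rect\<close> on rectangles of width 2 in the logarithmic
  coordinate, with \<open>D'\<close> comparing the values of \<open>A\<close> across them. The rate
  \<open>j\<close> is so small that \<open>j * D'\<close> is half of the gain
  \<open>e / (D' * k)\<close>.\<close>

lemma small_between:
 fixes g :: "complex \<Rightarrow> complex" and A :: "real \<Rightarrow> real"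
 assumes g: "g holomorphic_on UNIV" and A: "\<And>s t. s \<le> t \<Longrightarrow> A s \<le> A t" "\<And>s. A s > 0"
  and step: "EV s. A (s + 1) \<le> D * A s"
  and side: "e > 0" "EV s. norm (g (pt s c)) \<le> exp (- e * A s)" "EV s. norm (g (pt s d)) \<le> exp (- e * A s)"
  and mod: "\<And>j. j > 0 \<Longrightarrow> EV s. \<forall>y\<in>{c..d}. norm (g (pt s y)) \<le> exp (j * A s)"
 shows "\<exists>e>0. EV s. \<forall>y\<in>{c..d}. norm (g (pt s y)) \<le> exp (- e * A s)"
proof -
 define D' where "D' = max 1 D"
 define k where "k = cosh (pi * (d - c) / 4)"
 have k: "k \<ge> 1" unfolding k_def by (rule cosh_real_ge_1)
 have D': "D' \<ge> 1" by (simp add: D'_def)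
 define j where "j = e / (2 * D' * D' * k)"
 define e' where "e' = e / (2 * D' * k)"
 have eta: "j > 0" "e' > 0" using side(1) D' k by (auto simp: j_def e'_def)
 obtain s1 where s1: "\<And>s. s \<ge> s1 \<Longrightarrow> A (s + 1) \<le> D * A s" using step by (auto simp: ev_top)
 obtain s2 where s2: "\<And>s. s \<ge> s2 \<Longrightarrow> norm (g (pt s c)) \<le> exp (- e * A s)" using side(2) by (auto simp: ev_top)
 obtain s3 where s3: "\<And>s. s \<ge> s3 \<Longrightarrow> norm (g (pt s d)) \<le> exp (- e * A s)" using side(3) by (auto simp: ev_top)
 obtain s4 where s4: "\<And>s y. s \<ge> s4 \<Longrightarrow> y \<in> {c..d} \<Longrightarrow> norm (g (pt s y)) \<le> exp (j * A s)"
  using mod[OF eta(1)] unfolding ev_top by blast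
 have hol: "(\<lambda>w. g (exp w)) holomorphic_on UNIV"
  by (rule hol_compose[OF _ g]) (auto intro: holomorphic_intros)
 have stepD: "A (s + 1) \<le> D' * A s" if "s \<ge> s1" for s
 proof -
  have "D * A s \<le> D' * A s" using A(2)[of s] by (intro mult_right_mono) (auto simp: D'_def)
  thus ?thesis using s1[OF that] by linarith
 qed
 have "norm (g (pt s y)) \<le> exp (- e' * A s)" if s: "s \<ge> max (max s1 s2) (max s3 s4) + 1" and th: "y \<in> {c..d}" for s y
 proof -
  have s': "s1 \<le> s" "s1 \<le> s - 1" using s by auto
  have up: "A t \<le> D' * A s" if "t \<le> s + 1" for t using A(1)[OF that] stepD[OF s'(1)] by linarith
  have low: "A s \<le> D' * A t" if "s - 1 \<le> t" for t
  proof -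
   have "D' * A (s - 1) \<le> D' * A t" using A(1)[OF that] D' by (intro mult_left_mono) auto
   thus ?thesis using stepD[OF s'(2)] by simp
  qed
  have "norm (g (pt s y)) \<le> exp (j * (D' * A s) - (e / D' * A s) / cosh (pi * (d - c) / 4))"
  proof (rule two_constants_rect[OF hol open_UNIV])
   fix w assume z: "s - 1 \<le> Re w" "Re w \<le> s + 1" "c \<le> Im w" "Im w \<le> d"
   have "norm (g (pt (Re w) (Im w))) \<le> exp (j * A (Re w))" by (rule s4) (use z s in auto)
   also have "\<dots> \<le> exp (j * (D' * A s))" using up[OF z(2)] eta by simp
   finally show "norm (g (exp w)) \<le> exp (j * (D' * A s))" by simp
  next
   fix w assume z: "s - 1 \<le> Re w" "Re w \<le> s + 1" "Im w = c \<or> Im w = d"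
   have "norm (g (pt (Re w) (Im w))) \<le> exp (- e * A (Re w))" using z(3) s2[of "Re w"] s3[of "Re w"] z s by auto
   also have "\<dots> \<le> exp (- (e / D' * A s))"
   proof -
    have "e / D' * A s \<le> e / D' * (D' * A (Re w))" using low[OF z(1)] side(1) D' by (intro mult_left_mono) auto
    thus ?thesis using D' by simp
   qed
   finally show "norm (g (exp w)) \<le> exp (- (e / D' * A s))" by simp
  qed (use th eta D' A(2)[of s] side(1) in auto)
  also have "j * (D' * A s) - (e / D' * A s) / cosh (pi * (d - c) / 4) = - e' * A s"
   unfolding k_def[symmetric] j_def e'_def using D' k by (simp add: field_simps)
  finally show ?thesis .
 qed
 thus ?thesis using eta(2) unfolding ev_top by blast
qed

text \<open>The situation of the locale \<^locale>\<open>decaying\<close> before the rotation; \<open>[a, b]\<close> are the directions of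
 the sector outside of which the function is small.\<close>

locale one_sided = log_side F G l u C A
 for F G :: "complex \<Rightarrow> complex" and l u C :: real and A :: "real \<Rightarrow> real" +
 fixes f :: "complex \<Rightarrow> complex" and p :: "complex poly" and \<rho> a b :: real
 assumes dirs: "l < a" "a < b" "b < u" "b - a \<le> pi"
  and f_eq: "\<And>z. f z = poly p z * F z" and p: "p \<noteq> 0"
  and A_step: "\<exists>D. EV s. A (s + 1) \<le> D * A s"
  and A_transc: "filterlim (\<lambda>s. A s / s) at_top at_top"
  and A_order: "EV s. A s \<le> exp (\<rho> * s)"
  and f_le: "\<And>w. norm (f (exp w)) \<le> exp (A (Re w))"
  and f_big: "EV s. \<exists>z. norm z = exp s \<and> exp (A s / 2) \<le> norm (f z)"
  and small: "\<And>c d. b < c \<Longrightarrow> d < a + 2 * pi \<Longrightarrow>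
    \<exists>e>0. EV s. \<forall>t\<in>{c..d}. norm (f (pt s t)) \<le> exp (- e * A s)"
  and ones: "\<exists>S. \<forall>s t. s \<ge> S \<and> b < t \<and> t < a + 2 * pi \<longrightarrow> f (pt s t) \<noteq> 1"
begin

definition "mid = (a + b) / 2"

lemma rotated_exp: "exp w * cis mid = exp (w + \<i> * of_real mid)"
 by (simp add: cis_conv_exp exp_add)

lemma f_entire: "f holomorphic_on X"
 by (rule poly_mult_holomorphic[OF F f_eq])

lemma A_to_top: "filterlim A at_top at_top"
 by (rule filterlim_at_top_of_ratio[OF A_transc])

lemma left_direction:
 assumes "norm z = exp s" "Re z \<le> exp s * cos c" "0 \<le> c" "c \<le> pi"
 shows "\<exists>t\<in>{c..2 * pi - c}. z = pt s t"
proof -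
 have "z \<noteq> 0" using assms(1) by auto
 define t where "t = Arg2pi z"
 have th: "0 \<le> t" "t < 2 * pi" by (auto simp: t_def Arg2pi_ge_0 Arg2pi_lt_2pi)
 have "z = of_real (exp s) * exp (\<i> * of_real t)" using Arg2pi_eq[of z] assms(1) by (simp add: t_def)
 hence z: "z = pt s t" by (simp add: Complex_eq exp_add exp_of_real)
 have co: "cos t \<le> cos c" using assms(2) by (simp add: z Re_exp)
 have "c \<le> t"
 proof (rule ccontr)
  assume "\<not> c \<le> t"
  hence "cos c < cos t" using th assms by (intro cos_monotone_0_pi) auto
  thus False using co by simp
 qed
 moreover have "t \<le> 2 * pi - c"
 proof (rule ccontr)
  assume "\<not> t \<le> 2 * pi - c"
  hence "cos c < cos (2 * pi - t)" using th assms by (intro cos_monotone_0_pi) auto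
  thus False using co by (simp add: cos_diff)
 qed
 ultimately show ?thesis using z by auto
qed

lemma pt_mid: "pt s t * cis mid = pt s (t + mid)"
 unfolding rotated_exp by (simp add: Complex_eq algebra_simps)

lemma left_decay:
 assumes c: "b - mid < c" "c \<le> pi"
 shows "\<exists>d>0. EV s. \<forall>z. norm z = exp s \<and> Re z \<le> exp s * cos c \<longrightarrow> norm (f (z * cis mid)) \<le> exp (- d * A s)"
proof -
 have c0: "0 \<le> c" using c dirs by (simp add: mid_def field_simps)
 have "b < c + mid" "2 * pi - c + mid < a + 2 * pi" using c by (auto simp: mid_def field_simps)
 from small[OF this] obtain d where e: "d > 0" "EV s. \<forall>t\<in>{c + mid..2 * pi - c + mid}. norm (f (pt s t)) \<le> exp (- d * A s)" by blast
 from e(2) have "EV s. \<forall>z. norm z = exp s \<and> Re z \<le> exp s * cos c \<longrightarrow> norm (f (z * cis mid)) \<le> exp (- d * A s)"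
 proof eventually_elim
  case (elim s)
  show ?case
  proof (intro allI impI; elim conjE)
   fix z :: complex assume "norm z = exp s" "Re z \<le> exp s * cos c"
   then obtain t where th: "t \<in> {c..2 * pi - c}" "z = pt s t" using left_direction c0 c(2) by blast
   have "norm (f (pt s (t + mid))) \<le> exp (- d * A s)" using th(1) elim by auto
   thus "norm (f (z * cis mid)) \<le> exp (- d * A s)" unfolding th(2) pt_mid .
  qed
 qed
 thus ?thesis using e(1) by blast
qed

text \<open>The rotation by \<open>mid\<close> takes the sector to the right half-plane. Since
  \<open>l < a\<close> and \<open>b < u\<close>, the rotated strip reaches strictly beyond the
  imaginary axis on both sides, as \<open>decaying\<close> demands.\<close>

lemma half_plane_case:
 assumes "b - a = pi"
 shows "\<exists>P g. \<forall>z. f z = poly P z * exp (g * z)"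
proof -
 have ab: "a = mid - pi / 2" "b = mid + pi / 2" unfolding mid_def using assms by (simp_all add: field_simps)
 have unrot: "z * cis (- mid) * cis mid = z" for z by (simp add: mult.assoc cis_mult)
 define f' where "f' z = f (z * cis mid)" for z
 define F' where "F' z = F (z * cis mid)" for z
 define G' where "G' x = G (x + \<i> * of_real mid)" for x
 define p' where "p' = pcompose p [:0, cis mid:]"
 have nc: "norm (z * cis mid) = norm z" for z by (simp add: norm_mult)
 interpret d: decaying F' G' "l - mid" "u - mid" C A f' p' \<rho>
 proof
  show "F' holomorphic_on UNIV" unfolding F'_def
   by (rule hol_compose[OF _ F]) (auto intro!: holomorphic_intros)
  show "F' 0 \<noteq> 0" using F_0 by (simp add: F'_def)
  show "G' holomorphic_on strip (l - mid) (u - mid)" unfolding G'_def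
   by (rule hol_compose[OF _ G]) (auto intro!: holomorphic_intros)
  show "F' (exp x) = exp (G' x)" if "x \<in> strip (l - mid) (u - mid)" for x
   unfolding F'_def G'_def rotated_exp by (rule FG) (use that in auto)
  show "norm (F' (exp x)) \<le> exp (A (Re x) + C)" for x
   using FA[of "x + \<i> * of_real mid"] by (simp add: F'_def rotated_exp)
  show "A s \<le> A t" if "s \<le> t" for s t by (rule A_mono[OF that])
  show "A s > 0" for s by (rule A_pos)
  show "C \<ge> 0" by (rule C)
  show "l - mid < - (pi / 2)" "pi / 2 < u - mid" using dirs ab by linarith+
  show "f' z = poly p' z * F' z" for z by (simp add: f'_def p'_def F'_def f_eq poly_pcompose mult.commute)
  show "p' \<noteq> 0"
  proof
   assume "p' = 0"
   hence z: "poly p' (w * cis (- mid)) = 0" for w by simp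
   have "poly p (w * cis (- mid) * cis mid) = 0" for w using z[of w] by (simp add: p'_def poly_pcompose mult.commute)
   hence "poly p w = 0" for w unfolding unrot .
   thus False using p poly_all_0_iff_0 by blast
  qed
  show "\<exists>D. EV s. A (s + 1) \<le> D * A s" by (rule A_step)
  show "filterlim (\<lambda>s. A s / s) at_top at_top" by (rule A_transc)
  show "EV s. A s \<le> exp (\<rho> * s)" by (rule A_order)
  show "norm (f' (exp x)) \<le> exp (A (Re x))" for x using f_le[of "x + \<i> * of_real mid"] by (simp add: f'_def rotated_exp)
  show "EV s. \<exists>z. norm z = exp s \<and> exp (A s / 2) \<le> norm (f' z)"
   using f_big
  proof eventually_elim
   case (elim s)
   then obtain z where "norm z = exp s" "exp (A s / 2) \<le> norm (f z)" by blast
   moreover have "f' (z * cis (- mid)) = f z" unfolding f'_def unrot ..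
   ultimately show ?case by (intro exI[of _ "z * cis (- mid)"]) (simp add: norm_mult)
  qed
  show "\<exists>v>0. EV s. \<forall>z. norm z = exp s \<and> Re z \<le> - j * exp s \<longrightarrow> norm (f' z) \<le> exp (- v * A s)" if de: "j > 0" for j
  proof -
   \<comment> \<open>The minimum with 1 keeps the argument within the domain of
     \<open>arccos\<close>.\<close>
   define c where "c = arccos (- min j 1)"
   have m: "- 1 \<le> - min j 1" "- min j 1 \<le> 1" "- min j 1 < 0" using de by auto
   have cc: "cos c = - min j 1" unfolding c_def using m by (intro cos_arccos) auto
   have c: "0 \<le> c" "c \<le> pi" unfolding c_def using arccos_bounded[OF m(1,2)] by auto
   have "pi / 2 < c"
   proof (rule ccontr)
    assume "\<not> pi / 2 < c"
    hence "cos c \<ge> 0" using c by (intro cos_ge_zero) auto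
    thus False using cc m by simp
   qed
   hence "b - mid < c" using ab by simp
   from left_decay[OF this c(2)] obtain v where e: "v > 0"
    "EV s. \<forall>z. norm z = exp s \<and> Re z \<le> exp s * cos c \<longrightarrow> norm (f (z * cis mid)) \<le> exp (- v * A s)" by blast
   have "EV s. \<forall>z. norm z = exp s \<and> Re z \<le> - j * exp s \<longrightarrow> norm (f' z) \<le> exp (- v * A s)"
    using e(2)
   proof eventually_elim
    case (elim s)
    have "- j * exp s \<le> exp s * cos c" unfolding cc using mult_right_mono[of "min j 1" j "exp s"] by (simp add: mult.commute)
    thus ?case using elim unfolding f'_def by (meson order_trans)
   qed
   thus ?thesis using e(1) by blast
  qed
  show "\<exists>X. \<forall>z. Re z \<le> - X \<longrightarrow> f' z \<noteq> 1"
  proof -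
   obtain S where S: "\<And>s y. s \<ge> S \<Longrightarrow> b < y \<Longrightarrow> y < a + 2 * pi \<Longrightarrow> f (pt s y) \<noteq> 1" using ones by blast
   have "f' z \<noteq> 1" if "Re z \<le> - exp S" for z
   proof -
    define s where "s = ln (norm z)"
    have nz: "norm z \<ge> exp S" using that abs_Re_le_cmod[of z] by linarith
    hence pos: "norm z > 0" using exp_gt_zero[of S] by linarith
    have s: "s \<ge> S" unfolding s_def using nz pos by (simp add: ln_ge_iff)
    have es: "norm z = exp s" using pos by (simp add: s_def)
    obtain y where th: "y \<in> {0..2 * pi - 0}" "z = pt s y"
     using left_direction[OF es, of 0] complex_Re_le_cmod[of z] es by auto
    have "exp s * cos y \<le> - exp S" using that by (simp add: th(2) Re_exp)
    hence "exp s * cos y < 0" using exp_gt_zero[of S] by linarith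
    hence co: "cos y < 0" by (simp add: mult_less_0_iff)
    have "pi / 2 < y"
    proof (rule ccontr)
     assume "\<not> pi / 2 < y"
     hence "cos y \<ge> 0" using th(1) by (intro cos_ge_zero) auto
     thus False using co by simp
    qed
    moreover have "y < 3 * pi / 2"
    proof (rule ccontr)
     assume "\<not> y < 3 * pi / 2"
     hence "cos (2 * pi - y) \<ge> 0" using th(1) by (intro cos_ge_zero) auto
     thus False using co by (simp add: cos_diff)
    qed
    ultimately have "f (pt s (y + mid)) \<noteq> 1" using s ab by (intro S) auto
    thus ?thesis unfolding f'_def th(2) pt_mid .
   qed
   thus ?thesis by blast
  qed
 qed
 obtain X h K where X: "X \<ge> 1" "h holomorphic_on {z. Re z < - X + 1}" "\<And>z. Re z \<le> - X \<Longrightarrow> exp (h z) = 1 - f' z"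
   "\<And>z. Re z \<le> - X \<Longrightarrow> norm (h z) \<le> norm z ^ K"
   "\<And>j. j > 0 \<Longrightarrow> log_near f' h X j"
  using d.log_poly_bound by blast
 interpret e: decaying_log F' G' "l - mid" "u - mid" C A f' p' \<rho> h X K
  by unfold_locales (use X in auto)
 obtain P g where P: "\<And>z. f' z = poly P z * exp (g * z)" using e.exponential_form by blast
 have "f z = poly (pcompose P [:0, cis (- mid):]) z * exp (g * cis (- mid) * z)" for z
  using P[of "z * cis (- mid)"] unfolding f'_def unrot by (simp add: poly_pcompose mult_ac)
 thus ?thesis by blast
qed

text \<open>The function is small outside a sector of half-angle \<open>w < pi / 2\<close>, in
  particular in a half-plane, which forces \<open>A s \<le> B * exp s\<close>. This is growth of
  order 1, below the critical order \<open>pi / (2 * w)\<close> of the sector, so Phragmen-Lindelof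
  makes the function bounded.\<close>

lemma narrow_case:
 assumes "b - a < pi"
 shows False
proof -
 define w where "w = (b - mid + pi / 2) / 2"
 have bm: "b - mid < pi / 2" "0 < b - mid" using assms dirs by (auto simp: mid_def field_simps)
 have w: "0 < w" "b - mid < w" "w < pi / 2" using bm by (auto simp: w_def)
 define g where "g z = f (z * cis mid)" for z
 have hg: "g holomorphic_on X" for X unfolding g_def
  by (rule hol_compose[OF _ f_entire]) (auto intro!: holomorphic_intros)
 have wpi: "w \<le> pi" using w pi_gt_zero by linarith
 obtain d where e: "d > 0" "EV s. \<forall>z. norm z = exp s \<and> Re z \<le> exp s * cos w \<longrightarrow> norm (g z) \<le> exp (- d * A s)"
  using left_decay[OF w(2) wpi] unfolding g_def by blast
 then obtain s0 where s0: "\<And>s z. s \<ge> s0 \<Longrightarrow> norm z = exp s \<Longrightarrow> Re z \<le> exp s * cos w \<Longrightarrow> norm (g z) \<le> exp (- d * A s)"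
  unfolding ev_top by blast
 have le1: "norm (g z) \<le> exp (- d * A (ln (norm z)))" if z: "norm z \<ge> exp s0" "Re z \<le> norm z * cos w" for z
 proof -
  have pos: "norm z > 0" using z(1) exp_gt_zero[of s0] by linarith
  hence "ln (norm z) \<ge> s0" using z(1) by (simp add: ln_ge_iff)
  thus ?thesis using s0[of "ln (norm z)" z] z pos by simp
 qed
 have cw: "cos w > 0" using w by (intro cos_gt_zero_pi) auto
 have "bounded (g ` cball 0 (exp s0))" by (intro compact_imp_bounded compact_continuous_image holomorphic_on_imp_continuous_on hg) auto
 then obtain M0 where "\<forall>y\<in>g ` cball 0 (exp s0). norm y \<le> M0" unfolding bounded_iff by blast
 hence M0: "norm (g z) \<le> M0" if "norm z \<le> exp s0" for z using that by simp
 define M where "M = max 1 M0"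
 have M: "M \<ge> 1" "M \<ge> M0" by (auto simp: M_def)
 have outer: "norm (g z) \<le> M" if "Re z \<le> norm z * cos w" for z
 proof (cases "norm z \<le> exp s0")
  case True thus ?thesis using M0[OF True] M by linarith
 next
  case False
  have "exp (- d * A (ln (norm z))) \<le> 1" using e(1) A_pos[of "ln (norm z)"] by simp
  thus ?thesis using le1[of z] that False M by linarith
 qed
 have nonpos: "Re z \<le> norm z * cos w" if "Re z \<le> 0" for z
  by (rule order_trans[OF that mult_nonneg_nonneg]) (use cw in auto)
 have gn: "\<not> (\<forall>z. norm z \<ge> 1 \<longrightarrow> norm (g z) \<le> M')" for M'
 proof
  assume a: "\<forall>z. norm z \<ge> 1 \<longrightarrow> norm (g z) \<le> M'"
  have "EV s. A s \<ge> 2 * \<bar>M'\<bar>" using A_to_top by (simp add: filterlim_at_top)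
  with f_big have "\<forall>\<^sub>F s in at_top :: real filter. False" using eventually_ge_at_top[of 0]
  proof eventually_elim
   case (elim s)
   then obtain z where z: "norm z = exp s" "exp (A s / 2) \<le> norm (f z)" by blast
   have "z * cis (- mid) * cis mid = z" by (simp add: mult.assoc cis_mult)
   hence "norm (f z) = norm (g (z * cis (- mid)))" by (simp only: g_def)
   also have "\<dots> \<le> M'" using a elim z by (simp add: norm_mult)
   finally have "exp (A s / 2) \<le> M'" using z by linarith
   thus False using exp_ge_add_one_self[of "A s / 2"] elim(2) by linarith
  qed
  thus False by simp
 qed
 obtain z0 where z0: "Re z0 < 0" "g z0 \<noteq> 0"
 proof -
  have "\<exists>z. Re z < 0 \<and> g z \<noteq> 0"
  proof (rule ccontr)
   assume n: "\<not> ?thesis"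
   have "g z = 0" for z
   proof (rule analytic_continuation_open[of "{z. Re z < 0}" UNIV g "\<lambda>_. 0"])
    show "{z::complex. Re z < 0} \<noteq> {}" by (auto intro: exI[of _ "-1"])
   qed (use n hg in \<open>auto intro: open_halfspace_Re_lt\<close>)
   thus False using gn[of 0] by simp
  qed
  thus thesis using that by blast
 qed
 have Mp: "M > 0" using M by simp
 have "\<exists>B>0. EV s. A s \<le> B * exp s"
 proof (rule decay_imp_exp_type[OF hg _ Mp A_mono e(1) _ z0])
  show "norm (g z) \<le> M" if "Re z < 0" for z using outer nonpos[of z] that by auto
  fix z :: complex assume z: "norm z \<ge> exp s0" "Re z \<le> - (3/4) * norm z"
  have "Re z \<le> 0" using z(2) norm_ge_zero[of z] by linarith
  hence "norm (g z) \<le> exp (- d * A (ln (norm z)))" using le1[OF z(1)] nonpos by blast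
  thus "norm (g z) \<le> 2 * exp (- d * A (ln (norm z)))" using exp_gt_zero[of "- d * A (ln (norm z))"] by linarith
 qed
 then obtain B where B: "B > 0" "EV s. A s \<le> B * exp s" by blast
 then obtain s1 where s1: "\<And>s. s \<ge> s1 \<Longrightarrow> A s \<le> B * exp s" by (auto simp: ev_top)
 have sector: "norm (g (of_real r * cis t)) \<le> M" if rt: "r \<ge> exp s0" "\<bar>t - 0\<bar> \<le> w" for r t
 proof (rule phragmen_lindelof_sector[OF hg open_UNIV _ _ _ _ _ _ _ _ rt])
  show "exp s0 > 0" "w > 0" "(0::real) \<le> 1" "1 * w < pi / 2" using w by auto
  show "norm (g (of_real r * cis t)) \<le> M" if "exp s0 \<le> r" "\<bar>t - 0\<bar> = w" for r t
  proof (rule outer)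
   have r: "r > 0" using that(1) exp_gt_zero[of s0] by linarith
   have "cos t = cos w" using that(2) by (metis cos_abs_real diff_zero)
   thus "Re (of_real r * cis t) \<le> norm (of_real r * cis t) * cos w" using r by (simp add: norm_mult)
  qed
  show "norm (g (of_real (exp s0) * cis t)) \<le> M" if "\<bar>t - 0\<bar> \<le> w" for t
  proof -
   have "norm (g (of_real (exp s0) * cis t)) \<le> M0" by (rule M0) (simp add: norm_mult del: of_real_exp)
   thus ?thesis using M by linarith
  qed
  show "\<exists>r\<ge>T. \<forall>t. \<bar>t - 0\<bar> \<le> w \<longrightarrow> norm (g (of_real r * cis t)) \<le> exp (B * r powr 1)" for T
  proof -
   define s where "s = max s1 (ln (max T 1))"
   have "T \<le> exp (ln (max T 1))" by simp
   also have "\<dots> \<le> exp s" by (simp only: exp_le_cancel_iff s_def max.cobounded2)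
   finally have T: "T \<le> exp s" .
   have "norm (g (of_real (exp s) * cis t)) \<le> exp (B * exp s powr 1)" for t
   proof -
    have "of_real (exp s) * cis t * cis mid = pt s (t + mid)"
     using pt_mid[of s t] by (simp add: exp_eq_polar exp_of_real)
    hence "norm (g (of_real (exp s) * cis t)) \<le> exp (A s)" using f_le[of "Complex s (t + mid)"] by (simp add: g_def del: of_real_exp)
    also have "\<dots> \<le> exp (B * exp s)" using s1[of s] by (simp add: s_def)
    finally show ?thesis by simp
   qed
   thus ?thesis using T by blast
  qed
 qed auto
 have "norm (g z) \<le> M" for z
 proof (cases "Re z \<le> norm z * cos w \<or> norm z \<le> exp s0")
  case True thus ?thesis using outer[of z] M0[of z] M by auto
 next
  case False
  hence nz: "norm z > exp s0" and re: "Re z > norm z * cos w" by auto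
  have z0: "z \<noteq> 0" using nz by auto
  have z: "z = of_real (norm z) * cis (Arg z)" using Arg_eq[OF z0] by (simp add: cis_conv_exp)
  have "Re z = norm z * cos (Arg z)" using arg_cong[OF z, of Re] by simp
  hence "cos w < cos \<bar>Arg z\<bar>" using re z0 by simp
  moreover have "cos \<bar>Arg z\<bar> \<le> cos w" if "w \<le> \<bar>Arg z\<bar>"
   using that w Arg_bounded[of z] by (intro cos_monotone_0_pi_le) auto
  ultimately have "\<bar>Arg z - 0\<bar> \<le> w" by fastforce
  thus ?thesis using sector[of "norm z" "Arg z"] nz z by simp
 qed
 thus False using gn[of M] by blast
qed

theorem exponential_polynomial: "\<exists>P c. \<forall>z. f z = poly P z * exp (c * z)"
 using half_plane_case narrow_case dirs(4) by force

end

lemma deriv_exponential_polynomial: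
 assumes "\<And>z. f z = a + poly P z * exp (b * z)"
 shows "\<exists>p q. \<forall>z. deriv f z = poly p z * exp (poly q z)"
proof (intro exI allI)
 fix z
 have "((\<lambda>z. a + poly P z * exp (b * z)) has_field_derivative
   (poly (pderiv P) z * exp (b * z) + poly P z * (exp (b * z) * b))) (at z)"
  by (auto intro!: derivative_eq_intros poly_DERIV)
 moreover have "f = (\<lambda>z. a + poly P z * exp (b * z))" by (rule ext) (rule assms)
 ultimately show "deriv f z = poly (pderiv P + smult b P) z * exp (poly [:0, b:] z)"
  by (simp add: DERIV_imp_deriv algebra_simps)
qed

section \<open>The cases close to 0 and close to 1\<close>

context separated begin

lemma f_big: "EV s. \<exists>z. norm z = exp s \<and> exp (A s / 2) \<le> norm (f z) \<and> exp (A s / 2) \<le> norm (1 - f z)"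
proof -
 have "EV s. A s \<ge> 6" using A_at_top by (simp add: filterlim_at_top)
 thus ?thesis
 proof eventually_elim
  case (elim s)
  obtain z where z: "norm z = exp s" "exp (A s) = 2 + norm (f z)" using A_max by blast
  have "exp (A s / 2) \<ge> 4" using elim exp_ge_add_one_self[of "A s / 2"] by linarith
  hence "4 * exp (A s / 2) \<le> exp (A s / 2) * exp (A s / 2)" by (intro mult_right_mono) auto
  also have "\<dots> = exp (A s)" by (simp add: mult_exp_exp)
  finally have "exp (A s / 2) + 3 \<le> exp (A s)" using \<open>exp (A s / 2) \<ge> 4\<close> by linarith
  moreover have "norm (f z) - 1 \<le> norm (1 - f z)" using norm_triangle_ineq2[of "f z" 1] by (simp add: norm_minus_commute)
  ultimately show ?case using z by (intro exI[of _ z]) auto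
 qed
qed

lemma one_plus_exp_le:
 assumes "d > 0"
 shows "EV s. 1 + exp (d / 2 * A s) \<le> exp (d * A s)"
proof -
 have "EV s. A s \<ge> 2 / d" using A_at_top by (simp add: filterlim_at_top)
 thus ?thesis
 proof eventually_elim
  case (elim s)
  have "d / 2 * A s \<ge> 1" using elim assms by (simp add: field_simps)
  hence 1: "exp (d / 2 * A s) \<ge> 2" using exp_ge_add_one_self[of "d / 2 * A s"] by linarith
  hence "2 * exp (d / 2 * A s) \<le> exp (d / 2 * A s) * exp (d / 2 * A s)" by (intro mult_right_mono) auto
  also have "\<dots> = exp (d * A s)" by (simp add: mult_exp_exp)
  finally show ?case using 1 by linarith
 qed
qed

lemma small_at:
 assumes "\<exists>w>0. EV s. \<forall>t\<in>{c..c}. norm (g (pt s t)) \<le> exp (- w * A s)"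
  and "\<exists>w>0. EV s. \<forall>t\<in>{d..d}. norm (g (pt s t)) \<le> exp (- w * A s)"
 shows "\<exists>w>0. (EV s. norm (g (pt s c)) \<le> exp (- w * A s)) \<and> (EV s. norm (g (pt s d)) \<le> exp (- w * A s))"
proof -
 obtain e1 where e1: "e1 > 0" "EV s. norm (g (pt s c)) \<le> exp (- e1 * A s)" using assms(1) by auto
 obtain e2 where e2: "e2 > 0" "EV s. norm (g (pt s d)) \<le> exp (- e2 * A s)" using assms(2) by auto
 define e where "e = min e1 e2"
 have le: "exp (- e1 * A s) \<le> exp (- e * A s)" "exp (- e2 * A s) \<le> exp (- e * A s)" for s
  by (intro exp_A_mono; simp add: e_def)+
 have "EV s. norm (g (pt s c)) \<le> exp (- e * A s)" using e1(2) by eventually_elim (use le in \<open>meson order_trans\<close>)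
 moreover have "EV s. norm (g (pt s d)) \<le> exp (- e * A s)" using e2(2) by eventually_elim (use le in \<open>meson order_trans\<close>)
 moreover have "e > 0" using e1 e2 by (simp add: e_def)
 ultimately show ?thesis by blast
qed

text \<open>Used with \<open>g = f\<close>, \<open>v = 1\<close> and with \<open>g = f - 1\<close>,
  \<open>v = - 1\<close>, so that \<open>g - v\<close> is the other one of the two functions. Its
  size \<open>exp (o(A))\<close> between the rays passes to \<open>g\<close>, and then the decay on
  the two rays spreads to all directions between them.\<close>

lemma complement:
 assumes g: "g holomorphic_on UNIV" and sm: "\<exists>w>0. EV s. \<forall>t\<in>{c..c}. norm (g (pt s t)) \<le> exp (- w * A s)"
   "\<exists>w>0. EV s. \<forall>t\<in>{d..d}. norm (g (pt s t)) \<le> exp (- w * A s)"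
  and v: "norm v = 1" and le: "\<And>j. j > 0 \<Longrightarrow> EV s. \<forall>t\<in>{c..d}. norm (g (pt s t) - v) \<le> exp (j * A s)"
  and ab: "c \<le> a" "b \<le> d"
 shows "\<exists>w>0. EV s. \<forall>t\<in>{a..b}. norm (g (pt s t)) \<le> exp (- w * A s)"
proof -
 obtain w where e: "w > 0" "EV s. norm (g (pt s c)) \<le> exp (- w * A s)" "EV s. norm (g (pt s d)) \<le> exp (- w * A s)"
  using small_at[OF sm] by blast
 obtain D where D: "EV s. A (s + 1) \<le> D * A s" using growth_step by blast
 have "\<exists>w>0. EV s. \<forall>t\<in>{c..d}. norm (g (pt s t)) \<le> exp (- w * A s)"
 proof (rule small_between[OF g S1.A_mono S1.A_pos D e])
  fix j :: real assume eta: "j > 0"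
  hence "j / 2 > 0" by simp
  from le[OF this] one_plus_exp_le[OF eta]
  show "EV s. \<forall>t\<in>{c..d}. norm (g (pt s t)) \<le> exp (j * A s)"
  proof eventually_elim
   case (elim s)
   show ?case
   proof
    fix t assume "t \<in> {c..d}"
    hence "norm (g (pt s t) - v) \<le> exp (j / 2 * A s)" using elim(1) by blast
    moreover have "norm (g (pt s t)) \<le> 1 + norm (g (pt s t) - v)" using norm_triangle_sub[of "g (pt s t)" v] v by simp
    ultimately show "norm (g (pt s t)) \<le> exp (j * A s)" using elim(2) by linarith
   qed
  qed
 qed auto
 then obtain w' where e': "w' > 0" "EV s. \<forall>t\<in>{c..d}. norm (g (pt s t)) \<le> exp (- w' * A s)" by blast
 have "EV s. \<forall>t\<in>{a..b}. norm (g (pt s t)) \<le> exp (- w' * A s)"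
  using e'(2) by eventually_elim (use ab in auto)
 thus ?thesis using e'(1) by blast
qed

text \<open>The arc is enlarged until its end rays lie in the two gaps, where \<open>Small\<close>
  gives decay; the second gap enters lowered by \<open>2 * pi\<close>.\<close>

lemma small_complement:
 assumes Small and ab: "b1 - 2 * pi < a" "b < a1"
 shows "\<exists>w>0. EV s. lo a b (- w) s"
proof -
 define c d where "c = min a (w2 - 2 * pi)" and "d = max b w1"
 have cd: "b1 - 2 * pi < c" "d < a1" "c \<le> a" "b \<le> d" "c + 2 * pi < a0 + 2 * pi" "b0 < d"
  using ab omega by (auto simp: c_def d_def)
 have "gap_arc (c + 2 * pi) (c + 2 * pi)" "gap_arc d d" using cd by (auto simp: gap_arc_def)
 hence sm: "\<exists>w>0. EV s. lo (c + 2 * pi) (c + 2 * pi) (- w) s" "\<exists>w>0. EV s. lo d d (- w) s"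
  using assms(1) unfolding Small_def by blast+
 have "pt s (c + 2 * pi) = pt s c" for s using pt_shift[of s "c + 2 * pi"] by simp
 hence sc: "\<exists>w>0. EV s. lo c c (- w) s" using sm(1) by simp
 show ?thesis
  by (rule complement[OF f_holomorphic sc sm(2) norm_one _ cd(3,4)]) (use assms(1) cd(1,2) in \<open>simp add: Small_def\<close>)
qed

lemma near1_complement:
 assumes Near1 and ab: "b0 < a" "b < a0 + 2 * pi"
 shows "\<exists>w>0. EV s. lo1 a b (- w) s"
proof -
 define c d where "c = min a w1" and "d = max b w2"
 have cd: "b0 < c" "d < a0 + 2 * pi" "c \<le> a" "b \<le> d" "c < a1" "b1 < d"
  using ab omega by (auto simp: c_def d_def)
 have "gap_arc c c" "gap_arc d d" using cd by (auto simp: gap_arc_def)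
 hence sm: "\<exists>w>0. EV s. lo1 c c (- w) s" "\<exists>w>0. EV s. lo1 d d (- w) s"
  using assms(1) unfolding Near1_def by blast+
 show ?thesis
  by (rule complement[of "\<lambda>z. f z - 1" c d "- 1", OF _ sm _ _ cd(3,4)])
   (use assms(1) cd(1,2) in \<open>auto simp: Near1_def intro!: holomorphic_intros f_holomorphic\<close>)
qed

lemma far_nonzero:
 "\<exists>S. \<forall>s t. s \<ge> S \<longrightarrow> (b0 < t \<and> t < a0 + 2 * pi \<longrightarrow> f (pt s t) \<noteq> 0) \<and> (b1 - 2 * pi < t \<and> t < a1 \<longrightarrow> f (pt s t) \<noteq> 1)"
proof -
 obtain S where S: "\<And>s. s \<ge> S \<Longrightarrow> \<forall>w. Re w = s \<longrightarrow>
  (w \<in> strip1 \<longrightarrow> f (exp w) \<noteq> 0) \<and> (w \<in> strip0 \<longrightarrow> f (exp w) \<noteq> 1)"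
  using nonzero_far unfolding ev_top by blast
 show ?thesis
 proof (intro exI[of _ S] allI impI)
  fix s t :: real assume "s \<ge> S"
  from S[OF this, rule_format, of "Complex s t"]
  show "(b0 < t \<and> t < a0 + 2 * pi \<longrightarrow> f (pt s t) \<noteq> 0) \<and> (b1 - 2 * pi < t \<and> t < a1 \<longrightarrow> f (pt s t) \<noteq> 1)" by simp
 qed
qed

text \<open>Outside the second sector \<open>f\<close> is small and, far out, free of 1-points; the
  strip free of zeros contains this sector with a margin on both sides. This is the situation of
  \<open>one_sided\<close> with the directions \<open>[a1, b1]\<close>.\<close>

theorem small_case:
 assumes Small and op: "b1 - a1 \<le> pi"
 shows "\<exists>p q. \<forall>z. deriv f z = poly p z * exp (poly q z)"
proof -
 interpret o: one_sided F1 G1 b0 "a0 + 2 * pi" C A f p1 \<rho> a1 b1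
 proof
  show "b0 < a1" "a1 < b1" "b1 < a0 + 2 * pi" "b1 - a1 \<le> pi" using ang op by auto
  show "f z = poly p1 z * F1 z" for z by (rule f1)
  show "p1 \<noteq> 0" by (rule p1)
  show "\<exists>D. EV s. A (s + 1) \<le> D * A s" by (rule growth_step)
  show "filterlim (\<lambda>s. A s / s) at_top at_top" by (rule A_transc)
  show "EV s. A s \<le> exp (\<rho> * s)" by (rule A_order)
  show "norm (f (exp u)) \<le> exp (A (Re u))" for u using A_ub[of u] by linarith
  show "EV s. \<exists>z. norm z = exp s \<and> exp (A s / 2) \<le> norm (f z)" using f_big by eventually_elim blast
  show "\<exists>w>0. EV s. lo c d (- w) s" if cd: "b1 < c" "d < a1 + 2 * pi" for c d
  proof -
   have "b1 - 2 * pi < c - 2 * pi" "d - 2 * pi < a1" using cd by auto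
   from small_complement[OF assms(1) this] obtain w where e: "w > 0"
    "EV s. lo (c - 2 * pi) (d - 2 * pi) (- w) s" by blast
   from e(2) have "EV s. lo c d (- w) s"
   proof eventually_elim
    case (elim s)
    show ?case
    proof
     fix t assume "t \<in> {c..d}"
     hence "t - 2 * pi \<in> {c - 2 * pi..d - 2 * pi}" by auto
     thus "norm (f (pt s t)) \<le> exp (- w * A s)" using elim pt_shift[of s t] by metis
    qed
   qed
   thus ?thesis using e(1) by blast
  qed
  obtain S where S: "\<forall>s t. s \<ge> S \<longrightarrow> (b0 < t \<and> t < a0 + 2 * pi \<longrightarrow> f (pt s t) \<noteq> 0) \<and> (b1 - 2 * pi < t \<and> t < a1 \<longrightarrow> f (pt s t) \<noteq> 1)"
   using far_nonzero by blast
  have "f (pt s t) \<noteq> 1" if "s \<ge> S" "b1 < t" "t < a1 + 2 * pi" for s t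
   using S[rule_format, of s "t - 2 * pi"] that unfolding pt_shift by simp
  thus "\<exists>S. \<forall>s t. s \<ge> S \<and> b1 < t \<and> t < a1 + 2 * pi \<longrightarrow> f (pt s t) \<noteq> 1" by blast
 qed
 obtain P b where "\<And>z. f z = poly P z * exp (b * z)" using o.exponential_polynomial by blast
 thus ?thesis by (intro deriv_exponential_polynomial[of f 0 P b]) simp
qed

text \<open>The same for \<open>1 - f\<close> and the directions \<open>[a0, b0]\<close>: zeros and
  1-points exchange their roles.\<close>

theorem near1_case:
 assumes Near1 and op: "b0 - a0 \<le> pi"
 shows "\<exists>p q. \<forall>z. deriv f z = poly p z * exp (poly q z)"
proof -
 interpret o: one_sided F0 G0 "b1 - 2 * pi" a1 C A "\<lambda>z. 1 - f z" "- p0" \<rho> a0 b0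
 proof
  show "b1 - 2 * pi < a0" "a0 < b0" "b0 < a1" "b0 - a0 \<le> pi" using ang op by auto
  show "1 - f z = poly (- p0) z * F0 z" for z using f0[of z] by (metis minus_diff_eq mult_minus_left poly_minus)
  show "- p0 \<noteq> 0" using p0 by simp
  show "\<exists>D. EV s. A (s + 1) \<le> D * A s" by (rule growth_step)
  show "filterlim (\<lambda>s. A s / s) at_top at_top" by (rule A_transc)
  show "EV s. A s \<le> exp (\<rho> * s)" by (rule A_order)
  show "norm (1 - f (exp w)) \<le> exp (A (Re w))" for w using A_ub[of w] norm_triangle_ineq4[of 1 "f (exp w)"] by simp
  show "EV s. \<exists>z. norm z = exp s \<and> exp (A s / 2) \<le> norm (1 - f z)" using f_big by eventually_elim blast
  show "\<exists>e>0. EV s. \<forall>t\<in>{c..d}. norm (1 - f (pt s t)) \<le> exp (- e * A s)" if cd: "b0 < c" "d < a0 + 2 * pi" for c d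
   using near1_complement[OF assms(1) cd] by (simp add: norm_minus_commute)
  obtain S where S: "\<forall>s t. s \<ge> S \<longrightarrow> (b0 < t \<and> t < a0 + 2 * pi \<longrightarrow> f (pt s t) \<noteq> 0) \<and> (b1 - 2 * pi < t \<and> t < a1 \<longrightarrow> f (pt s t) \<noteq> 1)"
   using far_nonzero by blast
  thus "\<exists>S. \<forall>s t. s \<ge> S \<and> b0 < t \<and> t < a0 + 2 * pi \<longrightarrow> 1 - f (pt s t) \<noteq> 1" by auto
 qed
 obtain P b where P: "\<And>z. 1 - f z = poly P z * exp (b * z)" using o.exponential_polynomial by blast
 have "f z = 1 + poly (- P) z * exp (b * z)" for z using P[of z] by (simp add: algebra_simps)
 thus ?thesis by (rule deriv_exponential_polynomial)
qed

theorem derivative_form: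
 assumes "b0 - a0 \<le> pi" "b1 - a1 \<le> pi"
 shows "\<exists>p q. \<forall>z. deriv f z = poly p z * exp (poly q z)"
 using regime large_case small_case near1_case assms by blast

end

section \<open>Removing finitely many zeros, the growth function and the conclusion\<close>

lemma divide_out_zero:
 assumes f: "f holomorphic_on UNIV" and nz: "\<exists>w. f w \<noteq> 0"
 shows "\<exists>n H. H holomorphic_on UNIV \<and> H z0 \<noteq> 0 \<and> (\<forall>z. f z = (z - z0) ^ n * H z)"
proof -
 define n where "n = nat (zorder f z0)"
 define g where "g = zor_poly f z0"
 have "\<exists>w\<in>UNIV. f w \<noteq> 0" using nz by simp
 note z = zorder_exist_zero[OF f open_UNIV connected_UNIV UNIV_I this, THEN conjunct2, folded n_def g_def]
 obtain r where r: "r > 0" "g holomorphic_on cball z0 r" "\<And>w. w \<in> cball z0 r \<Longrightarrow> f w = g w * (w - z0) ^ n \<and> g w \<noteq> 0"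
  using z[of z0, folded n_def g_def] by blast
 define H where "H w = (if w = z0 then g z0 else f w / (w - z0) ^ n)" for w
 have Hg: "H w = g w" if "w \<in> ball z0 r" for w using r(3)[of w] that by (auto simp: H_def)
 have "H holomorphic_on ball z0 r"
  by (rule holomorphic_transform[OF holomorphic_on_subset[OF r(2) ball_subset_cball]]) (simp add: Hg)
 moreover have "H holomorphic_on - {z0}"
 proof -
  have "(\<lambda>w. f w / (w - z0) ^ n) holomorphic_on - {z0}" by (intro holomorphic_intros holomorphic_on_subset[OF f]) auto
  thus ?thesis by (rule holomorphic_transform) (auto simp: H_def)
 qed
 ultimately have "H holomorphic_on (ball z0 r \<union> - {z0})" by (intro holomorphic_on_Un) auto
 moreover have "ball z0 r \<union> - {z0} = UNIV" using r(1) by auto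
 moreover have "H z0 \<noteq> 0" using r(1) r(3)[of z0] by (simp add: H_def)
 moreover have "f z = (z - z0) ^ n * H z" for z using r(1) r(3)[of z0] by (auto simp: H_def)
 ultimately show ?thesis by auto
qed

text \<open>Each new quotient divides the previous one, so it stays nonzero at the points already
  treated.\<close>

lemma divide_out_zeros:
 fixes f :: "complex \<Rightarrow> complex"
 assumes "finite Z" and f: "f holomorphic_on UNIV" and nz: "\<exists>w. f w \<noteq> 0"
 shows "\<exists>p H. p \<noteq> 0 \<and> H holomorphic_on UNIV \<and> (\<forall>z\<in>Z. H z \<noteq> 0) \<and> (\<forall>z. f z = poly p z * H z)"
 using assms(1)
proof (induction Z rule: finite_induct)
 case empty
 show ?case using f by (intro exI[of _ 1] exI[of _ f]) auto
next
 case (insert a Z)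
 then obtain p H where p: "p \<noteq> 0" "H holomorphic_on UNIV" "\<forall>z\<in>Z. H z \<noteq> 0" "\<And>z. f z = poly p z * H z" by blast
 have "\<exists>w. H w \<noteq> 0" using nz p(4) by force
 from divide_out_zero[OF p(2) this] obtain n K where K: "K holomorphic_on UNIV" "K a \<noteq> 0" "\<And>z. H z = (z - a) ^ n * K z" by blast
 have "p * [:- a, 1:] ^ n \<noteq> 0" using p(1) by simp
 moreover have "\<forall>z\<in>insert a Z. K z \<noteq> 0" using K p(3) by force
 moreover have "f z = poly (p * [:- a, 1:] ^ n) z * K z" for z using p(4)[of z] K(3)[of z] by (simp add: poly_power)
 ultimately show ?case using K(1) by blast
qed

lemma max_modulus_attained:
 assumes f: "f holomorphic_on UNIV" and r: "r > 0"
 shows "\<exists>z. norm z = r \<and> max_modulus f r = norm (f z) \<and> (\<forall>w. norm w \<le> r \<longrightarrow> norm (f w) \<le> norm (f z))"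
proof -
 have c: "continuous_on X f" for X using f holomorphic_on_imp_continuous_on holomorphic_on_subset by blast
 have "of_real r \<in> sphere (0::complex) r" using r by simp
 hence "sphere (0::complex) r \<noteq> {}" by blast
 then obtain z where z: "z \<in> sphere 0 r" "\<And>w. w \<in> sphere 0 r \<Longrightarrow> norm (f w) \<le> norm (f z)"
  using continuous_attains_sup[OF compact_sphere _ continuous_on_norm[OF c]] by blast
 have "norm (f w) \<le> norm (f z)" if "norm w \<le> r" for w
  by (rule maximum_modulus_frontier[of f "cball 0 r"])
    (use that z(2) c in \<open>auto intro: holomorphic_on_subset[OF f] simp: frontier_cball\<close>)
 moreover have "max_modulus f r = norm (f z)" unfolding max_modulus_def
  by (rule cSup_eq_maximum) (use z in auto)
 ultimately show ?thesis using z(1) by auto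
qed

text \<open>Cauchy's inequality removes all Taylor coefficients beyond \<open>N\<close>. The growth
  is assumed only on some arbitrarily large circles, because it will come from the negation of a
  limit.\<close>

lemma poly_growth_on_circles_imp_poly:
 assumes f: "f holomorphic_on UNIV" and gr: "\<And>T. \<exists>r\<ge>T. \<forall>z. norm z = r \<longrightarrow> norm (f z) \<le> r ^ N"
 shows "\<exists>p. f = poly p"
proof -
 have zero: "(deriv ^^ k) f 0 = 0" if k: "k > N" for k
 proof (rule ccontr)
  assume n: "(deriv ^^ k) f 0 \<noteq> 0"
  define T where "T = max 1 (fact k / norm ((deriv ^^ k) f 0) + 1)"
  obtain r where r: "r \<ge> T" "\<And>z. norm z = r \<Longrightarrow> norm (f z) \<le> r ^ N" using gr by blast
  have "1 \<le> T" "fact k / norm ((deriv ^^ k) f 0) + 1 \<le> T" unfolding T_def by (rule max.cobounded1, rule max.cobounded2)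
  hence r1: "r \<ge> 1" "r > fact k / norm ((deriv ^^ k) f 0)" using r(1) by linarith+
  have "norm ((deriv ^^ k) f 0) \<le> fact k * r ^ N / r ^ k"
   by (rule Cauchy_inequality) (use r1 r(2) f in \<open>auto intro: holomorphic_on_subset holomorphic_on_imp_continuous_on\<close>)
  also have "\<dots> = fact k / r ^ (k - N)" using r1 k by (simp add: power_diff)
  also have "\<dots> \<le> fact k / r ^ 1" using r1 k by (intro divide_left_mono power_increasing) auto
  finally have "norm ((deriv ^^ k) f 0) * r \<le> fact k" using r1 by (simp add: field_simps)
  moreover have "fact k < norm ((deriv ^^ k) f 0) * r" using r1(2) n by (simp add: field_simps)
  ultimately show False by linarith
 qed
 have "f w = poly (\<Sum>k\<le>N. monom ((deriv ^^ k) f 0 / fact k) k) w" for w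
 proof -
  have "(\<lambda>k. (deriv ^^ k) f 0 / fact k * (w - 0) ^ k) sums f w"
   by (rule holomorphic_power_series[of f 0 "norm w + 1"]) (use f holomorphic_on_subset in auto)
  moreover have "(\<lambda>k. (deriv ^^ k) f 0 / fact k * (w - 0) ^ k) sums (\<Sum>k\<le>N. (deriv ^^ k) f 0 / fact k * (w - 0) ^ k)"
   by (rule sums_finite) (use zero in auto)
  ultimately have "f w = (\<Sum>k\<le>N. (deriv ^^ k) f 0 / fact k * (w - 0) ^ k)" by (rule sums_unique2)
  thus ?thesis by (simp add: poly_sum poly_monom)
 qed
 thus ?thesis by blast
qed

lemma factor_log_side:
 assumes f: "f holomorphic_on UNIV" and nz: "\<exists>w. f w \<noteq> 0" and fin: "finite {z. f z = 0 \<and> z \<notin> S}"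
  and S: "\<And>x. x \<in> strip l u \<Longrightarrow> exp x \<notin> S"
  and A: "\<And>s t. s \<le> t \<Longrightarrow> A s \<le> A t" "\<And>s. A s > 0" "\<And>x. norm (f (exp x)) \<le> exp (A (Re x))"
 shows "\<exists>p F G C. p \<noteq> 0 \<and> (\<forall>z. f z = poly p z * F z) \<and> (\<forall>C'\<ge>C. log_side F G l u C' A)"
proof -
 \<comment> \<open>The point 0 is added because \<open>log_side\<close> demands
   \<open>F 0 \<noteq> 0\<close>, while a zero of \<open>f\<close> at 0 may belong to
   \<open>S\<close>.\<close>
 have "finite (insert 0 {z. f z = 0 \<and> z \<notin> S})" using fin by simp
 from divide_out_zeros[OF this f nz] obtain p F where p: "p \<noteq> 0" and F: "F holomorphic_on UNIV"
  and Fz: "\<forall>z\<in>insert 0 {z. f z = 0 \<and> z \<notin> S}. F z \<noteq> 0" and fF: "\<And>z. f z = poly p z * F z" by blast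
 have hF: "(\<lambda>x. F (exp x)) holomorphic_on strip l u"
  by (rule hol_compose[OF _ F]) (auto intro: holomorphic_intros)
 have "F (exp x) \<noteq> 0" if "x \<in> strip l u" for x
 proof
  assume F0: "F (exp x) = 0"
  hence "f (exp x) = 0" by (simp add: fF)
  thus False using S[OF that] Fz F0 by blast
 qed
 then obtain G where G: "G holomorphic_on strip l u" "\<And>x. x \<in> strip l u \<Longrightarrow> F (exp x) = exp (G x)"
  using contractible_imp_holomorphic_log[OF hF convex_imp_contractible[OF convex_strip]] by blast
 obtain c R where c: "c > 0" "\<And>z. norm z \<ge> R \<Longrightarrow> c \<le> norm (poly p z)" using poly_norm_bounds[OF p] by metis
 have "bounded (F ` cball 0 R)" by (intro compact_imp_bounded compact_continuous_image holomorphic_on_imp_continuous_on holomorphic_on_subset[OF F]) auto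
 then obtain M0 where "\<forall>y\<in>F ` cball 0 R. norm y \<le> M0" unfolding bounded_iff by blast
 hence M0: "norm (F z) \<le> max 1 M0" if "norm z \<le> R" for z using that by (auto simp: le_max_iff_disj)
 define C where "C = max (ln (max 1 M0)) (max 0 (- ln c))"
 have "log_side F G l u C' A" if C': "C' \<ge> C" for C'
 proof
  have Cs: "C' \<ge> 0" "ln (max 1 M0) \<le> C'" "- ln c \<le> C'" using C' by (auto simp: C_def)
  show "C' \<ge> 0" by (rule Cs)
  show "norm (F (exp x)) \<le> exp (A (Re x) + C')" for x
  proof (cases "norm (exp x) \<le> R")
   case True
   have "norm (F (exp x)) \<le> exp (ln (max 1 M0))" using M0[OF True] by simp
   also have "ln (max 1 M0) \<le> A (Re x) + C'" using Cs(2) A(2)[of "Re x"] by linarith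
   hence "exp (ln (max 1 M0)) \<le> exp (A (Re x) + C')" by (simp only: exp_le_cancel_iff)
   finally show ?thesis .
  next
   case False
   have "c * norm (F (exp x)) \<le> norm (f (exp x))" unfolding fF norm_mult using c(2)[of "exp x"] False by (intro mult_right_mono) auto
   also have "\<dots> \<le> exp (A (Re x))" by (rule A(3))
   finally have "norm (F (exp x)) \<le> exp (A (Re x)) / c" using c(1) by (simp add: field_simps)
   also have "\<dots> = exp (A (Re x) + - ln c)" using c(1) by (simp add: exp_diff)
   also have "\<dots> \<le> exp (A (Re x) + C')" using Cs(3) by simp
   finally show ?thesis .
  qed
 qed (use F G Fz A in auto)
 thus ?thesis using p fF by blast
qed

lemma closed_sector_shift: "closed_sector (a + 2 * pi * of_int k) (b + 2 * pi * of_int k) = closed_sector a b"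
proof -
 have sub: "closed_sector (a + 2 * pi * of_int k) (b + 2 * pi * of_int k) \<subseteq> closed_sector a b" for a b k
 proof
  fix z assume "z \<in> closed_sector (a + 2 * pi * of_int k) (b + 2 * pi * of_int k)"
  then obtain r t where t: "z = rcis r t" "r \<ge> 0" "a + 2 * pi * of_int k \<le> t" "t \<le> b + 2 * pi * of_int k" by (auto simp: closed_sector_def)
  have "cis (t - 2 * pi * of_int k) = cis t" by (simp add: cis_divide[symmetric])
  hence "z = rcis r (t - 2 * pi * of_int k)" by (simp add: t(1) rcis_def)
  thus "z \<in> closed_sector a b" using t(2-4) unfolding closed_sector_def
   by (intro CollectI exI[of _ r] exI[of _ "t - 2 * pi * of_int k"]) auto
 qed
 show ?thesis using sub[of a k b] sub[of "a + 2 * pi * of_int k" "- k" "b + 2 * pi * of_int k"] by auto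
qed

lemma exp_notin_closed_sector:
 assumes "\<And>t. a \<le> t \<Longrightarrow> t \<le> b \<Longrightarrow> \<bar>Im w - t\<bar> < 2 * pi \<and> Im w \<noteq> t"
 shows "exp w \<notin> closed_sector a b"
proof
 assume "exp w \<in> closed_sector a b"
 then obtain r t where t: "exp w = rcis r t" "r \<ge> 0" "a \<le> t" "t \<le> b" by (auto simp: closed_sector_def)
 have "r \<noteq> 0" using t(1) by auto
 hence r: "r > 0" using t(2) by simp
 have "pt (ln r) t = rcis r t" using r by (simp add: exp_eq_polar rcis_def exp_of_real)
 hence "exp (w - Complex (ln r) t) = 1" using t(1) r by (simp add: exp_diff)
 moreover have "\<bar>Im (w - Complex (ln r) t)\<bar> < 2 * pi" "w - Complex (ln r) t \<noteq> 0" using assms[OF t(3,4)] by (auto simp: complex_eq_iff)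
 ultimately show False using exp_neq_one by blast
qed

text \<open>\<open>k\<close> moves \<open>a1\<close> into the interval from \<open>a0\<close> to
  \<open>a0 + 2 * pi\<close>. After that, if one of the inequalities failed, a boundary direction of
  one sector would belong to both.\<close>

lemma disjoint_sectors_angles:
 assumes "a0 < b0" "a1 < b1" and disj: "closed_sector a0 b0 \<inter> closed_sector a1 b1 = {0}"
 shows "\<exists>k::int. b0 < a1 + 2 * pi * of_int k \<and> b1 + 2 * pi * of_int k < a0 + 2 * pi"
proof -
 define k where "k = - \<lfloor>(a1 - a0) / (2 * pi)\<rfloor>"
 define a b where "a = a1 + 2 * pi * of_int k" and "b = b1 + 2 * pi * of_int k"
 have "0 \<le> (a1 - a0) / (2 * pi) + of_int k" "(a1 - a0) / (2 * pi) + of_int k < 1" unfolding k_def by linarith+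
 hence "0 * (2 * pi) \<le> ((a1 - a0) / (2 * pi) + of_int k) * (2 * pi)" "((a1 - a0) / (2 * pi) + of_int k) * (2 * pi) < 1 * (2 * pi)"
  by (intro mult_right_mono mult_strict_right_mono; simp)+
 moreover have "((a1 - a0) / (2 * pi) + of_int k) * (2 * pi) = a - a0" by (simp add: a_def field_simps)
 ultimately have a: "a0 \<le> a" "a < a0 + 2 * pi" by auto
 have ab: "a < b" using assms by (simp add: a_def b_def)
 have disj': "closed_sector a0 b0 \<inter> closed_sector a b = {0}" using disj closed_sector_shift by (simp add: a_def b_def)
 have no: "\<not> (cis t \<in> closed_sector a0 b0 \<and> cis t \<in> closed_sector a b)" for t using disj' by (metis IntI cis_neq_zero singletonD)
 have m: "cis t \<in> closed_sector x y" if "x \<le> t" "t \<le> y" for t x y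
  unfolding closed_sector_def by (rule CollectI, rule exI[of _ 1], rule exI[of _ t]) (use that in \<open>simp add: rcis_def\<close>)
 have "b0 < a" using no[of a] m[of a0 a b0] m[of a a b] a ab by linarith
 moreover have "b < a0 + 2 * pi"
 proof (rule ccontr)
  assume "\<not> b < a0 + 2 * pi"
  hence "cis (a0 + 2 * pi) \<in> closed_sector a b" using a by (intro m) auto
  moreover have "cis (a0 + 2 * pi) = cis a0" by (simp add: cis_mult[symmetric])
  ultimately show False using no[of a0] m[of a0 a0 b0] assms by auto
 qed
 ultimately show ?thesis unfolding a_def b_def by blast
qed


theorem theorem1p3:
 fixes f :: "complex \<Rightarrow> complex" and S\<^sub>0 S\<^sub>1 :: "complex set" and \<theta>\<^sub>0 \<theta>\<^sub>1 :: real
 assumes "is_closed_sector S\<^sub>0 \<theta>\<^sub>0" and "\<theta>\<^sub>0 \<le> pi"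
  and "is_closed_sector S\<^sub>1 \<theta>\<^sub>1" and "\<theta>\<^sub>1 \<le> pi"
  and "S\<^sub>0 \<inter> S\<^sub>1 = {0}"
  and "transcendental_entire f"
  and "entire_order f < \<infinity>"
  and "finite {z. f z = 0 \<and> z \<notin> S\<^sub>0}"
  and "finite {z. f z = 1 \<and> z \<notin> S\<^sub>1}"
 shows "\<exists>(p :: complex poly) (q :: complex poly) (c :: complex). \<forall>z.
      f z = contour_integral (linepath 0 z) (\<lambda>\<zeta>. poly p \<zeta> * exp (poly q \<zeta>)) + c"
proof -
 obtain a0 b0 where s0: "a0 < b0" "S\<^sub>0 = closed_sector a0 b0" "b0 - a0 \<le> pi"
  using assms(1,2) unfolding is_closed_sector_def by auto
 obtain a b where s1: "a < b" "S\<^sub>1 = closed_sector a b" "b - a \<le> pi"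
  using assms(3,4) unfolding is_closed_sector_def by auto
 obtain k :: int where k: "b0 < a + 2 * pi * of_int k" "b + 2 * pi * of_int k < a0 + 2 * pi"
  using disjoint_sectors_angles[OF s0(1) s1(1)] assms(5) s0(2) s1(2) by blast
 define a1 b1 where "a1 = a + 2 * pi * of_int k" and "b1 = b + 2 * pi * of_int k"
 have S1: "S\<^sub>1 = closed_sector a1 b1" unfolding a1_def b1_def closed_sector_shift by (rule s1)
 have angles: "b0 < a1" "a1 < b1" "b1 < a0 + 2 * pi" "a0 < b0" "b1 - a1 \<le> pi" using k s0 s1 by (auto simp: a1_def b1_def)
 have f: "f holomorphic_on UNIV" and np: "\<nexists>p. f = poly p" using assms(6) by (auto simp: transcendental_entire_def)
 \<comment> \<open>The summand 2 makes \<open>A\<close> positive and lets \<open>exp (A s)\<close>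
   bound \<open>f\<close> and \<open>f - 1\<close> alike.\<close>
 define A where "A s = ln (2 + max_modulus f (exp s))" for s
 have mm: "\<exists>z. norm z = exp s \<and> max_modulus f (exp s) = norm (f z) \<and> (\<forall>w. norm w \<le> exp s \<longrightarrow> norm (f w) \<le> norm (f z))" for s
  by (rule max_modulus_attained[OF f]) simp
 have mm0: "max_modulus f (exp s) \<ge> 0" for s using mm[of s] by auto
 have eA: "exp (A s) = 2 + max_modulus f (exp s)" for s using mm0[of s] by (simp add: A_def)
 have A_pos: "A s > 0" for s using mm0[of s] by (simp add: A_def)
 have A_mono: "A s \<le> A t" if "s \<le> t" for s t
 proof -
  obtain z where z: "norm z = exp s" "max_modulus f (exp s) = norm (f z)" using mm[of s] by blast
  obtain w where "max_modulus f (exp t) = norm (f w)" "\<And>w'. norm w' \<le> exp t \<Longrightarrow> norm (f w') \<le> norm (f w)" using mm[of t] by blast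
  hence "max_modulus f (exp s) \<le> max_modulus f (exp t)" using z that by simp
  hence "exp (A s) \<le> exp (A t)" unfolding eA by simp
  thus ?thesis by simp
 qed
 have A_ub: "2 + norm (f (exp u)) \<le> exp (A (Re u))" for u
 proof -
  have "norm (f (exp u)) \<le> max_modulus f (exp (Re u))" using mm[of "Re u"] by auto
  thus ?thesis by (simp add: eA)
 qed
 have nz1: "\<exists>w. f w \<noteq> 0"
 proof (rule ccontr)
  assume "\<not> ?thesis"
  hence "f = poly 0" by auto
  thus False using np by blast
 qed
 have nz0: "\<exists>w. f w - 1 \<noteq> 0"
 proof (rule ccontr)
  assume "\<not> ?thesis"
  hence "f = poly 1" by auto
  thus False using np by blast
 qed
 have n1: "exp u \<notin> S\<^sub>0" if "u \<in> strip b0 (a0 + 2 * pi)" for u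
  unfolding s0(2) by (rule exp_notin_closed_sector) (use that angles in auto)
 have u1: "norm (f (exp u)) \<le> exp (A (Re u))" for u using A_ub[of u] by linarith
 obtain p1 F1 G1 C1 where 1: "p1 \<noteq> 0" "\<And>z. f z = poly p1 z * F1 z" "\<And>C'. C' \<ge> C1 \<Longrightarrow> log_side F1 G1 b0 (a0 + 2 * pi) C' A"
  using factor_log_side[where A = A, OF f nz1 assms(8) n1 A_mono A_pos u1] by blast
 have n0: "exp u \<notin> S\<^sub>1" if "u \<in> strip (b1 - 2 * pi) a1" for u
  unfolding S1 by (rule exp_notin_closed_sector) (use that angles in auto)
 have u0: "norm (f (exp u) - 1) \<le> exp (A (Re u))" for u
  using A_ub[of u] norm_triangle_ineq4[of "f (exp u)" 1] by simp
 have fin0: "finite {z. f z - 1 = 0 \<and> z \<notin> S\<^sub>1}" using assms(9) by simp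
 have hol0: "(\<lambda>z. f z - 1) holomorphic_on UNIV" by (intro holomorphic_intros f)
 obtain p0 F0 G0 C0 where 0: "p0 \<noteq> 0" "\<And>z. f z - 1 = poly p0 z * F0 z" "\<And>C'. C' \<ge> C0 \<Longrightarrow> log_side F0 G0 (b1 - 2 * pi) a1 C' A"
  using factor_log_side[where A = A, OF hol0 nz0 fin0 n0 A_mono A_pos u0] by blast
 obtain N :: nat where N: "entire_order f < ereal (real N)" using assms(7) less_PInf_Ex_of_nat by (metis less_irrefl)
 \<comment> \<open>The exponent \<open>N + 1\<close> in place of \<open>N\<close> absorbs the factor
   \<open>ln 3 + 1\<close> that comes from the summand 2 in \<open>A\<close>.\<close>
 have ord: "EV s. A s \<le> exp ((real N + 1) * s)"
 proof -
  have "EV r. ereal (ln (ln (max_modulus f r)) / ln r) < ereal (real N)"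
   using N unfolding entire_order_def by (rule Limsup_lessD)
  hence "EV s. ereal (ln (ln (max_modulus f (exp s))) / ln (exp s)) < ereal (real N)"
   using filterlim_iff[THEN iffD1, OF exp_at_top] by blast
  moreover have "EV s. exp s \<ge> ln 3 + (1::real)" by real_asymp
  ultimately show ?thesis using eventually_gt_at_top[of 0]
  proof eventually_elim
   case (elim s)
   let ?M = "max_modulus f (exp s)"
   have M3: "2 + ?M \<le> 3 * max 1 ?M" by simp
   have "A s \<le> ln (3 * max 1 ?M)" unfolding A_def using M3 mm0[of s] by (subst ln_le_cancel_iff) auto
   also have "\<dots> = ln 3 + ln (max 1 ?M)" by (subst ln_mult) auto
   also have "ln (max 1 ?M) \<le> exp (real N * s)"
   proof (cases "?M > 1")
    case True
    hence pos: "ln ?M > 0" by simp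
    have "ln (ln ?M) < real N * s" using elim(1,3) by (simp add: field_simps)
    hence "exp (ln (ln ?M)) \<le> exp (real N * s)" by simp
    thus ?thesis using pos True by (simp add: max_def)
   next
    case False thus ?thesis by (simp add: max_def)
   qed
   finally have le: "A s \<le> ln 3 + exp (real N * s)" by simp
   have "ln 3 * 1 \<le> ln 3 * exp (real N * s)" using elim(3) by (intro mult_left_mono) auto
   hence "A s \<le> ln 3 * exp (real N * s) + exp (real N * s)" using le by linarith
   hence "A s \<le> (ln 3 + 1) * exp (real N * s)" by (simp add: distrib_right)
   also have "\<dots> \<le> exp s * exp (real N * s)" using elim(2) by (intro mult_right_mono) auto
   also have "\<dots> = exp ((real N + 1) * s)" by (simp add: mult_exp_exp algebra_simps)
   finally show ?case .
  qed
 qed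
 \<comment> \<open>If \<open>A s / s\<close> did not tend to infinity, \<open>f\<close> would be
   bounded by a fixed power of the radius on arbitrarily large circles and would be a
   polynomial.\<close>
 have transc: "filterlim (\<lambda>s. A s / s) at_top at_top"
  unfolding filterlim_at_top_gt[of _ _ 0]
 proof (intro allI impI, rule ccontr)
  fix Z :: real assume Z: "Z > 0" and n: "\<not> (EV s. Z \<le> A s / s)"
  define K where "K = nat \<lceil>Z\<rceil>"
  have K: "real K \<ge> Z" unfolding K_def by linarith
  have "\<exists>r\<ge>T. \<forall>z. norm z = r \<longrightarrow> norm (f z) \<le> r ^ K" for T
  proof -
   obtain s where s: "s \<ge> max 1 (ln (max 1 T))" "A s / s < Z" using n unfolding ev_top by (meson not_le)
   have "T \<le> exp (ln (max 1 T))" by simp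
   also have "\<dots> \<le> exp s" using s(1) by (simp only: exp_le_cancel_iff)
   finally have T: "T \<le> exp s" .
   have "A s \<le> Z * s" using s by (simp add: field_simps)
   also have "\<dots> \<le> real K * s" using K s by (intro mult_right_mono) auto
   finally have "exp (A s) \<le> exp (real K * s)" by simp
   hence "max_modulus f (exp s) \<le> exp s ^ K" unfolding eA by (simp add: exp_of_nat_mult)
   moreover obtain z' where "max_modulus f (exp s) = norm (f z')" "\<And>w. norm w \<le> exp s \<Longrightarrow> norm (f w) \<le> norm (f z')" using mm[of s] by blast
   ultimately have "norm (f z) \<le> exp s ^ K" if "norm z = exp s" for z using that order_trans order_refl by metis
   thus ?thesis using T by blast
  qed
  hence "\<exists>p. f = poly p" by (rule poly_growth_on_circles_imp_poly[OF f])
  thus False using np by blast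
 qed
 interpret separated f F1 F0 G1 G0 p1 p0 a0 b0 a1 b1 "max C1 C0" "real N + 1" A
 proof (rule separated.intro)
  show "b0 < a1" "a1 < b1" "b1 < a0 + 2 * pi" "a0 < b0" by (rule angles)+
  show "log_side F1 G1 b0 (a0 + 2 * pi) (max C1 C0) A" by (rule 1) simp
  show "log_side F0 G0 (b1 - 2 * pi) a1 (max C1 C0) A" by (rule 0) simp
  show "\<exists>z. norm z = exp s \<and> exp (A s) = 2 + norm (f z)" for s using mm[of s] eA[of s] by auto
 qed (use 1 0 ord transc A_ub in auto)
 obtain p q where pq: "\<And>z. deriv f z = poly p z * exp (poly q z)" using derivative_form[OF s0(3) angles(5)] by blast
 have "f z = contour_integral (linepath 0 z) (\<lambda>u. poly p u * exp (poly q u)) + f 0" for z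
 proof -
  have "((\<lambda>u. poly p u * exp (poly q u)) has_contour_integral (f (pathfinish (linepath 0 z)) - f (pathstart (linepath 0 z)))) (linepath 0 z)"
  proof (rule contour_integral_primitive[where S = UNIV])
   show "(f has_field_derivative poly p x * exp (poly q x)) (at x within UNIV)" for x
    using holomorphic_derivI[OF f open_UNIV, of x] by (simp add: pq)
  qed (rule valid_path_linepath, simp)
  from contour_integral_unique[OF this] show ?thesis by simp
 qed
 from this show ?thesis by (rule_tac exI[of _ p], rule_tac exI[of _ q], rule_tac exI[of _ "f 0"], rule_tac allI)
qed

end
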